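(* Let $\Omega\subset X$ be a bounded open set that supports a $(1,1)$-Poincaré inequality, and suppose $\mu$ is doubling on $\Omega$. Then there is a linear trace operator $T$ on $\mathrm{BV}(\Omega)$ (assigning to each $u\in \mathrm{BV}(\Omega)$ a function $Tu$ on $\partial\Omega$) such that, given $u\in\mathrm{BV}(\Omega)$, for $\overline{\mathcal H}$-a.e. $x\in\partial\Omega$ we have $$\lim_{r\to 0^+}\frac{1}{\mu(B(x,r)\cap\Omega)}\int_{B(x,r)\cap\Omega}|u-Tu(x)|^{Q/(Q-1)}\,d\mu=0.$$ If $\Omega$ also satisfies the measure density condition (there is a constant $c_m>0$ such that $\mu(B(x,r)\cap\Omega)\ge c_m\,\mu(B(x,r))$ for $\mathcal H$-a.e. $x\in\partial\Omega$ and every $r\in(0,\operatorname{diam}(\Omega))$), then, given $u\in\mathrm{BV}(\Omega)$, the relation $\lim_{r\to 0^+}\frac{1}{\mu(B(x,r)\cap\Omega)}\int_{B(x,r)\cap\Omega}|u-Tu(x)|^{Q/(Q-1)}\,d\mu=0$ holds for $\mathcal H$-a.e. $x\in\partial\Omega$.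
   Context: Setting: $(X,d,\mu)$ is a complete metric space with a Borel regular outer measure $\mu$ that is doubling: there is $C_d>0$ with $0<\mu(B(x,2r))\le C_d\,\mu(B(x,r))<\infty$ for all $x\in X$, $r>0$. A nonnegative Borel function $g$ is an upper gradient of an extended real-valued function $u$ if for every rectifiable curve $\gamma$ (compact parameter interval) with end points $x,y$ one has $|u(x)-u(y)|\le\int_\gamma g\,ds$ when $u(x),u(y)$ are finite, and $\int_\gamma g\,ds=\infty$ otherwise. $X$ supports a $(1,1)$-Poincaré inequality: there are $C_P>0$, $\lambda\ge1$ such that for every ball $B(x,r)$, every locally integrable $u$ and every upper gradient $g$ of $u$, $\frac{1}{\mu(B(x,r))}\int_{B(x,r)}|u-u_{B(x,r)}|\,d\mu\le C_P\,r\,\frac{1}{\mu(B(x,\lambda r))}\int_{B(x,\lambda r)}g\,d\mu$, where $u_B=\frac{1}{\mu(B)}\int_B u\,d\mu$. $Q>1$ is a fixed exponent for which there is a constant $C\ge1$ with $\frac{\mu(B(y,r))}{\mu(B(x,R))}\ge C^{-1}(r/R)^Q$ for all $0<r\le R$ and $y\in B(x,R)$ (such $Q$ and $C$ are obtained by iterating the doubling condition). "$\mu$ is doubling on $\Omega$" means there is $C\ge 1$ with $0<\mu(B(x,2r)\cap\Omega)\le C\mu(B(x,r)\cap\Omega)<\infty$ for all $x\in\Omega$, $r>0$. "$\Omega$ supports a $(1,1)$-Poincaré inequality" means that the metric space $\Omega$, with the inherited metric and the restriction of $\mu$, satisfies the $(1,1)$-Poincaré inequality above (for some constants). BV: for an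 open set $\Omega$ and $u\in L^1_{\rm loc}(\Omega)$, $\|Du\|(\Omega):=\inf\{\liminf_{i\to\infty}\int_\Omega g_{u_i}\,d\mu:\ u_i\in \mathrm{Lip}_{\rm loc}(\Omega),\ u_i\to u \text{ in } L^1_{\rm loc}(\Omega)\}$, where each $g_{u_i}$ is an upper gradient of $u_i$ in $\Omega$; here "loc" means on every open $\Omega'$ whose closure is a compact subset of $\Omega$. $\mathrm{BV}(\Omega)$ is the set of $u\in L^1(\Omega)$ with $\|Du\|(\Omega)<\infty$. Hausdorff measures: for $A\subset X$, $\mathcal H_R(A):=\inf\{\sum_i \mu(B(x_i,r_i))/r_i:\ A\subset\bigcup_i B(x_i,r_i),\ r_i\le R\}$ (countable covers by balls) and $\mathcal H(A):=\lim_{R\to0}\mathcal H_R(A)$ (codimension $1$ Hausdorff measure). $\overline\mu$ is the zero extension of $\mu$ from $\Omega$ to $\overline\Omega$: $\overline\mu(A)=\mu(A\cap\Omega)$ for $A\subset\overline\Omega$. $\overline{\mathcal H}$ is the codimension $1$ Hausdorff measure defined in the same way in the metric space $\overline\Omega$ with the measure $\overline\mu$.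
   Formalization: The first limit (for H̄-a.e. boundary point) is stated when Q also satisfies the lower mass bound for μ restricted to Ω, since with only the bound on X it fails (planar square with cusps over a fat Cantor set, Q=2); the measure density part uses Q of X as stated. *)

theory Defs
  imports "HOL-Analysis.Analysis"
begin

text \<open>
  The ambient space \<open>X\<close> is a type. Every notion below takes a carrier \<open>S\<close> (which will be \<open>UNIV\<close>, the
  open set \<open>\<Omega>\<close>, or its closure) and refers to the metric space \<open>S\<close> with the inherited metric, so that
  the balls of \<open>S\<close> are the sets \<open>ball x r \<inter> S\<close> with \<open>x \<in> S\<close>.
\<close>

section \<open>Outer measures, doubling, mass bounds\<close>

definition borel_regular_outer_measure :: "('a::topological_space set \<Rightarrow> ennreal) \<Rightarrow> bool" where
  "borel_regular_outer_measure \<mu> \<longleftrightarrow>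
     outer_measure_space UNIV \<mu> \<and>
     sets borel \<subseteq> lambda_system UNIV UNIV \<mu> \<and>
     (\<forall>A. \<exists>B\<in>sets borel. A \<subseteq> B \<and> \<mu> B = \<mu> A)"

text \<open>
  Integrals with respect to an outer measure are integrals with respect to its restriction to the
  Caratheodory-measurable sets. For measurable \<open>\<Omega>\<close>, integrating over \<open>\<Omega>\<close> in this measure is the
  same as integrating with respect to the restriction of \<open>\<mu>\<close> to the subsets of \<open>\<Omega>\<close>.
\<close>

definition caratheodory :: "('a set \<Rightarrow> ennreal) \<Rightarrow> 'a measure" where
  "caratheodory \<mu> = measure_of UNIV (lambda_system UNIV UNIV \<mu>) \<mu>"

definition doubling_on :: "'a::metric_space set \<Rightarrow> ('a set \<Rightarrow> ennreal) \<Rightarrow> bool" where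
  "doubling_on S \<mu> \<longleftrightarrow>
     (\<exists>C>0. \<forall>x\<in>S. \<forall>r>0.
        0 < \<mu> (ball x (2 * r) \<inter> S) \<and>
        \<mu> (ball x (2 * r) \<inter> S) \<le> ennreal C * \<mu> (ball x r \<inter> S) \<and>
        ennreal C * \<mu> (ball x r \<inter> S) < \<infinity>)"

text \<open>
  The exponent obtained by iterating a doubling condition, for the metric measure space \<open>S\<close>. An
  exponent for the ambient space need not be one for a doubling subdomain \<open>\<Omega>\<close>: the planar cusp
  \<open>{(x, y). 0 < x < 1 \<and> \<bar>y\<bar> < x^2}\<close> needs \<open>Q = 3\<close>.
\<close>

definition mass_bound_exponent :: "'a::metric_space set \<Rightarrow> ('a set \<Rightarrow> ennreal) \<Rightarrow> real \<Rightarrow> bool" where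
  "mass_bound_exponent S \<mu> Q \<longleftrightarrow>
     (\<exists>C\<ge>1. \<forall>x\<in>S. \<forall>y\<in>S. \<forall>r R. 0 < r \<and> r \<le> R \<and> y \<in> ball x R \<longrightarrow>
        ennreal (inverse C * (r / R) powr Q) \<le> \<mu> (ball y r \<inter> S) / \<mu> (ball x R \<inter> S))"

section \<open>Curves and upper gradients\<close>

definition curve_length :: "(real \<Rightarrow> 'a::metric_space) \<Rightarrow> real \<Rightarrow> real \<Rightarrow> ennreal" where
  "curve_length \<gamma> a b =
     (SUP (n, t) \<in> {(n::nat, t::nat \<Rightarrow> real). t 0 = a \<and> t n = b \<and> (\<forall>i<n. t i \<le> t (Suc i))}.
        \<Sum>i<n. ennreal (dist (\<gamma> (t i)) (\<gamma> (t (Suc i)))))"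

definition rectifiable_curve_in :: "'a::metric_space set \<Rightarrow> (real \<Rightarrow> 'a) \<Rightarrow> real \<Rightarrow> real \<Rightarrow> bool" where
  "rectifiable_curve_in S \<gamma> a b \<longleftrightarrow>
     a \<le> b \<and> continuous_on {a..b} \<gamma> \<and> \<gamma> ` {a..b} \<subseteq> S \<and> curve_length \<gamma> a b < \<infinity>"

text \<open>
  The arc-length parametrization of a rectifiable curve. The length function \<open>t \<mapsto> curve_length \<gamma> a t\<close>
  is continuous and \<open>\<gamma>\<close> is constant where it is, so the parameter chosen on a level set does not matter.
\<close>

definition arc_length_param :: "(real \<Rightarrow> 'a::metric_space) \<Rightarrow> real \<Rightarrow> real \<Rightarrow> real \<Rightarrow> 'a" where
  "arc_length_param \<gamma> a b s = \<gamma> (Inf {t\<in>{a..b}. curve_length \<gamma> a t = ennreal s})"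

definition curve_integral ::
    "(real \<Rightarrow> 'a::metric_space) \<Rightarrow> real \<Rightarrow> real \<Rightarrow> ('a \<Rightarrow> ennreal) \<Rightarrow> ennreal" where
  "curve_integral \<gamma> a b g =
     (\<integral>\<^sup>+ s\<in>{0..enn2real (curve_length \<gamma> a b)}. g (arc_length_param \<gamma> a b s) \<partial>lborel)"

text \<open>
  Upper gradients may take the value \<open>\<infinity>\<close>. As usual, constant curves are not tested: they give no
  condition where \<open>u\<close> is finite, and would otherwise force \<open>u\<close> to be finite everywhere.
\<close>

definition upper_gradient_on ::
    "'a::metric_space set \<Rightarrow> ('a \<Rightarrow> ennreal) \<Rightarrow> ('a \<Rightarrow> ereal) \<Rightarrow> bool" where
  "upper_gradient_on S g u \<longleftrightarrow>
     g \<in> borel_measurable (restrict_space borel S) \<and>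
     (\<forall>\<gamma> a b. rectifiable_curve_in S \<gamma> a b \<and> 0 < curve_length \<gamma> a b \<longrightarrow>
        (if \<bar>u (\<gamma> a)\<bar> \<noteq> \<infinity> \<and> \<bar>u (\<gamma> b)\<bar> \<noteq> \<infinity>
         then e2ennreal \<bar>u (\<gamma> a) - u (\<gamma> b)\<bar> \<le> curve_integral \<gamma> a b g
         else curve_integral \<gamma> a b g = \<infinity>))"

section \<open>Local integrability and the Poincare inequality\<close>

text \<open>The sets meant by ``loc''.\<close>

definition compactly_inside :: "'a::topological_space set \<Rightarrow> 'a set \<Rightarrow> bool" where
  "compactly_inside V S \<longleftrightarrow> open V \<and> compact (closure V) \<and> closure V \<subseteq> S"

definition locally_integrable_on ::
    "'a::metric_space set \<Rightarrow> ('a set \<Rightarrow> ennreal) \<Rightarrow> ('a \<Rightarrow> ereal) \<Rightarrow> bool" where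
  "locally_integrable_on S \<mu> u \<longleftrightarrow>
     (\<forall>V. compactly_inside V S \<longrightarrow>
        u \<in> borel_measurable (restrict_space (caratheodory \<mu>) V) \<and>
        (\<integral>\<^sup>+ x\<in>V. e2ennreal \<bar>u x\<bar> \<partial>caratheodory \<mu>) < \<infinity>)"

definition average_on :: "('a set \<Rightarrow> ennreal) \<Rightarrow> 'a set \<Rightarrow> ('a \<Rightarrow> ennreal) \<Rightarrow> ennreal" where
  "average_on \<mu> B f = (\<integral>\<^sup>+ x\<in>B. f x \<partial>caratheodory \<mu>) / \<mu> B"

definition mean_value :: "('a set \<Rightarrow> ennreal) \<Rightarrow> 'a set \<Rightarrow> ('a \<Rightarrow> ereal) \<Rightarrow> real" where
  "mean_value \<mu> B u = (LINT x:B|caratheodory \<mu>. real_of_ereal (u x)) / enn2real (\<mu> B)"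

text \<open>
  To be used for open \<open>S\<close>. If a locally integrable \<open>u\<close> is not integrable over the ball, its mean value is
  \<open>0\<close> by convention and the left-hand side is \<open>\<infinity>\<close>: the inequality then says that \<open>g\<close> is not integrable
  over the enlarged ball, which follows from the inequality for truncations of \<open>u\<close>.
\<close>

definition poincare_1_1_on :: "'a::metric_space set \<Rightarrow> ('a set \<Rightarrow> ennreal) \<Rightarrow> bool" where
  "poincare_1_1_on S \<mu> \<longleftrightarrow>
     (\<exists>C>0. \<exists>L\<ge>1. \<forall>x\<in>S. \<forall>r>0. \<forall>u g.
        locally_integrable_on S \<mu> u \<and> upper_gradient_on S g u \<longrightarrow>
        average_on \<mu> (ball x r \<inter> S)
          (\<lambda>y. e2ennreal \<bar>u y - ereal (mean_value \<mu> (ball x r \<inter> S) u)\<bar>)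
        \<le> ennreal (C * r) * average_on \<mu> (ball x (L * r) \<inter> S) g)"

section \<open>Functions of bounded variation\<close>

definition Lip_loc :: "'a::metric_space set \<Rightarrow> ('a \<Rightarrow> real) set" where
  "Lip_loc S = {v. \<forall>V. compactly_inside V S \<longrightarrow> (\<exists>C. C-lipschitz_on V v)}"

definition L1_loc_tendsto ::
    "'a::metric_space set \<Rightarrow> ('a set \<Rightarrow> ennreal) \<Rightarrow> (nat \<Rightarrow> 'a \<Rightarrow> real) \<Rightarrow> ('a \<Rightarrow> real) \<Rightarrow> bool" where
  "L1_loc_tendsto S \<mu> v u \<longleftrightarrow>
     (\<forall>V. compactly_inside V S \<longrightarrow>
        (\<lambda>i. \<integral>\<^sup>+ x\<in>V. ennreal \<bar>v i x - u x\<bar> \<partial>caratheodory \<mu>) \<longlonglongrightarrow> 0)"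

definition total_variation ::
    "'a::metric_space set \<Rightarrow> ('a set \<Rightarrow> ennreal) \<Rightarrow> ('a \<Rightarrow> real) \<Rightarrow> ennreal" where
  "total_variation S \<mu> u =
     Inf {liminf (\<lambda>i. \<integral>\<^sup>+ x\<in>S. g i x \<partial>caratheodory \<mu>) | v g.
            (\<forall>i. v i \<in> Lip_loc S \<and> upper_gradient_on S (g i) (\<lambda>x. ereal (v i x))) \<and>
            L1_loc_tendsto S \<mu> v u}"

text \<open>Functions rather than classes modulo null sets, and only their values on \<open>S\<close> matter.\<close>

definition BV :: "'a::metric_space set \<Rightarrow> ('a set \<Rightarrow> ennreal) \<Rightarrow> ('a \<Rightarrow> real) set" where
  "BV S \<mu> = {u. set_integrable (caratheodory \<mu>) S u \<and> total_variation S \<mu> u < \<infinity>}"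

section \<open>Codimension 1 Hausdorff measure\<close>

text \<open>The index set \<open>I\<close> makes finite covers available.\<close>

definition codim1_content ::
    "'a::metric_space set \<Rightarrow> ('a set \<Rightarrow> ennreal) \<Rightarrow> real \<Rightarrow> 'a set \<Rightarrow> ennreal" where
  "codim1_content S \<nu> R A =
     Inf {(\<Sum>\<^sub>\<infinity>i\<in>I. \<nu> (ball (x i) (r i) \<inter> S) / ennreal (r i)) | (I::nat set) x r.
            (\<forall>i\<in>I. x i \<in> S \<and> 0 < r i \<and> r i \<le> R) \<and> A \<subseteq> (\<Union>i\<in>I. ball (x i) (r i) \<inter> S)}"

definition codim1_hausdorff ::
    "'a::metric_space set \<Rightarrow> ('a set \<Rightarrow> ennreal) \<Rightarrow> 'a set \<Rightarrow> ennreal" where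
  "codim1_hausdorff S \<nu> A = Lim (at_right 0) (\<lambda>R. codim1_content S \<nu> R A)"

definition zero_extension :: "'a set \<Rightarrow> ('a set \<Rightarrow> ennreal) \<Rightarrow> 'a set \<Rightarrow> ennreal" where
  "zero_extension \<Omega> \<mu> A = \<mu> (A \<inter> \<Omega>)"

section \<open>Traces\<close>

definition measure_density :: "'a::metric_space set \<Rightarrow> ('a set \<Rightarrow> ennreal) \<Rightarrow> bool" where
  "measure_density \<Omega> \<mu> \<longleftrightarrow>
     (\<exists>c>0. codim1_hausdorff UNIV \<mu>
        {x \<in> frontier \<Omega>. \<not> (\<forall>r. 0 < r \<and> r < diameter \<Omega> \<longrightarrow>
           ennreal c * \<mu> (ball x r) \<le> \<mu> (ball x r \<inter> \<Omega>))} = 0)"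

definition has_trace_value ::
    "'a::metric_space set \<Rightarrow> ('a set \<Rightarrow> ennreal) \<Rightarrow> real \<Rightarrow> ('a \<Rightarrow> real) \<Rightarrow> 'a \<Rightarrow> real \<Rightarrow> bool" where
  "has_trace_value \<Omega> \<mu> p u x c \<longleftrightarrow>
     ((\<lambda>r. average_on \<mu> (ball x r \<inter> \<Omega>) (\<lambda>y. ennreal (\<bar>u y - c\<bar> powr p))) \<longlongrightarrow> 0) (at_right 0)"

text \<open>
  An operator from \<open>BV \<Omega>\<close>, understood modulo equality almost everywhere on \<open>\<Omega>\<close>, to functions on the
  boundary.
\<close>

definition linear_boundary_operator ::
    "'a::metric_space set \<Rightarrow> ('a set \<Rightarrow> ennreal) \<Rightarrow> (('a \<Rightarrow> real) \<Rightarrow> 'a \<Rightarrow> real) \<Rightarrow> bool" where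
  "linear_boundary_operator \<Omega> \<mu> T \<longleftrightarrow>
     (\<forall>u\<in>BV \<Omega> \<mu>. \<forall>v\<in>BV \<Omega> \<mu>. (AE y in caratheodory \<mu>. y \<in> \<Omega> \<longrightarrow> u y = v y) \<longrightarrow>
        (\<forall>x\<in>frontier \<Omega>. T u x = T v x)) \<and>
     (\<forall>u\<in>BV \<Omega> \<mu>. \<forall>v\<in>BV \<Omega> \<mu>. \<forall>a b. \<forall>x\<in>frontier \<Omega>.
        T (\<lambda>y. a * u y + b * v y) x = a * T u x + b * T v x)"

end

theory Submission
  imports Defs "HOL-Library.Function_Algebras"
begin

text \<open>
  For a continuous \<open>v\<close> with upper gradient \<open>g\<close>, the Poincare inequality applied to the truncations of
  \<open>v\<close> bounds the smaller of two level sets of \<open>v\<close> in a ball by the integral of \<open>g\<close> over the strip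
  between the levels. Summing over Vitali families of balls in which both \<open>{v > t}\<close> and its complement
  have density bounded below, one gets, for almost every \<open>t\<close>, a relative isoperimetric inequality for
  \<open>{v > t}\<close>, and that \<open>{v > t}\<close> has asymptotically density at least or at most \<open>1/2\<close> at all boundary points
  outside a set of codimension 1 content zero. The first fact integrates over \<open>t\<close> to a
  Sobolev-Poincare inequality with exponent \<open>Q / (Q - 1)\<close>; the second one, at a countable dense set of
  levels, singles out the only possible trace value. The means in question then converge at every
  boundary point where \<open>g d\<mu>\<close> has codimension 1 density zero, and the other boundary points are
  negligible because \<open>g d\<mu>\<close> does not charge the boundary.

  A general \<open>u\<close> of bounded variation is averaged over balls of radius comparable to the distance to the
  boundary. By lower semicontinuity the average \<open>w\<close> has an integrable upper gradient, and
  the \<open>L\<close>-\<open>Q / (Q - 1)\<close> mean of \<open>u - w\<close> near a boundary point is controlled by that gradient, so the trace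
  of \<open>w\<close> is a trace of \<open>u\<close>. At a fixed boundary point, having a trace is a linear relation between
  functions and numbers; extending it to a linear functional gives linearity of \<open>T\<close> everywhere.

  Under the measure density condition, suppose that a ball with center in \<open>\<Omega>\<close> contains no boundary point
  at which the condition holds. The boundary then has covers with small codimension 1 sums there, and
  the ambient Poincare inequality for the corresponding cut-offs of the characteristic function of \<open>\<Omega>\<close>
  shows that a smaller ball lies in \<open>\<Omega>\<close> up to a null set. Hence the density condition holds at all points
  of \<open>\<Omega>\<close>, the mass bound with exponent \<open>Q\<close> passes to \<open>\<Omega>\<close>, and the two Hausdorff measures have the same
  null sets on the boundary.
\<close>

section \<open>Coverings and codimension 1 content\<close>

text \<open>The obstacle is that a function of bounded variation has no pointwise gradient, and
  neither its variation nor the perimeter of a level set is at hand as a measure. Both are replaced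
  by lower limits: \<open>phi\<close> for the perimeter and, in the Whitney step, the lower limit of
  the energies of one approximating sequence on each ball separately. Such limits are only
  superadditive, so estimates are made for finitely many disjoint balls or summed by Fatou's lemma.
  The exponent comes from one trade-off. A ball of radius \<open>s\<close> inside a ball of radius
  \<open>r\<close> carries at least the fraction \<open>(s / r) powr Q\<close> of its mass, up to a
  constant. Small mass therefore forces small radii, and a sum of masses divided by radii controls
  the total mass to the power \<open>1 - 1 / Q\<close>. In the error of the Whitney averages the
  same trade-off makes the powers of the radii cancel. Balls are centred in the closure throughout,
  since contents of boundary sets are computed there. Completeness enters through compactness of
  closed balls.\<close>

lemma vitali_covering_metric:
  fixes A :: "'a::metric_space set" and r :: "'a \<Rightarrow> real"
  assumes r: "\<And>x. x \<in> A \<Longrightarrow> 0 < r x \<and> r x \<le> R"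
  obtains D where "D \<subseteq> A" "disjoint_family_on (\<lambda>x. ball x (r x)) D"
    "\<And>x. x \<in> A \<Longrightarrow> \<exists>y\<in>D. ball x (r x) \<subseteq> ball y (5 * r y)"
proof -
  define meets where "meets x y \<longleftrightarrow> ball x (r x) \<inter> ball y (r y) \<noteq> {}" for x y
  \<comment> \<open>The admissible families carry an invariant: a ball meeting some chosen ball
    meets one whose radius is at least half its own. A merely maximal disjoint family would not
    control the radii and would give no enlargement factor.\<close>
  define F where "F = {D. D \<subseteq> A \<and> disjoint_family_on (\<lambda>x. ball x (r x)) D \<and>
     (\<forall>x\<in>A. (\<exists>y\<in>D. meets x y) \<longrightarrow> (\<exists>y\<in>D. meets x y \<and> r x \<le> 2 * r y))}"
  have FI: "D \<in> F" if "D \<subseteq> A" "disjoint_family_on (\<lambda>x. ball x (r x)) D"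
    "\<And>x y. x \<in> A \<Longrightarrow> y \<in> D \<Longrightarrow> meets x y \<Longrightarrow> \<exists>y\<in>D. meets x y \<and> r x \<le> 2 * r y" for D
    using that unfolding F_def by blast
  have F1: "D \<subseteq> A" and F2: "disjoint_family_on (\<lambda>x. ball x (r x)) D" if "D \<in> F" for D
    using that unfolding F_def by auto
  have F3: "\<exists>y\<in>D. meets x y \<and> r x \<le> 2 * r y" if "D \<in> F" "x \<in> A" "y \<in> D" "meets x y" for D x y
    using that unfolding F_def by blast
  have "\<exists>M\<in>F. \<forall>X\<in>F. M \<subseteq> X \<longrightarrow> X = M"
  proof (rule subset_Zorn')
    fix C assume C: "subset.chain F C"
    then have CF: "C \<subseteq> F" and lin: "\<And>X Y. X \<in> C \<Longrightarrow> Y \<in> C \<Longrightarrow> X \<subseteq> Y \<or> Y \<subseteq> X"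
      by (auto simp: subset_chain_def)
    have dj: "disjoint_family_on (\<lambda>x. ball x (r x)) (\<Union>C)"
      unfolding disjoint_family_on_def
    proof (intro ballI impI)
      fix x y assume "x \<in> \<Union>C" "y \<in> \<Union>C" "x \<noteq> y"
      then obtain X Y where "X \<in> C" "Y \<in> C" "x \<in> X" "y \<in> Y" by blast
      then obtain Z where "Z \<in> C" "x \<in> Z" "y \<in> Z" using lin by blast
      then show "ball x (r x) \<inter> ball y (r y) = {}"
        using F2[of Z] CF \<open>x \<noteq> y\<close> unfolding disjoint_family_on_def by blast
    qed
    have sub: "\<Union>C \<subseteq> A" using CF F1 by blast
    have mt: "\<exists>y\<in>\<Union>C. meets x y \<and> r x \<le> 2 * r y" if xu: "x \<in> A" "u \<in> \<Union>C" "meets x u" for x u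
    proof -
      obtain X where X: "u \<in> X" "X \<in> C" using xu(2) by (rule UnionE)
      have "X \<in> F" using CF X(2) by (rule subsetD)
      obtain w where "w \<in> X" "meets x w \<and> r x \<le> 2 * r w"
        using F3[OF \<open>X \<in> F\<close> xu(1) X(1) xu(3)] by (rule bexE)
      then show ?thesis using X(2) by (intro bexI[of _ w] UnionI)
    qed
    show "\<Union>C \<in> F" by (rule FI[OF sub dj]) (rule mt)
  qed
  then obtain D where D: "D \<in> F" and "\<forall>X\<in>F. D \<subseteq> X \<longrightarrow> X = D" by (rule bexE)
  then have max: "X = D" if "X \<in> F" "D \<subseteq> X" for X using that by simp
  \<comment> \<open>If some balls met no chosen ball, one with radius above half of their supremum
    could be added: a ball that meets only the new one has at most twice its radius. The common
    bound \<open>R\<close> makes the supremum finite.\<close>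
  have all_meet: "\<exists>y\<in>D. meets x y" if "x \<in> A" for x
  proof (rule ccontr)
    assume no: "\<not> ?thesis"
    define B where "B = {x\<in>A. \<not> (\<exists>y\<in>D. meets x y)}"
    have xB: "x \<in> B" using no that unfolding B_def by blast
    have bdd: "bdd_above (r ` B)" unfolding B_def by (rule bdd_aboveI[of _ R]) (use r in auto)
    have pos: "0 < Sup (r ` B)"
      using cSUP_upper[OF xB bdd] r[OF that] by linarith
    have "\<exists>z\<in>B. Sup (r ` B) / 2 < r z"
      using less_cSUP_iff[of B r "Sup (r ` B) / 2"] xB bdd pos by auto
    then obtain z where z: "z \<in> B" "Sup (r ` B) / 2 < r z" by blast
    have zA: "z \<in> A" using z unfolding B_def by blast
    have zD: "z \<notin> D"
    proof
      assume "z \<in> D"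
      moreover have "meets z z" using r[OF zA] unfolding meets_def by auto
      ultimately show False using z(1) unfolding B_def by blast
    qed
    have nm: "\<And>y. y \<in> D \<Longrightarrow> \<not> meets z y" using z unfolding B_def by blast
    have "insert z D \<in> F"
    proof (rule FI)
      show "insert z D \<subseteq> A" using zA F1[OF D] by blast
      show "disjoint_family_on (\<lambda>x. ball x (r x)) (insert z D)"
        using F2[OF D] nm unfolding disjoint_family_on_insert[OF zD] meets_def by blast
      fix y u assume y: "y \<in> A" "u\<in>insert z D" "meets y u"
      show "\<exists>u\<in>insert z D. meets y u \<and> r y \<le> 2 * r u"
      proof (cases "\<exists>u\<in>D. meets y u")
        case True
        then obtain v where "v \<in> D" "meets y v" by blast
        from F3[OF D y(1) this] show ?thesis by blast
      next
        case False
        then have "y \<in> B" using y unfolding B_def by blast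
        then have "r y \<le> 2 * r z" using cSUP_upper[OF _ bdd] z(2) by fastforce
        then show ?thesis using y False by blast
      qed
    qed
    then show False using max[of "insert z D"] zD by blast
  qed
  show ?thesis
  proof (rule that[of D])
    show "D \<subseteq> A" "disjoint_family_on (\<lambda>x. ball x (r x)) D" using F1[OF D] F2[OF D] .
    fix x assume x: "x \<in> A"
    then obtain y where y: "y \<in> D" "meets x y" "r x \<le> 2 * r y"
      using F3[OF D] all_meet[OF x] by blast
    then obtain w where w: "dist x w < r x" "dist y w < r y" unfolding meets_def by auto
    \<comment> \<open>Through the common point \<open>w\<close>, the distance from \<open>y\<close>
      is below \<open>r y + 2 * r x\<close>, and \<open>r x \<le> 2 * r y\<close>. This is the
      factor 5.\<close>
    have "ball x (r x) \<subseteq> ball y (5 * r y)"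
    proof
      fix u assume "u \<in> ball x (r x)"
      then have "dist x u < r x" by simp
      then have "dist y u < 5 * r y"
        using w y(3) dist_triangle[of y u w] dist_triangle[of w u x] by (simp add: dist_commute)
      then show "u \<in> ball y (5 * r y)" by simp
    qed
    then show "\<exists>y\<in>D. ball x (r x) \<subseteq> ball y (5 * r y)" using y by blast
  qed
qed

text \<open>The masses of disjoint sets in a finite measure are summable, so only countably many are
  positive. This is how Vitali families become countable without any separability of the
  space.\<close>

lemma (in finite_measure) countable_disjoint_family:
  assumes d: "disjoint_family_on F D" and m: "\<And>i. i \<in> D \<Longrightarrow> F i \<in> sets M"
    and p: "\<And>i. i \<in> D \<Longrightarrow> 0 < measure M (F i)"
  shows "countable D"
proof -
  have fin: "sum (\<lambda>i. measure M (F i)) J \<le> measure M (space M)" if "finite J" "J \<subseteq> D" for J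
  proof -
    have "sum (\<lambda>i. measure M (F i)) J = measure M (\<Union>i\<in>J. F i)"
      using that m d by (intro finite_measure_finite_Union[symmetric]) (auto intro: disjoint_family_on_mono)
    then show ?thesis by (simp add: bounded_measure)
  qed
  have "(\<lambda>i. measure M (F i)) summable_on D"
    by (rule nonneg_bdd_above_summable_on) (auto intro!: bdd_aboveI2[of _ _ "measure M (space M)"] fin)
  then have "countable {i\<in>D. measure M (F i) \<noteq> 0}" by (rule summable_countable_real)
  moreover have "{i\<in>D. measure M (F i) \<noteq> 0} = D" using p by fastforce
  ultimately show ?thesis by simp
qed

text \<open>Sums over Vitali families are bounded uniformly over finite subfamilies only. Exhausting
  the countable family by finite pieces and continuity from below carry the bound over to the
  union.\<close>

lemma emeasure_UN_le_finite_sums: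
  assumes "countable D" and m: "\<And>i. i \<in> D \<Longrightarrow> A i \<in> sets M"
    and T: "\<And>F. finite F \<Longrightarrow> F \<subseteq> D \<Longrightarrow> (\<Sum>i\<in>F. emeasure M (A i)) \<le> T"
  shows "emeasure M (\<Union>i\<in>D. A i) \<le> T"
proof (cases "D = {}")
  case False
  define e where "e = from_nat_into D"
  have rng: "range e = D" unfolding e_def using \<open>countable D\<close> False by simp
  define U where "U n = (\<Union>i\<in>e ` {..<n}. A i)" for n :: nat
  have eD: "e n \<in> D" for n using rng by blast
  have U: "range U \<subseteq> sets M" "incseq U"
  proof -
    show "range U \<subseteq> sets M" unfolding U_def using m eD by (auto intro!: sets.finite_UN)
    show "incseq U" unfolding U_def by (intro monoI UN_mono image_mono) auto
  qed
  have "(\<Union>i\<in>D. A i) = (\<Union>n. U n)"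
  proof -
    have "(\<Union>n. U n) = (\<Union>i\<in>range e. A i)" unfolding U_def by (auto intro: lessI)
    then show ?thesis using rng by simp
  qed
  moreover have "(SUP n. emeasure M (U n)) \<le> T"
  proof (rule SUP_least)
    fix n
    have "emeasure M (U n) \<le> (\<Sum>i\<in>e ` {..<n}. emeasure M (A i))"
      unfolding U_def using m eD by (intro emeasure_subadditive_finite) auto
    also have "\<dots> \<le> T" by (rule T) (use eD in auto)
    finally show "emeasure M (U n) \<le> T" .
  qed
  ultimately show ?thesis using SUP_emeasure_incseq[OF U] by simp
qed simp

section \<open>Codimension 1 content and its null sets\<close>

lemma codim1_content_antimono:
  assumes "R \<le> R'"
  shows "codim1_content S \<nu> R' A \<le> codim1_content S \<nu> R A"
  unfolding codim1_content_def
  by (rule Inf_superset_mono) (use assms in \<open>auto intro: order_trans\<close>, fastforce)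

lemma codim1_content_mono:
  assumes "A \<subseteq> B"
  shows "codim1_content S \<nu> R A \<le> codim1_content S \<nu> R B"
  unfolding codim1_content_def
  by (rule Inf_superset_mono) (use assms in blast)

text \<open>The content decreases in \<open>R\<close>, so the limit at 0 is the supremum over all
  scales. From here on only contents are handled.\<close>

lemma codim1_hausdorff_eq_0_iff:
  "codim1_hausdorff S \<nu> A = 0 \<longleftrightarrow> (\<forall>R>0. codim1_content S \<nu> R A = 0)"
proof -
  define c where "c R = codim1_content S \<nu> R A" for R
  define s where "s = (SUP R\<in>{0<..}. c R)"
  have "(c \<longlongrightarrow> s) (at_right 0)"
  proof (rule order_tendstoI)
    fix a assume "a < s"
    then obtain R where "R > 0" "a < c R" unfolding s_def less_SUP_iff by auto
    moreover have "a < c r" if "0 < r" "r < R" for r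
      using codim1_content_antimono[of r R S \<nu> A] \<open>a < c R\<close> that unfolding c_def by auto
    ultimately show "eventually (\<lambda>r. a < c r) (at_right 0)"
      unfolding eventually_at_right_field by blast
  next
    fix a assume "s < a"
    moreover have "c r \<le> s" if "r > 0" for r unfolding s_def using that by (auto intro: SUP_upper)
    ultimately show "eventually (\<lambda>r. c r < a) (at_right 0)"
      unfolding eventually_at_right_field by (metis order_le_less_trans zero_less_one)
  qed
  then have "codim1_hausdorff S \<nu> A = s"
    unfolding codim1_hausdorff_def c_def by (intro tendsto_Lim) auto
  moreover have "s = 0 \<longleftrightarrow> (\<forall>R>0. c R = 0)" unfolding s_def by (subst SUP_eq_iff) auto
  ultimately show ?thesis unfolding c_def by simp
qed

lemma codim1_contentI:
  assumes I: "\<And>i. i \<in> I \<Longrightarrow> x i \<in> S \<and> 0 < r i \<and> r i \<le> R" and A: "A \<subseteq> (\<Union>i\<in>(I::nat set). ball (x i) (r i) \<inter> S)"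
    and T: "\<And>F. finite F \<Longrightarrow> F \<subseteq> I \<Longrightarrow> (\<Sum>i\<in>F. \<nu> (ball (x i) (r i) \<inter> S) / ennreal (r i)) \<le> T"
  shows "codim1_content S \<nu> R A \<le> T"
proof -
  have "codim1_content S \<nu> R A \<le> (\<Sum>\<^sub>\<infinity>i\<in>I. \<nu> (ball (x i) (r i) \<inter> S) / ennreal (r i))"
    unfolding codim1_content_def
    by (rule Inf_lower, rule CollectI, rule exI[of _ I], rule exI[of _ x], rule exI[of _ r]) (use I A in auto)
  also have "\<dots> = (SUP F\<in>{F. finite F \<and> F \<subseteq> I}. \<Sum>i\<in>F. \<nu> (ball (x i) (r i) \<inter> S) / ennreal (r i))"
    by (rule nonneg_infsum_complete) simp
  also have "\<dots> \<le> T" by (rule SUP_least) (use T in auto)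
  finally show ?thesis .
qed

text \<open>Contents ask for covers indexed by natural numbers, while Vitali families are indexed by
  their centres; an enumeration of the countable set of centres converts one into the other.\<close>

lemma codim1_content_le_finite_sums:
  fixes \<rho> :: "'a::metric_space \<Rightarrow> real"
  assumes "countable D" and D: "\<And>x. x \<in> D \<Longrightarrow> x \<in> S \<and> 0 < \<rho> x \<and> \<rho> x \<le> R"
    and A: "A \<subseteq> (\<Union>x\<in>D. ball x (\<rho> x) \<inter> S)"
    and T: "\<And>F. finite F \<Longrightarrow> F \<subseteq> D \<Longrightarrow> (\<Sum>x\<in>F. \<nu> (ball x (\<rho> x) \<inter> S) / ennreal (\<rho> x)) \<le> T"
  shows "codim1_content S \<nu> R A \<le> T"
proof -
  define I where "I = to_nat_on D ` D"
  define x where "x = from_nat_into D"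
  have x: "x (to_nat_on D d) = d" if "d \<in> D" for d using that \<open>countable D\<close> unfolding x_def by simp
  have xI: "x ` I = D" and injx: "inj_on x I"
    unfolding I_def using x by (force simp: image_iff, force simp: inj_on_def)
  show ?thesis
  proof (rule codim1_contentI)
    show "x i \<in> S \<and> 0 < \<rho> (x i) \<and> \<rho> (x i) \<le> R" if "i \<in> I" for i using D xI that by blast
    show "A \<subseteq> (\<Union>i\<in>I. ball (x i) (\<rho> (x i)) \<inter> S)" using A unfolding xI[symmetric] by blast
    fix F assume F: "finite F" "F \<subseteq> I"
    have "(\<Sum>i\<in>F. \<nu> (ball (x i) (\<rho> (x i)) \<inter> S) / ennreal (\<rho> (x i))) =
       (\<Sum>d\<in>x ` F. \<nu> (ball d (\<rho> d) \<inter> S) / ennreal (\<rho> d))"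
      using inj_on_subset[OF injx F(2)] by (simp add: sum.reindex)
    also have "\<dots> \<le> T" by (rule T) (use F xI in auto)
    finally show "(\<Sum>i\<in>F. \<nu> (ball (x i) (\<rho> (x i)) \<inter> S) / ennreal (\<rho> (x i))) \<le> T" .
  qed
qed

lemma codim1_content_lessE:
  assumes "codim1_content S \<nu> R A < e"
  obtains I :: "nat set" and x r where "\<And>i. i \<in> I \<Longrightarrow> x i \<in> S \<and> 0 < r i \<and> r i \<le> R"
    "A \<subseteq> (\<Union>i\<in>I. ball (x i) (r i) \<inter> S)"
    "\<And>F. finite F \<Longrightarrow> F \<subseteq> I \<Longrightarrow> (\<Sum>i\<in>F. \<nu> (ball (x i) (r i) \<inter> S) / ennreal (r i)) < e"
proof -
  obtain I :: "nat set" and x r where I: "\<forall>i\<in>I. x i \<in> S \<and> 0 < r i \<and> r i \<le> R"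
    "A \<subseteq> (\<Union>i\<in>I. ball (x i) (r i) \<inter> S)"
    and s: "(\<Sum>\<^sub>\<infinity>i\<in>I. \<nu> (ball (x i) (r i) \<inter> S) / ennreal (r i)) < e"
    using assms unfolding codim1_content_def Inf_less_iff by blast
  show ?thesis
  proof (rule that[of I x r])
    fix F assume "finite F" "F \<subseteq> I"
    then have "(\<Sum>i\<in>F. \<nu> (ball (x i) (r i) \<inter> S) / ennreal (r i)) \<le>
       (\<Sum>\<^sub>\<infinity>i\<in>I. \<nu> (ball (x i) (r i) \<inter> S) / ennreal (r i))"
      by (subst nonneg_infsum_complete) (auto intro: SUP_upper)
    with s show "(\<Sum>i\<in>F. \<nu> (ball (x i) (r i) \<inter> S) / ennreal (r i)) < e" by simp
  qed (use I in auto)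
qed

text \<open>Covers of the pieces with sums below \<open>e * (1/2)^Suc k\<close> are merged through
  the pairing function. The scale \<open>R\<close> stays fixed, so no limit is involved.\<close>

lemma codim1_content_UN_eq_0:
  fixes A :: "nat \<Rightarrow> 'a::metric_space set"
  assumes z: "\<And>k. codim1_content S \<nu> R (A k) = 0"
  shows "codim1_content S \<nu> R (\<Union>k. A k) = 0"
proof -
  have *: "codim1_content S \<nu> R (\<Union>k. A k) \<le> 0 + ennreal e" if "0 < e" for e
  proof -
    define d where "d k = ennreal (e * (1/2)^Suc k)" for k
    have d: "0 < d k" for k using that unfolding d_def by simp
    define good where "good k T \<longleftrightarrow> (case T of (I, x, r) \<Rightarrow> (\<forall>i\<in>(I::nat set). x i \<in> S \<and> 0 < r i \<and> r i \<le> R) \<and>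
       A k \<subseteq> (\<Union>i\<in>I. ball (x i) (r i) \<inter> S) \<and>
       (\<forall>F. finite F \<longrightarrow> F \<subseteq> I \<longrightarrow> (\<Sum>i\<in>F. \<nu> (ball (x i) (r i) \<inter> S) / ennreal (r i)) \<le> d k))" for k T
    have "\<exists>T. good k T" for k
    proof -
      have "codim1_content S \<nu> R (A k) < d k" using z d by simp
      then obtain J :: "nat set" and y s where "\<And>i. i \<in> J \<Longrightarrow> y i \<in> S \<and> 0 < s i \<and> s i \<le> R"
        "A k \<subseteq> (\<Union>i\<in>J. ball (y i) (s i) \<inter> S)"
        and "\<And>F. finite F \<Longrightarrow> F \<subseteq> J \<Longrightarrow> (\<Sum>i\<in>F. \<nu> (ball (y i) (s i) \<inter> S) / ennreal (s i)) < d k"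
        by (rule codim1_content_lessE) blast
      then have "good k (J, y, s)" unfolding good_def by (auto intro: order_less_imp_le)
      then show ?thesis ..
    qed
    then obtain T where T: "\<And>k. good k (T k)" by metis
    define I where "I k = fst (T k)" for k
    define x where "x k = fst (snd (T k))" for k
    define r where "r k = snd (snd (T k))" for k
    have "good k (I k, x k, r k)" for k using T[of k] unfolding I_def x_def r_def by simp
    then have I: "\<And>k. \<forall>i\<in>I k. x k i \<in> S \<and> 0 < r k i \<and> r k i \<le> R"
       "\<And>k. A k \<subseteq> (\<Union>i\<in>I k. ball (x k i) (r k i) \<inter> S)"
       and le: "\<And>k F. finite F \<Longrightarrow> F \<subseteq> I k \<Longrightarrow> (\<Sum>i\<in>F. \<nu> (ball (x k i) (r k i) \<inter> S) / ennreal (r k i)) \<le> d k"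
      unfolding good_def by blast+
    define J where "J = prod_encode ` (SIGMA k:UNIV. I k)"
    define X where "X j = (case prod_decode j of (k, i) \<Rightarrow> x k i)" for j
    define P where "P j = (case prod_decode j of (k, i) \<Rightarrow> r k i)" for j
    have "codim1_content S \<nu> R (\<Union>k. A k) \<le> (\<Sum>\<^sub>\<infinity>j\<in>J. \<nu> (ball (X j) (P j) \<inter> S) / ennreal (P j))"
      unfolding codim1_content_def
    proof (rule Inf_lower, rule CollectI, rule exI[of _ J], rule exI[of _ X], rule exI[of _ P], intro conjI refl)
      show "\<forall>i\<in>J. X i \<in> S \<and> 0 < P i \<and> P i \<le> R" using I(1) unfolding J_def X_def P_def by auto
      show "(\<Union>k. A k) \<subseteq> (\<Union>i\<in>J. ball (X i) (P i) \<inter> S)"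
      proof
        fix y assume "y \<in> (\<Union>k. A k)"
        then obtain k where "y \<in> A k" by blast
        then obtain i where "i \<in> I k" "y \<in> ball (x k i) (r k i) \<inter> S" using I(2)[of k] by blast
        then have "prod_encode (k, i) \<in> J" "y \<in> ball (X (prod_encode (k, i))) (P (prod_encode (k, i))) \<inter> S"
          unfolding J_def X_def P_def by auto
        then show "y \<in> (\<Union>i\<in>J. ball (X i) (P i) \<inter> S)" by blast
      qed
    qed
    also have "\<dots> = (SUP F\<in>{F. finite F \<and> F \<subseteq> J}. \<Sum>j\<in>F. \<nu> (ball (X j) (P j) \<inter> S) / ennreal (P j))"
      by (rule nonneg_infsum_complete) simp
    also have "\<dots> \<le> ennreal e"
    proof (rule SUP_least, clarify)
      fix F assume F: "finite F" "F \<subseteq> J"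
      define G where "G = prod_decode ` F"
      have G: "finite G" "G \<subseteq> (SIGMA k:UNIV. I k)" using F unfolding G_def J_def by auto
      obtain n where n: "fst ` G \<subseteq> {..<n}" using G(1) finite_nat_iff_bounded[of "fst ` G"] by auto
      define H where "H k = {i. (k, i) \<in> G}" for k
      have H: "finite (H k)" "H k \<subseteq> I k" for k
      proof -
        have "H k \<subseteq> snd ` G" unfolding H_def by force
        then show "finite (H k)" using finite_imageI[OF G(1), of snd] finite_subset by blast
        show "H k \<subseteq> I k" using G(2) unfolding H_def by blast
      qed
      have GS: "G = (SIGMA k:{..<n}. H k)" using n unfolding H_def by force
      have "(\<Sum>j\<in>F. \<nu> (ball (X j) (P j) \<inter> S) / ennreal (P j)) =
         (\<Sum>(k, i)\<in>G. \<nu> (ball (x k i) (r k i) \<inter> S) / ennreal (r k i))"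
        unfolding G_def by (subst sum.reindex) (auto simp: X_def P_def case_prod_unfold intro: inj_onI dest: injD[OF inj_prod_decode])
      also have "\<dots> = (\<Sum>k<n. \<Sum>i\<in>H k. \<nu> (ball (x k i) (r k i) \<inter> S) / ennreal (r k i))"
        unfolding GS using H by (subst sum.Sigma) auto
      also have "\<dots> \<le> (\<Sum>k<n. d k)" by (intro sum_mono le H)
      also have "\<dots> = ennreal (\<Sum>k<n. e * (1/2)^Suc k)"
        unfolding d_def using that by (subst sum_ennreal) auto
      also have "\<dots> \<le> ennreal e"
      proof (rule ennreal_leI)
        have "(\<Sum>k<n. e * (1/2)^Suc k) = e * (1 - (1/2)^n)"
          by (induction n) (auto simp: field_simps)
        also have "\<dots> \<le> e" using that by (simp add: algebra_simps)
        finally show "(\<Sum>k<n. e * (1/2)^Suc k) \<le> e" .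
      qed
      finally show "(\<Sum>j\<in>F. \<nu> (ball (X j) (P j) \<inter> S) / ennreal (P j)) \<le> ennreal e" .
    qed
    finally show ?thesis by simp
  qed
  have "codim1_content S \<nu> R (\<Union>k. A k) \<le> 0" by (rule ennreal_le_epsilon) (rule *)
  then show ?thesis by simp
qed

text \<open>Layer-cake formula: \<open>f x powr p\<close> is the integral of a derivative over
  \<open>{0..<f x}\<close>, and Fubini exchanges the order. It turns bounds on superlevel sets into
  a bound on the integral.\<close>

lemma nn_integral_Cavalieri_powr:
  fixes f :: "'a \<Rightarrow> real"
  assumes "sigma_finite_measure M" and f[measurable]: "f \<in> borel_measurable M" and p: "1 < p"
    and nn: "\<And>x. 0 \<le> f x"
  shows "(\<integral>\<^sup>+x. ennreal (f x powr p) \<partial>M) =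
    (\<integral>\<^sup>+s\<in>{0..}. ennreal (p * s powr (p - 1)) * emeasure M {x\<in>space M. s < f x} \<partial>lborel)"
proof -
  interpret M: sigma_finite_measure M by fact
  interpret P: pair_sigma_finite M lborel ..
  have ftc: "(\<integral>\<^sup>+s. ennreal (p * s powr (p - 1)) * indicator {0..<c} s \<partial>lborel) = ennreal (c powr p)"
    if "0 \<le> c" for c :: real
  proof -
    have "(\<integral>\<^sup>+s. ennreal (p * s powr (p - 1)) * indicator {0..<c} s \<partial>lborel) =
       (\<integral>\<^sup>+s. ennreal (p * s powr (p - 1)) * indicator {0..c} s \<partial>lborel)"
      by (rule nn_integral_cong_AE, rule AE_mp[OF AE_lborel_singleton[of c]]) (auto simp: indicator_def)
    \<comment> \<open>The truncation \<open>max 0 s\<close> makes the antiderivative differentiable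
      at the end point 0 as well; the derivative there is 0 because \<open>p > 1\<close>.\<close>
    also have "\<dots> = ennreal (max 0 c powr p - max 0 0 powr p)"
    proof (rule nn_integral_FTC_Icc)
      show "(\<lambda>s. p * s powr (p - 1)) \<in> borel_measurable borel" by measurable
      fix s :: real assume s: "s \<in> {0..c}"
      show "((\<lambda>s. max 0 s powr p) has_real_derivative p * s powr (p - 1)) (at s)"
      proof (cases "s = 0")
        case False
        then have "s > 0" using s by simp
        then have "((\<lambda>s. s powr p) has_real_derivative p * s powr (p - 1)) (at s)"
          by (auto intro!: derivative_eq_intros simp: powr_diff)
        moreover have "\<forall>\<^sub>F y in nhds s. max 0 y powr p = y powr p"
          using eventually_nhds_in_open[of "{0<..}" s] \<open>s > 0\<close> by (auto elim!: eventually_mono)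
        ultimately show ?thesis by (subst DERIV_cong_ev[OF refl _ refl]) auto
      next
        case True
        have "((\<lambda>y. (max 0 y powr p - 0) / (y - 0)) \<longlongrightarrow> 0) (at 0)"
        proof (rule Lim_transform_eventually[where f="\<lambda>y. max 0 y powr (p - 1)"])
          have "((\<lambda>y::real. max 0 y powr (p - 1)) \<longlongrightarrow> max 0 0 powr (p-1)) (at 0)"
            using tendsto_max[OF tendsto_const[of "0::real" "at 0"] tendsto_ident_at[of "0::real" UNIV]]
            by (intro tendsto_powr2) (use p in auto)
          then show "((\<lambda>y::real. max 0 y powr (p - 1)) \<longlongrightarrow> 0) (at 0)" using p by simp
          show "\<forall>\<^sub>F x in at 0. max 0 x powr (p - 1) = (max 0 x powr p - 0) / (x - 0)"
            using p unfolding eventually_at_filter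
            by (auto intro!: always_eventually simp: powr_diff max_def)
        qed
        then have "((\<lambda>s. max 0 s powr p) has_real_derivative 0) (at 0)"
          using p by (simp add: has_field_derivative_iff)
        then show ?thesis using True p by simp
      qed
    qed (use p that in auto)
    finally show ?thesis using p that by simp
  qed
  have "(\<integral>\<^sup>+x. ennreal (f x powr p) \<partial>M) =
     (\<integral>\<^sup>+x. \<integral>\<^sup>+s. ennreal (p * s powr (p - 1)) * indicator {0..<f x} s \<partial>lborel \<partial>M)"
    by (intro nn_integral_cong) (simp add: ftc nn)
  also have "\<dots> = (\<integral>\<^sup>+x. \<integral>\<^sup>+s. ennreal (p * s powr (p - 1)) * (indicator {0..} s * (if s < f x then 1 else 0)) \<partial>lborel \<partial>M)"
    by (intro nn_integral_cong) (auto simp: indicator_def)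
  also have "\<dots> = (\<integral>\<^sup>+s. \<integral>\<^sup>+x. ennreal (p * s powr (p - 1)) * (indicator {0..} s * (if s < f x then 1 else 0)) \<partial>M \<partial>lborel)"
    by (rule P.Fubini'[symmetric]) measurable
  also have "\<dots> = (\<integral>\<^sup>+s\<in>{0..}. ennreal (p * s powr (p - 1)) * emeasure M {x\<in>space M. s < f x} \<partial>lborel)"
  proof (intro nn_integral_cong)
    fix s :: real
    have "(\<integral>\<^sup>+x. ennreal (p * s powr (p - 1)) * (indicator {0..} s * (if s < f x then 1 else 0)) \<partial>M) =
      (\<integral>\<^sup>+x. (ennreal (p * s powr (p - 1)) * indicator {0..} s) * indicator {x\<in>space M. s < f x} x \<partial>M)"
      by (intro nn_integral_cong) (auto simp: indicator_def)
    also have "\<dots> = (ennreal (p * s powr (p - 1)) * indicator {0..} s) * emeasure M {x\<in>space M. s < f x}"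
      by (subst nn_integral_cmult_indicator) auto
    finally show "(\<integral>\<^sup>+x. ennreal (p * s powr (p - 1)) * (indicator {0..} s * (if s < f x then 1 else 0)) \<partial>M) =
      ennreal (p * s powr (p - 1)) * emeasure M {x\<in>space M. s < f x} * indicator {0..} s"
      by (simp add: mult_ac)
  qed
  finally show ?thesis .
qed

section \<open>Level sets in doubling domains\<close>

text \<open>\<nu> stands for the measure of the domain extended by zero to the whole type, so that
  plain balls replace their intersections with \<Omega>. The conditions are imposed for centres in
  the closure, since boundary points are centres both of covers and of the means that define a
  trace.\<close>

locale doubling_domain = finite_measure \<nu>
  for \<nu> :: "'a::metric_space measure" +
  fixes \<Omega> :: "'a set" and Cd Q cm :: real
  assumes borel_sets: "sets borel \<subseteq> sets \<nu>"
    and open_dom: "open \<Omega>" and bounded_dom: "bounded \<Omega>"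
    and null_compl: "emeasure \<nu> (- \<Omega>) = 0"
    and Cd_ge_1: "1 \<le> Cd"
    and ball_pos: "x \<in> closure \<Omega> \<Longrightarrow> 0 < r \<Longrightarrow> 0 < measure \<nu> (ball x r)"
    and ball_double: "x \<in> closure \<Omega> \<Longrightarrow> 0 < r \<Longrightarrow> measure \<nu> (ball x (2 * r)) \<le> Cd * measure \<nu> (ball x r)"
    and Q_gt_1: "1 < Q" and cm_pos: "0 < cm"
    and mass_bound: "x \<in> closure \<Omega> \<Longrightarrow> y \<in> closure \<Omega> \<Longrightarrow> 0 < r \<Longrightarrow> r \<le> R \<Longrightarrow> y \<in> ball x R \<Longrightarrow>
      cm * (r / R) powr Q * measure \<nu> (ball x R) \<le> measure \<nu> (ball y r)"
begin

lemma space_UNIV: "space \<nu> = UNIV"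
proof -
  have "UNIV \<in> sets \<nu>" using borel_sets by (rule subsetD) simp
  then show ?thesis using sets.sets_into_space by blast
qed

lemma ball_sets [simp, measurable]: "ball x r \<in> sets \<nu>"
  using borel_sets by auto

lemma open_sets: "open U \<Longrightarrow> U \<in> sets \<nu>"
  using borel_sets by auto

definition dbl :: "real \<Rightarrow> real" where
  "dbl a = Cd ^ (LEAST k. a \<le> 2 ^ k)"

lemma dbl_ge_1: "1 \<le> dbl a"
  unfolding dbl_def using Cd_ge_1 by simp

lemma ball_dbl:
  assumes "x \<in> closure \<Omega>" "0 < r"
  shows "measure \<nu> (ball x (a * r)) \<le> dbl a * measure \<nu> (ball x r)"
proof -
  have *: "measure \<nu> (ball x (2 ^ k * r)) \<le> Cd ^ k * measure \<nu> (ball x r)" for k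
  proof (induction k)
    case (Suc k)
    have "measure \<nu> (ball x (2 ^ Suc k * r)) \<le> Cd * measure \<nu> (ball x (2 ^ k * r))"
      using ball_double[of x "2 ^ k * r"] assms by (simp add: mult.assoc)
    also have "\<dots> \<le> Cd * (Cd ^ k * measure \<nu> (ball x r))"
      using Suc Cd_ge_1 by (intro mult_left_mono) auto
    finally show ?case by (simp add: mult.assoc)
  qed simp
  have "\<exists>k. a \<le> 2 ^ k" using real_arch_pow[of 2 a] by (auto intro: less_imp_le)
  then have "a \<le> 2 ^ (LEAST k. a \<le> 2 ^ k)" by (rule LeastI_ex)
  then have "measure \<nu> (ball x (a * r)) \<le> measure \<nu> (ball x (2 ^ (LEAST k. a \<le> 2 ^ k) * r))"
    using assms by (intro finite_measure_mono subset_ball mult_right_mono) auto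
  with *[of "LEAST k. a \<le> 2 ^ k"] show ?thesis unfolding dbl_def by linarith
qed

lemma AE_dom: "AE y in \<nu>. y \<in> \<Omega>"
  using null_compl open_sets[OF open_dom] borel_sets open_dom
  by (intro AE_I[of _ _ "- \<Omega>"]) auto

lemma measure_Int_dom:
  assumes "A \<in> sets \<nu>" shows "measure \<nu> (A \<inter> \<Omega>) = measure \<nu> A"
  using AE_dom assms open_sets[OF open_dom] by (intro measure_eq_AE) auto

text \<open>By \<open>codim1_hausdorff_eq_0_iff\<close> these are the sets of codimension 1
  Hausdorff measure zero in the closure.\<close>

definition null_set :: "'a set \<Rightarrow> bool" where
  "null_set A \<longleftrightarrow> (\<forall>R>0. codim1_content (closure \<Omega>) (emeasure \<nu>) R A = 0)"

lemma null_set_mono: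
  assumes "A \<subseteq> B" "null_set B" shows "null_set A"
  unfolding null_set_def
proof (intro allI impI)
  fix R :: real assume "0 < R"
  then have "codim1_content (closure \<Omega>) (emeasure \<nu>) R A \<le> 0"
    using codim1_content_mono[OF assms(1), of "closure \<Omega>" "emeasure \<nu>" R] assms(2)
    unfolding null_set_def by simp
  then show "codim1_content (closure \<Omega>) (emeasure \<nu>) R A = 0" by simp
qed

lemma null_set_UN: "(\<And>k::nat. null_set (A k)) \<Longrightarrow> null_set (\<Union>k. A k)"
  unfolding null_set_def by (simp add: codim1_content_UN_eq_0)

lemma null_set_Un:
  assumes "null_set A" "null_set B" shows "null_set (A \<union> B)"
proof (rule null_set_mono)
  show "null_set (\<Union>k::nat. if k = 0 then A else B)" using assms by (intro null_set_UN) auto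
  have "A \<subseteq> (if (0::nat) = 0 then A else B)" "B \<subseteq> (if (Suc 0) = 0 then A else B)" by auto
  then show "A \<union> B \<subseteq> (\<Union>k::nat. if k = 0 then A else B)" by blast
qed

text \<open>Vitali families cover only after dilation, while the estimates concern the original
  balls. Doubling compares the masses, and dividing by the larger radius only helps.\<close>

lemma content_le:
  assumes "countable D" "D \<subseteq> closure \<Omega>" and r: "\<And>x. x \<in> D \<Longrightarrow> 0 < r x \<and> a * r x \<le> R" and "1 \<le> a"
    and A: "A \<subseteq> closure \<Omega>" "A \<subseteq> (\<Union>x\<in>D. ball x (a * r x))"
    and T: "\<And>F. finite F \<Longrightarrow> F \<subseteq> D \<Longrightarrow> ennreal (\<Sum>x\<in>F. measure \<nu> (ball x (r x)) / r x) \<le> T"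
  shows "codim1_content (closure \<Omega>) (emeasure \<nu>) R A \<le> ennreal (dbl a) * T"
proof (rule codim1_content_le_finite_sums[where \<rho>="\<lambda>x. a * r x"])
  show "countable D" by fact
  show "x \<in> closure \<Omega> \<and> 0 < a * r x \<and> a * r x \<le> R" if "x \<in> D" for x
    using assms(2) r[OF that] \<open>1 \<le> a\<close> that by auto
  show "A \<subseteq> (\<Union>x\<in>D. ball x (a * r x) \<inter> closure \<Omega>)" using A by blast
  fix F assume F: "finite F" "F \<subseteq> D"
  have nn: "0 \<le> measure \<nu> (ball x (r x)) / r x" if "x \<in> F" for x
    using r[of x] F that by (intro divide_nonneg_nonneg) auto
  have "(\<Sum>x\<in>F. emeasure \<nu> (ball x (a * r x) \<inter> closure \<Omega>) / ennreal (a * r x))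
     \<le> (\<Sum>x\<in>F. ennreal (dbl a * (measure \<nu> (ball x (r x)) / r x)))"
  proof (rule sum_mono)
    fix x assume "x \<in> F"
    then have x: "x \<in> closure \<Omega>" "0 < r x" using F assms(2) r by auto
    have "emeasure \<nu> (ball x (a * r x) \<inter> closure \<Omega>) / ennreal (a * r x)
       \<le> emeasure \<nu> (ball x (a * r x)) / ennreal (a * r x)"
      by (intro divide_right_mono_ennreal emeasure_mono) auto
    also have "\<dots> = ennreal (measure \<nu> (ball x (a * r x)) / (a * r x))"
      using x \<open>1 \<le> a\<close> by (simp add: emeasure_eq_measure divide_ennreal)
    also have "\<dots> \<le> ennreal (dbl a * (measure \<nu> (ball x (r x)) / r x))"
    proof (rule ennreal_leI)
      have "measure \<nu> (ball x (a * r x)) / (a * r x) \<le> measure \<nu> (ball x (a * r x)) / r x"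
        using x \<open>1 \<le> a\<close> by (intro divide_left_mono) auto
      also have "\<dots> \<le> dbl a * measure \<nu> (ball x (r x)) / r x"
        using x ball_dbl[of x "r x" a] by (intro divide_right_mono) auto
      finally show "measure \<nu> (ball x (a * r x)) / (a * r x) \<le> dbl a * (measure \<nu> (ball x (r x)) / r x)"
        by simp
    qed
    finally show "emeasure \<nu> (ball x (a * r x) \<inter> closure \<Omega>) / ennreal (a * r x)
       \<le> ennreal (dbl a * (measure \<nu> (ball x (r x)) / r x))" .
  qed
  also have "\<dots> = ennreal (dbl a * (\<Sum>x\<in>F. measure \<nu> (ball x (r x)) / r x))"
    using mult_nonneg_nonneg[OF _ nn, of "dbl a"] dbl_ge_1[of a] by (subst sum_ennreal) (auto simp: sum_distrib_left)
  also have "\<dots> = ennreal (dbl a) * ennreal (\<Sum>x\<in>F. measure \<nu> (ball x (r x)) / r x)"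
    using dbl_ge_1[of a] nn by (intro ennreal_mult sum_nonneg) auto
  also have "\<dots> \<le> ennreal (dbl a) * T" by (intro mult_left_mono T F) simp
  finally show "(\<Sum>x\<in>F. emeasure \<nu> (ball x (a * r x) \<inter> closure \<Omega>) / ennreal (a * r x)) \<le> ennreal (dbl a) * T" .
qed

section \<open>Thin collars of the boundary\<close>

definition collar :: "real \<Rightarrow> 'a set" where
  "collar e = (\<Union>x\<in>frontier \<Omega>. ball x e)"

lemma collar_open: "open (collar e)"
  unfolding collar_def by auto

lemma collar_sets [simp]: "collar e \<in> sets \<nu>"
  by (rule open_sets[OF collar_open])

lemma collar_mono: "e \<le> e' \<Longrightarrow> collar e \<subseteq> collar e'"
  unfolding collar_def by (rule UN_mono[OF order_refl]) (rule subset_ball)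

lemma frontier_closure: "x \<in> frontier \<Omega> \<Longrightarrow> x \<in> closure \<Omega>"
  unfolding frontier_def by blast

text \<open>The collars decrease to a subset of the closed frontier, which misses the open set
  \<Omega>; so their intersection is negligible for a measure that does not charge the
  complement.\<close>

lemma collar_measure_0:
  assumes "finite_measure G" "sets G = sets \<nu>" "emeasure G (- \<Omega>) = 0"
  shows "(\<lambda>n. measure G (collar (c / real (Suc n)))) \<longlonglongrightarrow> 0"
proof (cases "0 < c")
  case True
  interpret G: finite_measure G by fact
  have cs: "collar s \<in> sets G" for s using assms(2) by simp
  have "(\<lambda>n. measure G (collar (c / real (Suc n)))) \<longlonglongrightarrow> measure G (\<Inter>n. collar (c / real (Suc n)))"
  proof (rule G.finite_Lim_measure_decseq)
    show "range (\<lambda>n. collar (c / real (Suc n))) \<subseteq> sets G" using cs by (rule image_subsetI)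
    show "decseq (\<lambda>n. collar (c / real (Suc n)))"
      unfolding decseq_def
    proof (intro allI impI collar_mono)
      fix m n :: nat assume "m \<le> n" then show "c / real (Suc n) \<le> c / real (Suc m)"
        using True by (intro divide_left_mono) auto
    qed
  qed
  moreover have "(\<Inter>n. collar (c / real (Suc n))) \<subseteq> - \<Omega>"
  proof
    fix y assume y: "y \<in> (\<Inter>n. collar (c / real (Suc n)))"
    have "y \<in> closure (frontier \<Omega>)"
      unfolding closure_approachable
    proof (intro allI impI)
      fix e :: real assume "0 < e"
      obtain n where "1 / real (Suc n) < e / c" using nat_approx_posE[of "e / c"] True \<open>0 < e\<close> by auto
      then have "c / real (Suc n) < e" using True by (simp add: field_simps)
      moreover have "y \<in> collar (c / real (Suc n))" using y by blast
      then obtain x where "x \<in> frontier \<Omega>" "dist x y < c / real (Suc n)"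
        unfolding collar_def by auto
      ultimately show "\<exists>x\<in>frontier \<Omega>. dist x y < e" by (intro bexI[of _ x]) auto
    qed
    then have "y \<in> frontier \<Omega>" using frontier_closed by (metis closure_closed)
    then show "y \<in> - \<Omega>" using open_dom by (simp add: frontier_def interior_open)
  qed
  then have "emeasure G (\<Inter>n. collar (c / real (Suc n))) \<le> emeasure G (- \<Omega>)"
    using assms(2) borel_sets open_dom by (intro emeasure_mono) auto
  then have "measure G (\<Inter>n. collar (c / real (Suc n))) = 0"
    using assms(3) by (simp add: measure_def)
  ultimately show ?thesis by simp
next
  case False
  then have "collar (c / real (Suc n)) = {}" for n
    unfolding collar_def by (auto simp: divide_le_0_iff not_less intro!: ball_empty)
  then show ?thesis by simp
qed

text \<open>Where the quotient exceeds \<open>1 / Suc k\<close> for arbitrarily small radii, such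
  radii can be chosen so that the balls stay in an arbitrarily thin collar. For a disjoint subfamily
  the codimension 1 sum is then at most \<open>Suc k\<close> times the measure \<open>G\<close> of
  that collar, which tends to 0.\<close>

lemma frontier_density_0:
  assumes "finite_measure G" "sets G = sets \<nu>" "emeasure G (- \<Omega>) = 0" "1 \<le> a"
  shows "null_set {x\<in>frontier \<Omega>. \<not> ((\<lambda>r. r * measure G (ball x (a * r)) / measure \<nu> (ball x r)) \<longlongrightarrow> 0) (at_right 0)}"
proof -
  interpret G: finite_measure G by fact
  define Z where "Z k = {x\<in>frontier \<Omega>. \<forall>e>0. \<exists>r. 0 < r \<and> r < e \<and>
      measure \<nu> (ball x r) / real (Suc k) \<le> r * measure G (ball x (a * r))}" for k
  have "null_set (Z k)" for k
    unfolding null_set_def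
  proof (intro allI impI)
    fix R :: real assume "0 < R"
    define e where "e n = R / (5 * a) / real (Suc n)" for n
    have e: "0 < e n" "5 * a * e n \<le> R" for n
    proof -
      show "0 < e n" using \<open>0 < R\<close> \<open>1 \<le> a\<close> unfolding e_def by simp
      have "5 * a * e n = R / real (Suc n)" using \<open>1 \<le> a\<close> unfolding e_def by simp
      also have "\<dots> \<le> R / 1" using \<open>0 < R\<close> by (intro divide_left_mono) auto
      finally show "5 * a * e n \<le> R" by simp
    qed
    have le: "codim1_content (closure \<Omega>) (emeasure \<nu>) R (Z k) \<le>
       ennreal (dbl (5 * a)) * ennreal (real (Suc k) * measure G (collar (a * e n)))" for n
    proof -
      have "\<forall>x\<in>Z k. \<exists>r. 0 < r \<and> r < e n \<and> measure \<nu> (ball x r) / real (Suc k) \<le> r * measure G (ball x (a * r))"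
        using e(1)[of n] unfolding Z_def by blast
      then obtain r where r: "\<And>x. x \<in> Z k \<Longrightarrow> 0 < r x \<and> r x < e n \<and>
          measure \<nu> (ball x (r x)) / real (Suc k) \<le> r x * measure G (ball x (a * r x))" by metis
      have Zc: "Z k \<subseteq> closure \<Omega>" "Z k \<subseteq> frontier \<Omega>" unfolding Z_def using frontier_closure by auto
      \<comment> \<open>Disjointness is wanted for the balls of radius \<open>a * r x\<close>,
        because these carry the measure \<open>G\<close>.\<close>
      obtain D where D: "D \<subseteq> Z k" "disjoint_family_on (\<lambda>x. ball x (a * r x)) D"
         "\<And>x. x \<in> Z k \<Longrightarrow> \<exists>y\<in>D. ball x (a * r x) \<subseteq> ball y (5 * (a * r y))"
      proof (rule vitali_covering_metric[of "Z k" "\<lambda>x. a * r x" "a * e n"])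
        show "0 < a * r x \<and> a * r x \<le> a * e n" if "x \<in> Z k" for x
          using r[OF that] \<open>1 \<le> a\<close> by auto
      qed blast
      have cD: "countable D"
      proof (rule countable_disjoint_family[OF D(2)])
        fix x assume "x \<in> D"
        then have "x \<in> closure \<Omega>" "0 < r x" using D(1) Zc r by auto
        then show "0 < measure \<nu> (ball x (a * r x))" using \<open>1 \<le> a\<close> by (intro ball_pos) auto
      qed simp
      show ?thesis
      proof (rule content_le[OF cD, where r=r])
        show "D \<subseteq> closure \<Omega>" "Z k \<subseteq> closure \<Omega>" using D(1) Zc by auto
        show "1 \<le> 5 * a" using \<open>1 \<le> a\<close> by simp
        show "0 < r x \<and> 5 * a * r x \<le> R" if "x \<in> D" for x
        proof -
          have "5 * a * r x \<le> 5 * a * e n" using r[of x] that D(1) \<open>1 \<le> a\<close> by (intro mult_left_mono) auto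
          then show ?thesis using e(2)[of n] r[of x] that D(1) by auto
        qed
        show "Z k \<subseteq> (\<Union>x\<in>D. ball x (5 * a * r x))"
        proof
          fix x assume x: "x \<in> Z k"
          then have "x \<in> ball x (a * r x)" using r[OF x] \<open>1 \<le> a\<close> by simp
          then show "x \<in> (\<Union>x\<in>D. ball x (5 * a * r x))"
            using D(3)[OF x] unfolding mult.assoc by blast
        qed
        fix F assume F: "finite F" "F \<subseteq> D"
        have "(\<Sum>x\<in>F. measure \<nu> (ball x (r x)) / r x) \<le> (\<Sum>x\<in>F. real (Suc k) * measure G (ball x (a * r x)))"
        proof (rule sum_mono)
          fix x assume "x \<in> F"
          then have "x \<in> Z k" using D(1) F by auto
          then show "measure \<nu> (ball x (r x)) / r x \<le> real (Suc k) * measure G (ball x (a * r x))"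
            using r[of x] by (simp add: field_simps)
        qed
        also have "\<dots> = real (Suc k) * measure G (\<Union>x\<in>F. ball x (a * r x))"
          using F D assms(2) by (subst G.finite_measure_finite_Union) (auto simp: sum_distrib_left intro: disjoint_family_on_mono)
        also have "\<dots> \<le> real (Suc k) * measure G (collar (a * e n))"
        proof (intro mult_left_mono G.finite_measure_mono)
          show "(\<Union>x\<in>F. ball x (a * r x)) \<subseteq> collar (a * e n)"
          proof (rule UN_least)
            fix x assume "x \<in> F"
            then have x: "x \<in> Z k" "x \<in> frontier \<Omega>" using F D(1) Zc by auto
            have "ball x (a * r x) \<subseteq> ball x (a * e n)"
              using r[OF x(1)] \<open>1 \<le> a\<close> by (intro subset_ball mult_left_mono) auto
            then show "ball x (a * r x) \<subseteq> collar (a * e n)"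
              using x(2) unfolding collar_def by blast
          qed
        qed (use assms(2) in auto)
        finally show "ennreal (\<Sum>x\<in>F. measure \<nu> (ball x (r x)) / r x) \<le> ennreal (real (Suc k) * measure G (collar (a * e n)))"
          by (rule ennreal_leI)
      qed
    qed
    have "(\<lambda>n. ennreal (dbl (5 * a)) * ennreal (real (Suc k) * measure G (collar (a * e n)))) \<longlonglongrightarrow>
        ennreal (dbl (5 * a)) * ennreal (real (Suc k) * 0)"
    proof (intro ennreal_tendsto_cmult tendsto_ennrealI tendsto_mult tendsto_const)
      show "(\<lambda>n. measure G (collar (a * e n))) \<longlonglongrightarrow> 0"
        using collar_measure_0[OF assms(1-3), of "a * (R / (5 * a))"] unfolding e_def times_divide_eq_right .
    qed simp
    then show "codim1_content (closure \<Omega>) (emeasure \<nu>) R (Z k) = 0"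
      using le by (simp add: LIMSEQ_le_const le_zero_eq[symmetric] del: le_zero_eq)
  qed
  then have "null_set (\<Union>k. Z k)" by (rule null_set_UN)
  moreover have "{x\<in>frontier \<Omega>. \<not> ((\<lambda>r. r * measure G (ball x (a * r)) / measure \<nu> (ball x r)) \<longlongrightarrow> 0) (at_right 0)} \<subseteq> (\<Union>k. Z k)"
  proof (rule subsetI, rule ccontr)
    fix x assume x: "x \<in> {x\<in>frontier \<Omega>. \<not> ((\<lambda>r. r * measure G (ball x (a * r)) / measure \<nu> (ball x r)) \<longlongrightarrow> 0) (at_right 0)}"
      and nx: "x \<notin> (\<Union>k. Z k)"
    have "((\<lambda>r. r * measure G (ball x (a * r)) / measure \<nu> (ball x r)) \<longlongrightarrow> 0) (at_right 0)"
    proof (rule tendstoI)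
      fix d :: real assume "0 < d"
      then obtain k where k: "1 / real (Suc k) < d" using nat_approx_posE by blast
      have "x \<notin> Z k" using nx by blast
      then obtain e where e: "e > 0" "\<And>r. 0 < r \<Longrightarrow> r < e \<Longrightarrow> \<not> measure \<nu> (ball x r) / real (Suc k) \<le> r * measure G (ball x (a * r))"
        using x unfolding Z_def by blast
      have "dist (r * measure G (ball x (a * r)) / measure \<nu> (ball x r)) 0 < d" if "0 < r" "r < e" for r
      proof -
        have "0 < measure \<nu> (ball x r)" using x that by (auto intro: ball_pos frontier_closure)
        then have "r * measure G (ball x (a * r)) / measure \<nu> (ball x r) < 1 / real (Suc k)"
          using e(2)[OF that] by (simp add: field_simps)
        then show ?thesis using k that by simp
      qed
      then show "\<forall>\<^sub>F r in at_right 0. dist (r * measure G (ball x (a * r)) / measure \<nu> (ball x r)) 0 < d"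
        unfolding eventually_at_right_field using e(1) by blast
    qed
    then show False using x by blast
  qed
  ultimately show ?thesis by (rule null_set_mono[rotated])
qed

end

text \<open>\<open>G\<close> stands for the upper gradient times the measure, and
  \<open>level\<close> is what the Poincare inequality says about the truncation of \<open>v\<close>
  between \<open>t\<close> and \<open>t + e\<close>, multiplied by \<open>e\<close>. The extreme
  level sets are closed at the levels and the strip is open, which makes the condition invariant
  under a change of sign of \<open>v\<close>.\<close>

locale level_poincare = doubling_domain \<nu> \<Omega> Cd Q cm + G: finite_measure G
  for \<nu> :: "'a::metric_space measure" and \<Omega> :: "'a set" and Cd Q cm :: real
    and G :: "'a measure" +
  fixes v :: "'a \<Rightarrow> real" and K L :: real
  assumes sets_G: "sets G = sets \<nu>"
    and v_meas [measurable]: "v \<in> borel_measurable \<nu>"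
    and v_cont: "continuous_on \<Omega> v"
    and K_pos: "0 < K" and L_ge_1: "1 \<le> L"
    and level: "x \<in> closure \<Omega> \<Longrightarrow> 0 < r \<Longrightarrow> 0 < e \<Longrightarrow>
      e * min (measure \<nu> (ball x r \<inter> {y. v y \<le> t})) (measure \<nu> (ball x r \<inter> {y. t + e \<le> v y}))
        \<le> K * r * measure G (ball x (L * r) \<inter> {y. t < v y \<and> v y < t + e})"
begin

lemma v_sets [simp]:
  "{y. t < v y} \<in> sets \<nu>" "{y. v y \<le> t} \<in> sets \<nu>" "{y. t \<le> v y} \<in> sets \<nu>" "{y. v y < t} \<in> sets \<nu>"
  "{y. s < v y \<and> v y < t} \<in> sets \<nu>"
proof -
  have *: "v -` X \<in> sets \<nu>" if "X \<in> sets borel" for X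
    using measurable_sets[OF v_meas that] by (simp add: space_UNIV)
  show "{y. t < v y} \<in> sets \<nu>" "{y. v y \<le> t} \<in> sets \<nu>" "{y. t \<le> v y} \<in> sets \<nu>" "{y. v y < t} \<in> sets \<nu>"
    "{y. s < v y \<and> v y < t} \<in> sets \<nu>"
    using *[of "{t<..}"] *[of "{..t}"] *[of "{t..}"] *[of "{..<t}"] *[of "{s<..<t}"]
    by (simp_all add: vimage_def)
qed

text \<open>The perimeter of \<open>{v > t}\<close> in \<open>U\<close>, as a limit of normalized integrals over thin level strips;
  no coarea formula is needed to bound its integral in \<open>t\<close>.\<close>

definition phi :: "'a set \<Rightarrow> real \<Rightarrow> ennreal" where
  "phi U t = liminf (\<lambda>n. ennreal (real (Suc n) * measure G (U \<inter> {y. t < v y \<and> v y < t + 1 / real (Suc n)})))"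

lemma phi_strip_eq:
  assumes "U \<in> sets \<nu>"
  shows "ennreal (real (Suc n) * measure G (U \<inter> {y. t < v y \<and> v y < t + 1 / real (Suc n)})) =
    (\<integral>\<^sup>+y. ennreal (real (Suc n)) * (indicator U y * (if t < v y \<and> v y < t + 1 / real (Suc n) then 1 else 0)) \<partial>G)"
proof -
  have "(\<integral>\<^sup>+y. ennreal (real (Suc n)) * (indicator U y * (if t < v y \<and> v y < t + 1 / real (Suc n) then 1 else 0)) \<partial>G)
     = (\<integral>\<^sup>+y. ennreal (real (Suc n)) * indicator (U \<inter> {y. t < v y \<and> v y < t + 1 / real (Suc n)}) y \<partial>G)"
    by (intro nn_integral_cong) (auto simp: indicator_def)
  also have "\<dots> = ennreal (real (Suc n)) * emeasure G (U \<inter> {y. t < v y \<and> v y < t + 1 / real (Suc n)})"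
    using assms by (intro nn_integral_cmult_indicator) (auto simp: sets_G)
  finally show ?thesis by (simp add: G.emeasure_eq_measure ennreal_mult del: of_nat_Suc)
qed

lemma v_meas_G [measurable]: "v \<in> borel_measurable G"
  using v_meas unfolding measurable_cong_sets[OF sets_G refl] .

lemma phi_strip_meas:
  assumes "U \<in> sets \<nu>"
  shows "(\<lambda>t. ennreal (real (Suc n) * measure G (U \<inter> {y. t < v y \<and> v y < t + 1 / real (Suc n)}))) \<in> borel_measurable borel"
proof -
  have [measurable]: "U \<in> sets G" using assms sets_G by simp
  show ?thesis
    unfolding phi_strip_eq[OF assms] by (rule G.borel_measurable_nn_integral) measurable
qed

lemma phi_meas: "U \<in> sets \<nu> \<Longrightarrow> phi U \<in> borel_measurable borel"
  unfolding phi_def by (intro borel_measurable_liminf phi_strip_meas)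

text \<open>For each point \<open>y\<close> the levels \<open>t\<close> whose strip contains
  \<open>y\<close> form an interval of length \<open>1 / Suc n\<close>. By Fubini every normalized
  strip measure thus has integral exactly \<open>measure G U\<close> in \<open>t\<close>, and
  Fatou's lemma passes to the lower limit. The result plays the part of the coarea
  inequality.\<close>

lemma integral_phi_le:
  assumes "U \<in> sets \<nu>"
  shows "(\<integral>\<^sup>+t. phi U t \<partial>lborel) \<le> ennreal (measure G U)"
proof -
  interpret P: pair_sigma_finite G lborel ..
  have [measurable]: "U \<in> sets G" using assms sets_G by simp
  have eq: "(\<integral>\<^sup>+t. ennreal (real (Suc n) * measure G (U \<inter> {y. t < v y \<and> v y < t + 1 / real (Suc n)})) \<partial>lborel)
     = ennreal (measure G U)" for n
  proof -
    have "(\<integral>\<^sup>+t. ennreal (real (Suc n) * measure G (U \<inter> {y. t < v y \<and> v y < t + 1 / real (Suc n)})) \<partial>lborel) =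
      (\<integral>\<^sup>+y. \<integral>\<^sup>+t. ennreal (real (Suc n)) * (indicator U y * (if t < v y \<and> v y < t + 1 / real (Suc n) then 1 else 0)) \<partial>lborel \<partial>G)"
      unfolding phi_strip_eq[OF assms] by (rule P.Fubini') measurable
    also have "\<dots> = (\<integral>\<^sup>+y. indicator U y \<partial>G)"
    proof (rule nn_integral_cong)
      fix y
      have "(\<integral>\<^sup>+t. ennreal (real (Suc n)) * (indicator U y * (if t < v y \<and> v y < t + 1 / real (Suc n) then 1 else 0)) \<partial>lborel)
        = (\<integral>\<^sup>+t. (ennreal (real (Suc n)) * indicator U y) * indicator {v y - 1 / real (Suc n) <..< v y} t \<partial>lborel)"
        by (intro nn_integral_cong) (auto simp: indicator_def field_simps)
      also have "\<dots> = (ennreal (real (Suc n)) * indicator U y) * ennreal (1 / real (Suc n))"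
        by (subst nn_integral_cmult_indicator) auto
      also have "\<dots> = indicator U y * (ennreal (real (Suc n)) * ennreal (1 / real (Suc n)))"
        by (simp add: mult_ac)
      also have "\<dots> = indicator U y" by (subst ennreal_mult[symmetric]) auto
      finally show "(\<integral>\<^sup>+t. ennreal (real (Suc n)) * (indicator U y * (if t < v y \<and> v y < t + 1 / real (Suc n) then 1 else 0)) \<partial>lborel)
         = indicator U y" .
    qed
    finally show ?thesis by (simp add: G.emeasure_eq_measure)
  qed
  have "(\<integral>\<^sup>+t. phi U t \<partial>lborel) \<le>
    liminf (\<lambda>n. \<integral>\<^sup>+t. ennreal (real (Suc n) * measure G (U \<inter> {y. t < v y \<and> v y < t + 1 / real (Suc n)})) \<partial>lborel)"
    unfolding phi_def using phi_strip_meas[OF assms] by (intro nn_integral_liminf) simp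
  then show ?thesis unfolding eq by (simp add: Liminf_const)
qed

text \<open>The dilated balls are disjoint, so their strips add up inside \<open>U\<close>. The
  condition \<open>level\<close> sees \<open>{y. t + 1 / real (Suc n) \<le> v y}\<close> instead of
  \<open>{y. t < v y}\<close>. For large \<open>n\<close> this loses at most half of the mass,
  simultaneously for all balls because \<open>F\<close> is finite; hence the factor
  \<open>\<theta> / (2 * K)\<close>.\<close>

lemma phi_box:
  assumes F: "finite F" "F \<subseteq> closure \<Omega>" and r: "\<And>x. x \<in> F \<Longrightarrow> 0 < r x"
    and dj: "disjoint_family_on (\<lambda>x. ball x (L * r x)) F"
    and U: "U \<in> sets \<nu>" "\<And>x. x \<in> F \<Longrightarrow> ball x (L * r x) \<subseteq> U" and \<theta>: "0 < \<theta>"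
    and hi: "\<And>x. x \<in> F \<Longrightarrow> \<theta> * measure \<nu> (ball x (r x)) \<le> measure \<nu> (ball x (r x) \<inter> {y. t < v y})"
    and lo: "\<And>x. x \<in> F \<Longrightarrow> \<theta> * measure \<nu> (ball x (r x)) \<le> measure \<nu> (ball x (r x) \<inter> {y. v y \<le> t})"
  shows "ennreal (\<theta> / (2 * K) * (\<Sum>x\<in>F. measure \<nu> (ball x (r x)) / r x)) \<le> phi U t"
  unfolding phi_def
proof (rule Liminf_bounded)
  define S where "S n = {y. t < v y \<and> v y < t + 1 / real (Suc n)}" for n
  have "\<forall>\<^sub>F n in sequentially. \<theta> / 2 * measure \<nu> (ball x (r x)) < measure \<nu> (ball x (r x) \<inter> {y. t + 1 / real (Suc n) \<le> v y})"
    if "x \<in> F" for x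
  proof -
    have un: "(\<Union>n. ball x (r x) \<inter> {y. t + 1 / real (Suc n) \<le> v y}) = ball x (r x) \<inter> {y. t < v y}"
    proof (intro equalityI subsetI)
      fix y assume y: "y \<in> ball x (r x) \<inter> {y. t < v y}"
      then obtain n where "1 / real (Suc n) < v y - t" using nat_approx_posE[of "v y - t"] by auto
      then show "y \<in> (\<Union>n. ball x (r x) \<inter> {y. t + 1 / real (Suc n) \<le> v y})" using y by (auto intro!: exI[of _ n])
    next
      fix y assume "y \<in> (\<Union>n. ball x (r x) \<inter> {y. t + 1 / real (Suc n) \<le> v y})"
      then obtain n where "y \<in> ball x (r x)" "t + 1 / real (Suc n) \<le> v y" by blast
      moreover have "0 < 1 / real (Suc n)" by simp
      ultimately have "y \<in> ball x (r x)" "t < v y" by linarith+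
      then show "y \<in> ball x (r x) \<inter> {y. t < v y}" by blast
    qed
    have "(\<lambda>n. measure \<nu> (ball x (r x) \<inter> {y. t + 1 / real (Suc n) \<le> v y})) \<longlonglongrightarrow>
       measure \<nu> (\<Union>n. ball x (r x) \<inter> {y. t + 1 / real (Suc n) \<le> v y})"
    proof (rule finite_Lim_measure_incseq)
      show "incseq (\<lambda>n. ball x (r x) \<inter> {y. t + 1 / real (Suc n) \<le> v y})"
      proof (rule monoI, rule subsetI)
        fix m n :: nat and y assume "m \<le> n" and y: "y \<in> ball x (r x) \<inter> {y. t + 1 / real (Suc m) \<le> v y}"
        have "1 / real (Suc n) \<le> 1 / real (Suc m)" using \<open>m \<le> n\<close> by (intro divide_left_mono) auto
        then show "y \<in> ball x (r x) \<inter> {y. t + 1 / real (Suc n) \<le> v y}" using y by auto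
      qed
    qed auto
    moreover have "\<theta> / 2 * measure \<nu> (ball x (r x)) < measure \<nu> (\<Union>n. ball x (r x) \<inter> {y. t + 1 / real (Suc n) \<le> v y})"
    proof -
      have "0 < \<theta> * measure \<nu> (ball x (r x))"
        using \<theta> ball_pos[of x "r x"] r[OF that] F(2) that by auto
      then show ?thesis using hi[OF that] unfolding un by linarith
    qed
    ultimately show ?thesis by (rule order_tendstoD)
  qed
  then have "\<forall>\<^sub>F n in sequentially. \<forall>x\<in>F. \<theta> / 2 * measure \<nu> (ball x (r x)) < measure \<nu> (ball x (r x) \<inter> {y. t + 1 / real (Suc n) \<le> v y})"
    using F(1) by (simp add: eventually_ball_finite)
  then show "\<forall>\<^sub>F n in sequentially. ennreal (\<theta> / (2 * K) * (\<Sum>x\<in>F. measure \<nu> (ball x (r x)) / r x)) \<le>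
     ennreal (real (Suc n) * measure G (U \<inter> {y. t < v y \<and> v y < t + 1 / real (Suc n)}))"
  proof eventually_elim
    case (elim n)
    have "\<theta> / (2 * K) * (\<Sum>x\<in>F. measure \<nu> (ball x (r x)) / r x) = (\<Sum>x\<in>F. \<theta> / (2 * K) * (measure \<nu> (ball x (r x)) / r x))"
      by (simp add: sum_distrib_left)
    also have "\<dots> \<le> (\<Sum>x\<in>F. real (Suc n) * measure G (ball x (L * r x) \<inter> S n))"
    proof (rule sum_mono)
      fix x assume x: "x \<in> F"
      have "0 \<le> \<theta> * measure \<nu> (ball x (r x))" using \<theta> by simp
      then have "\<theta> / 2 * measure \<nu> (ball x (r x)) \<le>
         min (measure \<nu> (ball x (r x) \<inter> {y. v y \<le> t})) (measure \<nu> (ball x (r x) \<inter> {y. t + 1 / real (Suc n) \<le> v y}))"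
        using elim x lo[OF x] by fastforce
      then have "1 / real (Suc n) * (\<theta> / 2 * measure \<nu> (ball x (r x))) \<le>
         1 / real (Suc n) * min (measure \<nu> (ball x (r x) \<inter> {y. v y \<le> t})) (measure \<nu> (ball x (r x) \<inter> {y. t + 1 / real (Suc n) \<le> v y}))"
        by (rule mult_left_mono) simp
      also have "\<dots> \<le> K * r x * measure G (ball x (L * r x) \<inter> S n)"
        unfolding S_def using x F(2) r[OF x] by (intro level) auto
      finally show "\<theta> / (2 * K) * (measure \<nu> (ball x (r x)) / r x) \<le> real (Suc n) * measure G (ball x (L * r x) \<inter> S n)"
        using r[OF x] K_pos by (simp add: field_simps del: of_nat_Suc)
    qed
    also have "\<dots> = real (Suc n) * measure G (\<Union>x\<in>F. ball x (L * r x) \<inter> S n)"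
    proof (subst G.finite_measure_finite_Union)
      show "(\<lambda>x. ball x (L * r x) \<inter> S n) ` F \<subseteq> sets G" unfolding S_def by (auto simp: sets_G)
      show "disjoint_family_on (\<lambda>x. ball x (L * r x) \<inter> S n) F"
        using dj unfolding disjoint_family_on_def by blast
    qed (use F in \<open>auto simp: sum_distrib_left\<close>)
    also have "\<dots> \<le> real (Suc n) * measure G (U \<inter> S n)"
      using U by (intro mult_left_mono G.finite_measure_mono) (auto simp: S_def sets_G)
    finally show ?case unfolding S_def by (rule ennreal_leI)
  qed
qed

text \<open>The selection is made for the balls dilated by \<open>L\<close>, on which
  \<open>level\<close> measures the strip. The cover then consists of balls dilated by
  \<open>5 * L\<close>.\<close>

lemma box_cover:
  assumes A: "A \<subseteq> closure \<Omega>" and r: "\<And>x. x \<in> A \<Longrightarrow> 0 < r x \<and> r x \<le> R"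
    and U: "U \<in> sets \<nu>" "\<And>x. x \<in> A \<Longrightarrow> ball x (L * r x) \<subseteq> U" and \<theta>: "0 < \<theta>"
    and hi: "\<And>x. x \<in> A \<Longrightarrow> \<theta> * measure \<nu> (ball x (r x)) \<le> measure \<nu> (ball x (r x) \<inter> {y. t < v y})"
    and lo: "\<And>x. x \<in> A \<Longrightarrow> \<theta> * measure \<nu> (ball x (r x)) \<le> measure \<nu> (ball x (r x) \<inter> {y. v y \<le> t})"
  obtains D where "countable D" "D \<subseteq> A" "A \<subseteq> (\<Union>x\<in>D. ball x (5 * L * r x))"
    "\<And>F. finite F \<Longrightarrow> F \<subseteq> D \<Longrightarrow> ennreal (\<theta> / (2 * K) * (\<Sum>x\<in>F. measure \<nu> (ball x (r x)) / r x)) \<le> phi U t"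
proof -
  obtain D where D: "D \<subseteq> A" "disjoint_family_on (\<lambda>x. ball x (L * r x)) D"
     "\<And>x. x \<in> A \<Longrightarrow> \<exists>y\<in>D. ball x (L * r x) \<subseteq> ball y (5 * (L * r y))"
  proof (rule vitali_covering_metric[of A "\<lambda>x. L * r x" "L * R"])
    show "0 < L * r x \<and> L * r x \<le> L * R" if "x \<in> A" for x
      using r[OF that] L_ge_1 by auto
  qed blast
  show ?thesis
  proof (rule that)
    show "countable D"
    proof (rule countable_disjoint_family[OF D(2)])
      fix x assume "x \<in> D"
      then have "x \<in> closure \<Omega>" "0 < r x" using D(1) A r by auto
      then show "0 < measure \<nu> (ball x (L * r x))" using L_ge_1 by (intro ball_pos) auto
    qed simp
    show "A \<subseteq> (\<Union>x\<in>D. ball x (5 * L * r x))"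
    proof
      fix x assume x: "x \<in> A"
      then have "x \<in> ball x (L * r x)" using r[OF x] L_ge_1 by simp
      then show "x \<in> (\<Union>x\<in>D. ball x (5 * L * r x))"
        using D(3)[OF x] unfolding mult.assoc by blast
    qed
    show "ennreal (\<theta> / (2 * K) * (\<Sum>x\<in>F. measure \<nu> (ball x (r x)) / r x)) \<le> phi U t"
      if "finite F" "F \<subseteq> D" for F
    proof (rule phi_box)
      have FA: "F \<subseteq> A" using that D(1) by blast
      show "F \<subseteq> closure \<Omega>" using FA A by blast
      show "disjoint_family_on (\<lambda>x. ball x (L * r x)) F" by (rule disjoint_family_on_mono[OF that(2) D(2)])
      fix x assume "x \<in> F"
      then have "x \<in> A" using FA by blast
      then show "0 < r x" "ball x (L * r x) \<subseteq> U"
        "\<theta> * measure \<nu> (ball x (r x)) \<le> measure \<nu> (ball x (r x) \<inter> {y. t < v y})"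
        "\<theta> * measure \<nu> (ball x (r x)) \<le> measure \<nu> (ball x (r x) \<inter> {y. v y \<le> t})"
        by (simp_all add: r U(2) hi lo)
    qed (use that U \<theta> in auto)
  qed (use D in auto)
qed

text \<open>Two doublings are built in. In \<open>isoperimetric\<close> a ball about
  \<open>y\<close> of radius \<open>2 * r\<close> has at most \<open>Cd ^ 2\<close> times the mass
  of \<open>ball x r\<close>, so half of the latter is a fraction \<theta>0 of the former. In
  \<open>crossing\<close> one doubling is spent, through
  \<open>\<theta>0 \<le> 1 / (2 * Cd)\<close>.\<close>

definition \<theta>0 :: real where "\<theta>0 = 1 / (2 * Cd ^ 2)"

lemma \<theta>0: "0 < \<theta>0" "\<theta>0 \<le> 1 / 2" "\<theta>0 \<le> 1 / (2 * Cd)"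
proof -
  have "1 * Cd \<le> Cd * Cd" using Cd_ge_1 by (intro mult_right_mono) auto
  then have "Cd \<le> Cd ^ 2" "1 \<le> Cd ^ 2" using Cd_ge_1 by (auto simp: power2_eq_square intro: order_trans)
  then show "0 < \<theta>0" "\<theta>0 \<le> 1 / 2" "\<theta>0 \<le> 1 / (2 * Cd)"
    using Cd_ge_1 unfolding \<theta>0_def by (auto intro!: divide_left_mono simp: field_simps)
qed

lemma ball_split:
  "measure \<nu> (ball x r) = measure \<nu> (ball x r \<inter> {y. t < v y}) + measure \<nu> (ball x r \<inter> {y. v y \<le> t})"
proof -
  have "measure \<nu> ((ball x r \<inter> {y. t < v y}) \<union> (ball x r \<inter> {y. v y \<le> t})) =
     measure \<nu> (ball x r \<inter> {y. t < v y}) + measure \<nu> (ball x r \<inter> {y. v y \<le> t})"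
    by (rule finite_measure_Union) auto
  moreover have "(ball x r \<inter> {y. t < v y}) \<union> (ball x r \<inter> {y. v y \<le> t}) = ball x r" by auto
  ultimately show ?thesis by simp
qed

text \<open>A discrete intermediate value argument: the radius is halved from \<open>r1\<close> on
  until the sublevel set first has density below \<theta>0. One step earlier it is still thick, and
  by doubling the superlevel set, which has at least half of the smaller ball, has density \<theta>0
  in the larger one.\<close>

lemma crossing:
  assumes x: "x \<in> closure \<Omega>" and r: "0 < r2" "r2 \<le> r1"
    and lo: "\<theta>0 * measure \<nu> (ball x r1) \<le> measure \<nu> (ball x r1 \<inter> {y. v y \<le> t})"
    and hi: "measure \<nu> (ball x r2 \<inter> {y. v y \<le> t}) < \<theta>0 * measure \<nu> (ball x r2)"
  shows "\<exists>r. 0 < r \<and> r \<le> r1 \<and> \<theta>0 * measure \<nu> (ball x r) \<le> measure \<nu> (ball x r \<inter> {y. t < v y}) \<and>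
    \<theta>0 * measure \<nu> (ball x r) \<le> measure \<nu> (ball x r \<inter> {y. v y \<le> t})"
proof -
  define low where "low s \<longleftrightarrow> measure \<nu> (ball x s \<inter> {y. v y \<le> t}) < \<theta>0 * measure \<nu> (ball x s)" for s
  define \<rho> where "\<rho> k = r1 / 2 ^ k" for k :: nat
  have \<rho>: "0 < \<rho> k" "\<rho> k \<le> r1" "\<rho> k = 2 * \<rho> (Suc k)" for k
    using r unfolding \<rho>_def by (auto simp: field_simps)
  have up: "\<theta>0 * measure \<nu> (ball x s) \<le> measure \<nu> (ball x s \<inter> {y. t < v y})"
    if "low s'" "0 < s'" "s' \<le> s" "s \<le> 2 * s'" for s s'
  proof -
    have "measure \<nu> (ball x s) \<le> measure \<nu> (ball x (2 * s'))"
      using that by (intro finite_measure_mono subset_ball) auto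
    also have "\<dots> \<le> Cd * measure \<nu> (ball x s')" by (intro ball_double x that)
    finally have 1: "measure \<nu> (ball x s) \<le> Cd * measure \<nu> (ball x s')" .
    have "(1 - \<theta>0) * measure \<nu> (ball x s') \<le> measure \<nu> (ball x s' \<inter> {y. t < v y})"
      using that(1) ball_split[of x s' t] unfolding low_def by (simp add: algebra_simps)
    moreover have "1 / 2 * measure \<nu> (ball x s') \<le> (1 - \<theta>0) * measure \<nu> (ball x s')"
      using \<theta>0 by (intro mult_right_mono) auto
    moreover have "measure \<nu> (ball x s' \<inter> {y. t < v y}) \<le> measure \<nu> (ball x s \<inter> {y. t < v y})"
      using that by (intro finite_measure_mono) auto
    ultimately have 2: "1 / 2 * measure \<nu> (ball x s') \<le> measure \<nu> (ball x s \<inter> {y. t < v y})" by linarith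
    have "\<theta>0 * measure \<nu> (ball x s) \<le> 1 / (2 * Cd) * (Cd * measure \<nu> (ball x s'))"
      using \<theta>0 1 Cd_ge_1 by (intro mult_mono) auto
    also have "\<dots> = 1 / 2 * measure \<nu> (ball x s')" using Cd_ge_1 by simp
    finally show ?thesis using 2 by linarith
  qed
  have "\<exists>k. r1 / r2 < 2 ^ k" using real_arch_pow[of 2 "r1/r2"] by simp
  then have ex: "\<exists>k. \<rho> k < r2" using r unfolding \<rho>_def by (simp add: field_simps)
  define m where "m = (LEAST k. \<rho> k < r2)"
  have m: "\<rho> m < r2" unfolding m_def using ex by (rule LeastI_ex)
  have "m \<noteq> 0" using m r by (cases m) (auto simp: \<rho>_def)
  then obtain k where k: "m = Suc k" by (cases m) auto
  have "\<not> \<rho> k < r2" using not_less_Least[of k "\<lambda>k. \<rho> k < r2"] k unfolding m_def by auto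
  \<comment> \<open>\<open>\<rho> k\<close> is the last halved radius not below \<open>r2\<close>,
    hence at most \<open>2 * r2\<close>. If the sublevel set is still thick there, comparison with
    \<open>r2\<close> itself shows that the superlevel set is thick as well.\<close>
  then have k2: "r2 \<le> \<rho> k" "\<rho> k \<le> 2 * r2" using m \<rho>(3)[of k] unfolding k by auto
  show ?thesis
  proof (cases "low (\<rho> k)")
    case False
    then show ?thesis
      using up[of r2 "\<rho> k"] hi r(1) k2 \<rho>(1,2)[of k] unfolding low_def by (intro exI[of _ "\<rho> k"]) auto
  next
    case True
    define j where "j = (LEAST j. low (\<rho> j))"
    have j: "low (\<rho> j)" unfolding j_def using True by (rule LeastI)
    have "\<not> low r1" using lo unfolding low_def by simp
    then have "j \<noteq> 0" using j by (cases j) (auto simp: \<rho>_def)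
    then obtain i where i: "j = Suc i" by (cases j) auto
    have "\<not> low (\<rho> i)" using not_less_Least[of i "\<lambda>k. low (\<rho> k)"] i unfolding j_def by auto
    moreover have "\<theta>0 * measure \<nu> (ball x (\<rho> i)) \<le> measure \<nu> (ball x (\<rho> i) \<inter> {y. t < v y})"
      using up[OF j[unfolded i], of "\<rho> i"] \<rho>(1)[of "Suc i"] \<rho>(3)[of i] by simp
    ultimately show ?thesis using \<rho>(1,2)[of i] unfolding low_def by (intro exI[of _ "\<rho> i"]) auto
  qed
qed

end

section \<open>Isoperimetric and Sobolev-Poincare inequalities\<close>

text \<open>The Sobolev conjugate of 1 in dimension \<open>Q\<close>, which is also the dual
  exponent of \<open>Q\<close>.\<close>

definition sobolev_exponent :: "real \<Rightarrow> real" where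
  "sobolev_exponent Q = Q / (Q - 1)"

context doubling_domain begin

abbreviation pp :: real where "pp \<equiv> sobolev_exponent Q"

lemma pp: "1 < pp" "0 < 1 / pp" "1 / pp = 1 - 1 / Q" "pp / Q = pp - 1" "1 / pp * pp = 1" "pp * (1 / pp) = 1"
  using Q_gt_1 unfolding sobolev_exponent_def by (auto simp: field_simps)

end

context level_poincare begin

text \<open>The factors come from the dilated cover, from the mass bound that limits the radii, and
  from \<open>phi_box\<close>.\<close>

definition Ciso :: real where
  "Ciso = dbl (5 * L) * (2 * cm powr (- 1 / Q) * (2 * K / \<theta>0))"

lemma Ciso_pos: "0 < Ciso"
  unfolding Ciso_def using dbl_ge_1[of "5 * L"] cm_pos K_pos \<theta>0(1) by (intro mult_pos_pos) auto

text \<open>By continuity \<open>{y. t < v y}\<close> fills small balls around each of its points in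
  \<Omega>, while at radius \<open>2 * r\<close> its complement is thick; \<open>crossing\<close>
  gives a radius at which both are. A Vitali subfamily of these balls has a codimension 1 sum
  bounded by the perimeter, and the mass bound turns this into a bound on the total mass.\<close>

lemma isoperimetric:
  assumes x: "x \<in> closure \<Omega>" and r: "0 < r"
    and half: "measure \<nu> (ball x r \<inter> {y. t < v y}) \<le> measure \<nu> (ball x r) / 2"
  shows "ennreal (measure \<nu> (ball x r \<inter> {y. t < v y}) powr (1 / pp)) \<le>
    ennreal (Ciso * r * measure \<nu> (ball x r) powr (- 1 / Q)) * phi (ball x (3 * L * r)) t"
proof -
  define mB where "mB = measure \<nu> (ball x r)"
  have mB: "0 < mB" unfolding mB_def by (rule ball_pos[OF x r])
  have cpos: "0 < Ciso * r * mB powr (- 1 / Q)" using Ciso_pos r mB by simp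
  define U where "U = ball x (3 * L * r)"
  show ?thesis
  proof (cases "phi U t = top")
    case True
    define c where "c = Ciso * r * mB powr (- 1 / Q)"
    have "ennreal c * phi U t = top" using True cpos unfolding c_def[symmetric] by (simp add: ennreal_mult_top)
    then show ?thesis unfolding c_def U_def mB_def by simp
  next
    case False
    then obtain \<phi> where \<phi>: "0 \<le> \<phi>" "phi U t = ennreal \<phi>" by (cases "phi U t") auto
    \<comment> \<open>Intersecting with \<Omega> loses no mass and yields an open set, as
      \<open>v\<close> is known to be continuous on \<Omega> only.\<close>
    define A where "A = ball x r \<inter> {y. t < v y} \<inter> \<Omega>"
    have "\<exists>s. 0 < s \<and> s \<le> 2 * r \<and> \<theta>0 * measure \<nu> (ball y s) \<le> measure \<nu> (ball y s \<inter> {y. t < v y}) \<and>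
      \<theta>0 * measure \<nu> (ball y s) \<le> measure \<nu> (ball y s \<inter> {y. v y \<le> t})" if y: "y \<in> A" for y
    proof -
      have yc: "y \<in> closure \<Omega>" and yx: "dist x y < r" and yv: "t < v y" "y \<in> \<Omega>"
        using y closure_subset unfolding A_def by auto
      have "openin (top_of_set \<Omega>) (\<Omega> \<inter> v -` {t<..})"
        by (rule continuous_openin_preimage_gen[OF v_cont]) simp
      then have "open (\<Omega> \<inter> v -` {t<..})" using open_dom by (simp add: openin_open_eq)
      then obtain e where e: "0 < e" "ball y e \<subseteq> \<Omega> \<inter> v -` {t<..}"
        using yv by (auto elim: openE)
      define r2 where "r2 = min e (2 * r)"
      have r2: "0 < r2" "r2 \<le> 2 * r" "ball y r2 \<subseteq> ball y e" using e r unfolding r2_def by (auto intro: subset_ball)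
      then have "ball y r2 \<inter> {y. v y \<le> t} = {}" using e(2) by auto
      then have hi: "measure \<nu> (ball y r2 \<inter> {y. v y \<le> t}) < \<theta>0 * measure \<nu> (ball y r2)"
        using \<theta>0(1) ball_pos[OF yc r2(1)] by simp
      have sub: "ball x r \<subseteq> ball y (2 * r)" "ball y (2 * r) \<subseteq> ball x (4 * r)"
      proof -
        show "ball x r \<subseteq> ball y (2 * r)"
        proof
          fix z assume "z \<in> ball x r"
          then show "z \<in> ball y (2 * r)" using yx dist_triangle[of y z x] by (simp add: dist_commute)
        qed
        show "ball y (2 * r) \<subseteq> ball x (4 * r)"
        proof
          fix z assume "z \<in> ball y (2 * r)"
          then show "z \<in> ball x (4 * r)" using yx dist_triangle[of x z y] r by simp
        qed
      qed
      have "measure \<nu> (ball y (2 * r)) \<le> measure \<nu> (ball x (2 * (2 * r)))"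
        using sub(2) by (intro finite_measure_mono) auto
      also have "\<dots> \<le> Cd * (Cd * mB)"
        using ball_double[OF x, of "2 * r"] ball_double[OF x r] r Cd_ge_1 unfolding mB_def
        by (intro order_trans[OF ball_double[OF x] mult_left_mono]) auto
      finally have "\<theta>0 * measure \<nu> (ball y (2 * r)) \<le> \<theta>0 * (Cd * (Cd * mB))"
        using \<theta>0(1) by (intro mult_left_mono) auto
      also have "\<dots> = mB / 2" using Cd_ge_1 unfolding \<theta>0_def by (simp add: power2_eq_square)
      also have "\<dots> \<le> measure \<nu> (ball x r \<inter> {y. v y \<le> t})"
        using half ball_split[of x r t] unfolding mB_def by simp
      also have "\<dots> \<le> measure \<nu> (ball y (2 * r) \<inter> {y. v y \<le> t})"
        using sub(1) by (intro finite_measure_mono) auto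
      finally have lo: "\<theta>0 * measure \<nu> (ball y (2 * r)) \<le> measure \<nu> (ball y (2 * r) \<inter> {y. v y \<le> t})" .
      show ?thesis by (rule crossing[OF yc r2(1,2) lo hi])
    qed
    then obtain s where s: "\<And>y. y \<in> A \<Longrightarrow> 0 < s y \<and> s y \<le> 2 * r"
      "\<And>y. y \<in> A \<Longrightarrow> \<theta>0 * measure \<nu> (ball y (s y)) \<le> measure \<nu> (ball y (s y) \<inter> {y. t < v y})"
      "\<And>y. y \<in> A \<Longrightarrow> \<theta>0 * measure \<nu> (ball y (s y)) \<le> measure \<nu> (ball y (s y) \<inter> {y. v y \<le> t})"
      by metis
    have Ac: "A \<subseteq> closure \<Omega>" unfolding A_def using closure_subset by auto
    have AU: "ball y (L * s y) \<subseteq> U" if "y \<in> A" for y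
    proof
      fix z assume "z \<in> ball y (L * s y)"
      moreover have "L * s y \<le> L * (2 * r)" using s(1)[OF that] L_ge_1 by (intro mult_left_mono) auto
      moreover have "dist x y < r" using that unfolding A_def by simp
      moreover have "1 * r \<le> L * r" using L_ge_1 r by (intro mult_right_mono) auto
      ultimately show "z \<in> U" using dist_triangle[of x z y] unfolding U_def by simp
    qed
    obtain D where D: "countable D" "D \<subseteq> A" "A \<subseteq> (\<Union>x\<in>D. ball x (5 * L * s x))"
      "\<And>F. finite F \<Longrightarrow> F \<subseteq> D \<Longrightarrow> ennreal (\<theta>0 / (2 * K) * (\<Sum>x\<in>F. measure \<nu> (ball x (s x)) / s x)) \<le> phi U t"
      by (rule box_cover[OF Ac s(1) _ AU \<theta>0(1) s(2,3)]) (auto simp: U_def)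
    define \<Phi> where "\<Phi> = 2 * K / \<theta>0 * \<phi>"
    have \<Phi>: "0 \<le> \<Phi>" unfolding \<Phi>_def using K_pos \<theta>0(1) \<phi> by simp
    define T where "T = (2 * r * (cm * mB) powr (- 1 / Q) * \<Phi>) powr pp"
    have sT: "(\<Sum>y\<in>F. measure \<nu> (ball y (s y))) \<le> T" if F: "finite F" "F \<subseteq> D" for F
    proof -
      define a where "a = (\<Sum>y\<in>F. measure \<nu> (ball y (s y)))"
      have a0: "0 \<le> a" unfolding a_def by (intro sum_nonneg) simp
      have "ennreal (\<theta>0 / (2 * K) * (\<Sum>x\<in>F. measure \<nu> (ball x (s x)) / s x)) \<le> ennreal \<phi>"
        using D(4)[OF F] \<phi> by simp
      then have "\<theta>0 / (2 * K) * (\<Sum>x\<in>F. measure \<nu> (ball x (s x)) / s x) \<le> \<phi>"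
        using \<phi>(1) by (simp add: ennreal_le_iff)
      then have sum\<Phi>: "(\<Sum>x\<in>F. measure \<nu> (ball x (s x)) / s x) \<le> \<Phi>"
        unfolding \<Phi>_def using K_pos \<theta>0(1) by (simp add: field_simps)
      show ?thesis
      proof (cases "a = 0")
        case True
        then show ?thesis unfolding a_def[symmetric] T_def by simp
      next
        case False
        with a0 have apos: "0 < a" by simp
        \<comment> \<open>Every selected ball has mass at most the sum \<open>a\<close>, so the mass
          bound in \<open>ball x (2 * r)\<close> forces its radius below \<open>b\<close>. Replacing
          the radii by \<open>b\<close> gives \<open>a \<le> \<Phi> * b\<close>, where
          \<open>b\<close> is proportional to \<open>a powr (1 / Q)\<close>; division leaves
          \<open>a\<close> to the power \<open>1 - 1 / Q\<close>.\<close>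
        define b where "b = 2 * r * (a / (cm * mB)) powr (1 / Q)"
        have b0: "0 \<le> b" unfolding b_def using r by simp
        have sb: "s y \<le> b" if y: "y \<in> F" for y
        proof -
          have yA: "y \<in> A" using y F D(2) by auto
          then have yx: "y \<in> ball x (2 * r)" "y \<in> closure \<Omega>" using r Ac unfolding A_def by auto
          have "cm * (s y / (2 * r)) powr Q * mB \<le> cm * (s y / (2 * r)) powr Q * measure \<nu> (ball x (2 * r))"
            unfolding mB_def using cm_pos r by (intro mult_left_mono finite_measure_mono subset_ball) auto
          also have "\<dots> \<le> measure \<nu> (ball y (s y))"
            using s(1)[OF yA] yx by (intro mass_bound x) auto
          also have "\<dots> \<le> a" unfolding a_def using y F by (intro member_le_sum) auto
          finally have "(s y / (2 * r)) powr Q \<le> a / (cm * mB)"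
            using cm_pos mB by (simp add: field_simps)
          then have "((s y / (2 * r)) powr Q) powr (1 / Q) \<le> (a / (cm * mB)) powr (1 / Q)"
            using Q_gt_1 by (intro powr_mono2) auto
          then have "s y / (2 * r) \<le> (a / (cm * mB)) powr (1 / Q)"
            using Q_gt_1 s(1)[OF yA] r by (simp add: powr_powr)
          then show ?thesis using r unfolding b_def by (simp add: field_simps)
        qed
        have "a = (\<Sum>y\<in>F. measure \<nu> (ball y (s y)) / s y * s y)"
          unfolding a_def using s(1) F D(2) by (intro sum.cong) force+
        also have "\<dots> \<le> (\<Sum>y\<in>F. measure \<nu> (ball y (s y)) / s y * b)"
          using s(1) F D(2) sb by (intro sum_mono mult_left_mono divide_nonneg_nonneg) force+
        also have "\<dots> = (\<Sum>y\<in>F. measure \<nu> (ball y (s y)) / s y) * b" by (rule sum_distrib_right[symmetric])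
        also have "\<dots> \<le> \<Phi> * b" using sum\<Phi> b0 by (rule mult_right_mono)
        also have "\<dots> = 2 * r * (cm * mB) powr (- 1 / Q) * \<Phi> * a powr (1 / Q)"
          unfolding b_def using apos cm_pos mB by (simp add: powr_divide powr_minus field_simps)
        finally have "a \<le> 2 * r * (cm * mB) powr (- 1 / Q) * \<Phi> * a powr (1 / Q)" .
        then have "a / a powr (1 / Q) \<le> 2 * r * (cm * mB) powr (- 1 / Q) * \<Phi>"
          using apos by (simp add: divide_le_eq)
        moreover have "a / a powr (1 / Q) = a powr (1 / pp)"
          using apos powr_diff[of a 1 "1 / Q"] by (simp only: pp(3)) simp
        ultimately have "a powr (1 / pp) \<le> 2 * r * (cm * mB) powr (- 1 / Q) * \<Phi>" by simp
        then have "(a powr (1 / pp)) powr pp \<le> T"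
          unfolding T_def using pp(1) by (intro powr_mono2) auto
        then show ?thesis unfolding a_def[symmetric] powr_powr pp(5) using apos by simp
      qed
    qed
    have "emeasure \<nu> (\<Union>y\<in>D. ball y (5 * L * s y)) \<le> ennreal (dbl (5 * L) * T)"
    proof (rule emeasure_UN_le_finite_sums[OF D(1)])
      fix F assume F: "finite F" "F \<subseteq> D"
      have "(\<Sum>i\<in>F. emeasure \<nu> (ball i (5 * L * s i))) = ennreal (\<Sum>i\<in>F. measure \<nu> (ball i (5 * L * s i)))"
        by (simp add: emeasure_eq_measure)
      also have "\<dots> \<le> ennreal (\<Sum>i\<in>F. dbl (5 * L) * measure \<nu> (ball i (s i)))"
      proof (intro ennreal_leI sum_mono ball_dbl)
        fix i assume "i \<in> F"
        then have "i \<in> A" using F D(2) by auto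
        then show "i \<in> closure \<Omega>" "0 < s i" using Ac s(1) by auto
      qed
      also have "\<dots> = ennreal (dbl (5 * L) * (\<Sum>i\<in>F. measure \<nu> (ball i (s i))))"
        by (simp add: sum_distrib_left)
      also have "\<dots> \<le> ennreal (dbl (5 * L) * T)"
        using sT[OF F] dbl_ge_1[of "5 * L"] by (intro ennreal_leI mult_left_mono) auto
      finally show "(\<Sum>i\<in>F. emeasure \<nu> (ball i (5 * L * s i))) \<le> ennreal (dbl (5 * L) * T)" .
    qed simp
    moreover have "emeasure \<nu> A \<le> emeasure \<nu> (\<Union>y\<in>D. ball y (5 * L * s y))"
      using D(1,3) by (intro emeasure_mono sets.countable_UN'') auto
    ultimately have "ennreal (measure \<nu> A) \<le> ennreal (dbl (5 * L) * T)"
      by (simp add: emeasure_eq_measure[symmetric])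
    moreover have "0 \<le> dbl (5 * L) * T" unfolding T_def using dbl_ge_1[of "5 * L"] by simp
    ultimately have mA: "measure \<nu> A \<le> dbl (5 * L) * T" by (simp add: ennreal_le_iff)
    have "measure \<nu> (ball x r \<inter> {y. t < v y}) = measure \<nu> A"
      unfolding A_def by (rule measure_Int_dom[symmetric]) auto
    then have "measure \<nu> (ball x r \<inter> {y. t < v y}) powr (1 / pp) \<le> (dbl (5 * L) * T) powr (1 / pp)"
      using mA pp(2) by (simp add: powr_mono2)
    also have "\<dots> = dbl (5 * L) powr (1 / pp) * T powr (1 / pp)"
      by (rule powr_mult)
    also have "T powr (1 / pp) = 2 * r * (cm * mB) powr (- 1 / Q) * \<Phi>"
      unfolding T_def using pp(1) \<Phi> r by (simp add: powr_powr)
    also have "dbl (5 * L) powr (1 / pp) * (2 * r * (cm * mB) powr (- 1 / Q) * \<Phi>) \<le>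
      dbl (5 * L) * (2 * r * (cm * mB) powr (- 1 / Q) * \<Phi>)"
    proof (rule mult_right_mono)
      have "dbl (5 * L) powr (1 / pp) \<le> dbl (5 * L) powr 1"
        using dbl_ge_1[of "5 * L"] pp(3) Q_gt_1 by (intro powr_mono) auto
      then show "dbl (5 * L) powr (1 / pp) \<le> dbl (5 * L)" using dbl_ge_1[of "5 * L"] by simp
    qed (use r \<Phi> in auto)
    also have "\<dots> = Ciso * r * mB powr (- 1 / Q) * \<phi>"
      unfolding Ciso_def \<Phi>_def using cm_pos mB by (simp add: powr_mult)
    finally have "ennreal (measure \<nu> (ball x r \<inter> {y. t < v y}) powr (1 / pp)) \<le> ennreal (Ciso * r * mB powr (- 1 / Q) * \<phi>)"
      by (rule ennreal_leI)
    also have "\<dots> = ennreal (Ciso * r * mB powr (- 1 / Q)) * phi U t"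
      unfolding \<phi>(2) using cpos \<phi>(1) by (intro ennreal_mult) auto
    finally show ?thesis unfolding U_def mB_def .
  qed
qed

text \<open>Truncation argument: \<open>\<psi> s\<close>, the power \<open>1 / pp\<close> of the
  mass of the superlevel set at \<open>m + s\<close>, is decreasing in \<open>s\<close> and has
  integral at most \<open>J\<close>. Hence \<open>s * \<psi> s \<le> J\<close>, and the integrand
  \<open>s powr (pp - 1) * \<psi> s powr pp\<close> of the layer-cake formula is at most
  \<open>J powr (pp - 1) * \<psi> s\<close>, which integrates to at most
  \<open>J powr pp\<close>.\<close>

lemma sobolev_poincare_plus:
  assumes x: "x \<in> closure \<Omega>" and r: "0 < r"
    and half: "measure \<nu> (ball x r \<inter> {y. m < v y}) \<le> measure \<nu> (ball x r) / 2"
  shows "(\<integral>\<^sup>+y\<in>ball x r. ennreal (max 0 (v y - m) powr pp) \<partial>\<nu>) \<le>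
    ennreal (pp * (Ciso * r * measure G (ball x (3 * L * r)) / measure \<nu> (ball x r)) powr pp * measure \<nu> (ball x r))"
proof -
  define mB where "mB = measure \<nu> (ball x r)"
  have mB: "0 < mB" unfolding mB_def by (rule ball_pos[OF x r])
  define U where "U = ball x (3 * L * r)"
  define c where "c = Ciso * r * mB powr (- 1 / Q)"
  have c: "0 < c" unfolding c_def using Ciso_pos r mB by simp
  define J where "J = c * measure G U"
  have J: "0 \<le> J" unfolding J_def using c by simp
  define \<psi> where "\<psi> s = measure \<nu> (ball x r \<inter> {y. m + s < v y}) powr (1 / pp)" for s
  have \<psi>le: "ennreal (\<psi> s) \<le> ennreal c * phi U (m + s)" if "0 \<le> s" for s
    unfolding \<psi>_def c_def mB_def U_def
  proof (rule isoperimetric[OF x r])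
    have "measure \<nu> (ball x r \<inter> {y. m + s < v y}) \<le> measure \<nu> (ball x r \<inter> {y. m < v y})"
      using that by (intro finite_measure_mono) auto
    then show "measure \<nu> (ball x r \<inter> {y. m + s < v y}) \<le> measure \<nu> (ball x r) / 2"
      using half by simp
  qed
  have [measurable]: "phi U \<in> borel_measurable borel" unfolding U_def by (rule phi_meas) simp
  have tot: "(\<integral>\<^sup>+s. ennreal c * phi U (m + s) \<partial>lborel) \<le> ennreal J"
  proof -
    have "(\<integral>\<^sup>+s. ennreal c * phi U (m + s) \<partial>lborel) = ennreal c * (\<integral>\<^sup>+s. phi U (m + s) \<partial>lborel)"
      by (rule nn_integral_cmult) measurable
    also have "(\<integral>\<^sup>+s. phi U (m + s) \<partial>lborel) = (\<integral>\<^sup>+s. phi U s \<partial>lborel)"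
      using nn_integral_real_affine[of "phi U" 1 m] by simp
    also have "ennreal c * (\<integral>\<^sup>+s. phi U s \<partial>lborel) \<le> ennreal c * ennreal (measure G U)"
      by (intro mult_left_mono integral_phi_le) (auto simp: U_def)
    also have "\<dots> = ennreal J" unfolding J_def using c by (simp add: ennreal_mult)
    finally show ?thesis .
  qed
  have s\<psi>: "s * \<psi> s \<le> J" if s: "0 \<le> s" for s
  proof -
    have "ennreal (s * \<psi> s) = (\<integral>\<^sup>+t. ennreal (\<psi> s) * indicator {0..s} t \<partial>lborel)"
      using s by (subst nn_integral_cmult_indicator) (auto simp: ennreal_mult mult.commute \<psi>_def)
    also have "\<dots> \<le> (\<integral>\<^sup>+t. ennreal c * phi U (m + t) \<partial>lborel)"
    proof (rule nn_integral_mono)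
      fix t :: real
      show "ennreal (\<psi> s) * indicator {0..s} t \<le> ennreal c * phi U (m + t)"
      proof (cases "t \<in> {0..s}")
        case True
        then have "measure \<nu> (ball x r \<inter> {y. m + s < v y}) \<le> measure \<nu> (ball x r \<inter> {y. m + t < v y})"
          by (intro finite_measure_mono) auto
        then have "\<psi> s \<le> \<psi> t" unfolding \<psi>_def using pp(2) by (intro powr_mono2) auto
        then have "ennreal (\<psi> s) \<le> ennreal (\<psi> t)" by (rule ennreal_leI)
        also have "\<dots> \<le> ennreal c * phi U (m + t)" using True by (intro \<psi>le) auto
        finally show ?thesis using True by simp
      qed auto
    qed
    also note tot
    finally show ?thesis using J by (simp add: ennreal_le_iff)
  qed
  define f where "f y = max 0 (v y - m) * indicator (ball x r) y" for y
  have [measurable]: "f \<in> borel_measurable \<nu>" unfolding f_def by measurable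
  have sigma: "sigma_finite_measure \<nu>" by unfold_locales
  have f_eq: "{y\<in>space \<nu>. s < f y} = ball x r \<inter> {y. m + s < v y}" if "0 \<le> s" for s
    unfolding f_def space_UNIV using that by (auto simp: indicator_def max_def split: if_splits)
  have "(\<integral>\<^sup>+y\<in>ball x r. ennreal (max 0 (v y - m) powr pp) \<partial>\<nu>) = (\<integral>\<^sup>+y. ennreal (f y powr pp) \<partial>\<nu>)"
    unfolding f_def using pp(1) by (intro nn_integral_cong) (auto simp: indicator_def)
  also have "\<dots> = (\<integral>\<^sup>+s\<in>{0..}. ennreal (pp * s powr (pp - 1)) * emeasure \<nu> {y\<in>space \<nu>. s < f y} \<partial>lborel)"
    by (rule nn_integral_Cavalieri_powr[OF sigma _ pp(1)]) (auto simp: f_def)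
  also have "\<dots> \<le> (\<integral>\<^sup>+s. ennreal (pp * J powr (pp - 1)) * (ennreal c * phi U (m + s)) \<partial>lborel)"
  proof (rule nn_integral_mono)
    fix s :: real
    show "ennreal (pp * s powr (pp - 1)) * emeasure \<nu> {y\<in>space \<nu>. s < f y} * indicator {0..} s \<le>
       ennreal (pp * J powr (pp - 1)) * (ennreal c * phi U (m + s))"
    proof (cases "0 \<le> s")
      case True
      have \<psi>0: "0 \<le> \<psi> s" unfolding \<psi>_def by simp
      have "measure \<nu> (ball x r \<inter> {y. m + s < v y}) = \<psi> s powr pp"
        unfolding \<psi>_def powr_powr pp(5) by simp
      also have "\<dots> = \<psi> s powr (pp - 1) * \<psi> s powr 1"
        by (subst powr_add[symmetric]) simp
      finally have "pp * s powr (pp - 1) * measure \<nu> (ball x r \<inter> {y. m + s < v y}) = pp * (s * \<psi> s) powr (pp - 1) * \<psi> s"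
        using True \<psi>0 by (simp add: powr_mult)
      also have "\<dots> \<le> pp * J powr (pp - 1) * \<psi> s"
        using s\<psi>[OF True] True \<psi>0 pp(1) by (intro mult_right_mono mult_left_mono powr_mono2) auto
      finally have "ennreal (pp * s powr (pp - 1) * measure \<nu> (ball x r \<inter> {y. m + s < v y})) \<le> ennreal (pp * J powr (pp - 1) * \<psi> s)"
        by (rule ennreal_leI)
      moreover have "ennreal (pp * s powr (pp - 1)) * emeasure \<nu> {y\<in>space \<nu>. s < f y} * indicator {0..} s =
         ennreal (pp * s powr (pp - 1) * measure \<nu> (ball x r \<inter> {y. m + s < v y}))"
        unfolding f_eq[OF True] emeasure_eq_measure using True pp(1) by (simp add: ennreal_mult)
      moreover have "ennreal (pp * J powr (pp - 1) * \<psi> s) = ennreal (pp * J powr (pp - 1)) * ennreal (\<psi> s)"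
        using pp(1) \<psi>0 by (intro ennreal_mult) auto
      moreover have "\<dots> \<le> ennreal (pp * J powr (pp - 1)) * (ennreal c * phi U (m + s))"
        by (intro mult_left_mono \<psi>le True) simp
      ultimately show ?thesis by simp
    qed simp
  qed
  also have "\<dots> = ennreal (pp * J powr (pp - 1)) * (\<integral>\<^sup>+s. ennreal c * phi U (m + s) \<partial>lborel)"
    by (rule nn_integral_cmult) measurable
  also have "\<dots> \<le> ennreal (pp * J powr (pp - 1)) * ennreal J"
    using tot by (intro mult_left_mono) auto
  also have "\<dots> = ennreal (pp * J powr (pp - 1) * J)" using J pp(1) by (simp add: ennreal_mult)
  also have "pp * J powr (pp - 1) * J = pp * J powr pp"
  proof -
    have "J powr (pp - 1) * J powr 1 = J powr pp" by (subst powr_add[symmetric]) simp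
    then show ?thesis using J by simp
  qed
  \<comment> \<open>Here \<open>1 / pp = 1 - 1 / Q\<close> turns the mass factor in \<open>J\<close>
    into a mean value over the ball.\<close>
  also have "J powr pp = (Ciso * r * measure G U / mB) powr pp * mB"
  proof -
    have "J = (Ciso * r * measure G U / mB) * mB powr (1 / pp)"
    proof -
      have "mB powr (- 1 / Q) = mB powr (1 / pp) / mB"
        using mB powr_diff[of mB "1 / pp" 1] pp(3) by simp
      then show ?thesis unfolding J_def c_def by simp
    qed
    then have "J powr pp = (Ciso * r * measure G U / mB * mB powr (1 / pp)) powr pp" by (rule arg_cong)
    also have "\<dots> = (Ciso * r * measure G U / mB) powr pp * (mB powr (1 / pp)) powr pp"
      by (rule powr_mult)
    finally have "J powr pp = (Ciso * r * measure G U / mB) powr pp * (mB powr (1 / pp)) powr pp" .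
    then show ?thesis using mB pp(1) by (simp add: powr_powr)
  qed
  finally show ?thesis unfolding U_def mB_def by (simp add: mult.assoc)
qed

text \<open>The strip of \<open>- v\<close> above \<open>t\<close> is the strip of \<open>v\<close>
  above \<open>- t - e\<close>, with the two extreme level sets exchanged. Statements about
  superlevel sets thus yield their counterparts for sublevel sets.\<close>

lemma level_poincare_uminus: "level_poincare \<nu> \<Omega> Cd Q cm G (\<lambda>y. - v y) K L"
proof unfold_locales
  fix x and r e t :: real assume xr: "x \<in> closure \<Omega>" "0 < r" "0 < e"
  have "{y. - v y \<le> t} = {y. (- t - e) + e \<le> v y}" "{y. t + e \<le> - v y} = {y. v y \<le> - t - e}"
    "{y. t < - v y \<and> - v y < t + e} = {y. (- t - e) < v y \<and> v y < (- t - e) + e}" by auto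
  then show "e * min (measure \<nu> (ball x r \<inter> {y. - v y \<le> t})) (measure \<nu> (ball x r \<inter> {y. t + e \<le> - v y}))
        \<le> K * r * measure G (ball x (L * r) \<inter> {y. t < - v y \<and> - v y < t + e})"
    using level[OF xr, of "- t - e"] by (simp only: min.commute)
qed (use sets_G v_cont K_pos L_ge_1 in \<open>auto intro: continuous_on_minus\<close>)

lemma sobolev_poincare_minus:
  assumes x: "x \<in> closure \<Omega>" and r: "0 < r"
    and half: "measure \<nu> (ball x r \<inter> {y. v y < m}) \<le> measure \<nu> (ball x r) / 2"
  shows "(\<integral>\<^sup>+y\<in>ball x r. ennreal (max 0 (m - v y) powr pp) \<partial>\<nu>) \<le>
    ennreal (pp * (Ciso * r * measure G (ball x (3 * L * r)) / measure \<nu> (ball x r)) powr pp * measure \<nu> (ball x r))"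
proof -
  interpret neg: level_poincare \<nu> \<Omega> Cd Q cm G "\<lambda>y. - v y" K L by (rule level_poincare_uminus)
  have "{y. v y < m} = {y. - m < - v y}" by auto
  then show ?thesis using neg.sobolev_poincare_plus[OF x r, of "- m"] half by simp
qed

text \<open>\<open>m\<close> is the infimum of the levels whose superlevel set has at most half of
  the mass. Continuity from below shows that the infimum is attained, and that the sublevel sets
  below \<open>m\<close>, each with at most half of the mass, exhaust the strict sublevel
  set.\<close>

lemma median_exists:
  assumes x: "x \<in> closure \<Omega>" and r: "0 < r"
  obtains m where "measure \<nu> (ball x r \<inter> {y. m < v y}) \<le> measure \<nu> (ball x r) / 2"
    "measure \<nu> (ball x r \<inter> {y. v y < m}) \<le> measure \<nu> (ball x r) / 2"
proof -
  define h where "h t = measure \<nu> (ball x r \<inter> {y. t < v y})" for t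
  define H where "H = measure \<nu> (ball x r) / 2"
  have Hpos: "0 < H" unfolding H_def using ball_pos[OF x r] by simp
  have hmono: "h t \<le> h s" if "s \<le> t" for s t
    unfolding h_def using that by (intro finite_measure_mono) auto
  have "(\<lambda>n. h (real n)) \<longlonglongrightarrow> measure \<nu> (\<Inter>n. ball x r \<inter> {y. real n < v y})"
    unfolding h_def by (rule finite_Lim_measure_decseq) (auto simp: decseq_def intro: order_le_less_trans)
  moreover have "(\<Inter>n. ball x r \<inter> {y. real n < v y}) = {}"
  proof -
    have "\<exists>n. \<not> real n < v y" for y using reals_Archimedean2[of "v y"] by (auto intro: less_asym)
    then show ?thesis by blast
  qed
  ultimately have "(\<lambda>n. h (real n)) \<longlonglongrightarrow> 0" by simp
  then have "\<forall>\<^sub>F n in sequentially. h (real n) < H" by (rule order_tendstoD) (rule Hpos)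
  then obtain n1 where n1: "h (real n1) < H" by (auto simp: eventually_sequentially)
  have "(\<lambda>n. h (- real n)) \<longlonglongrightarrow> measure \<nu> (\<Union>n. ball x r \<inter> {y. - real n < v y})"
    unfolding h_def by (rule finite_Lim_measure_incseq) (auto simp: incseq_def intro: order_le_less_trans)
  moreover have "(\<Union>n. ball x r \<inter> {y. - real n < v y}) = ball x r"
  proof -
    have "\<exists>n. - real n < v y" for y using reals_Archimedean2[of "- v y"] by (auto simp: minus_less_iff)
    then show ?thesis by auto
  qed
  ultimately have "(\<lambda>n. h (- real n)) \<longlonglongrightarrow> 2 * H" unfolding H_def by simp
  then have "\<forall>\<^sub>F n in sequentially. H < h (- real n)" by (rule order_tendstoD) (use Hpos in simp)
  then obtain n2 where n2: "H < h (- real n2)" by (auto simp: eventually_sequentially)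
  define T where "T = {t. h t \<le> H}"
  have T: "real n1 \<in> T" "bdd_below T"
  proof -
    show "real n1 \<in> T" using n1 unfolding T_def by simp
    show "bdd_below T"
    proof (rule bdd_belowI[of _ "- real n2"])
      fix t assume "t \<in> T"
      then show "- real n2 \<le> t"
        using n2 hmono[of t "- real n2"] unfolding T_def by (cases "- real n2 \<le> t") auto
    qed
  qed
  define m where "m = Inf T"
  have above: "h t \<le> H" if "m < t" for t
  proof -
    obtain s where "s \<in> T" "s < t" using cInf_less_iff[OF _ T(2), of t] T(1) \<open>m < t\<close> unfolding m_def by blast
    then show ?thesis using hmono[of s t] unfolding T_def by simp
  qed
  have below: "H < h t" if "t < m" for t
    using cInf_lower[OF _ T(2), of t] that unfolding m_def T_def by force
  show ?thesis
  proof (rule that)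
    have "(\<lambda>n. h (m + 1 / real (Suc n))) \<longlonglongrightarrow> measure \<nu> (\<Union>n. ball x r \<inter> {y. m + 1 / real (Suc n) < v y})"
      unfolding h_def
    proof (rule finite_Lim_measure_incseq)
      show "incseq (\<lambda>n. ball x r \<inter> {y. m + 1 / real (Suc n) < v y})"
      proof (rule monoI, rule subsetI)
        fix i j :: nat and y assume "i \<le> j" and y: "y \<in> ball x r \<inter> {y. m + 1 / real (Suc i) < v y}"
        have "1 / real (Suc j) \<le> 1 / real (Suc i)" using \<open>i \<le> j\<close> by (intro divide_left_mono) auto
        then show "y \<in> ball x r \<inter> {y. m + 1 / real (Suc j) < v y}" using y by auto
      qed
    qed auto
    moreover have "(\<Union>n. ball x r \<inter> {y. m + 1 / real (Suc n) < v y}) = ball x r \<inter> {y. m < v y}"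
    proof (intro equalityI subsetI)
      fix y assume y: "y \<in> ball x r \<inter> {y. m < v y}"
      then obtain n where "1 / real (Suc n) < v y - m" using nat_approx_posE[of "v y - m"] by auto
      then show "y \<in> (\<Union>n. ball x r \<inter> {y. m + 1 / real (Suc n) < v y})" using y by (auto intro!: exI[of _ n])
    next
      fix y assume "y \<in> (\<Union>n. ball x r \<inter> {y. m + 1 / real (Suc n) < v y})"
      then obtain n where "y \<in> ball x r" "m + 1 / real (Suc n) < v y" by blast
      moreover have "0 < 1 / real (Suc n)" by simp
      ultimately have "y \<in> ball x r" "m < v y" by linarith+
      then show "y \<in> ball x r \<inter> {y. m < v y}" by blast
    qed
    ultimately have lim: "(\<lambda>n. h (m + 1 / real (Suc n))) \<longlonglongrightarrow> h m" unfolding h_def by simp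
    have "h (m + 1 / real (Suc n)) \<le> H" for n by (rule above) simp
    with lim have "h m \<le> H" by (intro LIMSEQ_le_const2[OF lim]) auto
    then show "measure \<nu> (ball x r \<inter> {y. m < v y}) \<le> measure \<nu> (ball x r) / 2" unfolding h_def H_def .
    define l where "l t = measure \<nu> (ball x r \<inter> {y. v y \<le> t})" for t
    have l: "l t \<le> H" if "t < m" for t
      using below[OF that] ball_split[of x r t] unfolding h_def l_def H_def by simp
    have "(\<lambda>n. l (m - 1 / real (Suc n))) \<longlonglongrightarrow> measure \<nu> (\<Union>n. ball x r \<inter> {y. v y \<le> m - 1 / real (Suc n)})"
      unfolding l_def
    proof (rule finite_Lim_measure_incseq)
      show "incseq (\<lambda>n. ball x r \<inter> {y. v y \<le> m - 1 / real (Suc n)})"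
      proof (rule monoI, rule subsetI)
        fix i j :: nat and y assume "i \<le> j" and y: "y \<in> ball x r \<inter> {y. v y \<le> m - 1 / real (Suc i)}"
        have "1 / real (Suc j) \<le> 1 / real (Suc i)" using \<open>i \<le> j\<close> by (intro divide_left_mono) auto
        then show "y \<in> ball x r \<inter> {y. v y \<le> m - 1 / real (Suc j)}" using y by auto
      qed
    qed auto
    moreover have "(\<Union>n. ball x r \<inter> {y. v y \<le> m - 1 / real (Suc n)}) = ball x r \<inter> {y. v y < m}"
    proof (intro equalityI subsetI)
      fix y assume y: "y \<in> ball x r \<inter> {y. v y < m}"
      then obtain n where "1 / real (Suc n) < m - v y" using nat_approx_posE[of "m - v y"] by auto
      then show "y \<in> (\<Union>n. ball x r \<inter> {y. v y \<le> m - 1 / real (Suc n)})" using y by (auto intro!: exI[of _ n])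
    next
      fix y assume "y \<in> (\<Union>n. ball x r \<inter> {y. v y \<le> m - 1 / real (Suc n)})"
      then obtain n where "y \<in> ball x r" "v y \<le> m - 1 / real (Suc n)" by blast
      moreover have "0 < 1 / real (Suc n)" by simp
      ultimately have "y \<in> ball x r" "v y < m" by linarith+
      then show "y \<in> ball x r \<inter> {y. v y < m}" by blast
    qed
    ultimately have lim2: "(\<lambda>n. l (m - 1 / real (Suc n))) \<longlonglongrightarrow> measure \<nu> (ball x r \<inter> {y. v y < m})" by simp
    have "l (m - 1 / real (Suc n)) \<le> H" for n by (rule l) simp
    then have "measure \<nu> (ball x r \<inter> {y. v y < m}) \<le> H" by (intro LIMSEQ_le_const2[OF lim2]) auto
    then show "measure \<nu> (ball x r \<inter> {y. v y < m}) \<le> measure \<nu> (ball x r) / 2" unfolding H_def .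
  qed
qed

text \<open>A median satisfies the half-mass conditions of both one-sided estimates, which is why
  \<open>m\<close> is not a mean value.\<close>

lemma sobolev_poincare:
  assumes x: "x \<in> closure \<Omega>" and r: "0 < r"
  obtains m where "(\<integral>\<^sup>+y\<in>ball x r. ennreal (\<bar>v y - m\<bar> powr pp) \<partial>\<nu>) \<le>
    ennreal (2 * pp * (Ciso * r * measure G (ball x (3 * L * r)) / measure \<nu> (ball x r)) powr pp * measure \<nu> (ball x r))"
proof -
  obtain m where m: "measure \<nu> (ball x r \<inter> {y. m < v y}) \<le> measure \<nu> (ball x r) / 2"
    "measure \<nu> (ball x r \<inter> {y. v y < m}) \<le> measure \<nu> (ball x r) / 2"
    by (rule median_exists[OF x r])
  define T where "T = pp * (Ciso * r * measure G (ball x (3 * L * r)) / measure \<nu> (ball x r)) powr pp * measure \<nu> (ball x r)"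
  have T: "0 \<le> T" unfolding T_def using pp(1) by (intro mult_nonneg_nonneg) auto
  have "(\<integral>\<^sup>+y\<in>ball x r. ennreal (\<bar>v y - m\<bar> powr pp) \<partial>\<nu>) =
    (\<integral>\<^sup>+y. ennreal (max 0 (v y - m) powr pp) * indicator (ball x r) y + ennreal (max 0 (m - v y) powr pp) * indicator (ball x r) y \<partial>\<nu>)"
    using pp(1) by (intro nn_integral_cong) (auto simp: indicator_def max_def abs_if)
  also have "\<dots> = (\<integral>\<^sup>+y\<in>ball x r. ennreal (max 0 (v y - m) powr pp) \<partial>\<nu>) + (\<integral>\<^sup>+y\<in>ball x r. ennreal (max 0 (m - v y) powr pp) \<partial>\<nu>)"
    by (rule nn_integral_add) measurable
  also have "\<dots> \<le> ennreal T + ennreal T"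
    unfolding T_def by (intro add_mono sobolev_poincare_plus sobolev_poincare_minus x r m)
  also have "\<dots> = ennreal (2 * T)" using T by (simp flip: ennreal_plus)
  finally show ?thesis using that[of m] unfolding T_def by (simp add: mult.assoc)
qed

end

section \<open>Traces of continuous functions\<close>

lemma tendsto_0_ennrealI:
  fixes f :: "'a \<Rightarrow> ennreal"
  assumes "\<And>e::real. 0 < e \<Longrightarrow> \<forall>\<^sub>F x in F. f x \<le> ennreal e"
  shows "(f \<longlongrightarrow> 0) F"
proof (rule order_tendstoI)
  fix a :: ennreal assume "0 < a"
  then obtain b where b: "0 < b" "b < a" using dense by blast
  then have "b \<noteq> top" by auto
  then obtain e where e: "b = ennreal e" "0 \<le> e" by (cases b) auto
  then have "0 < e" using b(1) by simp
  from assms[OF this] show "\<forall>\<^sub>F x in F. f x < a"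
    by eventually_elim (use b e in auto)
qed auto

context doubling_domain begin

lemma null_set_UN_countable:
  assumes "countable D" "\<And>t. t \<in> D \<Longrightarrow> null_set (A t)"
  shows "null_set (\<Union>t\<in>D. A t)"
proof (cases "D = {}")
  case False
  then have "(\<Union>t\<in>D. A t) = (\<Union>k. A (from_nat_into D k))"
  proof -
    have "(\<Union>t\<in>range (from_nat_into D). A t) = (\<Union>k. A (from_nat_into D k))" by auto
    then show ?thesis using range_from_nat_into[OF False assms(1)] by simp
  qed
  then show ?thesis using null_set_UN assms(2) from_nat_into[OF False] by metis
next
  case True
  have "null_set (\<Union>k::nat. {})"
  proof (rule null_set_UN)
    show "null_set {}"
      unfolding null_set_def
    proof (intro allI impI)
      fix R :: real
      have "codim1_content (closure \<Omega>) (emeasure \<nu>) R {} \<le> 0"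
        by (rule codim1_content_le_finite_sums[of "{}" _ "\<lambda>_. 1"]) auto
      then show "codim1_content (closure \<Omega>) (emeasure \<nu>) R {} = 0" by simp
    qed
  qed
  then show ?thesis using True by simp
qed

definition avg :: "('a \<Rightarrow> real) \<Rightarrow> 'a \<Rightarrow> real \<Rightarrow> ennreal" where
  "avg f x r = (\<integral>\<^sup>+y\<in>ball x r. ennreal (\<bar>f y\<bar> powr pp) \<partial>\<nu>) / emeasure \<nu> (ball x r)"

lemma three_powr:
  fixes a b c :: real
  assumes "0 \<le> a" "0 \<le> b" "0 \<le> c"
  shows "(a + b + c) powr pp \<le> 3 powr pp * (a powr pp + b powr pp + c powr pp)"
proof -
  define m where "m = max a (max b c)"
  have "(a + b + c) powr pp \<le> (3 * m) powr pp"
    using assms pp(1) unfolding m_def by (intro powr_mono2) auto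
  also have "\<dots> = 3 powr pp * m powr pp" by (rule powr_mult)
  also have "m powr pp \<le> a powr pp + b powr pp + c powr pp"
    unfolding m_def max_def by auto
  finally show ?thesis by simp
qed

text \<open>The bounded set \<Omega> lies in a ball of fixed radius about each point of its closure,
  and this ball is a fixed dilation of \<open>ball x r\<close>; so doubling bounds the mass of
  \<Omega>.\<close>

lemma ball_lower_bound:
  assumes "\<Omega> \<noteq> {}" "0 < r"
  obtains c where "0 < c" "\<And>x. x \<in> closure \<Omega> \<Longrightarrow> c \<le> measure \<nu> (ball x r)"
proof -
  obtain z where z: "z \<in> \<Omega>" using assms by auto
  obtain B where B: "0 < B" "\<And>x y. x \<in> closure \<Omega> \<Longrightarrow> y \<in> closure \<Omega> \<Longrightarrow> dist x y \<le> B"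
  proof -
    have bc: "bounded (closure \<Omega>)" using bounded_dom by (rule bounded_closure)
    show thesis
      by (rule that[of "diameter (closure \<Omega>) + 1"])
        (use diameter_bounded_bound[OF bc] diameter_ge_0[OF bc] in \<open>auto intro: order_trans\<close>, force)
  qed
  define m where "m = measure \<nu> \<Omega>"
  have sub: "\<Omega> \<subseteq> ball x (2 * B)" if "x \<in> closure \<Omega>" for x
    using B that closure_subset[of \<Omega>] by (force simp: subset_iff)
  have mx: "m \<le> dbl (2 * B / r) * measure \<nu> (ball x r)" if "x \<in> closure \<Omega>" for x
  proof -
    have "m \<le> measure \<nu> (ball x (2 * B / r * r))"
      unfolding m_def using sub[OF that] assms(2) by (intro finite_measure_mono) auto
    also have "\<dots> \<le> dbl (2 * B / r) * measure \<nu> (ball x r)" by (rule ball_dbl[OF that assms(2)])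
    finally show ?thesis .
  qed
  have "0 < m"
  proof -
    obtain e where "0 < e" "ball z e \<subseteq> \<Omega>" using open_dom z by (auto elim: openE)
    then have "measure \<nu> (ball z e) \<le> m"
      unfolding m_def using open_sets[OF open_dom] by (intro finite_measure_mono)
    moreover have "0 < measure \<nu> (ball z e)" using z closure_subset \<open>0 < e\<close> by (intro ball_pos) auto
    ultimately show ?thesis by simp
  qed
  show ?thesis
  proof (rule that)
    show "0 < m / dbl (2 * B / r)" using \<open>0 < m\<close> dbl_ge_1[of "2 * B / r"] by simp
    show "m / dbl (2 * B / r) \<le> measure \<nu> (ball x r)" if "x \<in> closure \<Omega>" for x
      using mx[OF that] dbl_ge_1[of "2 * B / r"] by (simp add: divide_le_eq mult.commute)
  qed
qed

end

section \<open>Densities of the level sets at boundary points\<close>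

context level_poincare begin

lemma box_sum:
  assumes "ennreal (\<theta> / (2 * K) * s) \<le> P" "0 < \<theta>" "0 \<le> s"
  shows "ennreal s \<le> ennreal (2 * K / \<theta>) * P"
proof -
  have "ennreal s = ennreal (2 * K / \<theta>) * ennreal (\<theta> / (2 * K) * s)"
    using assms K_pos by (subst ennreal_mult[symmetric]) auto
  also have "\<dots> \<le> ennreal (2 * K / \<theta>) * P" using assms(1) by (intro mult_left_mono) auto
  finally show ?thesis .
qed

definition both :: "real \<Rightarrow> 'a \<Rightarrow> real \<Rightarrow> bool" where
  "both t x r \<longleftrightarrow> \<theta>0 * measure \<nu> (ball x r) \<le> measure \<nu> (ball x r \<inter> {y. t < v y}) \<and>
    \<theta>0 * measure \<nu> (ball x r) \<le> measure \<nu> (ball x r \<inter> {y. v y \<le> t})"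

text \<open>This is \<open>box_cover\<close> for radii at which both level sets are thick. The set
  \<open>U\<close> is free, so that it can be a thin collar or the whole space.\<close>

lemma both_content:
  assumes A: "A \<subseteq> closure \<Omega>" and ex: "\<And>x. x \<in> A \<Longrightarrow> \<exists>r. 0 < r \<and> r \<le> e \<and> both t x r"
    and U: "U \<in> sets \<nu>" "\<And>x. x \<in> A \<Longrightarrow> ball x (L * e) \<subseteq> U" and R: "5 * L * e \<le> R"
  shows "codim1_content (closure \<Omega>) (emeasure \<nu>) R A \<le> ennreal (dbl (5 * L)) * (ennreal (2 * K / \<theta>0) * phi U t)"
proof -
  obtain r where r: "\<And>x. x \<in> A \<Longrightarrow> 0 < r x \<and> r x \<le> e" "\<And>x. x \<in> A \<Longrightarrow> both t x (r x)"
    using ex by metis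
  have rU: "ball x (L * r x) \<subseteq> U" if "x \<in> A" for x
  proof -
    have "ball x (L * r x) \<subseteq> ball x (L * e)"
      using r(1)[OF that] L_ge_1 by (intro subset_ball mult_left_mono) auto
    then show ?thesis using U(2)[OF that] by blast
  qed
  have r2: "\<theta>0 * measure \<nu> (ball x (r x)) \<le> measure \<nu> (ball x (r x) \<inter> {y. t < v y})"
    and r3: "\<theta>0 * measure \<nu> (ball x (r x)) \<le> measure \<nu> (ball x (r x) \<inter> {y. v y \<le> t})" if "x \<in> A" for x
    using r(2)[OF that] unfolding both_def by simp_all
  obtain D where D: "countable D" "D \<subseteq> A" "A \<subseteq> (\<Union>x\<in>D. ball x (5 * L * r x))"
    "\<And>F. finite F \<Longrightarrow> F \<subseteq> D \<Longrightarrow> ennreal (\<theta>0 / (2 * K) * (\<Sum>x\<in>F. measure \<nu> (ball x (r x)) / r x)) \<le> phi U t"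
    by (rule box_cover[OF A r(1) U(1) rU \<theta>0(1) r2 r3]) auto
  show ?thesis
  proof (rule content_le[OF D(1)])
    show "D \<subseteq> closure \<Omega>" using D(2) A by auto
    show "0 < r x \<and> 5 * L * r x \<le> R" if "x \<in> D" for x
    proof -
      have "x \<in> A" using that D(2) by auto
      then have "5 * L * r x \<le> 5 * L * e" "0 < r x" using r(1) L_ge_1 by (auto intro!: mult_left_mono)
      then show ?thesis using R by simp
    qed
    show "1 \<le> 5 * L" using L_ge_1 by simp
    fix F assume F: "finite F" "F \<subseteq> D"
    show "ennreal (\<Sum>x\<in>F. measure \<nu> (ball x (r x)) / r x) \<le> ennreal (2 * K / \<theta>0) * phi U t"
    proof (rule box_sum[OF D(4)[OF F] \<theta>0(1)])
      have "0 < r x" if "x \<in> F" for x using that F D(2) r(1) by auto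
      then show "0 \<le> (\<Sum>x\<in>F. measure \<nu> (ball x (r x)) / r x)"
        by (intro sum_nonneg divide_nonneg_nonneg) (auto intro: less_imp_le)
    qed
  qed (use A D in auto)
qed

text \<open>\<open>up\<close> and \<open>dn\<close> say on which side of 1/2 the density of the
  superlevel set settles, not that it converges; this is all that the half-mass conditions
  require.\<close>

definition up :: "real \<Rightarrow> 'a \<Rightarrow> bool" where
  "up t x \<longleftrightarrow> (\<forall>\<^sub>F r in at_right 0. measure \<nu> (ball x r) / 2 < measure \<nu> (ball x r \<inter> {y. t < v y}))"

definition dn :: "real \<Rightarrow> 'a \<Rightarrow> bool" where
  "dn t x \<longleftrightarrow> (\<forall>\<^sub>F r in at_right 0. measure \<nu> (ball x r \<inter> {y. t < v y}) < measure \<nu> (ball x r) / 2)"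

lemma level_mono: "s \<le> t \<Longrightarrow> measure \<nu> (ball x r \<inter> {y. t < v y}) \<le> measure \<nu> (ball x r \<inter> {y. s < v y})"
  by (intro finite_measure_mono) auto

lemma up_mono: "s \<le> t \<Longrightarrow> up t x \<Longrightarrow> up s x"
  unfolding up_def by (erule eventually_mono) (metis level_mono order_less_le_trans)

lemma dn_mono: "s \<le> t \<Longrightarrow> dn s x \<Longrightarrow> dn t x"
  unfolding dn_def by (erule eventually_mono) (metis level_mono order_le_less_trans)

text \<open>If the sublevel set is thick at one small radius, \<open>crossing\<close> keeps it thick
  at all smaller ones, since a change would produce a radius satisfying \<open>both\<close>; the
  superlevel set must then be thin. If the sublevel set is never thick, the superlevel set
  dominates.\<close>

lemma up_or_dn:
  assumes x: "x \<in> closure \<Omega>" and e: "0 < e" and nb: "\<And>r. 0 < r \<Longrightarrow> r < e \<Longrightarrow> \<not> both t x r"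
  shows "up t x \<or> dn t x"
proof (cases "\<exists>r1. 0 < r1 \<and> r1 < e \<and> \<theta>0 * measure \<nu> (ball x r1) \<le> measure \<nu> (ball x r1 \<inter> {y. v y \<le> t})")
  case True
  then obtain r1 where r1: "0 < r1" "r1 < e" "\<theta>0 * measure \<nu> (ball x r1) \<le> measure \<nu> (ball x r1 \<inter> {y. v y \<le> t})"
    by blast
  have "measure \<nu> (ball x r \<inter> {y. t < v y}) < measure \<nu> (ball x r) / 2" if r: "0 < r" "r < r1" for r
  proof -
    have "\<theta>0 * measure \<nu> (ball x r) \<le> measure \<nu> (ball x r \<inter> {y. v y \<le> t})"
    proof (rule ccontr)
      assume "\<not> ?thesis"
      then obtain s where "0 < s" "s \<le> r1" "both t x s"
        using crossing[OF x r(1) _ r1(3)] r(2) unfolding both_def by force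
      then show False using nb[of s] r1(2) by simp
    qed
    then have "measure \<nu> (ball x r \<inter> {y. t < v y}) < \<theta>0 * measure \<nu> (ball x r)"
      using nb[OF r(1)] r(2) r1(2) unfolding both_def by force
    also have "\<dots> \<le> 1 / 2 * measure \<nu> (ball x r)" using \<theta>0(2) by (intro mult_right_mono) auto
    finally show ?thesis by simp
  qed
  then have "dn t x" unfolding dn_def eventually_at_right_field using r1(1) by blast
  then show ?thesis ..
next
  case False
  have "measure \<nu> (ball x r) / 2 < measure \<nu> (ball x r \<inter> {y. t < v y})" if "0 < r" "r < e" for r
  proof -
    have "measure \<nu> (ball x r \<inter> {y. v y \<le> t}) < \<theta>0 * measure \<nu> (ball x r)" using False that by force
    also have "\<dots> \<le> 1 / 2 * measure \<nu> (ball x r)" using \<theta>0(2) by (intro mult_right_mono) auto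
    finally show ?thesis using ball_split[of x r t] by simp
  qed
  then have "up t x" unfolding up_def eventually_at_right_field using e by blast
  then show ?thesis ..
qed

text \<open>The perimeter of the superlevel set does not charge the boundary. As \<open>phi\<close>
  is not a measure in its set argument, this is expressed by an infimum over shrinking
  collars.\<close>

definition good :: "real \<Rightarrow> bool" where
  "good t \<longleftrightarrow> (INF n. phi (collar (1 / real (Suc n))) t) = 0"

lemma ennreal_eq_0I:
  fixes a c :: ennreal
  assumes "\<And>n. a \<le> c * f n" "(INF n. f n) = 0" "c \<noteq> top"
  shows "a = 0"
proof -
  obtain k where k: "c = ennreal k" "0 \<le> k" using assms(3) by (cases c) auto
  have *: "a \<le> 0 + ennreal e" if "0 < e" for e
  proof -
    have "(INF n. f n) < ennreal (e / (k + 1))" using assms(2) that k by simp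
    then obtain n where n: "f n < ennreal (e / (k + 1))" unfolding INF_less_iff by blast
    have "a \<le> c * f n" by (rule assms(1))
    also have "\<dots> \<le> ennreal k * ennreal (e / (k + 1))"
      unfolding k(1) using n by (intro mult_left_mono) auto
    also have "\<dots> = ennreal (k * (e / (k + 1)))" using k that by (intro ennreal_mult[symmetric]) auto
    also have "\<dots> \<le> ennreal e" using k that by (intro ennreal_leI) (simp add: field_simps)
    finally show ?thesis by simp
  qed
  have "a \<le> 0" by (rule ennreal_le_epsilon) (rule *)
  then show ?thesis by simp
qed

text \<open>The exceptional points have arbitrarily small radii satisfying \<open>both\<close>, so
  they can be covered inside any collar. Their content at every scale is therefore at most a
  constant times \<open>phi\<close> of that collar.\<close>

lemma good_null:
  assumes "good t"
  shows "null_set {x\<in>frontier \<Omega>. \<not> (up t x \<or> dn t x)}"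
  unfolding null_set_def
proof (intro allI impI)
  fix R :: real assume R: "0 < R"
  let ?A = "{x\<in>frontier \<Omega>. \<not> (up t x \<or> dn t x)}"
  define c where "c = ennreal (dbl (5 * L)) * ennreal (2 * K / \<theta>0)"
  have le: "codim1_content (closure \<Omega>) (emeasure \<nu>) R ?A \<le> c * phi (collar (1 / real (Suc n))) t" for n
  proof -
    define e where "e = min (1 / real (Suc n) / L) (R / (5 * L))"
    have e: "0 < e" "L * e \<le> 1 / real (Suc n)" "5 * L * e \<le> R"
    proof -
      show "0 < e" unfolding e_def using R L_ge_1 by simp
      have "L * e \<le> L * (1 / real (Suc n) / L)" unfolding e_def using L_ge_1 by (intro mult_left_mono) auto
      then show "L * e \<le> 1 / real (Suc n)" using L_ge_1 by simp
      have "5 * L * e \<le> 5 * L * (R / (5 * L))" unfolding e_def using L_ge_1 by (intro mult_left_mono) auto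
      then show "5 * L * e \<le> R" using L_ge_1 by simp
    qed
    have "codim1_content (closure \<Omega>) (emeasure \<nu>) R ?A \<le>
       ennreal (dbl (5 * L)) * (ennreal (2 * K / \<theta>0) * phi (collar (1 / real (Suc n))) t)"
    proof (rule both_content[of _ e])
      show "?A \<subseteq> closure \<Omega>" using frontier_closure by auto
      show "\<exists>r>0. r \<le> e \<and> both t x r" if "x \<in> ?A" for x
      proof (rule ccontr)
        assume "\<not> ?thesis"
        then have "\<not> both t x r" if "0 < r" "r < e" for r using that by force
        then show False using up_or_dn[of x e t] e(1) that frontier_closure by auto
      qed
      show "ball x (L * e) \<subseteq> collar (1 / real (Suc n))" if "x \<in> ?A" for x
      proof -
        have "ball x (L * e) \<subseteq> ball x (1 / real (Suc n))" using e(2) by (rule subset_ball)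
        then show ?thesis using that unfolding collar_def by blast
      qed
    qed (use e in auto)
    then show ?thesis unfolding c_def by (simp add: mult.assoc)
  qed
  show "codim1_content (closure \<Omega>) (emeasure \<nu>) R ?A = 0"
    by (rule ennreal_eq_0I[OF le]) (use assms in \<open>auto simp: good_def c_def ennreal_mult_eq_top_iff\<close>)
qed

text \<open>The infimum has integral at most the measure \<open>G\<close> of each collar, and these
  measures tend to 0.\<close>

lemma AE_good:
  assumes GN: "emeasure G (- \<Omega>) = 0"
  shows "AE t in lborel. good t"
proof -
  have ms: "(\<lambda>t. INF n. phi (collar (1 / real (Suc n))) t) \<in> borel_measurable lborel"
  proof -
    have "phi (collar (1 / real (Suc n))) \<in> borel_measurable lborel" for n using phi_meas by simp
    then show ?thesis by measurable
  qed
  have "(\<integral>\<^sup>+t. (INF n. phi (collar (1 / real (Suc n))) t) \<partial>lborel) \<le> ennreal (measure G (collar (1 / real (Suc n))))" for n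
  proof -
    have "(\<integral>\<^sup>+t. (INF n. phi (collar (1 / real (Suc n))) t) \<partial>lborel) \<le> (\<integral>\<^sup>+t. phi (collar (1 / real (Suc n))) t \<partial>lborel)"
      by (intro nn_integral_mono INF_lower) auto
    also have "\<dots> \<le> ennreal (measure G (collar (1 / real (Suc n))))" by (rule integral_phi_le) simp
    finally show ?thesis .
  qed
  moreover have "(\<lambda>n. ennreal (measure G (collar (1 / real (Suc n))))) \<longlonglongrightarrow> ennreal 0"
    by (intro tendsto_ennrealI collar_measure_0 G.finite_measure_axioms sets_G GN)
  ultimately have "(\<integral>\<^sup>+t. (INF n. phi (collar (1 / real (Suc n))) t) \<partial>lborel) \<le> ennreal 0"
    by (intro LIMSEQ_le_const) auto
  then have "AE t in lborel. (INF n. phi (collar (1 / real (Suc n))) t) = 0"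
    using nn_integral_0_iff_AE[OF ms] by simp
  then show ?thesis unfolding good_def .
qed

lemma ex_good:
  assumes GN: "emeasure G (- \<Omega>) = 0" and "a < b"
  shows "\<exists>t. a < t \<and> t < b \<and> good t"
proof (rule ccontr)
  assume no: "\<not> ?thesis"
  have "AE t in lborel. t \<notin> {a<..<b}"
    using AE_good[OF GN] by eventually_elim (use no in auto)
  then have "{a<..<b} \<in> null_sets lborel" by (subst AE_iff_null_sets) auto
  then show False using assms(2) by (simp add: null_sets_def)
qed

text \<open>These are the points where the trace would be \<infinity>. For large \<open>t\<close>
  the superlevel set is thin at a fixed radius, uniformly over the boundary, yet it dominates at
  small radii, so \<open>crossing\<close> applies. The content is thus at most a constant times
  \<open>phi UNIV t\<close> for all large \<open>t\<close>, whereas \<open>phi UNIV\<close> has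
  finite integral over the half-line.\<close>

lemma all_up_null: "null_set {x\<in>frontier \<Omega>. \<forall>t. up t x}"
  unfolding null_set_def
proof (intro allI impI)
  fix R :: real assume R: "0 < R"
  let ?Z = "{x\<in>frontier \<Omega>. \<forall>t. up t x}"
  show "codim1_content (closure \<Omega>) (emeasure \<nu>) R ?Z = 0"
  proof (cases "\<Omega> = {}")
    case True
    have "codim1_content (closure \<Omega>) (emeasure \<nu>) R ?Z \<le> 0"
      by (rule codim1_content_le_finite_sums[of "{}" _ "\<lambda>_. 1"]) (auto simp: True)
    then show ?thesis by simp
  next
    case False
    define e where "e = R / (5 * L)"
    have e: "0 < e" "5 * L * e \<le> R" unfolding e_def using R L_ge_1 by auto
    obtain c where c: "0 < c" "\<And>x. x \<in> closure \<Omega> \<Longrightarrow> c \<le> measure \<nu> (ball x e)"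
      by (rule ball_lower_bound[OF False e(1)]) auto
    have "(\<lambda>n. measure \<nu> {y. real n < v y}) \<longlonglongrightarrow> measure \<nu> (\<Inter>n. {y. real n < v y})"
      by (rule finite_Lim_measure_decseq) (auto simp: decseq_def intro: order_le_less_trans)
    moreover have "(\<Inter>n. {y. real n < v y}) = {}"
    proof -
      have "\<exists>n. \<not> real n < v y" for y using reals_Archimedean2[of "v y"] by (auto intro: less_asym)
      then show ?thesis by blast
    qed
    ultimately have "(\<lambda>n. measure \<nu> {y. real n < v y}) \<longlonglongrightarrow> 0" by simp
    then have "\<forall>\<^sub>F n in sequentially. measure \<nu> {y. real n < v y} < c / 2"
      by (rule order_tendstoD) (use c in simp)
    then obtain n0 where n0: "measure \<nu> {y. real n0 < v y} < c / 2" by (auto simp: eventually_sequentially)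
    have le: "codim1_content (closure \<Omega>) (emeasure \<nu>) R ?Z \<le>
       ennreal (dbl (5 * L)) * (ennreal (2 * K / \<theta>0) * phi UNIV t)" if t: "real n0 \<le> t" for t
    proof (rule both_content[of _ e])
      show "?Z \<subseteq> closure \<Omega>" using frontier_closure by auto
      show "\<exists>r>0. r \<le> e \<and> both t x r" if x: "x \<in> ?Z" for x
      proof -
        have xc: "x \<in> closure \<Omega>" using x frontier_closure by simp
        have "measure \<nu> (ball x e \<inter> {y. t < v y}) \<le> measure \<nu> {y. real n0 < v y}"
          using t by (intro finite_measure_mono) auto
        then have "measure \<nu> (ball x e) / 2 \<le> measure \<nu> (ball x e \<inter> {y. v y \<le> t})"
          using n0 c(2)[OF xc] ball_split[of x e t] by simp
        moreover have "\<theta>0 * measure \<nu> (ball x e) \<le> 1 / 2 * measure \<nu> (ball x e)"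
          using \<theta>0(2) by (intro mult_right_mono) auto
        ultimately have lo: "\<theta>0 * measure \<nu> (ball x e) \<le> measure \<nu> (ball x e \<inter> {y. v y \<le> t})" by simp
        have "up t x" using x by simp
        then obtain d where d: "0 < d" "\<And>r. 0 < r \<Longrightarrow> r < d \<Longrightarrow> measure \<nu> (ball x r) / 2 < measure \<nu> (ball x r \<inter> {y. t < v y})"
          unfolding up_def eventually_at_right_field by blast
        define s where "s = min (d / 2) e"
        have s: "0 < s" "s < d" "s \<le> e" unfolding s_def using d(1) e(1) by auto
        show ?thesis
        proof (cases "\<theta>0 * measure \<nu> (ball x s) \<le> measure \<nu> (ball x s \<inter> {y. v y \<le> t})")
          case True
          have "\<theta>0 * measure \<nu> (ball x s) \<le> 1 / 2 * measure \<nu> (ball x s)"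
            using \<theta>0(2) by (intro mult_right_mono) auto
          then have "both t x s" using True d(2)[OF s(1,2)] unfolding both_def by simp
          then show ?thesis using s by blast
        next
          case False
          then show ?thesis
            using crossing[OF xc s(1,3) lo] unfolding both_def by simp
        qed
      qed
    qed (use e open_sets[of UNIV] in auto)
    show ?thesis
    proof (rule ccontr)
      assume nz: "codim1_content (closure \<Omega>) (emeasure \<nu>) R ?Z \<noteq> 0"
      define k where "k = ennreal (dbl (5 * L)) * ennreal (2 * K / \<theta>0)"
      have k: "k \<noteq> top" "k \<noteq> 0" unfolding k_def using dbl_ge_1[of "5 * L"] K_pos \<theta>0(1)
        by (auto simp: ennreal_mult_eq_top_iff)
      \<comment> \<open>The content may be infinite; capping it at 1 gives a finite positive lower
        bound for \<open>phi UNIV\<close> on the half-line.\<close>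
      define d where "d = min 1 (codim1_content (closure \<Omega>) (emeasure \<nu>) R ?Z) / k"
      have d0: "d \<noteq> 0" unfolding d_def using nz k by (auto simp: ennreal_divide_eq_0_iff min_def)
      have dle: "d \<le> phi UNIV t" if "real n0 \<le> t" for t
      proof -
        have "min 1 (codim1_content (closure \<Omega>) (emeasure \<nu>) R ?Z) \<le> phi UNIV t * k"
          using le[OF that] unfolding k_def by (auto simp: mult_ac intro: min.coboundedI2)
        then show ?thesis
          unfolding d_def using k by (subst divide_le_posI_ennreal) (auto simp: zero_less_iff_neq_zero mult.commute)
      qed
      have "d * top = (\<integral>\<^sup>+t. d * indicator {real n0..} t \<partial>lborel)"
      proof -
        have "ennreal (real n) \<le> emeasure lborel {real n0..}" for n
        proof -
          have "emeasure lborel {real n0..real n0 + real n} \<le> emeasure lborel {real n0..}"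
            by (intro emeasure_mono) auto
          then show ?thesis by simp
        qed
        then have "emeasure lborel {real n0..} = top"
        proof (cases "emeasure lborel {real n0..}")
          case (real y)
          obtain n where "y < real n" using reals_Archimedean2 by blast
          moreover have "ennreal (real n) \<le> ennreal y" using \<open>\<And>n. ennreal (real n) \<le> _\<close>[of n] real by simp
          ultimately show ?thesis using real by (simp add: ennreal_le_iff)
        qed
        then show ?thesis by (subst nn_integral_cmult_indicator) auto
      qed
      also have "\<dots> \<le> (\<integral>\<^sup>+t. phi UNIV t \<partial>lborel)"
        by (intro nn_integral_mono) (auto simp: indicator_def dle)
      also have "\<dots> \<le> ennreal (measure G UNIV)" using open_sets[of UNIV] by (intro integral_phi_le) auto
      finally show False using d0 by (simp add: ennreal_mult_top top_unique)
    qed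
  qed
qed

text \<open>A change of sign reduces this to the previous case; shifting the level by 1 absorbs the
  difference between strict and non-strict inequalities.\<close>

lemma all_dn_null: "null_set {x\<in>frontier \<Omega>. \<forall>t. dn t x}"
proof -
  interpret neg: level_poincare \<nu> \<Omega> Cd Q cm G "\<lambda>y. - v y" K L by (rule level_poincare_uminus)
  have "neg.up t x" if "dn (- t - 1) x" for t x
    using that unfolding dn_def neg.up_def
  proof (rule eventually_mono)
    fix r assume lt: "measure \<nu> (ball x r \<inter> {y. - t - 1 < v y}) < measure \<nu> (ball x r) / 2"
    have "{y. t < - v y} = {y. v y < - t}" by auto
    moreover have "measure \<nu> (ball x r \<inter> {y. v y \<le> - t - 1}) \<le> measure \<nu> (ball x r \<inter> {y. v y < - t})"
      by (intro finite_measure_mono) auto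
    ultimately show "measure \<nu> (ball x r) / 2 < measure \<nu> (ball x r \<inter> {y. t < - v y})"
      using lt ball_split[of x r "- t - 1"] by simp
  qed
  then have "{x\<in>frontier \<Omega>. \<forall>t. dn t x} \<subseteq> {x\<in>frontier \<Omega>. \<forall>t. neg.up t x}" by blast
  then show ?thesis using neg.all_up_null by (rule null_set_mono)
qed

text \<open>\<open>v - c\<close> is split at the levels \<open>t1\<close> and \<open>t2\<close>. The
  middle part is at most \<open>e\<close>; the outer parts satisfy the half-mass conditions, so the
  one-sided Sobolev-Poincare inequalities bound them by the codimension 1 density of
  \<open>G\<close>.\<close>

lemma trace_at:
  assumes x: "x \<in> closure \<Omega>" and t: "up t1 x" "dn t2 x" "t1 < c" "c < t2" and e: "t2 - c \<le> e" "c - t1 \<le> e" "0 < e"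
    and dens: "((\<lambda>r. r * measure G (ball x (3 * L * r)) / measure \<nu> (ball x r)) \<longlongrightarrow> 0) (at_right 0)"
  shows "\<forall>\<^sub>F r in at_right 0. avg (\<lambda>y. v y - c) x r \<le> ennreal (2 * 3 powr pp * e powr pp)"
proof -
  define q where "q r = Ciso * r * measure G (ball x (3 * L * r)) / measure \<nu> (ball x r)" for r
  have "(q \<longlongrightarrow> Ciso * 0) (at_right 0)"
    using tendsto_mult_left[OF dens, of Ciso] unfolding q_def by (simp add: mult.assoc)
  \<comment> \<open>\<open>d\<close> solves \<open>pp * d powr pp = e powr pp / 2\<close>, so the
    two outer parts together contribute no more than the middle one.\<close>
  moreover define d where "d = e * (1 / (2 * pp)) powr (1 / pp)"
  have d: "0 < d" unfolding d_def using e pp(1) by simp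
  ultimately have "\<forall>\<^sub>F r in at_right 0. q r < d" by (intro order_tendstoD) auto
  moreover have "\<forall>\<^sub>F r in at_right 0. (0::real) < r" by (simp add: eventually_at_right_less)
  ultimately show ?thesis using t(1,2) unfolding up_def dn_def
  proof eventually_elim
    case (elim r)
    define mB where "mB = measure \<nu> (ball x r)"
    have mB: "0 < mB" unfolding mB_def by (rule ball_pos[OF x elim(2)])
    have q0: "0 \<le> q r" unfolding q_def using Ciso_pos elim(2) by simp
    have "q r powr pp \<le> d powr pp" using q0 elim(1) pp(1) by (intro powr_mono2) auto
    also have "d powr pp = e powr pp * (1 / (2 * pp))"
      unfolding d_def using e(3) pp(1) by (subst powr_mult) (simp_all add: powr_powr)
    finally have "pp * q r powr pp \<le> pp * (e powr pp * (1 / (2 * pp)))"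
      using pp(1) by (intro mult_left_mono) auto
    then have qe: "pp * q r powr pp \<le> e powr pp / 2" using pp(1) by simp
    have A: "(\<integral>\<^sup>+y\<in>ball x r. ennreal (max 0 (v y - t2) powr pp) \<partial>\<nu>) \<le> ennreal (e powr pp / 2 * mB)"
    proof -
      have "(\<integral>\<^sup>+y\<in>ball x r. ennreal (max 0 (v y - t2) powr pp) \<partial>\<nu>) \<le> ennreal (pp * q r powr pp * mB)"
        using sobolev_poincare_plus[OF x elim(2), of t2] elim(4) unfolding q_def mB_def by simp
      also have "\<dots> \<le> ennreal (e powr pp / 2 * mB)"
        using qe mB by (intro ennreal_leI mult_right_mono) auto
      finally show ?thesis .
    qed
    have B: "(\<integral>\<^sup>+y\<in>ball x r. ennreal (max 0 (t1 - v y) powr pp) \<partial>\<nu>) \<le> ennreal (e powr pp / 2 * mB)"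
    proof -
      have "measure \<nu> (ball x r \<inter> {y. v y < t1}) \<le> measure \<nu> (ball x r \<inter> {y. v y \<le> t1})"
        by (intro finite_measure_mono) auto
      then have "measure \<nu> (ball x r \<inter> {y. v y < t1}) \<le> measure \<nu> (ball x r) / 2"
        using elim(3) ball_split[of x r t1] by simp
      then have "(\<integral>\<^sup>+y\<in>ball x r. ennreal (max 0 (t1 - v y) powr pp) \<partial>\<nu>) \<le> ennreal (pp * q r powr pp * mB)"
        using sobolev_poincare_minus[OF x elim(2), of t1] unfolding q_def mB_def by simp
      also have "\<dots> \<le> ennreal (e powr pp / 2 * mB)"
        using qe mB by (intro ennreal_leI mult_right_mono) auto
      finally show ?thesis .
    qed
    have "(\<integral>\<^sup>+y\<in>ball x r. ennreal (\<bar>v y - c\<bar> powr pp) \<partial>\<nu>) \<le>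
      (\<integral>\<^sup>+y. ennreal (3 powr pp) * (ennreal (max 0 (v y - t2) powr pp) * indicator (ball x r) y +
        ennreal (max 0 (t1 - v y) powr pp) * indicator (ball x r) y + ennreal (e powr pp) * indicator (ball x r) y) \<partial>\<nu>)"
    proof (rule nn_integral_mono)
      fix y
      have "\<bar>v y - c\<bar> \<le> max 0 (v y - t2) + max 0 (t1 - v y) + e" using t e by (auto simp: max_def)
      then have "\<bar>v y - c\<bar> powr pp \<le> (max 0 (v y - t2) + max 0 (t1 - v y) + e) powr pp"
        using pp(1) by (intro powr_mono2) auto
      also have "\<dots> \<le> 3 powr pp * (max 0 (v y - t2) powr pp + max 0 (t1 - v y) powr pp + e powr pp)"
        using e(3) by (intro three_powr) auto
      finally have "ennreal (\<bar>v y - c\<bar> powr pp) \<le> ennreal (3 powr pp * (max 0 (v y - t2) powr pp + max 0 (t1 - v y) powr pp + e powr pp))"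
        by (rule ennreal_leI)
      then show "ennreal (\<bar>v y - c\<bar> powr pp) * indicator (ball x r) y \<le> ennreal (3 powr pp) * (ennreal (max 0 (v y - t2) powr pp) * indicator (ball x r) y +
        ennreal (max 0 (t1 - v y) powr pp) * indicator (ball x r) y + ennreal (e powr pp) * indicator (ball x r) y)"
        by (auto simp: indicator_def ennreal_mult)
    qed
    also have "\<dots> = ennreal (3 powr pp) * ((\<integral>\<^sup>+y\<in>ball x r. ennreal (max 0 (v y - t2) powr pp) \<partial>\<nu>) +
        (\<integral>\<^sup>+y\<in>ball x r. ennreal (max 0 (t1 - v y) powr pp) \<partial>\<nu>) + ennreal (e powr pp) * emeasure \<nu> (ball x r))"
      by (simp add: nn_integral_cmult nn_integral_add nn_integral_cmult_indicator)
    also have "\<dots> \<le> ennreal (3 powr pp) * (ennreal (e powr pp / 2 * mB) + ennreal (e powr pp / 2 * mB) + ennreal (e powr pp * mB))"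
      using A B mB by (intro mult_left_mono add_mono) (auto simp: emeasure_eq_measure ennreal_mult mB_def)
    also have "\<dots> = ennreal (2 * 3 powr pp * e powr pp * mB)"
      using mB by (simp flip: ennreal_plus ennreal_mult)
    finally have "avg (\<lambda>y. v y - c) x r \<le> ennreal (2 * 3 powr pp * e powr pp * mB) / emeasure \<nu> (ball x r)"
      unfolding avg_def by (rule divide_right_mono_ennreal)
    also have "\<dots> = ennreal (2 * 3 powr pp * e powr pp)"
      using mB unfolding emeasure_eq_measure mB_def[symmetric] by (simp add: divide_ennreal)
    finally show ?case .
  qed
qed

lemma trace_exists:
  assumes GN: "emeasure G (- \<Omega>) = 0"
  shows "null_set {x\<in>frontier \<Omega>. \<not> (\<exists>c. ((\<lambda>r. avg (\<lambda>y. v y - c) x r) \<longlongrightarrow> 0) (at_right 0))}"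
proof -
  have "\<exists>g. \<forall>a b. a < b \<longrightarrow> a < g a b \<and> g a b < b \<and> good (g a b)"
    using ex_good[OF GN] by metis
  then obtain g where g: "\<And>a b. a < b \<Longrightarrow> a < g a b \<and> g a b < b \<and> good (g a b)" by blast
  \<comment> \<open>One good level between any two rationals: a dense set of levels that is
    countable, so that the exceptional boundary sets may be united.\<close>
  define D where "D = (\<lambda>(a, b). g a b) ` {(a, b). a \<in> \<rat> \<and> b \<in> \<rat> \<and> a < b}"
  have cD: "countable D"
  proof -
    have "countable (\<rat> \<times> \<rat> :: (real \<times> real) set)" by (intro countable_SIGMA countable_rat)
    moreover have "{(a, b). a \<in> \<rat> \<and> b \<in> \<rat> \<and> a < b} \<subseteq> (\<rat> \<times> \<rat> :: (real \<times> real) set)" by auto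
    ultimately show ?thesis unfolding D_def by (intro countable_image) (rule countable_subset)
  qed
  have goodD: "good t" if "t \<in> D" for t using that g unfolding D_def by auto
  have dense: "\<exists>t\<in>D. a < t \<and> t < b" if "a < b" for a b
  proof -
    obtain p where p: "p \<in> \<rat>" "a < p" "p < b" using Rats_dense_in_real[OF \<open>a < b\<close>] by blast
    obtain q where q: "q \<in> \<rat>" "p < q" "q < b" using Rats_dense_in_real[OF p(3)] by blast
    have "g p q \<in> D" unfolding D_def using p q by force
    then show ?thesis using g[OF q(2)] p q by (intro bexI[of _ "g p q"]) auto
  qed
  define N where "N = {x\<in>frontier \<Omega>. \<not> ((\<lambda>r. r * measure G (ball x (3 * L * r)) / measure \<nu> (ball x r)) \<longlongrightarrow> 0) (at_right 0)}
     \<union> ({x\<in>frontier \<Omega>. \<forall>t. up t x} \<union> {x\<in>frontier \<Omega>. \<forall>t. dn t x}) \<union> (\<Union>t\<in>D. {x\<in>frontier \<Omega>. \<not> (up t x \<or> dn t x)})"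
  have "null_set N"
    unfolding N_def
    using frontier_density_0[OF G.finite_measure_axioms sets_G GN, of "3 * L"] L_ge_1
    by (intro null_set_Un all_up_null all_dn_null null_set_UN_countable cD good_null goodD) auto
  have *: "\<exists>c. ((\<lambda>r. avg (\<lambda>y. v y - c) x r) \<longlongrightarrow> 0) (at_right 0)" if xf: "x \<in> frontier \<Omega>" and xN: "x \<notin> N" for x
  proof -
    have dens: "((\<lambda>r. r * measure G (ball x (3 * L * r)) / measure \<nu> (ball x r)) \<longlongrightarrow> 0) (at_right 0)"
      and D: "\<And>t. t \<in> D \<Longrightarrow> up t x \<or> dn t x" using xf xN unfolding N_def by auto
    obtain a where a: "\<not> up a x" using xf xN unfolding N_def by auto
    obtain b where b: "\<not> dn b x" using xf xN unfolding N_def by auto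
    define T where "T = {t. up t x}"
    have T: "bdd_above T" "T \<noteq> {}"
    proof -
      show "bdd_above T"
      proof (rule bdd_aboveI[of _ a])
        fix t assume "t \<in> T"
        then show "t \<le> a" using up_mono[of a t x] a unfolding T_def by (cases "t \<le> a") auto
      qed
      obtain s where "s \<in> D" "s < b" using dense[of "b - 1" b] by auto
      then have "up s x" using D[of s] dn_mono[of s b x] b by auto
      then show "T \<noteq> {}" unfolding T_def by blast
    qed
    \<comment> \<open>Levels below \<open>c\<close> are \<open>up\<close> by monotonicity; levels of
      \<open>D\<close> above \<open>c\<close> are not \<open>up\<close>, hence \<open>dn\<close>.
      The supremum is finite because neither all levels are \<open>up\<close> nor all are
      \<open>dn\<close>.\<close>
    define c where "c = Sup T"
    have lower: "up t x" if "t < c" for t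
    proof -
      obtain s where "s \<in> T" "t < s" using less_cSup_iff[OF T(2,1), of t] \<open>t < c\<close> unfolding c_def by blast
      then show ?thesis using up_mono[of t s x] unfolding T_def by auto
    qed
    have upper: "\<not> up t x" if "c < t" for t
      using cSup_upper[OF _ T(1), of t] that unfolding c_def T_def by force
    have "((\<lambda>r. avg (\<lambda>y. v y - c) x r) \<longlongrightarrow> 0) (at_right 0)"
    proof (rule tendsto_0_ennrealI)
      fix \<eta> :: real assume \<eta>: "0 < \<eta>"
      define e where "e = (\<eta> / (2 * 3 powr pp)) powr (1 / pp)"
      have e: "0 < e" "2 * 3 powr pp * e powr pp = \<eta>"
        unfolding e_def using \<eta> pp(1) by (auto simp: powr_powr)
      obtain t2 where t2: "t2 \<in> D" "c < t2" "t2 < c + e" using dense[of c "c + e"] e(1) by auto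
      then have "dn t2 x" using D[of t2] upper[of t2] by auto
      moreover have "up (c - e) x" using lower[of "c - e"] e(1) by simp
      ultimately show "\<forall>\<^sub>F r in at_right 0. avg (\<lambda>y. v y - c) x r \<le> ennreal \<eta>"
        using trace_at[OF frontier_closure[OF xf], of "c - e" t2 c e] t2 e(1) dens unfolding e(2) by simp
    qed
    then show ?thesis by blast
  qed
  have "{x\<in>frontier \<Omega>. \<not> (\<exists>c. ((\<lambda>r. avg (\<lambda>y. v y - c) x r) \<longlongrightarrow> 0) (at_right 0))} \<subseteq> N"
    using * by blast
  then show ?thesis using \<open>null_set N\<close> by (rule null_set_mono)
qed

end

section \<open>Curves and upper gradients\<close>

definition param_partition :: "real \<Rightarrow> real \<Rightarrow> nat \<Rightarrow> (nat \<Rightarrow> real) \<Rightarrow> bool" where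
  "param_partition a b n t \<longleftrightarrow> t 0 = a \<and> t n = b \<and> (\<forall>i<n. t i \<le> t (Suc i))"

definition chord_sum :: "(real \<Rightarrow> 'a::metric_space) \<Rightarrow> nat \<Rightarrow> (nat \<Rightarrow> real) \<Rightarrow> ennreal" where
  "chord_sum \<gamma> n t = (\<Sum>i<n. ennreal (dist (\<gamma> (t i)) (\<gamma> (t (Suc i)))))"

lemma curve_length_altdef:
  "curve_length \<gamma> a b = (SUP (n, t) \<in> {(n, t). param_partition a b n t}. chord_sum \<gamma> n t)"
  unfolding curve_length_def param_partition_def chord_sum_def ..

lemma curve_length_upper: "param_partition a b n t \<Longrightarrow> chord_sum \<gamma> n t \<le> curve_length \<gamma> a b"
  unfolding curve_length_altdef by (rule SUP_upper2[of "(n, t)"]) auto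

lemma curve_length_least:
  "(\<And>n t. param_partition a b n t \<Longrightarrow> chord_sum \<gamma> n t \<le> M) \<Longrightarrow> curve_length \<gamma> a b \<le> M"
  unfolding curve_length_altdef by (rule SUP_least) auto

lemma param_partition_mono:
  assumes "param_partition a b n t" "i \<le> j" "j \<le> n"
  shows "t i \<le> t j"
  using assms(2,3)
proof (induction rule: dec_induct)
  case (step m)
  then have "t m \<le> t (Suc m)" using assms(1) unfolding param_partition_def by simp
  with step show ?case by simp
qed simp

lemma param_partition_trivial: "a \<le> b \<Longrightarrow> param_partition a b 1 (\<lambda>i. if i = 0 then a else b)"
  unfolding param_partition_def by simp

lemma dist_le_curve_length: "a \<le> b \<Longrightarrow> ennreal (dist (\<gamma> a) (\<gamma> b)) \<le> curve_length \<gamma> a b"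
  using curve_length_upper[OF param_partition_trivial, of a b \<gamma>] by (simp add: chord_sum_def)

lemma curve_length_append:
  assumes "a \<le> b" "b \<le> c"
  shows "curve_length \<gamma> a b + curve_length \<gamma> b c \<le> curve_length \<gamma> a c"
proof -
  have *: "chord_sum \<gamma> n t + chord_sum \<gamma> m s \<le> curve_length \<gamma> a c"
    if t: "param_partition a b n t" and s: "param_partition b c m s" for n t m s
  proof -
    define w where "w i = (if i \<le> n then t i else s (i - n))" for i
    have w: "param_partition a c (n + m) w"
      unfolding param_partition_def
    proof (intro conjI allI impI)
      show "w 0 = a" "w (n + m) = c" using t s unfolding w_def param_partition_def by auto
      fix i assume "i < n + m"
      then consider "i < n" | "i = n" | "n < i" by linarith
      then show "w i \<le> w (Suc i)"
      proof cases
        case 2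
        have "0 < m" using 2 \<open>i < n + m\<close> by simp
        then show ?thesis using 2 t s unfolding w_def param_partition_def by auto
      next
        case 3
        then have "s (i - n) \<le> s (Suc (i - n))" using s \<open>i < n + m\<close> unfolding param_partition_def by simp
        then show ?thesis using 3 unfolding w_def by (simp add: Suc_diff_le)
      qed (use t in \<open>auto simp: w_def param_partition_def\<close>)
    qed
    have "chord_sum \<gamma> (n + m) w = chord_sum \<gamma> n t + chord_sum \<gamma> m s"
    proof -
      have "chord_sum \<gamma> (n + m) w = chord_sum \<gamma> n w + (\<Sum>i<m. ennreal (dist (\<gamma> (w (n + i))) (\<gamma> (w (Suc (n + i))))))"
        unfolding chord_sum_def by (induction m) (auto simp: add.assoc)
      moreover have "chord_sum \<gamma> n w = chord_sum \<gamma> n t"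
        unfolding chord_sum_def w_def by (intro sum.cong) auto
      moreover have "w (n + i) = s i" for i
        using t s unfolding w_def param_partition_def by (cases i) auto
      moreover from this have "w (Suc (n + i)) = s (Suc i)" for i by (metis add_Suc_right)
      ultimately show ?thesis unfolding chord_sum_def by simp
    qed
    then show ?thesis using curve_length_upper[OF w, of \<gamma>] by simp
  qed
  have ne: "{(n, t). param_partition a b n t} \<noteq> {}" "{(n, t). param_partition b c n t} \<noteq> {}"
    using param_partition_trivial assms by blast+
  show ?thesis
  proof -
    have "curve_length \<gamma> a b + curve_length \<gamma> b c = (SUP p\<in>{(n, t). param_partition b c n t}. curve_length \<gamma> a b + (case p of (n, t) \<Rightarrow> chord_sum \<gamma> n t))"
      unfolding curve_length_altdef[of \<gamma> b c] by (rule ennreal_SUP_add_right[OF ne(2)])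
    also have "\<dots> \<le> curve_length \<gamma> a c"
    proof (rule SUP_least, clarify)
      fix m s assume s: "param_partition b c m s"
      have "curve_length \<gamma> a b + chord_sum \<gamma> m s = (SUP p\<in>{(n, t). param_partition a b n t}. (case p of (n, t) \<Rightarrow> chord_sum \<gamma> n t) + chord_sum \<gamma> m s)"
        unfolding curve_length_altdef[of \<gamma> a b] by (rule ennreal_SUP_add_left[OF ne(1), symmetric])
      also have "\<dots> \<le> curve_length \<gamma> a c"
        by (rule SUP_least) (use * s in auto)
      finally show "curve_length \<gamma> a b + chord_sum \<gamma> m s \<le> curve_length \<gamma> a c" .
    qed
    finally show ?thesis .
  qed
qed

text \<open>Clamping the points at \<open>b\<close> from either side splits the partition without
  changing the number of points; repeated points contribute chords of length 0.\<close>

lemma chord_sum_split: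
  assumes t: "param_partition a c n t" and b: "a \<le> b" "b \<le> c"
  shows "param_partition a b n (\<lambda>i. min (t i) b)" "param_partition b c n (\<lambda>i. max (t i) b)"
    "chord_sum \<gamma> n t \<le> chord_sum \<gamma> n (\<lambda>i. min (t i) b) + chord_sum \<gamma> n (\<lambda>i. max (t i) b)"
proof -
  show "param_partition a b n (\<lambda>i. min (t i) b)" "param_partition b c n (\<lambda>i. max (t i) b)"
    using t b unfolding param_partition_def by (auto simp: min_def max_def intro: order_trans)
  show "chord_sum \<gamma> n t \<le> chord_sum \<gamma> n (\<lambda>i. min (t i) b) + chord_sum \<gamma> n (\<lambda>i. max (t i) b)"
    unfolding chord_sum_def sum.distrib[symmetric]
  proof (rule sum_mono)
    fix i assume "i \<in> {..<n}"
    then have le: "t i \<le> t (Suc i)" using t unfolding param_partition_def by simp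
    have "dist (\<gamma> (t i)) (\<gamma> (t (Suc i))) \<le> dist (\<gamma> (min (t i) b)) (\<gamma> (min (t (Suc i)) b)) + dist (\<gamma> (max (t i) b)) (\<gamma> (max (t (Suc i)) b))"
      using le dist_triangle[of "\<gamma> (t i)" "\<gamma> (t (Suc i))" "\<gamma> b"] by (auto simp: min_def max_def)
    then show "ennreal (dist (\<gamma> (t i)) (\<gamma> (t (Suc i)))) \<le> ennreal (dist (\<gamma> (min (t i) b)) (\<gamma> (min (t (Suc i)) b))) + ennreal (dist (\<gamma> (max (t i) b)) (\<gamma> (max (t (Suc i)) b)))"
      by (simp flip: ennreal_plus)
  qed
qed

lemma curve_length_add:
  assumes "a \<le> b" "b \<le> c"
  shows "curve_length \<gamma> a c = curve_length \<gamma> a b + curve_length \<gamma> b c"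
proof (rule antisym)
  show "curve_length \<gamma> a c \<le> curve_length \<gamma> a b + curve_length \<gamma> b c"
  proof (rule curve_length_least)
    fix n t assume t: "param_partition a c n t"
    note s = chord_sum_split[OF t assms]
    show "chord_sum \<gamma> n t \<le> curve_length \<gamma> a b + curve_length \<gamma> b c"
      using s(3)[of \<gamma>] add_mono[OF curve_length_upper[OF s(1), of \<gamma>] curve_length_upper[OF s(2), of \<gamma>]]
      by (rule order_trans)
  qed
qed (rule curve_length_append[OF assms])

lemma chord_sum_jump:
  assumes t: "param_partition x y n t" and v: "\<And>i. i \<le> n \<Longrightarrow> t i = x \<or> t i = y"
  shows "chord_sum \<gamma> n t = ennreal (dist (\<gamma> x) (\<gamma> y))"
proof -
  have "chord_sum \<gamma> k t = ennreal (dist (\<gamma> x) (\<gamma> (t k)))" if "k \<le> n" for k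
    using that
  proof (induction k)
    case 0
    then show ?case using t unfolding chord_sum_def param_partition_def by simp
  next
    case (Suc k)
    have "chord_sum \<gamma> (Suc k) t = chord_sum \<gamma> k t + ennreal (dist (\<gamma> (t k)) (\<gamma> (t (Suc k))))"
      unfolding chord_sum_def by simp
    also have "\<dots> = ennreal (dist (\<gamma> x) (\<gamma> (t k))) + ennreal (dist (\<gamma> (t k)) (\<gamma> (t (Suc k))))"
      using Suc by simp
    also have "\<dots> = ennreal (dist (\<gamma> x) (\<gamma> (t (Suc k))))"
    proof (cases "t k = x")
      case False
      then have "t k = y" using v[of k] Suc by auto
      moreover have "t (Suc k) \<le> y" "t k \<le> t (Suc k)"
        using param_partition_mono[OF t, of "Suc k" n] param_partition_mono[OF t, of k "Suc k"] t Suc unfolding param_partition_def by auto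
      ultimately have "t (Suc k) = y" by simp
      then show ?thesis using \<open>t k = y\<close> by simp
    qed simp
    finally show ?case .
  qed
  from this[of n] show ?thesis using t unfolding param_partition_def by simp
qed

text \<open>Across a gap without partition points the curve is seen through a single chord;
  splitting at \<open>x\<close> and at \<open>y\<close> isolates it.\<close>

lemma chord_sum_gap:
  assumes t: "param_partition a b n t" and xy: "a \<le> x" "x \<le> y" "y \<le> b"
    and gap: "\<And>i. i \<le> n \<Longrightarrow> t i \<le> x \<or> y \<le> t i"
  shows "chord_sum \<gamma> n t \<le> curve_length \<gamma> a x + ennreal (dist (\<gamma> x) (\<gamma> y)) + curve_length \<gamma> y b"
proof -
  note s1 = chord_sum_split[OF t xy(1) order_trans[OF xy(2,3)]]
  note s2 = chord_sum_split[OF s1(2) xy(2,3)]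
  have "chord_sum \<gamma> n (\<lambda>i. min (max (t i) x) y) = ennreal (dist (\<gamma> x) (\<gamma> y))"
    by (rule chord_sum_jump[OF s2(1)]) (use gap xy in \<open>force simp: min_def max_def\<close>)
  then have "chord_sum \<gamma> n (\<lambda>i. max (t i) x) \<le> ennreal (dist (\<gamma> x) (\<gamma> y)) + curve_length \<gamma> y b"
    using s2(3)[of \<gamma>] curve_length_upper[OF s2(2), of \<gamma>] by (metis add_left_mono order_trans)
  then have "chord_sum \<gamma> n (\<lambda>i. min (t i) x) + chord_sum \<gamma> n (\<lambda>i. max (t i) x) \<le>
     curve_length \<gamma> a x + (ennreal (dist (\<gamma> x) (\<gamma> y)) + curve_length \<gamma> y b)"
    by (intro add_mono curve_length_upper s1(1))
  then show ?thesis using s1(3)[of \<gamma>] by (simp add: add.assoc)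
qed

section \<open>Arc-length parametrization\<close>

locale rect_curve =
  fixes \<gamma> :: "real \<Rightarrow> 'a::metric_space" and a b :: real
  assumes ab: "a \<le> b" and cont: "continuous_on {a..b} \<gamma>" and fin: "curve_length \<gamma> a b < \<infinity>"
begin

definition len :: "real \<Rightarrow> real" where "len t = enn2real (curve_length \<gamma> a t)"

lemma fin_sub: "a \<le> s \<Longrightarrow> s \<le> t \<Longrightarrow> t \<le> b \<Longrightarrow> curve_length \<gamma> s t < \<infinity>"
  using fin curve_length_add[of a s b \<gamma>] curve_length_add[of s t b \<gamma>] by (auto simp: less_top)

lemma curve_length_len:
  assumes "a \<le> s" "s \<le> t" "t \<le> b"
  shows "curve_length \<gamma> s t = ennreal (len t - len s)" "len s \<le> len t"
proof -
  obtain p q where p: "curve_length \<gamma> a s = ennreal p" "0 \<le> p" and q: "curve_length \<gamma> s t = ennreal q" "0 \<le> q"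
    using fin_sub[of a s] fin_sub[of s t] assms by (cases "curve_length \<gamma> a s"; cases "curve_length \<gamma> s t") auto
  then have "curve_length \<gamma> a t = ennreal (p + q)"
    using curve_length_add[of a s t \<gamma>] assms by simp
  then have "len t = p + q" "len s = p" unfolding len_def using p q by (simp_all only: enn2real_ennreal add_nonneg_nonneg)
  then show "curve_length \<gamma> s t = ennreal (len t - len s)" "len s \<le> len t" using q by auto
qed

lemma len_a: "len a = 0"
proof -
  have "curve_length \<gamma> a a + curve_length \<gamma> a a = curve_length \<gamma> a a" using curve_length_add[of a a a \<gamma>] by simp
  moreover have "curve_length \<gamma> a a < \<infinity>" using fin_sub[of a a] ab by simp
  ultimately have "curve_length \<gamma> a a = 0" by (cases "curve_length \<gamma> a a") (auto simp flip: ennreal_plus)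
  then show ?thesis unfolding len_def by simp
qed

lemma len_nonneg: "0 \<le> len t"
  unfolding len_def by simp

lemma dist_le_len:
  assumes "a \<le> s" "s \<le> t" "t \<le> b"
  shows "dist (\<gamma> s) (\<gamma> t) \<le> len t - len s"
  using dist_le_curve_length[OF assms(2), of \<gamma>] curve_length_len[OF assms] by (simp add: ennreal_le_iff)

text \<open>A partition whose chord sum misses the total length by less than \<open>e\<close> misses
  less than \<open>e\<close> on each of its gaps. This reduces continuity of \<open>len\<close> to
  continuity of the curve.\<close>

lemma len_gap:
  assumes e: "0 < e"
  obtains n t where "param_partition a b n t"
    "\<And>x y. a \<le> x \<Longrightarrow> x \<le> y \<Longrightarrow> y \<le> b \<Longrightarrow> (\<And>i. i \<le> n \<Longrightarrow> t i \<le> x \<or> y \<le> t i) \<Longrightarrow> len y - len x < dist (\<gamma> x) (\<gamma> y) + e"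
proof -
  have tot: "curve_length \<gamma> a b = ennreal (len b)" using curve_length_len[of a b] ab len_a by simp
  show ?thesis
  proof (cases "len b < e")
    case True
    show ?thesis
    proof (rule that[OF param_partition_trivial[OF ab]])
      fix x y assume xy: "a \<le> x" "x \<le> y" "y \<le> b"
      then have "len y - len x \<le> len b" using curve_length_len(2)[of y b] len_nonneg[of x] by simp
      then show "len y - len x < dist (\<gamma> x) (\<gamma> y) + e" using True zero_le_dist[of "\<gamma> x" "\<gamma> y"] by linarith
    qed
  next
    case False
    then have "ennreal (len b - e) < curve_length \<gamma> a b" unfolding tot using e by (intro ennreal_lessI) auto
    then obtain n t where t: "param_partition a b n t" "ennreal (len b - e) < chord_sum \<gamma> n t"
      unfolding curve_length_altdef less_SUP_iff by auto
    show ?thesis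
    proof (rule that[OF t(1)])
      fix x y assume xy: "a \<le> x" "x \<le> y" "y \<le> b" and gap: "\<And>i. i \<le> n \<Longrightarrow> t i \<le> x \<or> y \<le> t i"
      have "ennreal (len b - e) < curve_length \<gamma> a x + ennreal (dist (\<gamma> x) (\<gamma> y)) + curve_length \<gamma> y b"
        using t(2) chord_sum_gap[OF t(1) xy gap, of \<gamma>] by (rule less_le_trans)
      also have "\<dots> = ennreal (len x + dist (\<gamma> x) (\<gamma> y) + (len b - len y))"
        using curve_length_len[of a x] curve_length_len[of y b] xy len_a len_nonneg[of x] by (simp flip: ennreal_plus)
      finally have "len b - e < len x + dist (\<gamma> x) (\<gamma> y) + (len b - len y)"
        using False by (subst (asm) ennreal_less_iff) auto
      then show "len y - len x < dist (\<gamma> x) (\<gamma> y) + e" by simp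
    qed
  qed
qed

lemma continuous_len: "continuous_on {a..b} len"
  unfolding continuous_on_iff
proof (intro ballI allI impI)
  fix t0 and e :: real assume t0: "t0 \<in> {a..b}" and e: "0 < e"
  obtain n t where t: "param_partition a b n t"
    and gap: "\<And>x y. a \<le> x \<Longrightarrow> x \<le> y \<Longrightarrow> y \<le> b \<Longrightarrow> (\<And>i. i \<le> n \<Longrightarrow> t i \<le> x \<or> y \<le> t i) \<Longrightarrow> len y - len x < dist (\<gamma> x) (\<gamma> y) + e / 2"
    using len_gap[of "e / 2"] e by auto
  obtain d1 where d1: "0 < d1" "\<And>s. s \<in> {a..b} \<Longrightarrow> dist s t0 < d1 \<Longrightarrow> dist (\<gamma> s) (\<gamma> t0) < e / 2"
    using cont t0 e unfolding continuous_on_iff by (metis half_gt_zero)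
  \<comment> \<open>\<open>d2\<close> keeps the partition points other than \<open>t0\<close> away,
    so the interval between \<open>s\<close> and \<open>t0\<close> is a gap.\<close>
  obtain d2 where d2: "0 < d2" "\<And>x. x \<in> t ` {..n} \<Longrightarrow> x \<noteq> t0 \<Longrightarrow> d2 \<le> dist t0 x"
    using finite_set_avoid[of "t ` {..n}" t0] by auto
  show "\<exists>d>0. \<forall>s\<in>{a..b}. dist s t0 < d \<longrightarrow> dist (len s) (len t0) < e"
  proof (intro exI conjI ballI impI)
    show "0 < min d1 d2" using d1 d2 by simp
    fix s assume s: "s \<in> {a..b}" "dist s t0 < min d1 d2"
    have far: "t i = t0 \<or> d2 \<le> \<bar>t0 - t i\<bar>" if "i \<le> n" for i
      using d2(2)[of "t i"] that by (auto simp: dist_real_def)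
    have ds: "\<bar>s - t0\<bar> < d2" "dist (\<gamma> s) (\<gamma> t0) < e / 2" using s d1(2)[of s] by (auto simp: dist_real_def)
    show "dist (len s) (len t0) < e"
    proof (cases "t0 \<le> s")
      case True
      have "len s - len t0 < dist (\<gamma> t0) (\<gamma> s) + e / 2"
      proof (rule gap)
        fix i assume "i \<le> n"
        then show "t i \<le> t0 \<or> s \<le> t i" using far[of i] ds True by (auto simp: abs_if split: if_splits)
      qed (use s t0 True in auto)
      moreover have "len t0 \<le> len s" using curve_length_len(2)[of t0 s] s t0 True by simp
      ultimately show ?thesis using ds by (simp add: dist_real_def dist_commute)
    next
      case False
      have "len t0 - len s < dist (\<gamma> s) (\<gamma> t0) + e / 2"
      proof (rule gap)
        fix i assume "i \<le> n"
        then show "t i \<le> s \<or> t0 \<le> t i" using far[of i] ds False by (auto simp: abs_if split: if_splits)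
      qed (use s t0 False in auto)
      moreover have "len s \<le> len t0" using curve_length_len(2)[of s t0] s t0 False by simp
      ultimately show ?thesis using ds by (simp add: dist_real_def)
    qed
  qed
qed

definition \<tau> :: "real \<Rightarrow> real" where
  "\<tau> s = Inf {t\<in>{a..b}. curve_length \<gamma> a t = ennreal s}"

abbreviation c :: "real \<Rightarrow> 'a" where "c \<equiv> arc_length_param \<gamma> a b"

lemma c_\<tau>: "c s = \<gamma> (\<tau> s)"
  unfolding arc_length_param_def \<tau>_def ..

lemma \<tau>:
  assumes "0 \<le> s" "s \<le> len b"
  shows "\<tau> s \<in> {a..b}" "len (\<tau> s) = s"
proof -
  define T where "T = {t\<in>{a..b}. curve_length \<gamma> a t = ennreal s}"
  have T: "T = {t\<in>{a..b}. len t = s}"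
    unfolding T_def using curve_length_len[of a] len_a assms len_nonneg by (auto simp: ennreal_inj)
  have "closed T"
  proof -
    have "closed ({a..b} \<inter> len -` {s})"
      by (rule continuous_closed_preimage[OF continuous_len]) auto
    moreover have "{a..b} \<inter> len -` {s} = T" unfolding T by auto
    ultimately show ?thesis by simp
  qed
  moreover have "T \<noteq> {}"
    using IVT'[of len a s b] assms len_a ab continuous_len unfolding T by auto
  moreover have "bdd_below T" unfolding T by (rule bdd_belowI[of _ a]) auto
  ultimately have "Inf T \<in> T" by (intro closed_contains_Inf)
  then show "\<tau> s \<in> {a..b}" "len (\<tau> s) = s" unfolding \<tau>_def T_def[symmetric] unfolding T by auto
qed

lemma \<tau>_mono:
  assumes "0 \<le> s" "s \<le> s'" "s' \<le> len b"
  shows "\<tau> s \<le> \<tau> s'"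
proof (rule ccontr)
  assume *: "\<not> ?thesis"
  have "len (\<tau> s') \<le> len (\<tau> s)"
    using curve_length_len(2)[of "\<tau> s'" "\<tau> s"] \<tau>(1)[of s] \<tau>(1)[of s'] assms * by simp
  then have "s = s'" using \<tau>(2)[of s] \<tau>(2)[of s'] assms by simp
  then show False using * by simp
qed

lemma c_lipschitz:
  assumes "0 \<le> s" "s \<le> s'" "s' \<le> len b"
  shows "dist (c s) (c s') \<le> s' - s"
proof -
  have s: "\<tau> s \<in> {a..b}" "len (\<tau> s) = s" "\<tau> s' \<in> {a..b}" "len (\<tau> s') = s'"
    using \<tau>[of s] \<tau>[of s'] assms by auto
  have "dist (\<gamma> (\<tau> s)) (\<gamma> (\<tau> s')) \<le> len (\<tau> s') - len (\<tau> s)"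
    using s \<tau>_mono[OF assms] by (intro dist_le_len) auto
  then show ?thesis unfolding s c_\<tau> .
qed

text \<open>\<open>\<tau> (len t)\<close> may differ from \<open>t\<close>, but no length, hence no
  displacement, lies in between.\<close>

lemma c_len:
  assumes t: "t \<in> {a..b}"
  shows "c (len t) = \<gamma> t"
proof -
  have l: "0 \<le> len t" "len t \<le> len b" using curve_length_len(2)[of t b] t len_nonneg by auto
  have eq: "len (\<tau> (len t)) = len t" "\<tau> (len t) \<in> {a..b}" using \<tau>[OF l] by auto
  have "dist (\<gamma> (\<tau> (len t))) (\<gamma> t) \<le> 0"
  proof (cases "\<tau> (len t) \<le> t")
    case True
    have "dist (\<gamma> (\<tau> (len t))) (\<gamma> t) \<le> len t - len (\<tau> (len t))"
      using eq t True by (intro dist_le_len) auto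
    then show ?thesis unfolding eq(1) by simp
  next
    case False
    have "dist (\<gamma> t) (\<gamma> (\<tau> (len t))) \<le> len (\<tau> (len t)) - len t"
      using eq t False by (intro dist_le_len) auto
    then show ?thesis unfolding eq(1) by (simp add: dist_commute)
  qed
  then show ?thesis by (simp add: c_\<tau>)
qed

lemma c_ends: "c 0 = \<gamma> a" "c (len b) = \<gamma> b"
  using c_len[of a] c_len[of b] len_a ab by auto

lemma c_in: "0 \<le> s \<Longrightarrow> s \<le> len b \<Longrightarrow> c s \<in> \<gamma> ` {a..b}"
  using \<tau>(1) by (auto simp: c_\<tau>)

lemma c_continuous: "continuous_on {0..len b} c"
  unfolding continuous_on_iff
proof (intro ballI allI impI)
  fix s0 and e :: real assume s0: "s0 \<in> {0..len b}" and e: "0 < e"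
  show "\<exists>d>0. \<forall>s\<in>{0..len b}. dist s s0 < d \<longrightarrow> dist (c s) (c s0) < e"
  proof (intro exI conjI ballI impI)
    show "0 < e" by fact
    fix s assume s: "s \<in> {0..len b}" "dist s s0 < e"
    then show "dist (c s) (c s0) < e"
      using c_lipschitz[of s s0] c_lipschitz[of s0 s] s0 by (cases "s \<le> s0") (auto simp: dist_real_def dist_commute)
  qed
qed

lemma curve_integral_c: "curve_integral \<gamma> a b g = (\<integral>\<^sup>+s\<in>{0..len b}. g (c s) \<partial>lborel)"
  unfolding curve_integral_def len_def ..

text \<open>The upper bound is the Lipschitz property of \<open>c\<close>. For the lower bound,
  \<open>len\<close> maps a partition for \<gamma> to one for \<open>c\<close> with the same
  chords.\<close>

lemma curve_length_c:
  assumes "0 \<le> p" "p \<le> q" "q \<le> len b"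
  shows "curve_length c p q = ennreal (q - p)"
proof (rule antisym)
  show "curve_length c p q \<le> ennreal (q - p)"
  proof (rule curve_length_least)
    fix n t assume t: "param_partition p q n t"
    have "chord_sum c n t \<le> (\<Sum>i<n. ennreal (t (Suc i) - t i))"
      unfolding chord_sum_def
    proof (intro sum_mono ennreal_leI c_lipschitz)
      fix i assume "i \<in> {..<n}"
      then have "p \<le> t i" "t i \<le> t (Suc i)" "t (Suc i) \<le> q"
        using param_partition_mono[OF t, of 0 i] param_partition_mono[OF t, of i "Suc i"] param_partition_mono[OF t, of "Suc i" n] t
        unfolding param_partition_def by auto
      then show "0 \<le> t i" "t i \<le> t (Suc i)" "t (Suc i) \<le> len b" using assms by auto
    qed
    also have "\<dots> = ennreal (\<Sum>i<n. t (Suc i) - t i)"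
      using t unfolding param_partition_def by (intro sum_ennreal) auto
    also have "(\<Sum>i<n. t (Suc i) - t i) = q - p"
      using t unfolding param_partition_def by (simp add: sum_lessThan_telescope)
    finally show "chord_sum c n t \<le> ennreal (q - p)" .
  qed
  have pq: "0 \<le> q" "p \<le> len b" using assms by auto
  have "ennreal (q - p) = curve_length \<gamma> (\<tau> p) (\<tau> q)"
    using curve_length_len(1)[of "\<tau> p" "\<tau> q"] \<tau>_mono[OF assms] \<tau>[of p] \<tau>[of q] assms pq by simp
  also have "\<dots> \<le> curve_length c p q"
  proof (rule curve_length_least)
    fix n t assume t: "param_partition (\<tau> p) (\<tau> q) n t"
    have ti: "t i \<in> {a..b}" if "i \<le> n" for i
      using param_partition_mono[OF t, of 0 i] param_partition_mono[OF t, of i n] t that \<tau>(1)[of p] \<tau>(1)[of q] assms pq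
      unfolding param_partition_def by auto
    have "chord_sum \<gamma> n t = chord_sum c n (\<lambda>i. len (t i))"
      unfolding chord_sum_def using ti by (intro sum.cong refl) (simp add: c_len)
    also have "\<dots> \<le> curve_length c p q"
    proof (rule curve_length_upper)
      show "param_partition p q n (\<lambda>i. len (t i))"
        unfolding param_partition_def
      proof (intro conjI allI impI)
        show "len (t 0) = p" "len (t n) = q"
          using t \<tau>(2)[of p] \<tau>(2)[of q] assms pq unfolding param_partition_def by auto
        fix i assume "i < n"
        then show "len (t i) \<le> len (t (Suc i))"
          using curve_length_len(2)[of "t i" "t (Suc i)"] ti[of i] ti[of "Suc i"] t unfolding param_partition_def by auto
      qed
    qed
    finally show "chord_sum \<gamma> n t \<le> curve_length c p q" .
  qed
  finally show "ennreal (q - p) \<le> curve_length c p q" .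
qed

lemma g_c_measurable:
  fixes g :: "'a \<Rightarrow> ennreal"
  assumes g: "g \<in> borel_measurable (restrict_space borel S)" and S: "\<gamma> ` {a..b} \<subseteq> S"
  shows "(\<lambda>s. g (c s) * indicator {0..len b} s) \<in> borel_measurable borel"
proof -
  have "c \<in> measurable (restrict_space borel {0..len b}) (restrict_space borel S)"
  proof (rule measurable_restrict_space2)
    show "c \<in> space (restrict_space borel {0..len b}) \<rightarrow> S"
      using c_in S by (auto simp: space_restrict_space)
    show "c \<in> borel_measurable (restrict_space borel {0..len b})"
      by (rule borel_measurable_continuous_on_restrict[OF c_continuous])
  qed
  then have "(\<lambda>s. g (c s)) \<in> borel_measurable (restrict_space borel {0..len b})"
    using g by (rule measurable_compose)
  then show ?thesis by (subst (asm) borel_measurable_restrict_space_iff_ennreal) auto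
qed

text \<open>The piece of \<open>c\<close> over \<open>{p..q}\<close> is a rectifiable curve whose
  own arc-length parametrization is a translate of \<open>c\<close>, so the upper gradient may be
  tested on it. The case \<open>p = q\<close> is separate because constant curves are not
  tested.\<close>

lemma subcurve_bound:
  assumes ug: "upper_gradient_on S g (\<lambda>x. ereal (v x))" and S: "\<gamma> ` {a..b} \<subseteq> S"
    and pq: "0 \<le> p" "p \<le> q" "q \<le> len b"
  shows "ennreal \<bar>v (c p) - v (c q)\<bar> \<le> (\<integral>\<^sup>+s\<in>{p..q}. g (c s) \<partial>lborel)"
proof (cases "p = q")
  case False
  then have "p < q" using pq by simp
  have "rectifiable_curve_in S c p q"
    unfolding rectifiable_curve_in_def
    using pq S c_in curve_length_c[OF pq] continuous_on_subset[OF c_continuous, of "{p..q}"] by force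
  moreover have "0 < curve_length c p q" unfolding curve_length_c[OF pq] using \<open>p < q\<close> by simp
  ultimately have "e2ennreal \<bar>ereal (v (c p)) - ereal (v (c q))\<bar> \<le> curve_integral c p q g"
    using ug unfolding upper_gradient_on_def by force
  also have "curve_integral c p q g = (\<integral>\<^sup>+s\<in>{0..q - p}. g (c (p + s)) \<partial>lborel)"
    unfolding curve_integral_def
  proof (rule nn_integral_cong)
    have len: "enn2real (curve_length c p q) = q - p" unfolding curve_length_c[OF pq] using pq by simp
    fix s :: real
    show "g (arc_length_param c p q s) * indicator {0..enn2real (curve_length c p q)} s = g (c (p + s)) * indicator {0..q - p} s"
    proof (cases "s \<in> {0..q - p}")
      case True
      have "{t\<in>{p..q}. curve_length c p t = ennreal s} = {p + s}"
        using curve_length_c[of p] pq True by (auto simp: ennreal_inj)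
      then have "arc_length_param c p q s = c (p + s)"
        unfolding arc_length_param_def[of c p q] by simp
      then show ?thesis unfolding len by simp
    qed (simp add: len)
  qed
  also have "\<dots> = (\<integral>\<^sup>+s. (g (c (p + s)) * indicator {0..len b} (p + s)) * indicator {p..q} (p + s) \<partial>lborel)"
    using pq by (intro nn_integral_cong) (auto simp: indicator_def)
  also have "\<dots> = (\<integral>\<^sup>+s. (g (c s) * indicator {0..len b} s) * indicator {p..q} s \<partial>lborel)"
  proof -
    have [measurable]: "(\<lambda>s. g (c s) * indicator {0..len b} s) \<in> borel_measurable borel"
      using g_c_measurable[OF _ S] ug unfolding upper_gradient_on_def by blast
    have "(\<lambda>s. (g (c s) * indicator {0..len b} s) * indicator {p..q} s) \<in> borel_measurable borel" by measurable
    from nn_integral_real_affine[OF this, of 1 p] show ?thesis by simp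
  qed
  also have "\<dots> = (\<integral>\<^sup>+s\<in>{p..q}. g (c s) \<partial>lborel)"
    using pq by (intro nn_integral_cong) (auto simp: indicator_def)
  finally show ?thesis by simp
qed simp

end

section \<open>Criteria for upper gradients\<close>

lemma rect_curveI: "rectifiable_curve_in S \<gamma> a b \<Longrightarrow> rect_curve \<gamma> a b"
  unfolding rectifiable_curve_in_def rect_curve_def by simp

lemma upper_gradient_on_realI:
  assumes "g \<in> borel_measurable (restrict_space borel S)"
    "\<And>\<gamma> a b. rect_curve \<gamma> a b \<Longrightarrow> \<gamma> ` {a..b} \<subseteq> S \<Longrightarrow> ennreal \<bar>v (\<gamma> a) - v (\<gamma> b)\<bar> \<le> curve_integral \<gamma> a b g"
  shows "upper_gradient_on S g (\<lambda>x. ereal (v x))"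
  unfolding upper_gradient_on_def
proof (intro conjI allI impI)
  fix \<gamma> and a b :: real assume "rectifiable_curve_in S \<gamma> a b \<and> 0 < curve_length \<gamma> a b"
  then have "rectifiable_curve_in S \<gamma> a b" ..
  then have "ennreal \<bar>v (\<gamma> a) - v (\<gamma> b)\<bar> \<le> curve_integral \<gamma> a b g"
    by (intro assms(2)) (auto intro: rect_curveI simp: rectifiable_curve_in_def)
  then show "if \<bar>ereal (v (\<gamma> a))\<bar> \<noteq> \<infinity> \<and> \<bar>ereal (v (\<gamma> b))\<bar> \<noteq> \<infinity>
      then e2ennreal \<bar>ereal (v (\<gamma> a)) - ereal (v (\<gamma> b))\<bar> \<le> curve_integral \<gamma> a b g
      else curve_integral \<gamma> a b g = \<infinity>" by simp
qed (rule assms(1))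

text \<open>On short pieces of the arc-length parametrization the inequality holds with a local
  constant below \<open>g\<close>, and bisection glues the pieces together. The constant may be
  \<infinity>, which imposes nothing on distinct points; the cut-off functions of the ambient space
  exploit this.\<close>

lemma upper_gradient_lipschitz:
  fixes u :: "'a::metric_space \<Rightarrow> real"
  assumes g: "g \<in> borel_measurable (restrict_space borel S)"
    and loc: "\<And>x. x \<in> S \<Longrightarrow> \<exists>V M. open V \<and> x \<in> V \<and> (\<forall>y\<in>V \<inter> S. M \<le> g y) \<and>
      (\<forall>y\<in>V \<inter> S. \<forall>z\<in>V \<inter> S. ennreal \<bar>u y - u z\<bar> \<le> M * ennreal (dist y z))"
  shows "upper_gradient_on S g (\<lambda>x. ereal (u x))"
proof (rule upper_gradient_on_realI[OF g])
  fix \<gamma> and a b :: real assume rc: "rect_curve \<gamma> a b" and S: "\<gamma> ` {a..b} \<subseteq> S"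
  interpret rect_curve \<gamma> a b by fact
  define F where "F s = g (c s) * indicator {0..len b} s" for s
  have F[measurable]: "F \<in> borel_measurable borel"
    unfolding F_def by (rule g_c_measurable[OF g S])
  define P where "P p q \<longleftrightarrow> (0 \<le> p \<longrightarrow> p \<le> q \<longrightarrow> q \<le> len b \<longrightarrow>
     ennreal \<bar>u (c p) - u (c q)\<bar> \<le> (\<integral>\<^sup>+s\<in>{p..q}. F s \<partial>lborel))" for p q
  have "P 0 (len b)"
    using len_nonneg
  proof (induction rule: Bolzano)
    case (trans p q r)
    show ?case
      unfolding P_def
    proof (intro impI)
      assume b: "0 \<le> p" "p \<le> r" "r \<le> len b"
      have "ennreal \<bar>u (c p) - u (c r)\<bar> \<le> ennreal \<bar>u (c p) - u (c q)\<bar> + ennreal \<bar>u (c q) - u (c r)\<bar>"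
        by (simp flip: ennreal_plus)
      also have "\<dots> \<le> (\<integral>\<^sup>+s\<in>{p..q}. F s \<partial>lborel) + (\<integral>\<^sup>+s\<in>{q..r}. F s \<partial>lborel)"
        using trans b unfolding P_def by (intro add_mono) auto
      also have "\<dots> = (\<integral>\<^sup>+s. F s * indicator {p..q} s + F s * indicator {q..r} s \<partial>lborel)"
        by (rule nn_integral_add[symmetric]) measurable
      also have "\<dots> \<le> (\<integral>\<^sup>+s\<in>{p..r}. F s \<partial>lborel)"
        by (rule nn_integral_mono_AE, rule AE_mp[OF AE_lborel_singleton[of q]])
          (use trans(3,4) in \<open>auto simp: indicator_def\<close>)
      finally show "ennreal \<bar>u (c p) - u (c r)\<bar> \<le> (\<integral>\<^sup>+s\<in>{p..r}. F s \<partial>lborel)" .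
    qed
  next
    case (local x)
    have "c x \<in> S" using c_in[of x] local S by auto
    from loc[OF this] obtain V M where V: "open V" "c x \<in> V" "\<forall>y\<in>V \<inter> S. M \<le> g y"
      "\<forall>y\<in>V \<inter> S. \<forall>z\<in>V \<inter> S. ennreal \<bar>u y - u z\<bar> \<le> M * ennreal (dist y z)"
      by (elim exE conjE) (rule that)
    obtain e where e: "0 < e" "ball (c x) e \<subseteq> V" using V by (auto elim: openE)
    have inV: "c s \<in> V \<inter> S" if "s \<in> {0..len b}" "\<bar>s - x\<bar> < e" for s
    proof -
      have "dist (c x) (c s) < e"
        using c_lipschitz[of x s] c_lipschitz[of s x] that local by (cases "x \<le> s") (auto simp: dist_commute)
      then show ?thesis using e(2) c_in[of s] that S by auto
    qed
    show ?case
    proof (intro exI conjI allI impI)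
      show "0 < e" by fact
      fix p q assume pq: "p \<le> x \<and> x \<le> q \<and> q - p < e"
      show "P p q"
        unfolding P_def
      proof (intro impI)
        assume b: "0 \<le> p" "p \<le> q" "q \<le> len b"
        have "ennreal \<bar>u (c p) - u (c q)\<bar> \<le> M * ennreal (dist (c p) (c q))"
          using V(4) inV[of p] inV[of q] pq b by auto
        also have "\<dots> \<le> M * ennreal (q - p)"
          by (intro mult_left_mono ennreal_leI c_lipschitz b) simp
        also have "\<dots> = (\<integral>\<^sup>+s. M * indicator {p..q} s \<partial>lborel)"
          using b by (subst nn_integral_cmult_indicator) auto
        also have "\<dots> \<le> (\<integral>\<^sup>+s\<in>{p..q}. F s \<partial>lborel)"
        proof (rule nn_integral_mono)
          fix s
          show "M * indicator {p..q} s \<le> F s * indicator {p..q} s"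
          proof (cases "s \<in> {p..q}")
            case True
            then have "M \<le> g (c s)" using V(3) inV[of s] pq b by auto
            then show ?thesis using True b unfolding F_def by simp
          qed simp
        qed
        finally show "ennreal \<bar>u (c p) - u (c q)\<bar> \<le> (\<integral>\<^sup>+s\<in>{p..q}. F s \<partial>lborel)" .
      qed
    qed
  qed
  then have "ennreal \<bar>u (c 0) - u (c (len b))\<bar> \<le> (\<integral>\<^sup>+s\<in>{0..len b}. F s \<partial>lborel)"
    unfolding P_def using len_nonneg by simp
  also have "\<dots> = curve_integral \<gamma> a b g"
    unfolding curve_integral_c F_def by (intro nn_integral_cong) (auto simp: indicator_def)
  finally show "ennreal \<bar>u (\<gamma> a) - u (\<gamma> b)\<bar> \<le> curve_integral \<gamma> a b g" unfolding c_ends .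
qed

text \<open>Take the first time \<open>q\<close> at which \<beta> is reached and the last time
  \<open>p\<close> up to \<open>q\<close> with value at most \<alpha>. Strictly in between the
  function stays inside the open strip, so only the gradient there is used.\<close>

lemma level_strip_integral:
  fixes \<phi> :: "real \<Rightarrow> real" and F :: "real \<Rightarrow> ennreal"
  assumes l: "0 \<le> l" and cont: "continuous_on {0..l} \<phi>"
    and F: "\<And>p q. 0 \<le> p \<Longrightarrow> p \<le> q \<Longrightarrow> q \<le> l \<Longrightarrow> ennreal \<bar>\<phi> p - \<phi> q\<bar> \<le> (\<integral>\<^sup>+s\<in>{p..q}. F s \<partial>lborel)"
    and ab: "\<phi> 0 \<le> \<alpha>" "\<alpha> < \<beta>" "\<beta> \<le> \<phi> l"
  shows "ennreal (\<beta> - \<alpha>) \<le> (\<integral>\<^sup>+s\<in>{0..l}. F s * indicator {s. \<alpha> < \<phi> s \<and> \<phi> s < \<beta>} s \<partial>lborel)"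
proof -
  define B where "B = {0..l} \<inter> \<phi> -` {\<beta>..}"
  have B: "closed B" "l \<in> B" "bdd_below B"
    unfolding B_def using ab l by (auto intro!: continuous_closed_preimage[OF cont] bdd_belowI[of _ 0])
  define q where "q = Inf B"
  have qB: "q \<in> B" unfolding q_def using B by (intro closed_contains_Inf) auto
  have q: "0 \<le> q" "q \<le> l" "\<beta> \<le> \<phi> q" using qB unfolding B_def by auto
  have below: "\<phi> s < \<beta>" if "0 \<le> s" "s < q" for s
  proof (rule ccontr)
    assume "\<not> \<phi> s < \<beta>"
    then have "s \<in> B" unfolding B_def using that q by auto
    then have "q \<le> s" unfolding q_def by (rule cInf_lower[OF _ B(3)])
    then show False using that by simp
  qed
  define A where "A = {0..q} \<inter> \<phi> -` {..\<alpha>}"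
  have A: "closed A" "0 \<in> A" "bdd_above A"
    unfolding A_def using ab q continuous_on_subset[OF cont, of "{0..q}"]
    by (auto intro!: continuous_closed_preimage bdd_aboveI[of _ q])
  define p where "p = Sup A"
  have pA: "p \<in> A" unfolding p_def using A by (intro closed_contains_Sup) auto
  have p: "0 \<le> p" "p \<le> q" "\<phi> p \<le> \<alpha>" using pA unfolding A_def by auto
  have above: "\<alpha> < \<phi> s" if "p < s" "s \<le> q" for s
  proof (rule ccontr)
    assume "\<not> \<alpha> < \<phi> s"
    then have "s \<in> A" unfolding A_def using that p by auto
    then have "s \<le> p" unfolding p_def by (rule cSup_upper[OF _ A(3)])
    then show False using that by simp
  qed
  have "ennreal (\<beta> - \<alpha>) \<le> ennreal \<bar>\<phi> p - \<phi> q\<bar>"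
    using p q ab by (intro ennreal_leI) auto
  also have "\<dots> \<le> (\<integral>\<^sup>+s\<in>{p..q}. F s \<partial>lborel)" by (rule F[OF p(1,2) q(2)])
  also have "\<dots> \<le> (\<integral>\<^sup>+s\<in>{0..l}. F s * indicator {s. \<alpha> < \<phi> s \<and> \<phi> s < \<beta>} s \<partial>lborel)"
    by (rule nn_integral_mono_AE, rule AE_mp[OF AE_lborel_singleton[of p]], rule AE_mp[OF AE_lborel_singleton[of q]])
      (use below above p q in \<open>auto simp: indicator_def\<close>)
  finally show ?thesis .
qed

text \<open>The clamped function changes only while the open strip is crossed, and \<open>e\<close>
  times its change is the length of the crossed interval of values. A descending crossing becomes an
  ascending one by reflection.\<close>

lemma clamp_strip_integral:
  fixes \<phi> :: "real \<Rightarrow> real" and F :: "real \<Rightarrow> ennreal"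
  defines "h \<equiv> \<lambda>e t x::real. max 0 (min 1 ((x - t) / e))"
  assumes l: "0 \<le> l" and cont: "continuous_on {0..l} \<phi>" and e: "0 < e"
    and F: "\<And>p q. 0 \<le> p \<Longrightarrow> p \<le> q \<Longrightarrow> q \<le> l \<Longrightarrow> ennreal \<bar>\<phi> p - \<phi> q\<bar> \<le> (\<integral>\<^sup>+s\<in>{p..q}. F s \<partial>lborel)"
  shows "ennreal (e * \<bar>h e t (\<phi> 0) - h e t (\<phi> l)\<bar>) \<le> (\<integral>\<^sup>+s\<in>{0..l}. F s * indicator {s. t < \<phi> s \<and> \<phi> s < t + e} s \<partial>lborel)"
proof -
  have up: "ennreal (e * (h e t (\<psi> l) - h e t (\<psi> 0))) \<le> (\<integral>\<^sup>+s\<in>{0..l}. F s * indicator {s. t < \<psi> s \<and> \<psi> s < t + e} s \<partial>lborel)"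
    if less: "h e t (\<psi> 0) < h e t (\<psi> l)" and \<psi>c: "continuous_on {0..l} \<psi>"
      and \<psi>: "\<And>p q. 0 \<le> p \<Longrightarrow> p \<le> q \<Longrightarrow> q \<le> l \<Longrightarrow> ennreal \<bar>\<psi> p - \<psi> q\<bar> \<le> (\<integral>\<^sup>+s\<in>{p..q}. F s \<partial>lborel)"
    for t and \<psi> :: "real \<Rightarrow> real"
  proof -
    define \<alpha> where "\<alpha> = max (\<psi> 0) t"
    define \<beta> where "\<beta> = min (\<psi> l) (t + e)"
    have "\<psi> 0 < \<psi> l"
    proof (rule ccontr)
      assume "\<not> ?thesis"
      then have "(\<psi> l - t) / e \<le> (\<psi> 0 - t) / e" using e by (intro divide_right_mono) auto
      then have "h e t (\<psi> l) \<le> h e t (\<psi> 0)" unfolding h_def by (auto simp: max_def min_def)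
      then show False using less by simp
    qed
    moreover have "\<psi> 0 < t + e" "t < \<psi> l"
      using less e unfolding h_def by (auto simp: max_def min_def field_simps split: if_splits)
    ultimately have \<alpha>\<beta>: "\<alpha> < \<beta>" unfolding \<alpha>_def \<beta>_def using e by auto
    have "e * (h e t (\<psi> l) - h e t (\<psi> 0)) = \<beta> - \<alpha>"
    proof -
      have "e * h e t x = max 0 (min e (x - t))" for x
        unfolding h_def using e by (auto simp: max_def min_def field_simps)
      then show ?thesis
        using \<open>\<psi> 0 < t + e\<close> \<open>t < \<psi> l\<close> e unfolding \<alpha>_def \<beta>_def right_diff_distrib by (auto simp: max_def min_def)
    qed
    then have "ennreal (e * (h e t (\<psi> l) - h e t (\<psi> 0))) \<le> (\<integral>\<^sup>+s\<in>{0..l}. F s * indicator {s. \<alpha> < \<psi> s \<and> \<psi> s < \<beta>} s \<partial>lborel)"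
      using level_strip_integral[OF l \<psi>c \<psi> _ \<alpha>\<beta>] unfolding \<alpha>_def \<beta>_def by simp
    also have "\<dots> \<le> (\<integral>\<^sup>+s\<in>{0..l}. F s * indicator {s. t < \<psi> s \<and> \<psi> s < t + e} s \<partial>lborel)"
      by (rule nn_integral_mono) (auto simp: indicator_def \<alpha>_def \<beta>_def)
    finally show ?thesis .
  qed
  consider "h e t (\<phi> 0) = h e t (\<phi> l)" | "h e t (\<phi> 0) < h e t (\<phi> l)" | "h e t (\<phi> l) < h e t (\<phi> 0)" by linarith
  then show ?thesis
  proof cases
    case 2
    then have "\<bar>h e t (\<phi> 0) - h e t (\<phi> l)\<bar> = h e t (\<phi> l) - h e t (\<phi> 0)" by simp
    then show ?thesis using up[OF 2 cont F] by simp
  next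
    case 3
    have neg: "h e (- t - e) (- x) = 1 - h e t x" for x
      unfolding h_def using e by (auto simp: max_def min_def field_simps)
    have "ennreal (e * (h e (- t - e) (- \<phi> l) - h e (- t - e) (- \<phi> 0))) \<le>
      (\<integral>\<^sup>+s\<in>{0..l}. F s * indicator {s. - t - e < - \<phi> s \<and> - \<phi> s < - t - e + e} s \<partial>lborel)"
    proof (rule up)
      fix p q assume "0 \<le> p" "p \<le> q" "q \<le> l"
      from F[OF this] show "ennreal \<bar>- \<phi> p - - \<phi> q\<bar> \<le> (\<integral>\<^sup>+s\<in>{p..q}. F s \<partial>lborel)"
        by (simp add: abs_minus_commute)
    qed (use 3 in \<open>auto simp: neg intro: continuous_on_minus cont\<close>)
    moreover have "{s. - t - e < - \<phi> s \<and> - \<phi> s < - t - e + e} = {s. t < \<phi> s \<and> \<phi> s < t + e}" by auto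
    moreover have "h e (- t - e) (- \<phi> l) - h e (- t - e) (- \<phi> 0) = \<bar>h e t (\<phi> 0) - h e t (\<phi> l)\<bar>"
      unfolding neg using 3 by simp
    ultimately show ?thesis by simp
  qed simp
qed

text \<open>\<open>clamp_strip_integral\<close> applies to every rectifiable curve, so the
  restriction to the open strip needs no exceptional family of curves. This localization is what
  allows energies to be counted strip by strip in \<open>phi\<close>.\<close>

lemma upper_gradient_truncate:
  fixes v :: "'a::metric_space \<Rightarrow> real"
  assumes ug: "upper_gradient_on S g (\<lambda>x. ereal (v x))" and vc: "continuous_on S v" and e: "0 < e"
  shows "upper_gradient_on S (\<lambda>x. ennreal (1 / e) * (g x * indicator {x. t < v x \<and> v x < t + e} x))
    (\<lambda>x. ereal (max 0 (min 1 ((v x - t) / e))))"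
proof (rule upper_gradient_on_realI)
  have g[measurable]: "g \<in> borel_measurable (restrict_space borel S)" using ug unfolding upper_gradient_on_def by blast
  have v[measurable]: "v \<in> borel_measurable (restrict_space borel S)"
    by (rule borel_measurable_continuous_on_restrict[OF vc])
  have "(\<lambda>x. ennreal (1 / e) * (g x * indicator {t<..<t + e} (v x))) \<in> borel_measurable (restrict_space borel S)" by measurable
  moreover have "(\<lambda>x. indicator {t<..<t + e} (v x) :: ennreal) = indicator {x. t < v x \<and> v x < t + e}"
    by (auto simp: indicator_def)
  ultimately show "(\<lambda>x. ennreal (1 / e) * (g x * indicator {x. t < v x \<and> v x < t + e} x)) \<in> borel_measurable (restrict_space borel S)"
    by (simp only: fun_eq_iff)
next
  fix \<gamma> and a b :: real assume rc: "rect_curve \<gamma> a b" and S: "\<gamma> ` {a..b} \<subseteq> S"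
  interpret rect_curve \<gamma> a b by fact
  define \<phi> where "\<phi> s = v (c s)" for s
  have \<phi>: "continuous_on {0..len b} \<phi>"
  proof -
    have "c ` {0..len b} \<subseteq> S" using c_in S by auto
    then show ?thesis unfolding \<phi>_def
      by (intro continuous_on_compose2[OF vc c_continuous])
  qed
  have bd: "ennreal \<bar>\<phi> p - \<phi> q\<bar> \<le> (\<integral>\<^sup>+s\<in>{p..q}. g (c s) \<partial>lborel)" if "0 \<le> p" "p \<le> q" "q \<le> len b" for p q
    unfolding \<phi>_def by (rule subcurve_bound[OF ug S that])
  define I where "I = (\<integral>\<^sup>+s\<in>{0..len b}. g (c s) * indicator {s. t < \<phi> s \<and> \<phi> s < t + e} s \<partial>lborel)"
  have ci: "curve_integral \<gamma> a b (\<lambda>x. ennreal (1 / e) * (g x * indicator {x. t < v x \<and> v x < t + e} x)) = ennreal (1 / e) * I"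
  proof -
    have v[measurable]: "v \<in> borel_measurable (restrict_space borel S)"
      by (rule borel_measurable_continuous_on_restrict[OF vc])
    have [measurable]: "g \<in> borel_measurable (restrict_space borel S)" using ug unfolding upper_gradient_on_def by blast
    have "(\<lambda>x. g x * indicator {t<..<t + e} (v x)) \<in> borel_measurable (restrict_space borel S)" by measurable
    moreover have "(\<lambda>x. indicator {t<..<t + e} (v x) :: ennreal) = indicator {x. t < v x \<and> v x < t + e}"
      by (auto simp: indicator_def)
    ultimately have "(\<lambda>x. g x * indicator {x. t < v x \<and> v x < t + e} x) \<in> borel_measurable (restrict_space borel S)"
      by (simp only: fun_eq_iff)
    from g_c_measurable[OF this S]
    have "(\<lambda>s. g (c s) * indicator {x. t < v x \<and> v x < t + e} (c s) * indicator {0..len b} s) \<in> borel_measurable lborel" by simp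
    then have "(\<integral>\<^sup>+s. ennreal (1 / e) * (g (c s) * indicator {x. t < v x \<and> v x < t + e} (c s) * indicator {0..len b} s) \<partial>lborel) =
      ennreal (1 / e) * (\<integral>\<^sup>+s. g (c s) * indicator {x. t < v x \<and> v x < t + e} (c s) * indicator {0..len b} s \<partial>lborel)"
      by (rule nn_integral_cmult)
    moreover have "(\<integral>\<^sup>+s. g (c s) * indicator {x. t < v x \<and> v x < t + e} (c s) * indicator {0..len b} s \<partial>lborel) = I"
      unfolding I_def \<phi>_def by (intro nn_integral_cong) (auto simp: indicator_def)
    ultimately show ?thesis unfolding curve_integral_c by (simp add: mult.assoc)
  qed
  let ?d = "\<bar>max 0 (min 1 ((v (\<gamma> a) - t) / e)) - max 0 (min 1 ((v (\<gamma> b) - t) / e))\<bar>"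
  have "ennreal (e * ?d) \<le> I"
    using clamp_strip_integral[OF len_nonneg \<phi> e bd, of t] unfolding I_def by (simp add: \<phi>_def c_ends)
  then have "ennreal (1 / e) * ennreal (e * ?d) \<le> ennreal (1 / e) * I" by (intro mult_left_mono) auto
  moreover have "ennreal (1 / e) * ennreal (e * ?d) = ennreal ?d" using e by (subst ennreal_mult[symmetric]) auto
  ultimately show "ennreal ?d \<le> curve_integral \<gamma> a b (\<lambda>x. ennreal (1 / e) * (g x * indicator {x. t < v x \<and> v x < t + e} x))"
    unfolding ci by simp
qed

section \<open>Oscillation of limits in L1\<close>

context doubling_domain begin

text \<open>Hoelder's inequality up to a factor 2, from the pointwise bound \<open>\<bar>x\<bar>
  \<le> l + l powr (1 - pp) * \<bar>x\<bar> powr pp\<close>. The level \<open>l\<close> lies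
  slightly above \<delta>, so that \<delta> may be 0.\<close>

lemma L1_from_Lp:
  assumes f[measurable]: "f \<in> borel_measurable \<nu>" and A[measurable]: "A \<in> sets \<nu>" and m: "0 < measure \<nu> A"
    and d: "0 \<le> \<delta>" and le: "(\<integral>\<^sup>+y\<in>A. ennreal (\<bar>f y\<bar> powr pp) \<partial>\<nu>) \<le> ennreal (\<delta> powr pp * measure \<nu> A)"
  shows "(\<integral>\<^sup>+y\<in>A. ennreal \<bar>f y\<bar> \<partial>\<nu>) \<le> ennreal (2 * \<delta> * measure \<nu> A)"
proof (rule ennreal_le_epsilon)
  fix e :: real assume e: "0 < e"
  define l where "l = \<delta> + e / (2 * measure \<nu> A)"
  have l: "0 < l" "\<delta> \<le> l" unfolding l_def using e m d by (auto intro: add_nonneg_pos)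
  have pt: "\<bar>x\<bar> \<le> l + l powr (1 - pp) * \<bar>x\<bar> powr pp" for x :: real
  proof (cases "\<bar>x\<bar> \<le> l")
    case False
    then have x: "0 < \<bar>x\<bar>" using l by simp
    have "\<bar>x\<bar> = \<bar>x\<bar> powr (1 - pp) * \<bar>x\<bar> powr pp" using x by (simp flip: powr_add)
    also have "\<dots> \<le> l powr (1 - pp) * \<bar>x\<bar> powr pp"
      using False l pp(1) by (intro mult_right_mono powr_mono2') auto
    finally show ?thesis using l by simp
  qed (use l in \<open>simp add: add_increasing2\<close>)
  have "(\<integral>\<^sup>+y\<in>A. ennreal \<bar>f y\<bar> \<partial>\<nu>) \<le> (\<integral>\<^sup>+y. ennreal l * indicator A y + ennreal (l powr (1 - pp)) * (ennreal (\<bar>f y\<bar> powr pp) * indicator A y) \<partial>\<nu>)"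
  proof (rule nn_integral_mono)
    fix y
    have "ennreal \<bar>f y\<bar> \<le> ennreal l + ennreal (l powr (1 - pp)) * ennreal (\<bar>f y\<bar> powr pp)"
      using pt[of "f y"] l by (simp flip: ennreal_plus ennreal_mult)
    then show "ennreal \<bar>f y\<bar> * indicator A y \<le> ennreal l * indicator A y + ennreal (l powr (1 - pp)) * (ennreal (\<bar>f y\<bar> powr pp) * indicator A y)"
      by (auto simp: indicator_def)
  qed
  also have "\<dots> = ennreal l * emeasure \<nu> A + ennreal (l powr (1 - pp)) * (\<integral>\<^sup>+y\<in>A. ennreal (\<bar>f y\<bar> powr pp) \<partial>\<nu>)"
    by (simp add: nn_integral_add nn_integral_cmult nn_integral_cmult_indicator)
  also have "\<dots> \<le> ennreal (l * measure \<nu> A) + ennreal (l powr (1 - pp)) * ennreal (\<delta> powr pp * measure \<nu> A)"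
    using le l by (intro add_mono mult_left_mono) (auto simp: emeasure_eq_measure ennreal_mult)
  also have "\<dots> = ennreal (l * measure \<nu> A + l powr (1 - pp) * (\<delta> powr pp * measure \<nu> A))"
    using l by (simp flip: ennreal_plus ennreal_mult)
  also have "\<dots> \<le> ennreal (l * measure \<nu> A + l * measure \<nu> A)"
  proof (intro ennreal_leI add_left_mono)
    have "l powr (1 - pp) * (\<delta> powr pp * measure \<nu> A) \<le> l powr (1 - pp) * (l powr pp * measure \<nu> A)"
      using l d pp(1) by (intro mult_left_mono mult_right_mono powr_mono2) auto
    also have "\<dots> = l * measure \<nu> A" using l by (simp add: mult.assoc[symmetric] powr_add[symmetric])
    finally show "l powr (1 - pp) * (\<delta> powr pp * measure \<nu> A) \<le> l * measure \<nu> A" .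
  qed
  also have "l * measure \<nu> A + l * measure \<nu> A = 2 * \<delta> * measure \<nu> A + e"
    unfolding l_def using m by (simp add: field_simps)
  also have "ennreal (2 * \<delta> * measure \<nu> A + e) = ennreal (2 * \<delta> * measure \<nu> A) + ennreal e"
    using d e by (intro ennreal_plus) auto
  finally show "(\<integral>\<^sup>+y\<in>A. ennreal \<bar>f y\<bar> \<partial>\<nu>) \<le> ennreal (2 * \<delta> * measure \<nu> A) + ennreal e" .
qed

text \<open>The factor \<open>2 * pp\<close> of \<open>sobolev_poincare\<close> is absorbed into the
  base of the power.\<close>

definition Cosc :: "real \<Rightarrow> real \<Rightarrow> real" where
  "Cosc K L = (2 * pp) powr (1 / pp) * level_poincare.Ciso Cd Q cm K L"

text \<open>The Sobolev-Poincare inequality passes to limits in L1: choose a subsequence along which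
  the energies attain their lower limit, a further one that converges almost everywhere, and one
  along which the subtracted constants converge; then apply Fatou's lemma.\<close>

lemma ball_oscillation:
  fixes v :: "nat \<Rightarrow> 'a \<Rightarrow> real"
  assumes lp: "\<And>i. level_poincare \<nu> \<Omega> Cd Q cm (G i) (v i) K L"
    and x: "x \<in> closure \<Omega>" and r: "0 < r" and u: "integrable \<nu> u"
    and conv: "(\<lambda>i. \<integral>\<^sup>+y\<in>ball x r. ennreal \<bar>v i y - u y\<bar> \<partial>\<nu>) \<longlonglongrightarrow> 0"
    and a: "liminf (\<lambda>i. emeasure (G i) (ball x (3 * L * r))) = ennreal a" "0 \<le> a"
  shows "\<exists>c. (\<integral>\<^sup>+y\<in>ball x r. ennreal (\<bar>u y - c\<bar> powr pp) \<partial>\<nu>) \<le>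
    ennreal ((Cosc K L * r * a / measure \<nu> (ball x r)) powr pp * measure \<nu> (ball x r))"
proof -
  define mB where "mB = measure \<nu> (ball x r)"
  have mB: "0 < mB" unfolding mB_def by (rule ball_pos[OF x r])
  define C where "C = level_poincare.Ciso Cd Q cm K L"
  have C: "0 < C" unfolding C_def by (rule level_poincare.Ciso_pos[OF lp])
  have vm[measurable]: "v i \<in> borel_measurable \<nu>" for i using level_poincare.v_meas[OF lp] .
  have um[measurable]: "u \<in> borel_measurable \<nu>" using u by simp
  obtain \<phi>1 where \<phi>1: "strict_mono \<phi>1" "((\<lambda>i. emeasure (G i) (ball x (3 * L * r))) \<circ> \<phi>1) \<longlonglongrightarrow> ennreal a"
    using liminf_subseq_lim[of "\<lambda>i. emeasure (G i) (ball x (3 * L * r))"] unfolding a by blast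
  define f where "f n y = (v (\<phi>1 n) y - u y) * indicator (ball x r) y" for n y
  have fm[measurable]: "f n \<in> borel_measurable \<nu>" for n unfolding f_def by measurable
  have f_eq: "(\<integral>\<^sup>+y. ennreal (norm (f n y)) \<partial>\<nu>) = (\<integral>\<^sup>+y\<in>ball x r. ennreal \<bar>v (\<phi>1 n) y - u y\<bar> \<partial>\<nu>)" for n
    unfolding f_def by (intro nn_integral_cong) (auto simp: indicator_def)
  have conv1: "(\<lambda>n. \<integral>\<^sup>+y. ennreal (norm (f n y)) \<partial>\<nu>) \<longlonglongrightarrow> 0"
    unfolding f_eq using LIMSEQ_subseq_LIMSEQ[OF conv \<phi>1(1)] by (simp add: o_def)
  then have "\<forall>\<^sub>F n in sequentially. (\<integral>\<^sup>+y. ennreal (norm (f n y)) \<partial>\<nu>) < 1"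
    by (rule order_tendstoD) simp
  then obtain n0 where n0: "\<And>n. n0 \<le> n \<Longrightarrow> (\<integral>\<^sup>+y. ennreal (norm (f n y)) \<partial>\<nu>) < 1"
    unfolding eventually_sequentially by blast
  have int: "integrable \<nu> (f (n + n0))" for n
  proof (rule integrableI_bounded)
    show "(\<integral>\<^sup>+y. ennreal (norm (f (n + n0) y)) \<partial>\<nu>) < \<infinity>"
      using n0[of "n + n0"] by (auto intro: less_trans[OF _ ennreal_one_less_top])
  qed measurable
  have "(\<lambda>n. \<integral>y. norm (f (n + n0) y) \<partial>\<nu>) \<longlonglongrightarrow> 0"
  proof -
    have eq: "(\<integral>\<^sup>+y. ennreal (norm (f (n + n0) y)) \<partial>\<nu>) = ennreal (\<integral>y. norm (f (n + n0) y) \<partial>\<nu>)" for n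
      using integrable_norm[OF int] by (intro nn_integral_eq_integral) auto
    have "(\<lambda>n. ennreal (\<integral>y. norm (f (n + n0) y) \<partial>\<nu>)) \<longlonglongrightarrow> ennreal 0"
      using LIMSEQ_ignore_initial_segment[OF conv1, of n0] unfolding eq by simp
    then show ?thesis by (rule tendsto_ennrealD) auto
  qed
  then obtain \<phi>2 where \<phi>2: "strict_mono \<phi>2" "AE y in \<nu>. (\<lambda>n. f (\<phi>2 n + n0) y) \<longlonglongrightarrow> 0"
    using tendsto_L1_AE_subseq[of \<nu> "\<lambda>n. f (n + n0)"] int by blast
  define \<phi> where "\<phi> n = \<phi>1 (\<phi>2 n + n0)" for n
  define gm where "gm n = measure (G (\<phi> n)) (ball x (3 * L * r))" for n
  define T where "T n = 2 * pp * (C * r * gm n / mB) powr pp * mB" for n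
  have "\<exists>m. (\<integral>\<^sup>+y\<in>ball x r. ennreal (\<bar>v (\<phi> n) y - m\<bar> powr pp) \<partial>\<nu>) \<le> ennreal (T n)" for n
    using level_poincare.sobolev_poincare[OF lp x r, of "\<phi> n"] unfolding T_def gm_def C_def mB_def by blast
  then obtain m where m: "\<And>n. (\<integral>\<^sup>+y\<in>ball x r. ennreal (\<bar>v (\<phi> n) y - m n\<bar> powr pp) \<partial>\<nu>) \<le> ennreal (T n)"
    by metis
  have gm: "gm \<longlonglongrightarrow> a"
  proof -
    have "filterlim (\<lambda>n. \<phi>2 n + n0) at_top sequentially"
      using filterlim_subseq[OF \<phi>2(1)] by (rule filterlim_at_top_mono) auto
    from filterlim_compose[OF \<phi>1(2) this]
    have "(\<lambda>n. ennreal (gm n)) \<longlonglongrightarrow> ennreal a"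
      unfolding gm_def \<phi>_def o_def
      by (simp add: finite_measure.emeasure_eq_measure[OF level_poincare.axioms(2)[OF lp]])
    then show ?thesis by (rule tendsto_ennrealD) (auto simp: gm_def a)
  qed
  define TT where "TT = 2 * pp * (C * r * a / mB) powr pp * mB"
  have T: "T \<longlonglongrightarrow> TT"
    unfolding T_def TT_def using pp(1) C r mB a
    by (intro tendsto_mult tendsto_const tendsto_powr2 tendsto_divide gm) (auto simp: gm_def intro!: always_eventually)
  have T0: "0 \<le> T n" for n unfolding T_def using pp(1) mB by (intro mult_nonneg_nonneg) auto
  have TT0: "0 \<le> TT" unfolding TT_def using pp(1) mB by (intro mult_nonneg_nonneg) auto
  obtain B where B: "\<And>n. T n \<le> B"
  proof -
    have "bounded (range T)" using T convergent_imp_bounded by blast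
    then show thesis using that unfolding bounded_iff by (metis abs_le_D1 rangeI real_norm_def)
  qed
  define U where "U = (\<integral>y. \<bar>u y\<bar> \<partial>\<nu>)"
  \<comment> \<open>Integrating \<open>\<bar>m n\<bar> \<le> 1 + \<bar>v - m n\<bar> powr pp +
    \<bar>v - u\<bar> + \<bar>u\<bar>\<close> over the ball bounds the constants uniformly in
    \<open>n\<close>.\<close>
  have mbound: "\<bar>m n\<bar> \<le> (mB + B + 1 + U) / mB" for n
  proof -
    have "ennreal (\<bar>m n\<bar> * mB) = (\<integral>\<^sup>+y. ennreal \<bar>m n\<bar> * indicator (ball x r) y \<partial>\<nu>)"
      using mB by (subst nn_integral_cmult_indicator) (auto simp: emeasure_eq_measure mB_def ennreal_mult)
    also have "\<dots> \<le> (\<integral>\<^sup>+y. (indicator (ball x r) y + ennreal (\<bar>v (\<phi> n) y - m n\<bar> powr pp) * indicator (ball x r) y) +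
        (ennreal (norm (f (\<phi>2 n + n0) y)) + ennreal \<bar>u y\<bar>) \<partial>\<nu>)"
    proof (rule nn_integral_mono)
      fix y
      have "\<bar>z\<bar> \<le> 1 + \<bar>z\<bar> powr pp" for z :: real
      proof (cases "\<bar>z\<bar> \<le> 1")
        case False
        then have "\<bar>z\<bar> powr 1 \<le> \<bar>z\<bar> powr pp" using pp(1) by (intro powr_mono) auto
        then show ?thesis using False by simp
      qed (simp add: add_increasing2)
      then have "\<bar>m n\<bar> \<le> (1 + \<bar>v (\<phi> n) y - m n\<bar> powr pp) + (\<bar>v (\<phi> n) y - u y\<bar> + \<bar>u y\<bar>)"
        by (smt (verit))
      then have "ennreal \<bar>m n\<bar> \<le> (1 + ennreal (\<bar>v (\<phi> n) y - m n\<bar> powr pp)) + (ennreal \<bar>v (\<phi> n) y - u y\<bar> + ennreal \<bar>u y\<bar>)"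
        unfolding ennreal_1[symmetric] by (simp flip: ennreal_plus del: ennreal_1)
      then show "ennreal \<bar>m n\<bar> * indicator (ball x r) y \<le> (indicator (ball x r) y + ennreal (\<bar>v (\<phi> n) y - m n\<bar> powr pp) * indicator (ball x r) y) +
        (ennreal (norm (f (\<phi>2 n + n0) y)) + ennreal \<bar>u y\<bar>)"
        unfolding f_def \<phi>_def by (auto simp: indicator_def)
    qed
    also have "\<dots> = (emeasure \<nu> (ball x r) + (\<integral>\<^sup>+y\<in>ball x r. ennreal (\<bar>v (\<phi> n) y - m n\<bar> powr pp) \<partial>\<nu>)) +
       ((\<integral>\<^sup>+y. ennreal (norm (f (\<phi>2 n + n0) y)) \<partial>\<nu>) + (\<integral>\<^sup>+y. ennreal \<bar>u y\<bar> \<partial>\<nu>))"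
      by (simp add: nn_integral_add)
    also have "\<dots> \<le> (ennreal mB + ennreal B) + (ennreal 1 + ennreal U)"
    proof (intro add_mono)
      show "emeasure \<nu> (ball x r) \<le> ennreal mB" unfolding mB_def emeasure_eq_measure by simp
      show "(\<integral>\<^sup>+y\<in>ball x r. ennreal (\<bar>v (\<phi> n) y - m n\<bar> powr pp) \<partial>\<nu>) \<le> ennreal B"
        using m[of n] B[of n] by (meson ennreal_leI order_trans)
      show "(\<integral>\<^sup>+y. ennreal (norm (f (\<phi>2 n + n0) y)) \<partial>\<nu>) \<le> ennreal 1"
        using n0[of "\<phi>2 n + n0"] by simp
      show "(\<integral>\<^sup>+y. ennreal \<bar>u y\<bar> \<partial>\<nu>) \<le> ennreal U"
        unfolding U_def using u by (subst nn_integral_eq_integral) auto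
    qed
    also have "\<dots> = ennreal (mB + B + 1 + U)"
      using mB T0[of 0] B[of 0] unfolding U_def by (simp flip: ennreal_plus add: add.assoc del: ennreal_1)
    finally have "\<bar>m n\<bar> * mB \<le> mB + B + 1 + U"
      using mB T0[of 0] B[of 0] unfolding U_def by (subst (asm) ennreal_le_iff) auto
    then show ?thesis using mB by (simp add: field_simps)
  qed
  then have "bounded (range m)" unfolding bounded_iff by auto
  from bounded_imp_convergent_subsequence[OF this]
  obtain c \<phi>3 where \<phi>3: "strict_mono \<phi>3" "(m \<circ> \<phi>3) \<longlonglongrightarrow> c" by blast
  have "(\<integral>\<^sup>+y\<in>ball x r. ennreal (\<bar>u y - c\<bar> powr pp) \<partial>\<nu>) \<le>
     (\<integral>\<^sup>+y. liminf (\<lambda>n. ennreal (\<bar>v (\<phi> (\<phi>3 n)) y - m (\<phi>3 n)\<bar> powr pp) * indicator (ball x r) y) \<partial>\<nu>)"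
  proof (rule nn_integral_mono_AE)
    show "AE y in \<nu>. ennreal (\<bar>u y - c\<bar> powr pp) * indicator (ball x r) y \<le>
      liminf (\<lambda>n. ennreal (\<bar>v (\<phi> (\<phi>3 n)) y - m (\<phi>3 n)\<bar> powr pp) * indicator (ball x r) y)"
      using \<phi>2(2)
    proof eventually_elim
      case (elim y)
      show ?case
      proof (cases "y \<in> ball x r")
        case True
        have "(\<lambda>n. f (\<phi>2 (\<phi>3 n) + n0) y) \<longlonglongrightarrow> 0"
          using LIMSEQ_subseq_LIMSEQ[OF elim \<phi>3(1)] by (simp add: o_def)
        then have "(\<lambda>n. f (\<phi>2 (\<phi>3 n) + n0) y + u y - (m \<circ> \<phi>3) n) \<longlonglongrightarrow> 0 + u y - c"
          by (intro tendsto_diff tendsto_add tendsto_const \<phi>3(2))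
        then have "(\<lambda>n. \<bar>v (\<phi> (\<phi>3 n)) y - m (\<phi>3 n)\<bar>) \<longlonglongrightarrow> \<bar>u y - c\<bar>"
          using True unfolding f_def \<phi>_def by (intro tendsto_rabs) simp
        then have "(\<lambda>n. ennreal (\<bar>v (\<phi> (\<phi>3 n)) y - m (\<phi>3 n)\<bar> powr pp)) \<longlonglongrightarrow> ennreal (\<bar>u y - c\<bar> powr pp)"
          using pp(1) by (intro tendsto_ennrealI tendsto_powr2 tendsto_const) auto
        from lim_imp_Liminf[OF sequentially_bot this] show ?thesis using True by simp
      qed simp
    qed
  qed
  also have "\<dots> \<le> liminf (\<lambda>n. \<integral>\<^sup>+y. ennreal (\<bar>v (\<phi> (\<phi>3 n)) y - m (\<phi>3 n)\<bar> powr pp) * indicator (ball x r) y \<partial>\<nu>)"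
    by (rule nn_integral_liminf) measurable
  also have "\<dots> \<le> liminf (\<lambda>n. ennreal (T (\<phi>3 n)))"
    by (rule Liminf_mono) (auto intro: m always_eventually)
  also have "\<dots> = ennreal TT"
  proof (rule lim_imp_Liminf[OF sequentially_bot])
    show "(\<lambda>n. ennreal (T (\<phi>3 n))) \<longlonglongrightarrow> ennreal TT"
      using LIMSEQ_subseq_LIMSEQ[OF T \<phi>3(1)] by (intro tendsto_ennrealI) (simp add: o_def)
  qed
  also have "TT = (Cosc K L * r * a / mB) powr pp * mB"
  proof -
    have "Cosc K L * r * a / mB = (2 * pp) powr (1 / pp) * (C * r * a / mB)" unfolding Cosc_def C_def by simp
    then have "(Cosc K L * r * a / mB) powr pp = ((2 * pp) powr (1 / pp)) powr pp * (C * r * a / mB) powr pp"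
      by (simp only: powr_mult)
    also have "((2 * pp) powr (1 / pp)) powr pp = 2 * pp" unfolding powr_powr pp(5) using pp(1) by simp
    finally show ?thesis unfolding TT_def by simp
  qed
  finally show ?thesis unfolding mB_def by blast
qed

end

section \<open>Whitney smoothing\<close>

lemma abs_integral_le:
  fixes f g :: "'a \<Rightarrow> real"
  assumes "integrable M f" "integrable M g" "\<And>x. \<bar>f x\<bar> \<le> g x"
  shows "\<bar>integral\<^sup>L M f\<bar> \<le> integral\<^sup>L M g"
  using order_trans[OF integral_abs_bound integral_mono[OF integrable_abs[OF assms(1)] assms(2,3)]] .

section \<open>Averages over balls of Whitney size\<close>

locale whitney_domain = doubling_domain \<nu> \<Omega> Cd Q cm
  for \<nu> :: "'a::metric_space measure" and \<Omega> :: "'a set" and Cd Q cm :: real +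
  fixes L :: real
  assumes L1: "1 \<le> L" and compl_ne: "- \<Omega> \<noteq> {}"
begin

definition \<delta> :: "'a \<Rightarrow> real" where "\<delta> x = infdist x (- \<Omega>)"
text \<open>The Sobolev-Poincare inequality on \<open>ball z (4 * \<rho> z)\<close> uses the energy
  on the ball dilated by \<open>3 * L\<close>; this value makes the radius of the dilated ball equal
  to \<open>\<delta> z / 2\<close>, so that it stays inside \<Omega>.\<close>

definition \<kappa> :: real where "\<kappa> = 1 / (24 * L)"
definition \<rho> :: "'a \<Rightarrow> real" where "\<rho> x = \<kappa> * \<delta> x"

lemma \<kappa>: "0 < \<kappa>" "\<kappa> \<le> 1 / 24" "12 * L * \<kappa> = 1 / 2"
proof -
  show "0 < \<kappa>" "12 * L * \<kappa> = 1 / 2" unfolding \<kappa>_def using L1 by auto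
  show "\<kappa> \<le> 1 / 24" unfolding \<kappa>_def using L1 by (intro divide_left_mono) auto
qed

lemma \<delta>_pos: "x \<in> \<Omega> \<Longrightarrow> 0 < \<delta> x"
  unfolding \<delta>_def using open_dom compl_ne by (intro infdist_pos_not_in_closed) auto

lemma \<delta>_lip: "\<bar>\<delta> x - \<delta> y\<bar> \<le> dist x y"
  unfolding \<delta>_def by (rule infdist_triangle_abs)

lemma \<delta>_le: "y \<notin> \<Omega> \<Longrightarrow> \<delta> x \<le> dist x y"
  unfolding \<delta>_def by (rule infdist_le) simp

lemma \<rho>_pos: "x \<in> \<Omega> \<Longrightarrow> 0 < \<rho> x"
  unfolding \<rho>_def using \<delta>_pos \<kappa>(1) by simp

lemma \<rho>_lip: "\<bar>\<rho> x - \<rho> y\<bar> \<le> \<kappa> * dist x y"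
  unfolding \<rho>_def right_diff_distrib[symmetric] abs_mult using \<delta>_lip \<kappa>(1) by simp

lemma big_ball: "12 * L * \<rho> x = \<delta> x / 2" "24 * \<rho> x \<le> \<delta> x"
proof -
  show "12 * L * \<rho> x = \<delta> x / 2" unfolding \<rho>_def using \<kappa>(3) by (simp add: mult.assoc[symmetric])
  have "24 * \<kappa> * \<delta> x \<le> 1 * \<delta> x" using \<kappa> unfolding \<delta>_def by (intro mult_right_mono) (auto simp: infdist_nonneg)
  then show "24 * \<rho> x \<le> \<delta> x" unfolding \<rho>_def by simp
qed

lemma cball_dom: "s < \<delta> x \<Longrightarrow> cball x s \<subseteq> \<Omega>"
  using \<delta>_le[of _ x] by force

text \<open>A tent kernel, Lipschitz in \<open>x\<close> although both its centre and its width
  depend on \<open>x\<close>. Averaging with it takes the place of a partition of unity.\<close>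

definition \<eta> :: "'a \<Rightarrow> 'a \<Rightarrow> real" where "\<eta> x y = max 0 (\<rho> x - dist x y)"

lemma \<eta>_nonneg: "0 \<le> \<eta> x y" unfolding \<eta>_def by simp

lemma \<eta>_le: "x \<in> \<Omega> \<Longrightarrow> \<eta> x y \<le> \<rho> x" unfolding \<eta>_def using \<rho>_pos[of x] by auto

lemma \<eta>_lip: "\<bar>\<eta> x y - \<eta> x' y\<bar> \<le> 2 * dist x x'"
proof -
  have "\<kappa> * dist x x' \<le> 1 * dist x x'" using \<kappa> by (intro mult_right_mono) auto
  then have "\<bar>\<rho> x - \<rho> x'\<bar> \<le> dist x x'" using \<rho>_lip[of x x'] by simp
  moreover have "\<bar>dist x y - dist x' y\<bar> \<le> dist x x'"
    using dist_triangle[of x y x'] dist_triangle[of x' y x] by (simp add: dist_commute)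
  ultimately show ?thesis unfolding \<eta>_def by (auto simp: max_def abs_if split: if_splits)
qed

lemma \<eta>_meas [measurable]: "\<eta> x \<in> borel_measurable \<nu>"
proof -
  have "\<eta> x \<in> borel_measurable borel"
    unfolding \<eta>_def by (intro borel_measurable_continuous_onI continuous_intros)
  then have "\<eta> x -` A \<inter> space borel \<in> sets \<nu>" if "A \<in> sets borel" for A
    using measurable_sets[of "\<eta> x" borel borel A] that borel_sets by auto
  then show ?thesis by (intro measurableI) (auto simp: space_UNIV)
qed

lemma \<eta>_integrable:
  assumes x: "x \<in> \<Omega>" and f: "integrable \<nu> f"
  shows "integrable \<nu> (\<lambda>y. \<eta> x y * f y)"
proof (rule Bochner_Integration.integrable_bound)
  show "integrable \<nu> (\<lambda>y. \<rho> x * f y)" using f by simp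
  have [measurable]: "f \<in> borel_measurable \<nu>" using f by simp
  show "(\<lambda>y. \<eta> x y * f y) \<in> borel_measurable \<nu>" by measurable
  show "AE y in \<nu>. norm (\<eta> x y * f y) \<le> norm (\<rho> x * f y)"
    using \<eta>_le[OF x] \<eta>_nonneg \<rho>_pos[OF x] by (auto simp: abs_mult intro!: mult_right_mono)
qed

definition \<eta>N :: "'a \<Rightarrow> real" where "\<eta>N x = (\<integral>y. \<eta> x y \<partial>\<nu>)"

definition smooth :: "('a \<Rightarrow> real) \<Rightarrow> 'a \<Rightarrow> real" where
  "smooth u x = (\<integral>y. \<eta> x y * u y \<partial>\<nu>) / \<eta>N x"

text \<open>\<open>Cs1\<close> bounds the kernel mass from below: the kernel is at least
  \<open>\<rho> z / 4\<close> on a ball of radius \<open>\<rho> z / 4\<close>, and 20 is the ratio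
  of \<open>5 * \<rho> z\<close> to that radius. \<open>Cs\<close> collects the two terms of the
  quotient estimate in \<open>smooth_lip\<close>.\<close>

definition Cs1 :: real where "Cs1 = 1 / (4 * dbl 20)"
definition Cs :: real where "Cs = 2 / Cs1 + 4 / Cs1 ^ 2"

lemma Cs: "0 < Cs1" "0 < Cs" "2 / Cs1 \<le> Cs"
  unfolding Cs_def Cs1_def using dbl_ge_1[of 20] by (auto intro!: add_pos_pos)

context
  fixes z :: 'a assumes z: "z \<in> \<Omega>"
begin

text \<open>As \<kappa> is small, \<rho> is almost constant on a Whitney ball. All kernels centred
  there are thus supported in one common ball, on which the oscillation of \<open>u\<close> is
  estimated.\<close>

lemma near:
  assumes "x \<in> ball z (\<rho> z)"
  shows "x \<in> \<Omega>" "\<rho> z / 2 \<le> \<rho> x" "\<rho> x \<le> 2 * \<rho> z" "\<And>y. \<eta> x y \<noteq> 0 \<Longrightarrow> y \<in> ball z (4 * \<rho> z)"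
proof -
  have r: "0 < \<rho> z" by (rule \<rho>_pos[OF z])
  have d: "dist z x < \<rho> z" using assms by simp
  have "\<kappa> * dist z x \<le> 1 / 24 * \<rho> z" using \<kappa> d r by (intro mult_mono) auto
  then have dr: "\<bar>\<rho> z - \<rho> x\<bar> \<le> \<rho> z / 24" using \<rho>_lip[of z x] by simp
  then show "\<rho> z / 2 \<le> \<rho> x" and 2: "\<rho> x \<le> 2 * \<rho> z" using r by linarith+
  have "\<rho> z < \<delta> z" using big_ball(2)[of z] r by simp
  then show "x \<in> \<Omega>" using cball_dom[of "\<rho> z" z] d by auto
  fix y assume "\<eta> x y \<noteq> 0"
  then have "dist x y < \<rho> x" unfolding \<eta>_def by (auto simp: max_def split: if_splits)
  then show "y \<in> ball z (4 * \<rho> z)" using dist_triangle[of z y x] d 2 r by simp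
qed

lemma \<eta>N_lower:
  assumes x: "x \<in> ball z (\<rho> z)"
  shows "Cs1 * \<rho> z * measure \<nu> (ball z (4 * \<rho> z)) \<le> \<eta>N x"
proof -
  have r: "0 < \<rho> z" by (rule \<rho>_pos[OF z])
  note n = near[OF x]
  have xc: "x \<in> closure \<Omega>" using n(1) closure_subset by auto
  have "measure \<nu> (ball z (4 * \<rho> z)) \<le> measure \<nu> (ball x (20 * (\<rho> z / 4)))"
  proof (intro finite_measure_mono subsetI)
    fix y assume "y \<in> ball z (4 * \<rho> z)"
    then show "y \<in> ball x (20 * (\<rho> z / 4))" using x dist_triangle[of x y z] by (simp add: dist_commute)
  qed simp
  also have "\<dots> \<le> dbl 20 * measure \<nu> (ball x (\<rho> z / 4))" using r by (intro ball_dbl xc) simp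
  finally have m4: "measure \<nu> (ball z (4 * \<rho> z)) \<le> dbl 20 * measure \<nu> (ball x (\<rho> z / 4))" .
  have "\<rho> z / 4 * measure \<nu> (ball x (\<rho> z / 4)) = (\<integral>y. \<rho> z / 4 * indicator (ball x (\<rho> z / 4)) y \<partial>\<nu>)" by simp
  also have "\<dots> \<le> \<eta>N x"
    unfolding \<eta>N_def
  proof (rule integral_mono)
    show "integrable \<nu> (\<eta> x)" using \<eta>_integrable[OF n(1), of "\<lambda>_. 1"] by simp
    show "\<rho> z / 4 * indicator (ball x (\<rho> z / 4)) y \<le> \<eta> x y" for y
      using n(2) \<eta>_nonneg[of x y] r unfolding \<eta>_def by (auto simp: indicator_def max_def)
  qed (auto simp: emeasure_eq_measure)
  finally have "\<rho> z / 4 * measure \<nu> (ball x (\<rho> z / 4)) \<le> \<eta>N x" .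
  moreover have "Cs1 * \<rho> z * measure \<nu> (ball z (4 * \<rho> z)) \<le> Cs1 * \<rho> z * (dbl 20 * measure \<nu> (ball x (\<rho> z / 4)))"
    using m4 r Cs by (intro mult_left_mono) auto
  moreover have "\<dots> = \<rho> z / 4 * measure \<nu> (ball x (\<rho> z / 4))"
    unfolding Cs1_def using dbl_ge_1[of 20] by simp
  ultimately show ?thesis by simp
qed

context
  fixes u :: "'a \<Rightarrow> real" and c A :: real
  assumes u: "integrable \<nu> u" and A: "(\<integral>\<^sup>+y\<in>ball z (4 * \<rho> z). ennreal \<bar>u y - c\<bar> \<partial>\<nu>) \<le> ennreal A" "0 \<le> A"
begin

text \<open>The numerator of the average of \<open>u - c\<close>. Averages reproduce constants, so
  \<open>c\<close> may be subtracted and only the oscillation of \<open>u\<close> enters.\<close>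

definition PP :: "'a \<Rightarrow> real" where "PP x = (\<integral>y. \<eta> x y * (u y - c) \<partial>\<nu>)"

lemma u_c_int: "integrable \<nu> (\<lambda>y. u y - c)" using u by simp

lemma abs_int_le:
  assumes h: "integrable \<nu> h" and b: "\<And>y. \<bar>h y\<bar> \<le> k * (\<bar>u y - c\<bar> * indicator (ball z (4 * \<rho> z)) y)" and k: "0 \<le> k"
  shows "\<bar>\<integral>y. h y \<partial>\<nu>\<bar> \<le> k * A"
proof -
  have int: "integrable \<nu> (\<lambda>y. \<bar>u y - c\<bar> * indicator (ball z (4 * \<rho> z)) y)"
    using u_c_int by (intro integrable_real_mult_indicator) auto
  have "ennreal (\<integral>y. \<bar>u y - c\<bar> * indicator (ball z (4 * \<rho> z)) y \<partial>\<nu>) = (\<integral>\<^sup>+y. ennreal (\<bar>u y - c\<bar> * indicator (ball z (4 * \<rho> z)) y) \<partial>\<nu>)"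
    using int by (intro nn_integral_eq_integral[symmetric]) auto
  also have "\<dots> = (\<integral>\<^sup>+y\<in>ball z (4 * \<rho> z). ennreal \<bar>u y - c\<bar> \<partial>\<nu>)"
    by (intro nn_integral_cong) (auto simp: indicator_def)
  also note A(1)
  finally have le: "(\<integral>y. \<bar>u y - c\<bar> * indicator (ball z (4 * \<rho> z)) y \<partial>\<nu>) \<le> A"
    using A(2) by (simp add: ennreal_le_iff)
  have "\<bar>\<integral>y. h y \<partial>\<nu>\<bar> \<le> (\<integral>y. k * (\<bar>u y - c\<bar> * indicator (ball z (4 * \<rho> z)) y) \<partial>\<nu>)"
    by (rule abs_integral_le[OF h]) (use int b in auto)
  also have "\<dots> \<le> k * A" using le k by (simp add: mult_left_mono)
  finally show ?thesis .
qed

lemma PP_bound: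
  assumes x: "x \<in> ball z (\<rho> z)" shows "\<bar>PP x\<bar> \<le> 2 * \<rho> z * A"
  unfolding PP_def
proof (rule abs_int_le[OF \<eta>_integrable[OF near(1)[OF x] u_c_int]])
  fix y
  show "\<bar>\<eta> x y * (u y - c)\<bar> \<le> 2 * \<rho> z * (\<bar>u y - c\<bar> * indicator (ball z (4 * \<rho> z)) y)"
  proof (cases "\<eta> x y = 0")
    case False
    then show ?thesis
      using near[OF x] \<eta>_le[OF near(1)[OF x], of y] \<eta>_nonneg[of x y] by (auto simp: abs_mult intro!: mult_right_mono)
  qed (use \<rho>_pos[OF z] in auto)
qed (use \<rho>_pos[OF z] in auto)

lemma PP_diff:
  assumes x: "x \<in> ball z (\<rho> z)" and x': "x' \<in> ball z (\<rho> z)"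
  shows "\<bar>PP x - PP x'\<bar> \<le> 2 * dist x x' * A"
proof -
  note i = \<eta>_integrable[OF near(1)[OF x] u_c_int] \<eta>_integrable[OF near(1)[OF x'] u_c_int]
  have "PP x - PP x' = (\<integral>y. \<eta> x y * (u y - c) - \<eta> x' y * (u y - c) \<partial>\<nu>)"
    unfolding PP_def using i by simp
  also have "\<bar>\<dots>\<bar> \<le> 2 * dist x x' * A"
  proof (rule abs_int_le)
    fix y
    show "\<bar>\<eta> x y * (u y - c) - \<eta> x' y * (u y - c)\<bar> \<le> 2 * dist x x' * (\<bar>u y - c\<bar> * indicator (ball z (4 * \<rho> z)) y)"
    proof (cases "\<eta> x y = 0 \<and> \<eta> x' y = 0")
      case False
      then have "y \<in> ball z (4 * \<rho> z)" using near(4)[OF x] near(4)[OF x'] by auto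
      then show ?thesis
        using \<eta>_lip[of x y x'] by (auto simp: abs_mult left_diff_distrib[symmetric] intro!: mult_right_mono)
    qed auto
  qed (use i in auto)
  finally show ?thesis .
qed

lemma \<eta>N_diff:
  assumes x: "x \<in> ball z (\<rho> z)" and x': "x' \<in> ball z (\<rho> z)"
  shows "\<bar>\<eta>N x - \<eta>N x'\<bar> \<le> 2 * dist x x' * measure \<nu> (ball z (4 * \<rho> z))"
proof -
  have i: "integrable \<nu> (\<eta> x)" "integrable \<nu> (\<eta> x')"
    using \<eta>_integrable[OF near(1)[OF x], of "\<lambda>_. 1"] \<eta>_integrable[OF near(1)[OF x'], of "\<lambda>_. 1"] by auto
  have "\<eta>N x - \<eta>N x' = (\<integral>y. \<eta> x y - \<eta> x' y \<partial>\<nu>)" unfolding \<eta>N_def using i by simp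
  also have "\<bar>\<dots>\<bar> \<le> (\<integral>y. 2 * dist x x' * indicator (ball z (4 * \<rho> z)) y \<partial>\<nu>)"
  proof (rule abs_integral_le)
    fix y
    show "\<bar>\<eta> x y - \<eta> x' y\<bar> \<le> 2 * dist x x' * indicator (ball z (4 * \<rho> z)) y"
    proof (cases "\<eta> x y = 0 \<and> \<eta> x' y = 0")
      case False
      then have "y \<in> ball z (4 * \<rho> z)" using near(4)[OF x] near(4)[OF x'] by auto
      then show ?thesis using \<eta>_lip[of x y x'] by auto
    qed auto
  qed (use i in \<open>auto simp: emeasure_eq_measure\<close>)
  finally show ?thesis by simp
qed

lemma m4_pos: "0 < measure \<nu> (ball z (4 * \<rho> z))"
  using \<rho>_pos[OF z] z closure_subset by (intro ball_pos) auto

lemma \<eta>N_pos: "x \<in> ball z (\<rho> z) \<Longrightarrow> 0 < \<eta>N x"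
  using \<eta>N_lower[of x] mult_pos_pos[OF mult_pos_pos[OF Cs(1) \<rho>_pos[OF z]] m4_pos] by linarith

lemma smooth_PP:
  assumes x: "x \<in> ball z (\<rho> z)"
  shows "smooth u x - c = PP x / \<eta>N x"
proof -
  have "PP x = (\<integral>y. \<eta> x y * u y - c * \<eta> x y \<partial>\<nu>)" unfolding PP_def by (simp add: algebra_simps)
  also have "\<dots> = (\<integral>y. \<eta> x y * u y \<partial>\<nu>) - c * \<eta>N x"
    unfolding \<eta>N_def using \<eta>_integrable[OF near(1)[OF x] u] \<eta>_integrable[OF near(1)[OF x], of "\<lambda>_. 1"] by simp
  finally show ?thesis unfolding smooth_def using \<eta>N_pos[OF x] by (simp add: field_simps)
qed

lemma smooth_near:
  assumes x: "x \<in> ball z (\<rho> z)"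
  shows "\<bar>smooth u x - c\<bar> \<le> Cs * A / measure \<nu> (ball z (4 * \<rho> z))"
proof -
  define m where "m = measure \<nu> (ball z (4 * \<rho> z))"
  have m: "0 < m" unfolding m_def by (rule m4_pos)
  have r: "0 < \<rho> z" by (rule \<rho>_pos[OF z])
  have lo: "Cs1 * \<rho> z * m \<le> \<eta>N x" "0 < Cs1 * \<rho> z * m"
    using \<eta>N_lower[OF x] m r Cs unfolding m_def by auto
  have "\<bar>smooth u x - c\<bar> = \<bar>PP x\<bar> / \<eta>N x" unfolding smooth_PP[OF x] using \<eta>N_pos[OF x] by simp
  also have "\<dots> \<le> (2 * \<rho> z * A) / (Cs1 * \<rho> z * m)"
    using PP_bound[OF x] lo r A(2) by (intro frac_le) auto
  also have "\<dots> = 2 / Cs1 * (A / m)" using r by simp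
  also have "\<dots> \<le> Cs * (A / m)" using Cs A(2) m by (intro mult_right_mono) auto
  finally show ?thesis unfolding m_def by simp
qed

text \<open>A quotient rule: numerator and kernel mass are both Lipschitz in the centre, and the
  mass is bounded from below.\<close>

lemma smooth_lip:
  assumes x: "x \<in> ball z (\<rho> z)" and x': "x' \<in> ball z (\<rho> z)"
  shows "\<bar>smooth u x - smooth u x'\<bar> \<le> Cs * A / (\<rho> z * measure \<nu> (ball z (4 * \<rho> z))) * dist x x'"
proof -
  define m where "m = measure \<nu> (ball z (4 * \<rho> z))"
  define d where "d = dist x x'"
  have m: "0 < m" unfolding m_def by (rule m4_pos)
  have r: "0 < \<rho> z" by (rule \<rho>_pos[OF z])
  define q where "q = Cs1 * \<rho> z * m"
  have lo: "q \<le> \<eta>N x" "q \<le> \<eta>N x'" "0 < q"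
    using \<eta>N_lower[OF x] \<eta>N_lower[OF x'] m r Cs unfolding m_def q_def by auto
  have N: "0 < \<eta>N x" "0 < \<eta>N x'" using \<eta>N_pos x x' by auto
  have d0: "0 \<le> d" unfolding d_def by simp
  have "smooth u x - smooth u x' = (smooth u x - c) - (smooth u x' - c)" by simp
  also have "\<dots> = (PP x - PP x') / \<eta>N x + PP x' * (\<eta>N x' - \<eta>N x) / (\<eta>N x * \<eta>N x')"
    unfolding smooth_PP[OF x] smooth_PP[OF x'] using N by (simp add: field_simps)
  also have "\<bar>\<dots>\<bar> \<le> \<bar>PP x - PP x'\<bar> / \<eta>N x + \<bar>PP x'\<bar> * \<bar>\<eta>N x' - \<eta>N x\<bar> / (\<eta>N x * \<eta>N x')"
    using N by (intro order_trans[OF abs_triangle_ineq]) (simp add: abs_mult)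
  also have "\<dots> \<le> (2 * d * A) / q + (2 * \<rho> z * A) * (2 * d * m) / (q * q)"
  proof (intro add_mono frac_le mult_mono)
    show "\<bar>\<eta>N x' - \<eta>N x\<bar> \<le> 2 * d * m" using \<eta>N_diff[OF x' x] unfolding d_def m_def by (simp add: dist_commute)
    show "\<bar>PP x - PP x'\<bar> \<le> 2 * d * A" unfolding d_def by (rule PP_diff[OF x x'])
    show "\<bar>PP x'\<bar> \<le> 2 * \<rho> z * A" by (rule PP_bound[OF x'])
  qed (use lo r A(2) d0 m N in auto)
  also have "\<dots> = (2 / Cs1 + 4 / Cs1 ^ 2) * A / (\<rho> z * m) * d"
    unfolding q_def using r m Cs(1) by (simp add: field_simps power2_eq_square)
  finally show ?thesis unfolding Cs_def m_def d_def .
qed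

end

end

text \<open>For the overlap: all \<open>z\<close> whose ball of radius \<open>\<delta> z / 2\<close>
  contains \<open>x\<close> have \<open>\<delta> z\<close> comparable to \<open>\<delta> x\<close>.
  Their balls of radius \<open>\<rho> z / 5\<close> are disjoint, lie in
  \<open>ball x (3 * \<delta> x)\<close> and each carries a fixed fraction of its mass. The count is
  a measure in \<open>count_space\<close> because it is going to be integrated over
  \<open>D\<close>.\<close>

lemma whitney_cover:
  obtains D where "countable D" "D \<subseteq> \<Omega>" "\<And>x. x \<in> \<Omega> \<Longrightarrow> \<exists>z\<in>D. x \<in> ball z (\<rho> z)"
    "\<And>x. emeasure (count_space D) {z\<in>D. x \<in> ball z (\<delta> z / 2)} \<le> ennreal (dbl (25 / \<kappa>))"
proof -
  obtain y0 where y0: "y0 \<notin> \<Omega>" using compl_ne by auto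
  obtain B where B: "\<And>x. x \<in> \<Omega> \<Longrightarrow> dist y0 x \<le> B" using bounded_dom unfolding bounded_any_center[where a=y0] by auto
  obtain D where D: "D \<subseteq> \<Omega>" "disjoint_family_on (\<lambda>x. ball x (\<rho> x / 5)) D"
     "\<And>x. x \<in> \<Omega> \<Longrightarrow> \<exists>y\<in>D. ball x (\<rho> x / 5) \<subseteq> ball y (5 * (\<rho> y / 5))"
  proof (rule vitali_covering_metric[of \<Omega> "\<lambda>x. \<rho> x / 5" "\<kappa> * B / 5"])
    fix x assume x: "x \<in> \<Omega>"
    have "\<delta> x \<le> B" using \<delta>_le[OF y0, of x] B[OF x] by (simp add: dist_commute)
    then show "0 < \<rho> x / 5 \<and> \<rho> x / 5 \<le> \<kappa> * B / 5" using \<rho>_pos[OF x] \<kappa>(1) unfolding \<rho>_def by simp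
  qed blast
  have cD: "countable D"
  proof (rule countable_disjoint_family[OF D(2)])
    fix x assume "x \<in> D"
    then have "x \<in> \<Omega>" using D(1) by auto
    then show "0 < measure \<nu> (ball x (\<rho> x / 5))" using \<rho>_pos closure_subset by (intro ball_pos) auto
  qed simp
  show ?thesis
  proof (rule that[OF cD D(1)])
    show "\<exists>z\<in>D. x \<in> ball z (\<rho> z)" if x: "x \<in> \<Omega>" for x
    proof -
      obtain y where "y \<in> D" "ball x (\<rho> x / 5) \<subseteq> ball y (5 * (\<rho> y / 5))" using D(3)[OF x] by blast
      moreover have "x \<in> ball x (\<rho> x / 5)" using \<rho>_pos[OF x] by simp
      ultimately have "x \<in> ball y (5 * (\<rho> y / 5))" by blast
      then show ?thesis using \<open>y \<in> D\<close> by (intro bexI[of _ y]) auto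
    qed
    fix x
    define Z where "Z = {z\<in>D. x \<in> ball z (\<delta> z / 2)}"
    define N where "N = dbl (25 / \<kappa>)"
    have card: "real (card F) \<le> N" if F: "finite F" "F \<subseteq> Z" for F
    proof (cases "F = {}")
      case True
      then show ?thesis using dbl_ge_1[of "25 / \<kappa>"] unfolding N_def by simp
    next
      case False
      have zx: "z \<in> \<Omega>" "dist z x < \<delta> z / 2" "\<delta> z \<le> 2 * \<delta> x" "2 * \<delta> x \<le> 3 * \<delta> z" "0 < \<delta> z" if "z \<in> F" for z
      proof -
        show z: "z \<in> \<Omega>" "dist z x < \<delta> z / 2" using that F(2) D(1) unfolding Z_def by auto
        then show "\<delta> z \<le> 2 * \<delta> x" "2 * \<delta> x \<le> 3 * \<delta> z" using \<delta>_lip[of z x] by auto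
        show "0 < \<delta> z" by (rule \<delta>_pos[OF z(1)])
      qed
      obtain z0 where z0: "z0 \<in> F" using False by auto
      have xd: "0 < \<delta> x" using zx(3,5)[OF z0] by simp
      have "x \<in> \<Omega>" using cball_dom[of "\<delta> z0 / 2" z0] zx(2,5)[OF z0] by auto
      then have xc: "x \<in> closure \<Omega>" using closure_subset by auto
      define m where "m = measure \<nu> (ball x (3 * \<delta> x))"
      have m: "0 < m" unfolding m_def using xd by (intro ball_pos xc) simp
      have low: "m / N \<le> measure \<nu> (ball z (\<rho> z / 5))" if z: "z \<in> F" for z
      proof -
        have "m \<le> measure \<nu> (ball z (25 / \<kappa> * (\<rho> z / 5)))"
          unfolding m_def
        proof (intro finite_measure_mono subsetI)
          fix y assume "y \<in> ball x (3 * \<delta> x)"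
          then have "dist z y < 5 * \<delta> z" using zx[OF z] dist_triangle[of z y x] by simp
          moreover have "25 / \<kappa> * (\<rho> z / 5) = 5 * \<delta> z" unfolding \<rho>_def using \<kappa>(1) by simp
          ultimately show "y \<in> ball z (25 / \<kappa> * (\<rho> z / 5))" by simp
        qed simp
        also have "\<dots> \<le> N * measure \<nu> (ball z (\<rho> z / 5))"
          unfolding N_def using zx(1)[OF z] \<rho>_pos closure_subset by (intro ball_dbl) auto
        finally show ?thesis using dbl_ge_1[of "25 / \<kappa>"] unfolding N_def by (simp add: divide_le_eq mult.commute)
      qed
      have "real (card F) * (m / N) \<le> (\<Sum>z\<in>F. measure \<nu> (ball z (\<rho> z / 5)))"
        using sum_bounded_below[OF low, of F] by simp
      also have "\<dots> = measure \<nu> (\<Union>z\<in>F. ball z (\<rho> z / 5))"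
        using F D(2) unfolding Z_def by (intro finite_measure_finite_Union[symmetric]) (auto intro: disjoint_family_on_mono)
      also have "\<dots> \<le> m"
        unfolding m_def
      proof (intro finite_measure_mono UN_least subsetI)
        fix z y assume z: "z \<in> F" and y: "y \<in> ball z (\<rho> z / 5)"
        have "dist z y < \<delta> z" using y big_ball(2)[of z] zx(5)[OF z] by simp
        then show "y \<in> ball x (3 * \<delta> x)" using dist_triangle[of x y z] zx[OF z] by (simp add: dist_commute)
      qed simp
      finally have "real (card F) * (m / N) \<le> m" .
      then show ?thesis using m dbl_ge_1[of "25 / \<kappa>"] unfolding N_def by (simp add: field_simps)
    qed
    have "finite Z"
    proof (rule ccontr)
      assume "infinite Z"
      then obtain F where "finite F" "card F = nat \<lceil>N\<rceil> + 1" "F \<subseteq> Z" using infinite_arbitrarily_large by blast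
      then show False using card[of F] by linarith
    qed
    then have "emeasure (count_space D) Z = of_nat (card Z)"
      unfolding Z_def by (subst emeasure_count_space_finite) auto
    also have "\<dots> \<le> ennreal N" using ennreal_leI[OF card[OF \<open>finite Z\<close> order_refl]] unfolding ennreal_of_nat_eq_real_of_nat .
    finally show "emeasure (count_space D) {z\<in>D. x \<in> ball z (\<delta> z / 2)} \<le> ennreal (dbl (25 / \<kappa>))"
      unfolding Z_def N_def .
  qed
qed

end

lemma powr_add_le:
  fixes a b p :: real
  assumes "0 < p" "0 \<le> a" "0 \<le> b"
  shows "(a + b) powr p \<le> 2 powr p * (a powr p + b powr p)"
proof -
  have "(a + b) powr p \<le> (2 * max a b) powr p" using assms by (intro powr_mono2) auto
  also have "\<dots> = 2 powr p * max a b powr p" by (rule powr_mult)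
  also have "max a b powr p \<le> a powr p + b powr p" by (auto simp: max_def)
  finally show ?thesis by simp
qed

lemma nn_integral_powr_triangle:
  assumes p: "0 < p" and [measurable]: "f \<in> borel_measurable N" "g \<in> borel_measurable N" "A \<in> sets N"
    and h: "AE y in N. y \<in> A \<longrightarrow> \<bar>h y\<bar> \<le> \<bar>f y\<bar> + \<bar>g y :: real\<bar>"
  shows "(\<integral>\<^sup>+y\<in>A. ennreal (\<bar>h y\<bar> powr p) \<partial>N) \<le> ennreal (2 powr p) *
    ((\<integral>\<^sup>+y\<in>A. ennreal (\<bar>f y\<bar> powr p) \<partial>N) + (\<integral>\<^sup>+y\<in>A. ennreal (\<bar>g y\<bar> powr p) \<partial>N))"
proof -
  have "(\<integral>\<^sup>+y\<in>A. ennreal (\<bar>h y\<bar> powr p) \<partial>N) \<le>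
    (\<integral>\<^sup>+y. ennreal (2 powr p) * (ennreal (\<bar>f y\<bar> powr p) * indicator A y + ennreal (\<bar>g y\<bar> powr p) * indicator A y) \<partial>N)"
  proof (rule nn_integral_mono_AE)
    show "AE y in N. ennreal (\<bar>h y\<bar> powr p) * indicator A y \<le>
       ennreal (2 powr p) * (ennreal (\<bar>f y\<bar> powr p) * indicator A y + ennreal (\<bar>g y\<bar> powr p) * indicator A y)"
      using h
    proof eventually_elim
      case (elim y)
      show ?case
      proof (cases "y \<in> A")
        case True
        then have "\<bar>h y\<bar> powr p \<le> (\<bar>f y\<bar> + \<bar>g y\<bar>) powr p" using elim p by (intro powr_mono2) auto
        also have "\<dots> \<le> 2 powr p * (\<bar>f y\<bar> powr p + \<bar>g y\<bar> powr p)" by (rule powr_add_le[OF p]) auto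
        finally have "ennreal (\<bar>h y\<bar> powr p) \<le> ennreal (2 powr p * (\<bar>f y\<bar> powr p + \<bar>g y\<bar> powr p))" by (rule ennreal_leI)
        then show ?thesis using True by (simp add: ennreal_mult)
      qed simp
    qed
  qed
  also have "\<dots> = ennreal (2 powr p) *
    ((\<integral>\<^sup>+y\<in>A. ennreal (\<bar>f y\<bar> powr p) \<partial>N) + (\<integral>\<^sup>+y\<in>A. ennreal (\<bar>g y\<bar> powr p) \<partial>N))"
    by (simp add: nn_integral_cmult nn_integral_add)
  finally show ?thesis .
qed

lemmas (in doubling_domain) two_powr_integral = nn_integral_powr_triangle[OF order_less_trans[OF zero_less_one pp(1)], where N = \<nu>]

section \<open>Energy of the averages and their distance from the function\<close>

context whitney_domain begin

definition Capp :: real where "Capp = 2 powr pp * (dbl 4 * (1 / (2 * Cs)) powr pp + 1)"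

lemma Capp_nonneg: "0 \<le> Capp"
  unfolding Capp_def using dbl_ge_1[of 4] by (intro mult_nonneg_nonneg add_nonneg_nonneg) auto

text \<open>The lower limit of the energies on \<open>ball z (\<delta> z / 2)\<close> serves as the
  variation of \<open>u\<close> there. Its sum over the cover is finite by Fatou's lemma for the
  counting measure and the bounded overlap, without a variation measure.\<close>

lemma whitney_smoothing:
  fixes v :: "nat \<Rightarrow> 'a \<Rightarrow> real"
  assumes lp: "\<And>i. level_poincare \<nu> \<Omega> Cd Q cm (G i) (v i) K L"
    and u: "integrable \<nu> u" and tot: "\<And>i. emeasure (G i) UNIV \<le> ennreal M1"
    and conv: "\<And>z r. z \<in> \<Omega> \<Longrightarrow> 0 < r \<Longrightarrow> cball z r \<subseteq> \<Omega> \<Longrightarrow> (\<lambda>i. \<integral>\<^sup>+y\<in>ball z r. ennreal \<bar>v i y - u y\<bar> \<partial>\<nu>) \<longlonglongrightarrow> 0"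
  obtains D Lc where "countable D" "D \<subseteq> \<Omega>" "\<And>x. x \<in> \<Omega> \<Longrightarrow> \<exists>z\<in>D. x \<in> ball z (\<rho> z)" "\<And>z. 0 \<le> Lc z"
    "\<And>z x x'. z \<in> D \<Longrightarrow> x \<in> ball z (\<rho> z) \<Longrightarrow> x' \<in> ball z (\<rho> z) \<Longrightarrow> \<bar>smooth u x - smooth u x'\<bar> \<le> Lc z * dist x x'"
    "(\<integral>\<^sup>+z. ennreal (Lc z * measure \<nu> (ball z (\<rho> z))) \<partial>count_space D) < \<infinity>"
    "\<And>z. z \<in> D \<Longrightarrow> \<exists>c. (\<forall>y\<in>ball z (\<rho> z). \<bar>smooth u y - c\<bar> \<le> \<rho> z * Lc z) \<and>
       (\<integral>\<^sup>+y\<in>ball z (\<rho> z). ennreal (\<bar>u y - c\<bar> powr pp) \<partial>\<nu>) \<le>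
       ennreal (dbl 4 * (1 / (2 * Cs)) powr pp * (\<rho> z * Lc z) powr pp * measure \<nu> (ball z (\<rho> z)))"
proof -
  obtain D where D: "countable D" "D \<subseteq> \<Omega>" "\<And>x. x \<in> \<Omega> \<Longrightarrow> \<exists>z\<in>D. x \<in> ball z (\<rho> z)"
    and overlap: "\<And>x. emeasure (count_space D) {z\<in>D. x \<in> ball z (\<delta> z / 2)} \<le> ennreal (dbl (25 / \<kappa>))"
    by (rule whitney_cover) auto
  define N where "N = dbl (25 / \<kappa>)"
  define a where "a z = liminf (\<lambda>i. emeasure (G i) (ball z (\<delta> z / 2)))" for z
  have setsG: "sets (G i) = sets \<nu>" for i by (rule level_poincare.sets_G[OF lp])
  have atot: "(\<integral>\<^sup>+z. a z \<partial>count_space D) \<le> ennreal N * ennreal M1"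
  proof -
    have "(\<integral>\<^sup>+z. a z \<partial>count_space D) \<le> liminf (\<lambda>i. \<integral>\<^sup>+z. emeasure (G i) (ball z (\<delta> z / 2)) \<partial>count_space D)"
      unfolding a_def by (rule nn_integral_liminf) simp
    also have "\<dots> \<le> liminf (\<lambda>i. ennreal N * ennreal M1)"
    proof (rule Liminf_mono, rule always_eventually, rule allI)
      fix i
      have "(\<integral>\<^sup>+z. emeasure (G i) (ball z (\<delta> z / 2)) \<partial>count_space D) =
         (\<integral>\<^sup>+z. \<integral>\<^sup>+y. indicator (ball z (\<delta> z / 2)) y \<partial>G i \<partial>count_space D)"
        using setsG by (intro nn_integral_cong) (simp add: nn_integral_indicator)
      also have "\<dots> = (\<integral>\<^sup>+y. \<integral>\<^sup>+z. indicator (ball z (\<delta> z / 2)) y \<partial>count_space D \<partial>G i)"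
        by (rule nn_integral_count_space_nn_integral[symmetric, OF D(1)]) (intro borel_measurable_indicator, simp add: setsG)
      also have "\<dots> \<le> (\<integral>\<^sup>+y. ennreal N \<partial>G i)"
      proof (rule nn_integral_mono)
        fix y
        have "(\<integral>\<^sup>+z. indicator (ball z (\<delta> z / 2)) y \<partial>count_space D) = (\<integral>\<^sup>+z. indicator {z\<in>D. y \<in> ball z (\<delta> z / 2)} z \<partial>count_space D)"
          by (intro nn_integral_cong) (auto simp: indicator_def)
        also have "\<dots> = emeasure (count_space D) {z\<in>D. y \<in> ball z (\<delta> z / 2)}"
          by (rule nn_integral_indicator) auto
        also have "\<dots> \<le> ennreal N" unfolding N_def by (rule overlap)
        finally show "(\<integral>\<^sup>+z. indicator (ball z (\<delta> z / 2)) y \<partial>count_space D) \<le> ennreal N" .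
      qed
      also have "\<dots> = ennreal N * emeasure (G i) UNIV"
        using sets_eq_imp_space_eq[OF setsG[of i]] by (simp add: space_UNIV)
      also have "\<dots> \<le> ennreal N * ennreal M1" using tot by (intro mult_left_mono) auto
      finally show "(\<integral>\<^sup>+z. emeasure (G i) (ball z (\<delta> z / 2)) \<partial>count_space D) \<le> ennreal N * ennreal M1" .
    qed
    finally show ?thesis by (simp add: Liminf_const)
  qed
  have afin: "a z < \<infinity>" for z
  proof -
    have "a z \<le> liminf (\<lambda>i. ennreal M1)"
      unfolding a_def
    proof (rule Liminf_mono, rule always_eventually, rule allI)
      fix i
      have "emeasure (G i) (ball z (\<delta> z / 2)) \<le> emeasure (G i) UNIV"
        using setsG[of i] open_sets[of UNIV] by (intro emeasure_mono) auto
      then show "emeasure (G i) (ball z (\<delta> z / 2)) \<le> ennreal M1" using tot[of i] by simp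
    qed
    then have "a z \<le> ennreal M1" by (simp add: Liminf_const)
    then show ?thesis by (rule order_le_less_trans) simp
  qed
  define \<alpha> where "\<alpha> z = enn2real (a z)" for z
  have \<alpha>: "a z = ennreal (\<alpha> z)" "0 \<le> \<alpha> z" for z using afin[of z] unfolding \<alpha>_def by auto
  define m4 where "m4 z = measure \<nu> (ball z (4 * \<rho> z))" for z
  define Co where "Co = Cosc K L"
  have Co: "0 < Co" unfolding Co_def Cosc_def using pp(1) level_poincare.Ciso_pos[OF lp] by simp
  \<comment> \<open>The L1 oscillation on \<open>ball z (4 * \<rho> z)\<close> is at most
    \<open>8 * Co * \<rho> z * \<alpha> z\<close>: a factor 4 from the radius and 2 from
    \<open>L1_from_Lp\<close>. By \<open>smooth_lip\<close> it is divided by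
    \<open>\<rho> z * m4 z\<close> and multiplied by \<open>Cs\<close>.\<close>
  define Lc where "Lc z = Cs * (8 * Co * \<alpha> z) / m4 z" for z
  have Lc0: "0 \<le> Lc z" for z unfolding Lc_def m4_def using Cs Co \<alpha> by simp
  have zprop: "0 < \<rho> z" "z \<in> closure \<Omega>" "0 < m4 z" "m4 z \<le> dbl 4 * measure \<nu> (ball z (\<rho> z))" if z: "z \<in> D" for z
  proof -
    show r: "0 < \<rho> z" using \<rho>_pos z D(2) by auto
    show zc: "z \<in> closure \<Omega>" using z D(2) closure_subset by auto
    show "0 < m4 z" unfolding m4_def using r by (intro ball_pos zc) simp
    show "m4 z \<le> dbl 4 * measure \<nu> (ball z (\<rho> z))" unfolding m4_def by (rule ball_dbl[OF zc r])
  qed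
  have osc: "\<exists>c. (\<integral>\<^sup>+y\<in>ball z (4 * \<rho> z). ennreal (\<bar>u y - c\<bar> powr pp) \<partial>\<nu>) \<le> ennreal ((Co * (4 * \<rho> z) * \<alpha> z / m4 z) powr pp * m4 z)"
    if z: "z \<in> D" for z
    unfolding Co_def m4_def
  proof (rule ball_oscillation[OF lp zprop(2)[OF z] _ u])
    show "0 < 4 * \<rho> z" using zprop[OF z] by simp
    have "4 * \<rho> z < \<delta> z" using big_ball(2)[of z] zprop[OF z] by simp
    then show "(\<lambda>i. \<integral>\<^sup>+y\<in>ball z (4 * \<rho> z). ennreal \<bar>v i y - u y\<bar> \<partial>\<nu>) \<longlonglongrightarrow> 0"
      using zprop[OF z] D(2) z by (intro conv cball_dom) auto
    have eq: "3 * L * (4 * \<rho> z) = \<delta> z / 2" using big_ball(1)[of z] by simp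
    show "liminf (\<lambda>i. emeasure (G i) (ball z (3 * L * (4 * \<rho> z)))) = ennreal (\<alpha> z)"
      unfolding eq using \<alpha>(1)[of z] unfolding a_def .
  qed (rule \<alpha>)
  have um[measurable]: "u \<in> borel_measurable \<nu>" using u by simp
  have A1: "(\<integral>\<^sup>+y\<in>ball z (4 * \<rho> z). ennreal \<bar>u y - c\<bar> \<partial>\<nu>) \<le> ennreal (8 * Co * \<rho> z * \<alpha> z)"
    if z: "z \<in> D" and c: "(\<integral>\<^sup>+y\<in>ball z (4 * \<rho> z). ennreal (\<bar>u y - c\<bar> powr pp) \<partial>\<nu>) \<le> ennreal ((Co * (4 * \<rho> z) * \<alpha> z / m4 z) powr pp * m4 z)" for z c
  proof -
    have "(\<integral>\<^sup>+y\<in>ball z (4 * \<rho> z). ennreal \<bar>u y - c\<bar> \<partial>\<nu>) \<le> ennreal (2 * (Co * (4 * \<rho> z) * \<alpha> z / m4 z) * measure \<nu> (ball z (4 * \<rho> z)))"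
      using c zprop[OF z] Co \<alpha>(2)[of z] unfolding m4_def by (intro L1_from_Lp) auto
    also have "2 * (Co * (4 * \<rho> z) * \<alpha> z / m4 z) * measure \<nu> (ball z (4 * \<rho> z)) = 8 * Co * \<rho> z * \<alpha> z"
      using zprop[OF z] unfolding m4_def by simp
    finally show ?thesis .
  qed
  have Aeq: "Cs * (8 * Co * \<rho> z * \<alpha> z) / m4 z = \<rho> z * Lc z" for z unfolding Lc_def by simp
  show ?thesis
  proof (rule that[OF D Lc0])
    fix z x x' assume z: "z \<in> D" and x: "x \<in> ball z (\<rho> z)" "x' \<in> ball z (\<rho> z)"
    obtain c where c: "(\<integral>\<^sup>+y\<in>ball z (4 * \<rho> z). ennreal (\<bar>u y - c\<bar> powr pp) \<partial>\<nu>) \<le> ennreal ((Co * (4 * \<rho> z) * \<alpha> z / m4 z) powr pp * m4 z)"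
      using osc[OF z] by blast
    have "\<bar>smooth u x - smooth u x'\<bar> \<le> Cs * (8 * Co * \<rho> z * \<alpha> z) / (\<rho> z * m4 z) * dist x x'"
      unfolding m4_def using z D(2) Co \<alpha>(2)[of z] zprop[OF z] by (intro smooth_lip[OF _ u A1[OF z c] _ x]) auto
    also have "Cs * (8 * Co * \<rho> z * \<alpha> z) / (\<rho> z * m4 z) = Lc z" unfolding Lc_def using zprop[OF z] by simp
    finally show "\<bar>smooth u x - smooth u x'\<bar> \<le> Lc z * dist x x'" .
  next
    have "(\<integral>\<^sup>+z. ennreal (Lc z * measure \<nu> (ball z (\<rho> z))) \<partial>count_space D) \<le> (\<integral>\<^sup>+z. ennreal (8 * Cs * Co) * a z \<partial>count_space D)"
    proof (rule nn_integral_mono)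
      fix z assume "z \<in> space (count_space D)"
      then have z: "z \<in> D" by simp
      have "Lc z * measure \<nu> (ball z (\<rho> z)) \<le> Lc z * m4 z"
        unfolding m4_def using Lc0 zprop[OF z] by (intro mult_left_mono finite_measure_mono subset_ball) auto
      also have "\<dots> = 8 * Cs * Co * \<alpha> z" unfolding Lc_def using zprop[OF z] by simp
      finally have "ennreal (Lc z * measure \<nu> (ball z (\<rho> z))) \<le> ennreal (8 * Cs * Co * \<alpha> z)" by (rule ennreal_leI)
      also have "\<dots> = ennreal (8 * Cs * Co) * a z" unfolding \<alpha>(1) using Cs Co \<alpha>(2)[of z] by (intro ennreal_mult) auto
      finally show "ennreal (Lc z * measure \<nu> (ball z (\<rho> z))) \<le> ennreal (8 * Cs * Co) * a z" .
    qed
    also have "\<dots> = ennreal (8 * Cs * Co) * (\<integral>\<^sup>+z. a z \<partial>count_space D)" by (rule nn_integral_cmult) simp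
    also have "\<dots> \<le> ennreal (8 * Cs * Co) * (ennreal N * ennreal M1)" by (intro mult_left_mono atot) simp
    also have "\<dots> < \<infinity>" by (simp add: ennreal_mult_less_top)
    finally show "(\<integral>\<^sup>+z. ennreal (Lc z * measure \<nu> (ball z (\<rho> z))) \<partial>count_space D) < \<infinity>" .
  next
    fix z assume z: "z \<in> D"
    obtain c where c: "(\<integral>\<^sup>+y\<in>ball z (4 * \<rho> z). ennreal (\<bar>u y - c\<bar> powr pp) \<partial>\<nu>) \<le> ennreal ((Co * (4 * \<rho> z) * \<alpha> z / m4 z) powr pp * m4 z)"
      using osc[OF z] by blast
    have "\<bar>smooth u y - c\<bar> \<le> \<rho> z * Lc z" if y: "y \<in> ball z (\<rho> z)" for y
      unfolding Aeq[symmetric] m4_def using z D(2) Co \<alpha>(2)[of z] zprop[OF z]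
      by (intro smooth_near[OF _ u A1[OF z c] _ y]) auto
    moreover have "(\<integral>\<^sup>+y\<in>ball z (\<rho> z). ennreal (\<bar>u y - c\<bar> powr pp) \<partial>\<nu>) \<le>
       ennreal (dbl 4 * (1 / (2 * Cs)) powr pp * (\<rho> z * Lc z) powr pp * measure \<nu> (ball z (\<rho> z)))"
    proof -
      have "(\<integral>\<^sup>+y\<in>ball z (\<rho> z). ennreal (\<bar>u y - c\<bar> powr pp) \<partial>\<nu>) \<le> (\<integral>\<^sup>+y\<in>ball z (4 * \<rho> z). ennreal (\<bar>u y - c\<bar> powr pp) \<partial>\<nu>)"
        using zprop[OF z] by (intro nn_integral_mono) (auto simp: indicator_def)
      also note c
      also have "Co * (4 * \<rho> z) * \<alpha> z / m4 z = (1 / (2 * Cs)) * (\<rho> z * Lc z)" unfolding Lc_def using Cs by simp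
      also have "((1 / (2 * Cs)) * (\<rho> z * Lc z)) powr pp = (1 / (2 * Cs)) powr pp * (\<rho> z * Lc z) powr pp" by (rule powr_mult)
      also have "ennreal ((1 / (2 * Cs)) powr pp * (\<rho> z * Lc z) powr pp * m4 z) \<le>
         ennreal ((1 / (2 * Cs)) powr pp * (\<rho> z * Lc z) powr pp * (dbl 4 * measure \<nu> (ball z (\<rho> z))))"
        using zprop[OF z] by (intro ennreal_leI mult_left_mono) auto
      finally show ?thesis by (simp add: mult_ac)
    qed
    ultimately show "\<exists>c. (\<forall>y\<in>ball z (\<rho> z). \<bar>smooth u y - c\<bar> \<le> \<rho> z * Lc z) \<and>
       (\<integral>\<^sup>+y\<in>ball z (\<rho> z). ennreal (\<bar>u y - c\<bar> powr pp) \<partial>\<nu>) \<le>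
       ennreal (dbl 4 * (1 / (2 * Cs)) powr pp * (\<rho> z * Lc z) powr pp * measure \<nu> (ball z (\<rho> z)))" by blast
  qed
qed

text \<open>Whitney balls meeting \<open>ball x r\<close> are small and lie in
  \<open>ball x (3 * r)\<close>. On each of them the error is a power of
  \<open>\<rho> z * Lc z\<close>; the mass bound trades \<open>\<rho> z powr pp\<close> for a power
  of the mass, because \<open>Q * (1 - pp) = - pp\<close>. What remains is linear in the energy
  \<open>l z\<close>, so the errors can be summed.\<close>

lemma near_boundary:
  assumes D: "countable D" "D \<subseteq> \<Omega>" "\<And>x. x \<in> \<Omega> \<Longrightarrow> \<exists>z\<in>D. x \<in> ball z (\<rho> z)" and Lc0: "\<And>z. 0 \<le> Lc z"
    and app: "\<And>z. z \<in> D \<Longrightarrow> (\<integral>\<^sup>+y\<in>ball z (\<rho> z). ennreal (\<bar>f y\<bar> powr pp) \<partial>\<nu>) \<le> ennreal (Ca * (\<rho> z * Lc z) powr pp * measure \<nu> (ball z (\<rho> z)))"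
    and Ca: "0 \<le> Ca" and f[measurable]: "f \<in> borel_measurable \<nu>" and GW: "finite_measure GW" "sets GW = sets \<nu>"
    and GWlow: "\<And>A. A \<in> sets \<nu> \<Longrightarrow> (\<integral>\<^sup>+z. ennreal (Lc z * measure \<nu> (A \<inter> ball z (\<rho> z))) \<partial>count_space D) \<le> emeasure GW A"
    and x: "x \<in> frontier \<Omega>" and r: "0 < r"
  shows "avg f x r \<le> ennreal (Ca * cm powr (1 - pp) * 2 powr pp * (r * measure GW (ball x (3 * r)) / measure \<nu> (ball x r)) powr pp)"
proof -
  interpret GW: finite_measure GW by fact
  have xc: "x \<in> closure \<Omega>" by (rule frontier_closure[OF x])
  have xn: "x \<notin> \<Omega>" using x open_dom by (simp add: frontier_def interior_open)
  define m where "m = measure \<nu> (ball x r)"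
  have m: "0 < m" unfolding m_def by (rule ball_pos[OF xc r])
  define s where "s = measure GW (ball x (3 * r))"
  have s0: "0 \<le> s" unfolding s_def by simp
  define Z where "Z = {z\<in>D. ball z (\<rho> z) \<inter> ball x r \<noteq> {}}"
  define l where "l z = Lc z * measure \<nu> (ball z (\<rho> z))" for z
  have l0: "0 \<le> l z" for z unfolding l_def using Lc0 by simp
  have zp: "z \<in> closure \<Omega>" "0 < \<rho> z" "\<rho> z \<le> 2 * r" "z \<in> ball x (2 * r)" "ball z (\<rho> z) \<subseteq> ball x (3 * r)" if z: "z \<in> Z" for z
  proof -
    have zD: "z \<in> D" using z unfolding Z_def by simp
    show "z \<in> closure \<Omega>" using zD D(2) closure_subset by auto
    show r0: "0 < \<rho> z" using zD D(2) \<rho>_pos by auto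
    obtain y where y: "dist z y < \<rho> z" "dist x y < r" using z unfolding Z_def by auto
    have d: "dist x z < \<rho> z + r" using y dist_triangle[of x z y] by (simp add: dist_commute)
    \<comment> \<open>As \<open>x\<close> lies outside \<Omega>, its distance from \<open>z\<close>
      is at least \<open>\<delta> z\<close>. Since this distance is also below
      \<open>\<rho> z + r\<close>, the radius \<open>\<rho> z\<close> is below
      \<open>r / 23\<close>.\<close>
    have "24 * \<rho> z \<le> dist z x" using big_ball(2)[of z] \<delta>_le[OF xn, of z] by simp
    then have small: "23 * \<rho> z < r" using d by (simp add: dist_commute)
    then show "\<rho> z \<le> 2 * r" "z \<in> ball x (2 * r)" using r0 d by auto
    show "ball z (\<rho> z) \<subseteq> ball x (3 * r)"
    proof
      fix w assume "w \<in> ball z (\<rho> z)"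
      then show "w \<in> ball x (3 * r)" using dist_triangle[of x w z] d small r0 by simp
    qed
  qed
  have cZ: "countable Z" using D(1) unfolding Z_def by (rule countable_subset[rotated]) auto
  have suml: "(\<integral>\<^sup>+z. ennreal (l z) \<partial>count_space Z) \<le> ennreal s"
  proof -
    have "(\<integral>\<^sup>+z. ennreal (l z) \<partial>count_space Z) = (\<integral>\<^sup>+z. ennreal (Lc z * measure \<nu> (ball x (3 * r) \<inter> ball z (\<rho> z))) \<partial>count_space Z)"
    proof (rule nn_integral_cong)
      fix z assume "z \<in> space (count_space Z)"
      then have "ball x (3 * r) \<inter> ball z (\<rho> z) = ball z (\<rho> z)" using zp(5)[of z] by auto
      then show "ennreal (l z) = ennreal (Lc z * measure \<nu> (ball x (3 * r) \<inter> ball z (\<rho> z)))" unfolding l_def by simp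
    qed
    also have "\<dots> = (\<integral>\<^sup>+z. ennreal (Lc z * measure \<nu> (ball x (3 * r) \<inter> ball z (\<rho> z))) * indicator Z z \<partial>count_space UNIV)"
      by (simp add: nn_integral_count_space_indicator)
    also have "\<dots> \<le> (\<integral>\<^sup>+z. ennreal (Lc z * measure \<nu> (ball x (3 * r) \<inter> ball z (\<rho> z))) * indicator D z \<partial>count_space UNIV)"
      by (intro nn_integral_mono) (auto simp: indicator_def Z_def)
    also have "\<dots> = (\<integral>\<^sup>+z. ennreal (Lc z * measure \<nu> (ball x (3 * r) \<inter> ball z (\<rho> z))) \<partial>count_space D)"
      by (simp add: nn_integral_count_space_indicator)
    also have "\<dots> \<le> emeasure GW (ball x (3 * r))" by (rule GWlow) simp
    finally show ?thesis unfolding s_def by (simp add: GW.emeasure_eq_measure)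
  qed
  have ls: "l z \<le> s" if z: "z \<in> Z" for z
  proof -
    have "ennreal (l z) \<le> (\<integral>\<^sup>+z. ennreal (l z) \<partial>count_space Z)" by (rule nn_integral_ge_point[OF z])
    also note suml
    finally show ?thesis using s0 by (simp add: ennreal_le_iff)
  qed
  define k where "k = Ca * cm powr (1 - pp) * (2 * r) powr pp * m powr (1 - pp) * s powr (pp - 1)"
  have k0: "0 \<le> k" unfolding k_def using Ca by simp
  have tbound: "Ca * (\<rho> z * Lc z) powr pp * measure \<nu> (ball z (\<rho> z)) \<le> k * l z" if z: "z \<in> Z" for z
  proof -
    define b where "b = measure \<nu> (ball z (\<rho> z))"
    note zz = zp[OF z]
    have b: "0 < b" unfolding b_def by (rule ball_pos[OF zz(1,2)])
    have "cm * (\<rho> z / (2 * r)) powr Q * m \<le> cm * (\<rho> z / (2 * r)) powr Q * measure \<nu> (ball x (2 * r))"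
      unfolding m_def using cm_pos r by (intro mult_left_mono finite_measure_mono subset_ball) auto
    also have "\<dots> \<le> b" unfolding b_def by (rule mass_bound[OF xc zz(1,2,3,4)])
    finally have low: "cm * (\<rho> z / (2 * r)) powr Q * m \<le> b" .
    have pos: "0 < cm * (\<rho> z / (2 * r)) powr Q * m" using cm_pos zz r m by simp
    have "b powr (1 - pp) \<le> (cm * (\<rho> z / (2 * r)) powr Q * m) powr (1 - pp)"
      using low pos pp(1) by (intro powr_mono2') auto
    also have "\<dots> = cm powr (1 - pp) * ((\<rho> z / (2 * r)) powr Q) powr (1 - pp) * m powr (1 - pp)"
      by (simp only: powr_mult)
    also have "((\<rho> z / (2 * r)) powr Q) powr (1 - pp) = (\<rho> z / (2 * r)) powr (- pp)"
    proof -
      have "Q * (1 - pp) = - pp" using pp(4) Q_gt_1 by (simp add: field_simps)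
      then show ?thesis by (simp only: powr_powr)
    qed
    also have "(\<rho> z / (2 * r)) powr (- pp) = (2 * r) powr pp / \<rho> z powr pp"
      using zz r by (simp add: powr_minus powr_divide field_simps)
    finally have bb: "b powr (1 - pp) \<le> cm powr (1 - pp) * ((2 * r) powr pp / \<rho> z powr pp) * m powr (1 - pp)" .
    have "(\<rho> z * Lc z) powr pp * b = \<rho> z powr pp * (b powr (1 - pp) * (Lc z * b) powr pp)"
    proof -
      have "b powr (1 - pp) * (Lc z * b) powr pp = (b powr (1 - pp) * b powr pp) * Lc z powr pp"
        by (simp add: powr_mult)
      also have "b powr (1 - pp) * b powr pp = b" using b by (simp flip: powr_add)
      finally show ?thesis by (auto simp: powr_mult)
    qed
    also have "\<dots> \<le> \<rho> z powr pp * ((cm powr (1 - pp) * ((2 * r) powr pp / \<rho> z powr pp) * m powr (1 - pp)) * (s powr (pp - 1) * l z))"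
    proof (intro mult_left_mono mult_mono bb)
      \<comment> \<open>One power of \<open>l z\<close> is kept for the summation; the remaining
        \<open>pp - 1\<close> powers are bounded by the total energy \<open>s\<close>.\<close>
      have "(Lc z * b) powr pp = l z powr (pp - 1) * l z powr 1"
        unfolding l_def b_def by (subst powr_add[symmetric]) simp
      also have "\<dots> \<le> s powr (pp - 1) * l z powr 1"
        using ls[OF z] l0[of z] pp(1) by (intro mult_right_mono powr_mono2) auto
      finally show "(Lc z * b) powr pp \<le> s powr (pp - 1) * l z" using l0[of z] by simp
    qed (use m r cm_pos in auto)
    also have "\<dots> = cm powr (1 - pp) * (2 * r) powr pp * m powr (1 - pp) * s powr (pp - 1) * l z"
      using zz by simp
    finally have "Ca * ((\<rho> z * Lc z) powr pp * b) \<le> Ca * (cm powr (1 - pp) * (2 * r) powr pp * m powr (1 - pp) * s powr (pp - 1) * l z)"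
      using Ca by (rule mult_left_mono)
    then show ?thesis unfolding k_def b_def by (simp add: mult_ac)
  qed
  have "(\<integral>\<^sup>+y\<in>ball x r. ennreal (\<bar>f y\<bar> powr pp) \<partial>\<nu>) \<le>
     (\<integral>\<^sup>+y. \<integral>\<^sup>+z. ennreal (\<bar>f y\<bar> powr pp) * indicator (ball z (\<rho> z)) y \<partial>count_space Z \<partial>\<nu>)"
  proof (rule nn_integral_mono_AE)
    show "AE y in \<nu>. ennreal (\<bar>f y\<bar> powr pp) * indicator (ball x r) y \<le>
      (\<integral>\<^sup>+z. ennreal (\<bar>f y\<bar> powr pp) * indicator (ball z (\<rho> z)) y \<partial>count_space Z)"
      using AE_dom
    proof eventually_elim
      case (elim y)
      show ?case
      proof (cases "y \<in> ball x r")
        case True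
        obtain z where z: "z \<in> D" "y \<in> ball z (\<rho> z)" using D(3)[OF elim] by blast
        then have "z \<in> Z" unfolding Z_def using True by blast
        from nn_integral_ge_point[OF this, of "\<lambda>z. ennreal (\<bar>f y\<bar> powr pp) * indicator (ball z (\<rho> z)) y"]
        show ?thesis using z(2) True by simp
      qed simp
    qed
  qed
  also have "\<dots> = (\<integral>\<^sup>+z. \<integral>\<^sup>+y. ennreal (\<bar>f y\<bar> powr pp) * indicator (ball z (\<rho> z)) y \<partial>\<nu> \<partial>count_space Z)"
    by (rule nn_integral_count_space_nn_integral[OF cZ]) measurable
  also have "\<dots> \<le> (\<integral>\<^sup>+z. ennreal k * ennreal (l z) \<partial>count_space Z)"
  proof (rule nn_integral_mono)
    fix z assume "z \<in> space (count_space Z)"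
    then have z: "z \<in> Z" by simp
    then have "z \<in> D" unfolding Z_def by simp
    from app[OF this] have "(\<integral>\<^sup>+y\<in>ball z (\<rho> z). ennreal (\<bar>f y\<bar> powr pp) \<partial>\<nu>) \<le> ennreal (k * l z)"
      using ennreal_leI[OF tbound[OF z]] by (rule order_trans)
    then show "(\<integral>\<^sup>+y\<in>ball z (\<rho> z). ennreal (\<bar>f y\<bar> powr pp) \<partial>\<nu>) \<le> ennreal k * ennreal (l z)"
      using k0 l0 by (simp add: ennreal_mult)
  qed
  also have "\<dots> = ennreal k * (\<integral>\<^sup>+z. ennreal (l z) \<partial>count_space Z)" by (rule nn_integral_cmult) simp
  also have "\<dots> \<le> ennreal k * ennreal s" by (intro mult_left_mono suml) simp
  also have "\<dots> = ennreal (k * s)" using k0 s0 by (intro ennreal_mult[symmetric])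
  finally have "avg f x r \<le> ennreal (k * s) / ennreal m"
    unfolding avg_def m_def emeasure_eq_measure by (rule divide_right_mono_ennreal)
  also have "\<dots> = ennreal (k * s / m)" using k0 s0 m by (intro divide_ennreal) auto
  also have "k * s / m = Ca * cm powr (1 - pp) * 2 powr pp * (r * s / m) powr pp"
  proof -
    have "s powr (pp - 1) * s = s powr pp"
    proof -
      have "s powr (pp - 1) * s powr 1 = s powr pp" by (subst powr_add[symmetric]) simp
      then show ?thesis using s0 by simp
    qed
    moreover have "m powr (1 - pp) / m = 1 / m powr pp" using m by (simp add: powr_diff)
    moreover have "(2 * r) powr pp = 2 powr pp * r powr pp" by (rule powr_mult)
    moreover have "(r * s / m) powr pp = r powr pp * s powr pp / m powr pp"
      using r s0 m by (simp add: powr_divide powr_mult)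
    moreover have "k * s / m = Ca * cm powr (1 - pp) * (2 * r) powr pp * (m powr (1 - pp) / m) * (s powr (pp - 1) * s)"
      unfolding k_def by simp
    ultimately show ?thesis by simp
  qed
  finally show ?thesis unfolding s_def m_def .
qed

lemma bv_trace:
  assumes D: "countable D" "D \<subseteq> \<Omega>" "\<And>x. x \<in> \<Omega> \<Longrightarrow> \<exists>z\<in>D. x \<in> ball z (\<rho> z)" and Lc0: "\<And>z. 0 \<le> Lc z"
    and near: "\<And>z. z \<in> D \<Longrightarrow> \<exists>c. (\<forall>y\<in>ball z (\<rho> z). \<bar>w y - c\<bar> \<le> \<rho> z * Lc z) \<and>
       (\<integral>\<^sup>+y\<in>ball z (\<rho> z). ennreal (\<bar>u y - c\<bar> powr pp) \<partial>\<nu>) \<le>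
       ennreal (dbl 4 * (1 / (2 * Cs)) powr pp * (\<rho> z * Lc z) powr pp * measure \<nu> (ball z (\<rho> z)))"
    and u[measurable]: "u \<in> borel_measurable \<nu>"
    and lp: "level_poincare \<nu> \<Omega> Cd Q cm GW w K L'" and GN: "emeasure GW (- \<Omega>) = 0"
    and GWlow: "\<And>A. A \<in> sets \<nu> \<Longrightarrow> (\<integral>\<^sup>+z. ennreal (Lc z * measure \<nu> (A \<inter> ball z (\<rho> z))) \<partial>count_space D) \<le> emeasure GW A"
  shows "null_set {x\<in>frontier \<Omega>. \<not> (\<exists>c. ((\<lambda>r. avg (\<lambda>y. u y - c) x r) \<longlongrightarrow> 0) (at_right 0))}"
proof -
  interpret W: level_poincare \<nu> \<Omega> Cd Q cm GW w K L' by fact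
  have wm[measurable]: "w \<in> borel_measurable \<nu>" by (rule W.v_meas)
  have app: "(\<integral>\<^sup>+y\<in>ball z (\<rho> z). ennreal (\<bar>u y - w y\<bar> powr pp) \<partial>\<nu>) \<le> ennreal (Capp * (\<rho> z * Lc z) powr pp * measure \<nu> (ball z (\<rho> z)))"
    if z: "z \<in> D" for z
  proof -
    obtain c where c: "\<forall>y\<in>ball z (\<rho> z). \<bar>w y - c\<bar> \<le> \<rho> z * Lc z"
      "(\<integral>\<^sup>+y\<in>ball z (\<rho> z). ennreal (\<bar>u y - c\<bar> powr pp) \<partial>\<nu>) \<le>
       ennreal (dbl 4 * (1 / (2 * Cs)) powr pp * (\<rho> z * Lc z) powr pp * measure \<nu> (ball z (\<rho> z)))"
      using near[OF z] by blast
    define b where "b = measure \<nu> (ball z (\<rho> z))"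
    define q where "q = (\<rho> z * Lc z) powr pp"
    have "(\<integral>\<^sup>+y\<in>ball z (\<rho> z). ennreal (\<bar>u y - w y\<bar> powr pp) \<partial>\<nu>) \<le> ennreal (2 powr pp) *
      ((\<integral>\<^sup>+y\<in>ball z (\<rho> z). ennreal (\<bar>u y - c\<bar> powr pp) \<partial>\<nu>) + (\<integral>\<^sup>+y\<in>ball z (\<rho> z). ennreal (\<bar>w y - c\<bar> powr pp) \<partial>\<nu>))"
      by (rule two_powr_integral) auto
    also have "\<dots> \<le> ennreal (2 powr pp) * (ennreal (dbl 4 * (1 / (2 * Cs)) powr pp * q * b) + ennreal (q * b))"
    proof (intro mult_left_mono add_mono)
      show "(\<integral>\<^sup>+y\<in>ball z (\<rho> z). ennreal (\<bar>u y - c\<bar> powr pp) \<partial>\<nu>) \<le> ennreal (dbl 4 * (1 / (2 * Cs)) powr pp * q * b)"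
        using c(2) unfolding q_def b_def .
      have "(\<integral>\<^sup>+y\<in>ball z (\<rho> z). ennreal (\<bar>w y - c\<bar> powr pp) \<partial>\<nu>) \<le> (\<integral>\<^sup>+y. ennreal q * indicator (ball z (\<rho> z)) y \<partial>\<nu>)"
        unfolding q_def using c(1) pp(1) by (intro nn_integral_mono) (auto simp: indicator_def intro!: ennreal_leI powr_mono2)
      also have "\<dots> = ennreal (q * b)"
        by (subst nn_integral_cmult_indicator) (auto simp: emeasure_eq_measure b_def q_def ennreal_mult)
      finally show "(\<integral>\<^sup>+y\<in>ball z (\<rho> z). ennreal (\<bar>w y - c\<bar> powr pp) \<partial>\<nu>) \<le> ennreal (q * b)" .
    qed auto
    also have "\<dots> = ennreal (Capp * q * b)"
    proof -
      have nn: "0 \<le> dbl 4 * (1 / (2 * Cs)) powr pp * q * b" "0 \<le> q * b"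
        unfolding q_def b_def using dbl_ge_1[of 4] by (auto intro!: mult_nonneg_nonneg)
      have "ennreal (2 powr pp) * (ennreal (dbl 4 * (1 / (2 * Cs)) powr pp * q * b) + ennreal (q * b)) =
        ennreal (2 powr pp * (dbl 4 * (1 / (2 * Cs)) powr pp * q * b + q * b))"
        using nn by (simp add: ennreal_mult ennreal_plus)
      then show ?thesis unfolding Capp_def by (simp add: algebra_simps)
    qed
    finally show ?thesis unfolding q_def b_def .
  qed
  define N1 where "N1 = {x\<in>frontier \<Omega>. \<not> (\<exists>c. ((\<lambda>r. avg (\<lambda>y. w y - c) x r) \<longlongrightarrow> 0) (at_right 0))}"
  define N2 where "N2 = {x\<in>frontier \<Omega>. \<not> ((\<lambda>r. r * measure GW (ball x (3 * r)) / measure \<nu> (ball x r)) \<longlongrightarrow> 0) (at_right 0)}"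
  have "null_set (N1 \<union> N2)"
    unfolding N1_def N2_def
    by (intro null_set_Un W.trace_exists frontier_density_0 GN W.G.finite_measure_axioms W.sets_G) simp
  moreover have "\<exists>c. ((\<lambda>r. avg (\<lambda>y. u y - c) x r) \<longlongrightarrow> 0) (at_right 0)" if xf: "x \<in> frontier \<Omega>" and xN: "x \<notin> N1 \<union> N2" for x
  proof -
    have dens: "((\<lambda>r. r * measure GW (ball x (3 * r)) / measure \<nu> (ball x r)) \<longlongrightarrow> 0) (at_right 0)"
      using xf xN unfolding N2_def by blast
    obtain c where c: "((\<lambda>r. avg (\<lambda>y. w y - c) x r) \<longlongrightarrow> 0) (at_right 0)"
      using xf xN unfolding N1_def by blast
    define q where "q r = Capp * cm powr (1 - pp) * 2 powr pp * (r * measure GW (ball x (3 * r)) / measure \<nu> (ball x r)) powr pp" for r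
    have pos: "\<forall>\<^sub>F r in at_right 0. (0::real) < r" by (simp add: eventually_at_right_less)
    have "(q \<longlongrightarrow> Capp * cm powr (1 - pp) * 2 powr pp * 0 powr pp) (at_right 0)"
      unfolding q_def
      by (intro tendsto_mult tendsto_const tendsto_powr2 dens) (use pp(1) pos in \<open>auto elim: eventually_mono\<close>)
    then have q: "((\<lambda>r. ennreal (q r)) \<longlongrightarrow> 0) (at_right 0)"
      using pp(1) by (intro tendsto_ennrealI[of q 0, simplified]) simp
    have bound: "\<forall>\<^sub>F r in at_right 0. avg (\<lambda>y. u y - c) x r \<le> ennreal (2 powr pp) * (ennreal (q r) + avg (\<lambda>y. w y - c) x r)"
      using pos
    proof eventually_elim
      case (elim r)
      have "(\<integral>\<^sup>+y\<in>ball x r. ennreal (\<bar>u y - c\<bar> powr pp) \<partial>\<nu>) \<le> ennreal (2 powr pp) *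
         ((\<integral>\<^sup>+y\<in>ball x r. ennreal (\<bar>u y - w y\<bar> powr pp) \<partial>\<nu>) + (\<integral>\<^sup>+y\<in>ball x r. ennreal (\<bar>w y - c\<bar> powr pp) \<partial>\<nu>))"
        by (rule two_powr_integral) auto
      then have "avg (\<lambda>y. u y - c) x r \<le> ennreal (2 powr pp) * ((\<integral>\<^sup>+y\<in>ball x r. ennreal (\<bar>u y - w y\<bar> powr pp) \<partial>\<nu>) + (\<integral>\<^sup>+y\<in>ball x r. ennreal (\<bar>w y - c\<bar> powr pp) \<partial>\<nu>)) / emeasure \<nu> (ball x r)"
        unfolding avg_def by (rule divide_right_mono_ennreal)
      also have "\<dots> = ennreal (2 powr pp) * (avg (\<lambda>y. u y - w y) x r + avg (\<lambda>y. w y - c) x r)"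
        unfolding avg_def by (simp add: divide_ennreal_def distrib_left distrib_right mult.assoc)
      also have "\<dots> \<le> ennreal (2 powr pp) * (ennreal (q r) + avg (\<lambda>y. w y - c) x r)"
        unfolding q_def
        by (intro mult_left_mono add_right_mono near_boundary[OF D Lc0 app Capp_nonneg _ W.G.finite_measure_axioms W.sets_G GWlow xf elim]) auto
      finally show ?case .
    qed
    have "((\<lambda>r. ennreal (2 powr pp) * (ennreal (q r) + avg (\<lambda>y. w y - c) x r)) \<longlongrightarrow> ennreal (2 powr pp) * (0 + 0)) (at_right 0)"
      by (intro ennreal_tendsto_cmult tendsto_add q c) simp
    then have lim: "((\<lambda>r. ennreal (2 powr pp) * (ennreal (q r) + avg (\<lambda>y. w y - c) x r)) \<longlongrightarrow> 0) (at_right 0)" by simp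
    have "((\<lambda>r. avg (\<lambda>y. u y - c) x r) \<longlongrightarrow> 0) (at_right 0)"
      by (rule tendsto_sandwich[OF _ bound tendsto_const lim]) simp
    then show ?thesis by blast
  qed
  then have "{x\<in>frontier \<Omega>. \<not> (\<exists>c. ((\<lambda>r. avg (\<lambda>y. u y - c) x r) \<longlongrightarrow> 0) (at_right 0))} \<subseteq> N1 \<union> N2" by blast
  then show ?thesis using \<open>null_set (N1 \<union> N2)\<close> by (rule null_set_mono)
qed

end

section \<open>Metric spaces with an outer measure\<close>

lemma caratheodory_facts:
  fixes \<mu> :: "'a::topological_space set \<Rightarrow> ennreal"
  assumes "borel_regular_outer_measure \<mu>"
  shows "sets borel \<subseteq> sets (caratheodory \<mu>)" "space (caratheodory \<mu>) = UNIV"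
    "\<And>A. A \<in> sets (caratheodory \<mu>) \<Longrightarrow> emeasure (caratheodory \<mu>) A = \<mu> A"
proof -
  interpret sigma_algebra UNIV "UNIV :: 'a set set" using sigma_algebra_Pow[of UNIV] by simp
  have oms: "outer_measure_space UNIV \<mu>" and bs: "sets borel \<subseteq> lambda_system UNIV UNIV \<mu>"
    using assms unfolding borel_regular_outer_measure_def by auto
  have ms: "measure_space UNIV (lambda_system UNIV UNIV \<mu>) \<mu>" by (rule caratheodory_lemma[OF oms])
  then have sa: "sigma_algebra UNIV (lambda_system UNIV UNIV \<mu>)" by (simp add: measure_space_def)
  have sets: "sets (caratheodory \<mu>) = lambda_system UNIV UNIV \<mu>"
    unfolding caratheodory_def by (rule sigma_algebra.sets_measure_of_eq[OF sa])
  show "sets borel \<subseteq> sets (caratheodory \<mu>)" using bs sets by simp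
  show "space (caratheodory \<mu>) = UNIV" unfolding caratheodory_def by (rule sigma_algebra.space_measure_of_eq[OF sa])
  show "emeasure (caratheodory \<mu>) A = \<mu> A" if "A \<in> sets (caratheodory \<mu>)" for A
    unfolding caratheodory_def
    by (rule emeasure_measure_of_sigma[OF sa]) (use ms that sets in \<open>auto simp: measure_space_def\<close>)
qed

lemma doubling_onD:
  assumes "doubling_on S \<mu>"
  obtains C where "1 \<le> C" "\<And>x r. x \<in> S \<Longrightarrow> 0 < r \<Longrightarrow> 0 < \<mu> (ball x r \<inter> S)"
    "\<And>x r. x \<in> S \<Longrightarrow> 0 < r \<Longrightarrow> \<mu> (ball x r \<inter> S) < \<infinity>"
    "\<And>x r. x \<in> S \<Longrightarrow> 0 < r \<Longrightarrow> \<mu> (ball x (2 * r) \<inter> S) \<le> ennreal C * \<mu> (ball x r \<inter> S)"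
proof -
  obtain C where C: "0 < C" and d: "\<And>x r. x \<in> S \<Longrightarrow> 0 < r \<Longrightarrow> 0 < \<mu> (ball x (2 * r) \<inter> S) \<and>
     \<mu> (ball x (2 * r) \<inter> S) \<le> ennreal C * \<mu> (ball x r \<inter> S) \<and> ennreal C * \<mu> (ball x r \<inter> S) < \<infinity>"
    using assms unfolding doubling_on_def by blast
  show ?thesis
  proof (rule that[of "max 1 C"])
    fix x r assume x: "x \<in> S" "0 < (r::real)"
    show "0 < \<mu> (ball x r \<inter> S)" using d[OF x(1), of "r / 2"] x(2) by simp
    show "\<mu> (ball x r \<inter> S) < \<infinity>" using d[OF x] C by (auto simp: ennreal_mult_less_top)
    have "\<mu> (ball x (2 * r) \<inter> S) \<le> ennreal C * \<mu> (ball x r \<inter> S)" using d[OF x] by simp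
    also have "\<dots> \<le> ennreal (max 1 C) * \<mu> (ball x r \<inter> S)" by (intro mult_right_mono ennreal_leI) auto
    finally show "\<mu> (ball x (2 * r) \<inter> S) \<le> ennreal (max 1 C) * \<mu> (ball x r \<inter> S)" .
  qed simp
qed

locale metric_outer_measure =
  fixes \<mu> :: "'a::metric_space set \<Rightarrow> ennreal"
  assumes reg: "borel_regular_outer_measure \<mu>"
begin

abbreviation M :: "'a measure" where "M \<equiv> caratheodory \<mu>"

lemma borel_M: "sets borel \<subseteq> sets M" and space_M: "space M = UNIV"
  and emeasure_M: "A \<in> sets M \<Longrightarrow> emeasure M A = \<mu> A"
  using caratheodory_facts[OF reg] by auto

lemma M_borel:
  assumes "f \<in> borel_measurable borel" shows "f \<in> borel_measurable M"
proof (rule measurableI)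
  fix A :: "'b set" assume "A \<in> sets borel"
  then have "f -` A \<inter> space borel \<in> sets borel" using assms by (rule measurable_sets[rotated])
  then show "f -` A \<inter> space M \<in> sets M" using borel_M by (auto simp: space_M)
qed auto

lemma open_M: "open U \<Longrightarrow> U \<in> sets M"
  using borel_M by auto

lemma closed_M: "closed U \<Longrightarrow> U \<in> sets M"
  using borel_M by auto

lemma mono: "A \<in> sets M \<Longrightarrow> B \<in> sets M \<Longrightarrow> A \<subseteq> B \<Longrightarrow> \<mu> A \<le> \<mu> B"
  using emeasure_mono[of A B M] by (simp add: emeasure_M)

lemma restrict_borel_M:
  fixes g :: "'a \<Rightarrow> ennreal"
  assumes "open S" "g \<in> borel_measurable (restrict_space borel S)"
  shows "(\<lambda>x. g x * indicator S x) \<in> borel_measurable M"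
  using assms by (intro M_borel) (subst (asm) borel_measurable_restrict_space_iff_ennreal, auto)

text \<open>The Poincare inequality enters only through this comparison of the two extreme level sets.\<close>

lemma poincare_separation:
  assumes S: "open S"
    and P: "\<And>x r u g. x \<in> S \<Longrightarrow> 0 < r \<Longrightarrow> locally_integrable_on S \<mu> u \<Longrightarrow> upper_gradient_on S g u \<Longrightarrow>
        average_on \<mu> (ball x r \<inter> S) (\<lambda>y. e2ennreal \<bar>u y - ereal (mean_value \<mu> (ball x r \<inter> S) u)\<bar>)
        \<le> ennreal (C * r) * average_on \<mu> (ball x (L * r) \<inter> S) g"
    and C: "0 < C" and L: "1 \<le> L"
    and D: "\<And>x r. x \<in> S \<Longrightarrow> 0 < r \<Longrightarrow> 0 < \<mu> (ball x r \<inter> S)" "\<And>x r. x \<in> S \<Longrightarrow> 0 < r \<Longrightarrow> \<mu> (ball x r \<inter> S) < \<infinity>"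
    and f: "(\<lambda>x. f x * indicator S x :: real) \<in> borel_measurable M" "\<And>x. 0 \<le> f x \<and> f x \<le> 1"
    and g: "upper_gradient_on S g (\<lambda>x. ereal (f x))" and x: "x \<in> S" and r: "0 < r"
  shows "min (\<mu> (ball x r \<inter> S \<inter> {y. f y \<le> 0})) (\<mu> (ball x r \<inter> S \<inter> {y. 1 \<le> f y})) \<le>
    ennreal (2 * C * r) * (\<integral>\<^sup>+y\<in>ball x (L * r) \<inter> S. g y \<partial>M)"
proof -
  note [measurable] = f(1)
  define F where "F = (\<lambda>x. f x * indicator S x :: real)"
  have [measurable]: "F \<in> borel_measurable M" unfolding F_def by (rule f(1))
  define B where "B = ball x r \<inter> S"
  define B' where "B' = ball x (L * r) \<inter> S"
  have rL: "r \<le> L * r" using L r by simp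
  have BM[measurable]: "B \<in> sets M" "B' \<in> sets M" unfolding B_def B'_def using S by (auto intro!: open_M)
  have li: "locally_integrable_on S \<mu> (\<lambda>x. ereal (f x))"
    unfolding locally_integrable_on_def
  proof (intro allI impI conjI)
    fix V assume V: "compactly_inside V S"
    have VS: "V \<subseteq> S" "open V" "bounded V"
      using V closure_subset[of V] compact_imp_bounded[of "closure V"] bounded_subset[of "closure V" V]
      unfolding compactly_inside_def by auto
    have "(\<lambda>x. ereal (F x)) \<in> borel_measurable (restrict_space M V)" by (rule measurable_restrict_space1) measurable
    then show "(\<lambda>x. ereal (f x)) \<in> borel_measurable (restrict_space M V)"
      by (rule measurable_cong[THEN iffD1, rotated]) (use VS in \<open>auto simp: space_restrict_space F_def\<close>)
    obtain R where R: "0 < R" "V \<subseteq> ball x R" using VS(3) by (metis bounded_subset_ballD)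
    have "ball x R \<inter> S \<in> sets M" using S by (intro open_M) auto
    have "(\<integral>\<^sup>+y\<in>V. e2ennreal \<bar>ereal (f y)\<bar> \<partial>M) \<le> (\<integral>\<^sup>+y. indicator (ball x R \<inter> S) y \<partial>M)"
      using f(2) R(2) VS(1) by (intro nn_integral_mono) (auto simp: indicator_def subset_iff)
    also have "\<dots> = \<mu> (ball x R \<inter> S)" using \<open>ball x R \<inter> S \<in> sets M\<close> by (simp add: emeasure_M)
    also have "\<dots> < \<infinity>" by (rule D(2)[OF x R(1)])
    finally show "(\<integral>\<^sup>+y\<in>V. e2ennreal \<bar>ereal (f y)\<bar> \<partial>M) < \<infinity>" .
  qed
  define c where "c = mean_value \<mu> B (\<lambda>x. ereal (f x))"
  define X where "X = (\<integral>\<^sup>+y\<in>B. ennreal \<bar>f y - c\<bar> \<partial>M)"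
  define I where "I = (\<integral>\<^sup>+y\<in>B'. g y \<partial>M)"
  have b: "0 < \<mu> B" "\<mu> B < \<infinity>" unfolding B_def using D x r by auto
  have bb: "\<mu> B \<le> \<mu> B'" using rL unfolding B_def B'_def by (intro mono BM[unfolded B_def B'_def]) auto
  have "X / \<mu> B \<le> ennreal (C * r) * (I / \<mu> B')"
    using P[OF x r li g] unfolding average_on_def X_def I_def B_def[symmetric] B'_def[symmetric] c_def[symmetric] by simp
  then have "X / \<mu> B * \<mu> B \<le> ennreal (C * r) * (I / \<mu> B') * \<mu> B" by (rule mult_right_mono) simp
  moreover have "X / \<mu> B * \<mu> B = X" using b by (simp add: ennreal_divide_times ennreal_divide_self less_top)
  moreover have "ennreal (C * r) * (I / \<mu> B') * \<mu> B = ennreal (C * r) * (I * (\<mu> B / \<mu> B'))"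
    by (simp add: mult.assoc ennreal_divide_times)
  moreover have "ennreal (C * r) * (I * (\<mu> B / \<mu> B')) \<le> ennreal (C * r) * (I * 1)"
    using b bb by (intro mult_left_mono divide_le_posI_ennreal) auto
  ultimately have XI: "X \<le> ennreal (C * r) * I" by simp
  \<comment> \<open>The mean \<open>c\<close> is at distance at least 1/2 from 0 or from 1. On the
    corresponding extreme level set the deviation from \<open>c\<close> is at least 1/2, so its mass
    is at most twice the integral \<open>X\<close>.\<close>
  have half: "\<mu> (B \<inter> A) \<le> 2 * X" if A: "B \<inter> A \<in> sets M" and far: "\<And>y. y \<in> A \<Longrightarrow> 1 / 2 \<le> \<bar>f y - c\<bar>" for A
  proof -
    have "ennreal (1 / 2) * \<mu> (B \<inter> A) = (\<integral>\<^sup>+y. ennreal (1 / 2) * indicator (B \<inter> A) y \<partial>M)"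
      using A by (simp add: nn_integral_cmult_indicator emeasure_M)
    also have "\<dots> \<le> X"
      unfolding X_def
    proof (rule nn_integral_mono)
      fix y
      have "ennreal (1 / 2) \<le> ennreal \<bar>f y - c\<bar>" if "y \<in> A" using far[OF that] by (rule ennreal_leI)
      then show "ennreal (1 / 2) * indicator (B \<inter> A) y \<le> ennreal \<bar>f y - c\<bar> * indicator B y"
        by (cases "y \<in> B \<inter> A") auto
    qed
    finally have "2 * (ennreal (1 / 2) * \<mu> (B \<inter> A)) \<le> 2 * X" by (intro mult_left_mono) auto
    moreover have "2 * (ennreal (1 / 2) * \<mu> (B \<inter> A)) = \<mu> (B \<inter> A)"
    proof -
      have "(2::ennreal) * ennreal (1 / 2) = ennreal (2 * (1 / 2))" by (subst ennreal_mult) auto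
      then show ?thesis by (simp add: mult.assoc[symmetric])
    qed
    ultimately show ?thesis by simp
  qed
  have "min (\<mu> (B \<inter> {y. f y \<le> 0})) (\<mu> (B \<inter> {y. 1 \<le> f y})) \<le> 2 * X"
  proof (cases "c \<le> 1 / 2")
    case True
    have "B \<inter> {y. 1 \<le> f y} = B \<inter> {y\<in>space M. 1 \<le> F y}"
      unfolding F_def B_def space_M by auto
    also have "\<dots> \<in> sets M" by measurable
    finally have "\<mu> (B \<inter> {y. 1 \<le> f y}) \<le> 2 * X" by (rule half) (use True in auto)
    then show ?thesis by (rule min.coboundedI2)
  next
    case False
    have "B \<inter> {y. f y \<le> 0} = B \<inter> {y\<in>space M. F y \<le> 0}"
      unfolding F_def B_def space_M by auto
    also have "\<dots> \<in> sets M" by measurable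
    finally have "\<mu> (B \<inter> {y. f y \<le> 0}) \<le> 2 * X" by (rule half) (use False in auto)
    then show ?thesis by (rule min.coboundedI1)
  qed
  also have "2 * X \<le> 2 * (ennreal (C * r) * I)" using XI by (intro mult_left_mono) auto
  also have "\<dots> = ennreal (2 * C * r) * I"
  proof -
    have "(2::ennreal) * ennreal (C * r) = ennreal (2 * (C * r))" using C r by (subst ennreal_mult) auto
    then show ?thesis by (simp add: mult.assoc[symmetric])
  qed
  finally show ?thesis unfolding B_def B'_def I_def .
qed

text \<open>Disjoint balls of radius \<open>e / 5\<close> with centres in \<open>cball x R\<close>
  each carry a fixed fraction of the mass of \<open>ball x (R + e)\<close>, which contains them all;
  so there are at most \<open>C ^ k\<close> of them, and their dilations by 5 cover. With
  completeness, total boundedness gives compactness.\<close>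

lemma compact_cball:
  assumes dub: "doubling_on UNIV \<mu>" and comp: "complete (UNIV :: 'a set)"
  shows "compact (cball (x::'a) R)"
proof -
  obtain C where C: "1 \<le> C" and pos: "\<And>x r. 0 < r \<Longrightarrow> 0 < \<mu> (ball x r)" and fin: "\<And>x r. 0 < r \<Longrightarrow> \<mu> (ball x r) < \<infinity>"
    and d: "\<And>x r. 0 < r \<Longrightarrow> \<mu> (ball x (2 * r)) \<le> ennreal C * \<mu> (ball x r)"
    using doubling_onD[OF dub] by (metis UNIV_I inf_top_right)
  have iter: "\<mu> (ball x (2 ^ k * r)) \<le> ennreal (C ^ k) * \<mu> (ball x r)" if "0 < r" for x r k
  proof (induction k)
    case (Suc k)
    have "\<mu> (ball x (2 ^ Suc k * r)) \<le> ennreal C * \<mu> (ball x (2 ^ k * r))"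
      using d[of "2 ^ k * r" x] that by (simp add: mult.assoc)
    also have "\<dots> \<le> ennreal C * (ennreal (C ^ k) * \<mu> (ball x r))" using Suc by (intro mult_left_mono) auto
    finally show ?case using C by (simp add: ennreal_mult mult.assoc)
  qed simp
  have "\<exists>k. finite k \<and> cball x R \<subseteq> (\<Union>y\<in>k. ball y e)" if e: "0 < e" for e
  proof (cases "0 \<le> R")
    case R: True
    obtain D where D: "D \<subseteq> cball x R" "disjoint_family_on (\<lambda>y. ball y (e / 5)) D"
      "\<And>y. y \<in> cball x R \<Longrightarrow> \<exists>z\<in>D. ball y (e / 5) \<subseteq> ball z (5 * (e / 5))"
      by (rule vitali_covering_metric[of "cball x R" "\<lambda>_. e / 5" "e / 5"]) (use e in auto)
    define m where "m = \<mu> (ball x (R + e))"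
    have m: "0 < m" "m < \<infinity>" unfolding m_def using pos[of "R + e" x] fin[of "R + e" x] R e by simp_all
    obtain k :: nat where k: "(2 * R + e) / (e / 5) < 2 ^ k" using real_arch_pow[of 2] by auto
    have card: "real (card F) \<le> C ^ k" if F: "finite F" "F \<subseteq> D" for F
    proof -
      have low: "m \<le> ennreal (C ^ k) * \<mu> (ball y (e / 5))" if "y \<in> F" for y
      proof -
        have "ball x (R + e) \<subseteq> ball y (2 ^ k * (e / 5))"
        proof
          fix z assume "z \<in> ball x (R + e)"
          moreover have "dist x y \<le> R" using that F D(1) by auto
          moreover have "2 * R + e < 2 ^ k * (e / 5)" using k e by (simp add: field_simps)
          ultimately show "z \<in> ball y (2 ^ k * (e / 5))" using dist_triangle[of y z x] by (simp add: dist_commute)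
        qed
        then have "m \<le> \<mu> (ball y (2 ^ k * (e / 5)))" unfolding m_def by (intro mono open_M) auto
        also have "\<dots> \<le> ennreal (C ^ k) * \<mu> (ball y (e / 5))" using e by (intro iter) simp
        finally show ?thesis .
      qed
      have "of_nat (card F) * m \<le> (\<Sum>y\<in>F. ennreal (C ^ k) * \<mu> (ball y (e / 5)))"
        using sum_bounded_below[OF low, of F] by simp
      also have "\<dots> = ennreal (C ^ k) * (\<Sum>y\<in>F. emeasure M (ball y (e / 5)))"
        by (simp add: sum_distrib_left emeasure_M open_M)
      also have "(\<Sum>y\<in>F. emeasure M (ball y (e / 5))) = emeasure M (\<Union>y\<in>F. ball y (e / 5))"
        using F D(2) by (intro sum_emeasure) (auto intro: open_M disjoint_family_on_mono)
      also have "\<dots> \<le> emeasure M (ball x (R + e))"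
      proof (intro emeasure_mono UN_least subsetI open_M)
        fix y z assume "y \<in> F" "z \<in> ball y (e / 5)"
        moreover from this have "dist x y \<le> R" using F D(1) by auto
        ultimately show "z \<in> ball x (R + e)" using dist_triangle[of x z y] e by simp
      qed simp
      also have "\<dots> = m" unfolding m_def by (simp add: emeasure_M open_M)
      finally have "ennreal (real (card F)) * m \<le> ennreal (C ^ k) * m"
        by (simp add: mult_left_mono ennreal_of_nat_eq_real_of_nat)
      then have "ennreal (real (card F)) \<le> ennreal (C ^ k)"
        using m by (cases m) (auto simp: ennreal_mult[symmetric] C order_trans[OF zero_le_one] ennreal_le_iff)
      then show ?thesis using C by (simp add: ennreal_le_iff)
    qed
    have "finite D"
    proof (rule ccontr)
      assume "infinite D"
      then obtain F where "finite F" "card F = nat \<lceil>C ^ k\<rceil> + 1" "F \<subseteq> D" using infinite_arbitrarily_large by blast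
      then show False using card[of F] by linarith
    qed
    moreover have "cball x R \<subseteq> (\<Union>y\<in>D. ball y e)"
    proof
      fix y assume y: "y \<in> cball x R"
      then obtain z where z: "z \<in> D" "ball y (e / 5) \<subseteq> ball z e" using D(3)[OF y] by auto
      moreover have "y \<in> ball y (e / 5)" using e by simp
      ultimately have "y \<in> ball z e" by blast
      then show "y \<in> (\<Union>y\<in>D. ball y e)" using z(1) by blast
    qed
    ultimately show ?thesis by blast
  next
    case False
    then have "cball x R = {}" by simp
    then show ?thesis by (intro exI[of _ "{}"]) simp
  qed
  moreover have "complete (cball x R)"
    using complete_closed_subset[OF closed_cball _ comp] by simp
  ultimately show ?thesis unfolding compact_eq_totally_bounded by blast
qed

end

section \<open>Traces of functions of bounded variation\<close>

locale trace_setting = metric_outer_measure \<mu>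
  for \<mu> :: "'a::metric_space set \<Rightarrow> ennreal" +
  fixes \<Omega> :: "'a set" and Q CP LP :: real
  assumes opn: "open \<Omega>" and bdd: "bounded \<Omega>" and Q: "1 < Q"
    and dub: "doubling_on \<Omega> \<mu>" and mass: "mass_bound_exponent \<Omega> \<mu> Q"
    and CP: "0 < CP" and LP: "1 \<le> LP"
    and poincare: "\<And>x r u g. x \<in> \<Omega> \<Longrightarrow> 0 < r \<Longrightarrow> locally_integrable_on \<Omega> \<mu> u \<Longrightarrow> upper_gradient_on \<Omega> g u \<Longrightarrow>
        average_on \<mu> (ball x r \<inter> \<Omega>) (\<lambda>y. e2ennreal \<bar>u y - ereal (mean_value \<mu> (ball x r \<inter> \<Omega>) u)\<bar>)
        \<le> ennreal (CP * r) * average_on \<mu> (ball x (LP * r) \<inter> \<Omega>) g"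
    and proper: "\<And>x r. compact (cball (x::'a) r)"
begin

lemma dom_M [measurable, simp]: "\<Omega> \<in> sets M"
  by (rule open_M[OF opn])

definition \<nu> :: "'a measure" where "\<nu> = density M (indicator \<Omega>)"

lemma sets_\<nu>: "sets \<nu> = sets M" unfolding \<nu>_def by simp

lemma emeasure_\<nu>: "A \<in> sets M \<Longrightarrow> emeasure \<nu> A = \<mu> (A \<inter> \<Omega>)"
proof -
  assume A: "A \<in> sets M"
  have "emeasure \<nu> A = (\<integral>\<^sup>+x. indicator \<Omega> x * indicator A x \<partial>M)"
    unfolding \<nu>_def using A by (simp add: emeasure_density)
  also have "\<dots> = (\<integral>\<^sup>+x. indicator (A \<inter> \<Omega>) x \<partial>M)" by (intro nn_integral_cong) (auto simp: indicator_def)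
  also have "\<dots> = \<mu> (A \<inter> \<Omega>)" using A by (simp add: emeasure_M)
  finally show ?thesis .
qed

lemma nn_integral_\<nu>: "f \<in> borel_measurable M \<Longrightarrow> (\<integral>\<^sup>+x. f x \<partial>\<nu>) = (\<integral>\<^sup>+x\<in>\<Omega>. f x \<partial>M)"
  unfolding \<nu>_def by (subst nn_integral_density) (auto simp: mult.commute)

lemma meas_\<nu>: "f \<in> borel_measurable M \<Longrightarrow> f \<in> borel_measurable \<nu>"
  unfolding measurable_cong_sets[OF sets_\<nu> refl] .

text \<open>A centre in the closure is moved to a point of \<Omega> at a fraction of the radius. For
  doubling, the radii \<open>r / 2\<close> and \<open>4 * r\<close> about the new centre are three
  doublings apart; for the mass bound, the radii \<open>r / 2\<close> and \<open>2 * R\<close>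
  account for the factor \<open>(1 / 4) powr Q\<close>.\<close>

lemma domain_constants: "\<exists>Cd cm. doubling_domain \<nu> \<Omega> Cd Q cm"
proof -
  obtain C where C: "1 \<le> C" and pos: "\<And>x r. x \<in> \<Omega> \<Longrightarrow> 0 < r \<Longrightarrow> 0 < \<mu> (ball x r \<inter> \<Omega>)"
    and fin: "\<And>x r. x \<in> \<Omega> \<Longrightarrow> 0 < r \<Longrightarrow> \<mu> (ball x r \<inter> \<Omega>) < \<infinity>"
    and d: "\<And>x r. x \<in> \<Omega> \<Longrightarrow> 0 < r \<Longrightarrow> \<mu> (ball x (2 * r) \<inter> \<Omega>) \<le> ennreal C * \<mu> (ball x r \<inter> \<Omega>)"
    by (rule doubling_onD[OF dub]) auto
  obtain K where K: "1 \<le> K" and mb: "\<And>x y r R. x \<in> \<Omega> \<Longrightarrow> y \<in> \<Omega> \<Longrightarrow> 0 < r \<Longrightarrow> r \<le> R \<Longrightarrow> y \<in> ball x R \<Longrightarrow>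
     ennreal (inverse K * (r / R) powr Q) \<le> \<mu> (ball y r \<inter> \<Omega>) / \<mu> (ball x R \<inter> \<Omega>)"
    using mass unfolding mass_bound_exponent_def by blast
  have e\<nu>: "emeasure \<nu> (ball x r) = \<mu> (ball x r \<inter> \<Omega>)" for x r by (rule emeasure_\<nu>) (rule open_M, simp)
  have "emeasure \<nu> (space \<nu>) \<noteq> \<infinity>"
  proof (cases "\<Omega> = {}")
    case True
    have "emeasure \<nu> UNIV = \<mu> {}" using emeasure_\<nu>[of UNIV] True open_M[of UNIV] by simp
    also have "\<mu> {} = 0" using emeasure_M[of "{}"] by simp
    finally show ?thesis unfolding \<nu>_def by (simp add: space_M)
  next
    case False
    then obtain z where z: "z \<in> \<Omega>" by auto
    obtain R where R: "0 < R" "\<Omega> \<subseteq> ball z R" using bdd by (metis bounded_subset_ballD)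
    have "emeasure \<nu> UNIV = \<mu> (ball z R \<inter> \<Omega>)"
      using emeasure_\<nu>[of UNIV] open_M[of UNIV] R(2) by (simp add: Int_absorb1)
    then show ?thesis using fin[OF z R(1)] unfolding \<nu>_def by (simp add: space_M)
  qed
  then interpret \<nu>: finite_measure \<nu> by (rule finite_measureI)
  have m\<nu>: "\<mu> (ball x r \<inter> \<Omega>) = ennreal (measure \<nu> (ball x r))" for x r
    unfolding e\<nu>[symmetric] by (rule \<nu>.emeasure_eq_measure)
  have bs: "ball x r \<in> sets \<nu>" for x r unfolding sets_\<nu> by (rule open_M) simp
  have approx: "\<exists>x'\<in>\<Omega>. dist x x' < e" if "x \<in> closure \<Omega>" "0 < e" for x e
    using that unfolding closure_approachable by (metis dist_commute)
  have pos': "0 < measure \<nu> (ball x r)" if "x \<in> \<Omega>" "0 < r" for x r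
    using pos[OF that] unfolding m\<nu> by simp
  have d': "measure \<nu> (ball x (2 * r)) \<le> C * measure \<nu> (ball x r)" if "x \<in> \<Omega>" "0 < r" for x r
  proof -
    have "ennreal (measure \<nu> (ball x (2 * r))) \<le> ennreal (C * measure \<nu> (ball x r))"
      using d[OF that] C unfolding m\<nu> by (simp add: ennreal_mult)
    then show ?thesis using C by (simp add: ennreal_le_iff)
  qed
  have mb': "inverse K * (r / R) powr Q * measure \<nu> (ball x R) \<le> measure \<nu> (ball y r)"
    if xy: "x \<in> \<Omega>" "y \<in> \<Omega>" "0 < r" "r \<le> R" "y \<in> ball x R" for x y r R
  proof -
    have p: "0 < measure \<nu> (ball x R)" using xy by (intro pos') auto
    have "ennreal (inverse K * (r / R) powr Q) \<le> ennreal (measure \<nu> (ball y r) / measure \<nu> (ball x R))"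
      using mb[OF xy] p unfolding m\<nu> by (simp add: divide_ennreal)
    then have "inverse K * (r / R) powr Q \<le> measure \<nu> (ball y r) / measure \<nu> (ball x R)"
      by (subst (asm) ennreal_le_iff) auto
    then show ?thesis using p by (simp add: field_simps)
  qed
  have "doubling_domain \<nu> \<Omega> (C ^ 3) Q (inverse K * (1 / 4) powr Q)"
  proof unfold_locales
    show "sets borel \<subseteq> sets \<nu>" unfolding sets_\<nu> by (rule borel_M)
    have "\<mu> {} = 0" using emeasure_M[of "{}"] by simp
    moreover have "- \<Omega> \<in> sets M" by (rule closed_M) (use opn in auto)
    ultimately show "emeasure \<nu> (- \<Omega>) = 0"
      using emeasure_\<nu>[of "- \<Omega>"] by simp
    show "1 \<le> C ^ 3" using C by simp
    show "0 < inverse K * (1 / 4) powr Q" using K by simp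
  next
    fix x and r :: real assume x: "x \<in> closure \<Omega>" and r: "0 < r"
    obtain x' where x': "x' \<in> \<Omega>" "dist x x' < r / 2" using approx[OF x, of "r / 2"] r by auto
    have "ball x' (r / 2) \<subseteq> ball x r"
    proof
      fix y assume "y \<in> ball x' (r / 2)"
      then show "y \<in> ball x r" using dist_triangle[of x y x'] x'(2) by simp
    qed
    then have le: "measure \<nu> (ball x' (r / 2)) \<le> measure \<nu> (ball x r)" by (intro \<nu>.finite_measure_mono bs)
    then show "0 < measure \<nu> (ball x r)" using pos'[OF x'(1), of "r / 2"] r by simp
    have "ball x (2 * r) \<subseteq> ball x' (2 * (2 * (2 * (r / 2))))"
    proof
      fix y assume "y \<in> ball x (2 * r)"
      then show "y \<in> ball x' (2 * (2 * (2 * (r / 2))))" using dist_triangle[of x' y x] x'(2) r by (simp add: dist_commute)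
    qed
    then have "measure \<nu> (ball x (2 * r)) \<le> measure \<nu> (ball x' (2 * (2 * (2 * (r / 2)))))" by (intro \<nu>.finite_measure_mono bs)
    also have "\<dots> \<le> C * (C * (C * measure \<nu> (ball x' (r / 2))))"
    proof -
      have 1: "measure \<nu> (ball x' (2 * (2 * (2 * (r / 2))))) \<le> C * measure \<nu> (ball x' (2 * (2 * (r / 2))))"
        using r by (intro d' x') auto
      have 2: "measure \<nu> (ball x' (2 * (2 * (r / 2)))) \<le> C * measure \<nu> (ball x' (2 * (r / 2)))"
        using r by (intro d' x') auto
      have 3: "measure \<nu> (ball x' (2 * (r / 2))) \<le> C * measure \<nu> (ball x' (r / 2))"
        using r by (intro d' x') auto
      have C0: "0 \<le> C" using C by simp
      show ?thesis
        using order_trans[OF 1 mult_left_mono[OF order_trans[OF 2 mult_left_mono[OF 3 C0]] C0]] .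
    qed
    also have "\<dots> \<le> C * (C * (C * measure \<nu> (ball x r)))" using le C by (intro mult_left_mono) auto
    finally show "measure \<nu> (ball x (2 * r)) \<le> C ^ 3 * measure \<nu> (ball x r)" by (simp add: power3_eq_cube mult.assoc)
  next
    fix x y and r R :: real
    assume xy: "x \<in> closure \<Omega>" "y \<in> closure \<Omega>" "0 < r" "r \<le> R" "y \<in> ball x R"
    obtain x' where x': "x' \<in> \<Omega>" "dist x x' < r / 4" using approx[OF xy(1), of "r / 4"] xy by auto
    obtain y' where y': "y' \<in> \<Omega>" "dist y y' < r / 4" using approx[OF xy(2), of "r / 4"] xy by auto
    have "dist x' y' < 2 * R"
      using dist_triangle[of x' y' x] dist_triangle[of x y' y] x' y' xy by (simp add: dist_commute)
    then have "inverse K * ((r / 2) / (2 * R)) powr Q * measure \<nu> (ball x' (2 * R)) \<le> measure \<nu> (ball y' (r / 2))"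
      using xy by (intro mb' x' y') auto
    moreover have "((r / 2) / (2 * R)) powr Q = (1 / 4) powr Q * (r / R) powr Q"
      by (subst powr_mult[symmetric]) simp
    moreover have "measure \<nu> (ball x R) \<le> measure \<nu> (ball x' (2 * R))"
    proof (intro \<nu>.finite_measure_mono bs subsetI)
      fix w assume "w \<in> ball x R"
      then show "w \<in> ball x' (2 * R)" using dist_triangle[of x' w x] x' xy by (simp add: dist_commute)
    qed
    then have "inverse K * (1 / 4) powr Q * (r / R) powr Q * measure \<nu> (ball x R) \<le>
       inverse K * (1 / 4) powr Q * (r / R) powr Q * measure \<nu> (ball x' (2 * R))"
      using K by (intro mult_left_mono) auto
    moreover have "measure \<nu> (ball y' (r / 2)) \<le> measure \<nu> (ball y r)"
    proof (intro \<nu>.finite_measure_mono bs subsetI)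
      fix w assume "w \<in> ball y' (r / 2)"
      then show "w \<in> ball y r" using dist_triangle[of y w y'] y' xy by simp
    qed
    ultimately show "inverse K * (1 / 4) powr Q * (r / R) powr Q * measure \<nu> (ball x R) \<le> measure \<nu> (ball y r)"
      by (simp add: mult.assoc)
  qed (use opn bdd Q in auto)
  then show ?thesis by blast
qed

text \<open>The constants are chosen once so that the sublocale below has definite terms as
  parameters.\<close>

definition Cd :: real where "Cd = (SOME C. \<exists>c. doubling_domain \<nu> \<Omega> C Q c)"
definition cm :: real where "cm = (SOME c. doubling_domain \<nu> \<Omega> Cd Q c)"

lemma dd: "doubling_domain \<nu> \<Omega> Cd Q cm"
  unfolding cm_def by (rule someI_ex) (unfold Cd_def, rule someI_ex, rule domain_constants)

sublocale doubling_domain \<nu> \<Omega> Cd Q cm by (rule dd)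

text \<open>An upper gradient on \<Omega> is measurable only there; the indicator makes the density
  measurable on the whole type.\<close>

definition GG :: "('a \<Rightarrow> ennreal) \<Rightarrow> 'a measure" where
  "GG g = density M (\<lambda>x. g x * indicator \<Omega> x)"

lemma sets_GG: "sets (GG g) = sets M" unfolding GG_def by simp

lemma emeasure_GG:
  assumes "g \<in> borel_measurable (restrict_space borel \<Omega>)" "A \<in> sets M"
  shows "emeasure (GG g) A = (\<integral>\<^sup>+x\<in>A \<inter> \<Omega>. g x \<partial>M)"
proof -
  have "emeasure (GG g) A = (\<integral>\<^sup>+x. (g x * indicator \<Omega> x) * indicator A x \<partial>M)"
    unfolding GG_def using restrict_borel_M[OF opn assms(1)] assms(2) by (rule emeasure_density)
  also have "\<dots> = (\<integral>\<^sup>+x\<in>A \<inter> \<Omega>. g x \<partial>M)" by (intro nn_integral_cong) (auto simp: indicator_def)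
  finally show ?thesis .
qed

lemma cont_dom_meas:
  fixes v :: "'a \<Rightarrow> real"
  assumes "continuous_on \<Omega> v"
  shows "(\<lambda>x. v x * indicator \<Omega> x) \<in> borel_measurable M"
proof -
  have "(\<lambda>x. indicator \<Omega> x *\<^sub>R v x) \<in> borel_measurable borel"
    using opn assms by (intro borel_measurable_continuous_on_indicator) auto
  then show ?thesis by (intro M_borel) (simp add: mult.commute)
qed

text \<open>The centre is moved into \<Omega> by less than \<open>r\<close>. This doubles the
  radius, enlarges the ball on the right to radius \<open>3 * LP * r\<close>, and with the factor 2
  of \<open>poincare_separation\<close> gives \<open>4 * CP\<close>.\<close>

lemma level_poincare_dom:
  assumes v: "continuous_on \<Omega> v" and g: "upper_gradient_on \<Omega> g (\<lambda>x. ereal (v x))" and fin: "(\<integral>\<^sup>+x\<in>\<Omega>. g x \<partial>M) < \<infinity>"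
  shows "level_poincare \<nu> \<Omega> Cd Q cm (GG g) (\<lambda>x. v x * indicator \<Omega> x) (4 * CP) (3 * LP)"
proof -
  have gm: "g \<in> borel_measurable (restrict_space borel \<Omega>)" using g unfolding upper_gradient_on_def by blast
  have UM: "UNIV \<in> sets M" by (rule open_M) simp
  have "emeasure (GG g) (space (GG g)) \<noteq> \<infinity>"
    using emeasure_GG[OF gm UM] fin unfolding GG_def by (simp add: space_M)
  then interpret G: finite_measure "GG g" by (rule finite_measureI)
  define w where "w = (\<lambda>x. v x * indicator \<Omega> x)"
  have w[measurable]: "w \<in> borel_measurable M" unfolding w_def by (rule cont_dom_meas[OF v])
  obtain C where D: "\<And>x r. x \<in> \<Omega> \<Longrightarrow> 0 < r \<Longrightarrow> 0 < \<mu> (ball x r \<inter> \<Omega>)" "\<And>x r. x \<in> \<Omega> \<Longrightarrow> 0 < r \<Longrightarrow> \<mu> (ball x r \<inter> \<Omega>) < \<infinity>"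
    by (rule doubling_onD[OF dub]) auto
  show ?thesis
    unfolding w_def[symmetric]
  proof unfold_locales
    show "sets (GG g) = sets \<nu>" unfolding sets_GG sets_\<nu> ..
    show "w \<in> borel_measurable \<nu>" by (rule meas_\<nu>[OF w])
    show "continuous_on \<Omega> w" using v by (subst continuous_on_cong[OF refl, of _ _ v]) (auto simp: w_def)
    fix x and r e t :: real assume x: "x \<in> closure \<Omega>" and r: "0 < r" and e: "0 < e"
    obtain x' where x': "x' \<in> \<Omega>" "dist x x' < r" using x r unfolding closure_approachable by (metis dist_commute)
    define f where "f y = max 0 (min 1 ((v y - t) / e))" for y
    have ball1: "ball x r \<subseteq> ball x' (2 * r)"
    proof
      fix y assume "y \<in> ball x r"
      then show "y \<in> ball x' (2 * r)" using dist_triangle[of x' y x] x' by (simp add: dist_commute)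
    qed
    have ball2: "ball x' (LP * (2 * r)) \<subseteq> ball x (3 * LP * r)"
    proof
      fix y assume "y \<in> ball x' (LP * (2 * r))"
      moreover have "1 * r \<le> LP * r" using LP r by (intro mult_right_mono) auto
      ultimately show "y \<in> ball x (3 * LP * r)" using dist_triangle[of x y x'] x' by simp
    qed
    have fm: "(\<lambda>y. f y * indicator \<Omega> y) \<in> borel_measurable M"
    proof (rule cont_dom_meas)
      show "continuous_on \<Omega> f" unfolding f_def by (intro continuous_intros v) (use e in auto)
    qed
    have sep: "min (\<mu> (ball x' (2 * r) \<inter> \<Omega> \<inter> {y. f y \<le> 0})) (\<mu> (ball x' (2 * r) \<inter> \<Omega> \<inter> {y. 1 \<le> f y})) \<le>
       ennreal (2 * CP * (2 * r)) * (\<integral>\<^sup>+y\<in>ball x' (LP * (2 * r)) \<inter> \<Omega>. ennreal (1 / e) * (g y * indicator {y. t < v y \<and> v y < t + e} y) \<partial>M)"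
    proof (rule poincare_separation[OF opn poincare CP LP D fm _ _ x'(1)])
      show "0 \<le> f y \<and> f y \<le> 1" for y unfolding f_def by auto
      show "upper_gradient_on \<Omega> (\<lambda>y. ennreal (1 / e) * (g y * indicator {y. t < v y \<and> v y < t + e} y)) (\<lambda>x. ereal (f x))"
        unfolding f_def by (rule upper_gradient_truncate[OF g v e])
      show "0 < 2 * r" using r by simp
    qed
    have ws: "{y. w y \<le> t} \<in> sets M" "{y. t + e \<le> w y} \<in> sets M" "{y. t < w y \<and> w y < t + e} \<in> sets M"
    proof -
      have "{y\<in>space M. w y \<le> t} \<in> sets M" "{y\<in>space M. t + e \<le> w y} \<in> sets M" "{y\<in>space M. t < w y \<and> w y < t + e} \<in> sets M"
        by measurable
      then show "{y. w y \<le> t} \<in> sets M" "{y. t + e \<le> w y} \<in> sets M" "{y. t < w y \<and> w y < t + e} \<in> sets M"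
        by (simp_all add: space_M)
    qed
    have bM: "ball y s \<in> sets M" for y s by (rule open_M) simp
    have f0: "f y \<le> 0 \<longleftrightarrow> v y \<le> t" and f1: "1 \<le> f y \<longleftrightarrow> t + e \<le> v y" for y
      unfolding f_def using e by (auto simp: field_simps max_def min_def)
    have A0: "ennreal (measure \<nu> (ball x r \<inter> {y. w y \<le> t})) \<le> \<mu> (ball x' (2 * r) \<inter> \<Omega> \<inter> {y. f y \<le> 0})"
    proof -
      have "ennreal (measure \<nu> (ball x r \<inter> {y. w y \<le> t})) = \<mu> (ball x r \<inter> {y. w y \<le> t} \<inter> \<Omega>)"
        unfolding emeasure_eq_measure[symmetric] using bM ws by (intro emeasure_\<nu>) auto
      also have "\<dots> \<le> \<mu> (ball x' (2 * r) \<inter> \<Omega> \<inter> {y. w y \<le> t})"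
        using ball1 bM ws by (intro mono) auto
      also have "ball x' (2 * r) \<inter> \<Omega> \<inter> {y. w y \<le> t} = ball x' (2 * r) \<inter> \<Omega> \<inter> {y. f y \<le> 0}"
        unfolding f0 w_def by auto
      finally show ?thesis .
    qed
    have A1: "ennreal (measure \<nu> (ball x r \<inter> {y. t + e \<le> w y})) \<le> \<mu> (ball x' (2 * r) \<inter> \<Omega> \<inter> {y. 1 \<le> f y})"
    proof -
      have "ennreal (measure \<nu> (ball x r \<inter> {y. t + e \<le> w y})) = \<mu> (ball x r \<inter> {y. t + e \<le> w y} \<inter> \<Omega>)"
        unfolding emeasure_eq_measure[symmetric] using bM ws by (intro emeasure_\<nu>) auto
      also have "\<dots> \<le> \<mu> (ball x' (2 * r) \<inter> \<Omega> \<inter> {y. t + e \<le> w y})"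
        using ball1 bM ws by (intro mono) auto
      also have "ball x' (2 * r) \<inter> \<Omega> \<inter> {y. t + e \<le> w y} = ball x' (2 * r) \<inter> \<Omega> \<inter> {y. 1 \<le> f y}"
        unfolding f1 w_def by auto
      finally show ?thesis .
    qed
    have gM: "(\<lambda>y. g y * indicator \<Omega> y) \<in> borel_measurable M" by (rule restrict_borel_M[OF opn gm])
    define E where "E = measure (GG g) (ball x (3 * LP * r) \<inter> {y. t < w y \<and> w y < t + e})"
    have "(\<integral>\<^sup>+y\<in>ball x' (LP * (2 * r)) \<inter> \<Omega>. ennreal (1 / e) * (g y * indicator {y. t < v y \<and> v y < t + e} y) \<partial>M) \<le>
      (\<integral>\<^sup>+y. ennreal (1 / e) * ((g y * indicator \<Omega> y) * indicator (ball x (3 * LP * r) \<inter> {y. t < w y \<and> w y < t + e}) y) \<partial>M)"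
      using ball2 by (intro nn_integral_mono) (auto simp: indicator_def w_def)
    also have "\<dots> = ennreal (1 / e) * (\<integral>\<^sup>+y. (g y * indicator \<Omega> y) * indicator (ball x (3 * LP * r) \<inter> {y. t < w y \<and> w y < t + e}) y \<partial>M)"
      by (rule nn_integral_cmult, rule borel_measurable_times_ennreal[OF gM]) (use bM ws in auto)
    also have "(\<integral>\<^sup>+y. (g y * indicator \<Omega> y) * indicator (ball x (3 * LP * r) \<inter> {y. t < w y \<and> w y < t + e}) y \<partial>M) = ennreal E"
      unfolding E_def G.emeasure_eq_measure[symmetric] unfolding GG_def using gM bM ws by (intro emeasure_density[symmetric]) auto
    finally have "min (\<mu> (ball x' (2 * r) \<inter> \<Omega> \<inter> {y. f y \<le> 0})) (\<mu> (ball x' (2 * r) \<inter> \<Omega> \<inter> {y. 1 \<le> f y})) \<le>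
       ennreal (2 * CP * (2 * r)) * (ennreal (1 / e) * ennreal E)"
      using sep by (meson mult_left_mono order_trans zero_le)
    then have "min (ennreal (measure \<nu> (ball x r \<inter> {y. w y \<le> t}))) (ennreal (measure \<nu> (ball x r \<inter> {y. t + e \<le> w y}))) \<le>
       ennreal (2 * CP * (2 * r)) * (ennreal (1 / e) * ennreal E)"
      using min.mono[OF A0 A1] by (rule order_trans[rotated])
    also have "\<dots> = ennreal (4 * CP * r * E / e)"
      using CP r e unfolding E_def by (simp flip: ennreal_mult)
    finally have "ennreal (min (measure \<nu> (ball x r \<inter> {y. w y \<le> t})) (measure \<nu> (ball x r \<inter> {y. t + e \<le> w y}))) \<le> ennreal (4 * CP * r * E / e)"
      using min_of_mono[of ennreal "measure \<nu> (ball x r \<inter> {y. w y \<le> t})" "measure \<nu> (ball x r \<inter> {y. t + e \<le> w y})"]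
      by (simp add: monoI ennreal_leI)
    then have "min (measure \<nu> (ball x r \<inter> {y. w y \<le> t})) (measure \<nu> (ball x r \<inter> {y. t + e \<le> w y})) \<le> 4 * CP * r * E / e"
      using CP r e unfolding E_def by (subst (asm) ennreal_le_iff) auto
    then show "e * min (measure \<nu> (ball x r \<inter> {y. w y \<le> t})) (measure \<nu> (ball x r \<inter> {y. t + e \<le> w y}))
        \<le> 4 * CP * r * measure (GG g) (ball x (3 * LP * r) \<inter> {y. t < w y \<and> w y < t + e})"
      unfolding E_def using e by (simp add: field_simps)
  qed (use CP LP in auto)
qed

end

section \<open>Functions of bounded variation on the domain\<close>

lemma (in metric_outer_measure) BV_measurable: "u \<in> BV S \<mu> \<Longrightarrow> (\<lambda>y. u y * indicator S y) \<in> borel_measurable M"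
  unfolding BV_def set_integrable_def by (auto simp: mult.commute dest!: borel_measurable_integrable)

context trace_setting begin

text \<open>Compactness of closed balls makes small balls admissible test sets for local convergence
  and local Lipschitz continuity.\<close>

lemma ball_compactly_inside:
  assumes "cball x r \<subseteq> \<Omega>"
  shows "compactly_inside (ball x r) \<Omega>"
proof -
  have sub: "closure (ball x r) \<subseteq> cball x r" by (rule closure_minimal) auto
  have "compact (cball x r \<inter> closure (ball x r))" by (rule compact_Int_closed[OF proper]) simp
  then have "compact (closure (ball x r))" using sub by (simp add: Int_absorb1)
  then show ?thesis unfolding compactly_inside_def using sub assms by auto
qed

lemma dom_cball:
  assumes "x \<in> \<Omega>" obtains r where "0 < r" "cball x r \<subseteq> \<Omega>"
  using opn assms open_contains_cball by blast

lemma Lip_loc_continuous: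
  assumes "v \<in> Lip_loc \<Omega>" shows "continuous_on \<Omega> v"
proof -
  have "isCont v x" if x: "x \<in> \<Omega>" for x
  proof -
    obtain r where r: "0 < r" "cball x r \<subseteq> \<Omega>" by (rule dom_cball[OF x])
    then obtain C where "C-lipschitz_on (ball x r) v"
      using assms ball_compactly_inside[OF r(2)] unfolding Lip_loc_def by blast
    then have "continuous_on (ball x r) v" by (rule lipschitz_on_continuous_on)
    then show ?thesis using r(1) by (simp add: continuous_on_eq_continuous_at)
  qed
  then show ?thesis by (intro continuous_at_imp_continuous_on) auto
qed

text \<open>Finite variation only bounds a lower limit of energies; passing to a subsequence makes
  the bound uniform and keeps the local convergence.\<close>

lemma BV_sequences:
  assumes "u \<in> BV \<Omega> \<mu>"
  obtains v g and M1 :: real where "\<And>i. v i \<in> Lip_loc \<Omega>" "\<And>i. upper_gradient_on \<Omega> (g i) (\<lambda>x. ereal (v i x))"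
    "\<And>i. (\<integral>\<^sup>+x\<in>\<Omega>. g i x \<partial>M) \<le> ennreal M1" "L1_loc_tendsto \<Omega> \<mu> v u"
proof -
  have "total_variation \<Omega> \<mu> u < \<infinity>" using assms unfolding BV_def by simp
  then obtain v g where vg: "\<And>i. v i \<in> Lip_loc \<Omega>" "\<And>i. upper_gradient_on \<Omega> (g i) (\<lambda>x. ereal (v i x))"
    and conv: "L1_loc_tendsto \<Omega> \<mu> v u" and fin: "liminf (\<lambda>i. \<integral>\<^sup>+x\<in>\<Omega>. g i x \<partial>M) < \<infinity>"
    unfolding total_variation_def Inf_less_iff by blast
  obtain \<phi> where \<phi>: "strict_mono \<phi>" "((\<lambda>i. \<integral>\<^sup>+x\<in>\<Omega>. g i x \<partial>M) \<circ> \<phi>) \<longlonglongrightarrow> liminf (\<lambda>i. \<integral>\<^sup>+x\<in>\<Omega>. g i x \<partial>M)"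
    using liminf_subseq_lim[of "\<lambda>i. \<integral>\<^sup>+x\<in>\<Omega>. g i x \<partial>M"] by blast
  obtain l where l: "liminf (\<lambda>i. \<integral>\<^sup>+x\<in>\<Omega>. g i x \<partial>M) = ennreal l" "0 \<le> l" using fin by (auto simp: less_top_ennreal)
  have lt: "ennreal l < ennreal (l + 1)" using l by (intro ennreal_lessI) auto
  have "\<forall>\<^sub>F n in sequentially. ((\<lambda>i. \<integral>\<^sup>+x\<in>\<Omega>. g i x \<partial>M) \<circ> \<phi>) n < ennreal (l + 1)"
    by (rule order_tendstoD(2)[OF \<phi>(2)[unfolded l(1)] lt])
  then obtain n0 where n0: "\<And>n. n0 \<le> n \<Longrightarrow> (\<integral>\<^sup>+x\<in>\<Omega>. g (\<phi> n) x \<partial>M) < ennreal (l + 1)"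
    unfolding eventually_sequentially by auto
  define \<psi> where "\<psi> n = \<phi> (n + n0)" for n
  have \<psi>: "strict_mono \<psi>" using \<phi>(1) unfolding \<psi>_def strict_mono_def by simp
  show ?thesis
  proof (rule that[of "\<lambda>n. v (\<psi> n)" "\<lambda>n. g (\<psi> n)" "l + 1"])
    show "(\<integral>\<^sup>+x\<in>\<Omega>. g (\<psi> i) x \<partial>M) \<le> ennreal (l + 1)" for i
      unfolding \<psi>_def using n0[of "i + n0"] by simp
    show "L1_loc_tendsto \<Omega> \<mu> (\<lambda>n. v (\<psi> n)) u"
      unfolding L1_loc_tendsto_def
    proof (intro allI impI)
      fix V assume "compactly_inside V \<Omega>"
      then have "(\<lambda>i. \<integral>\<^sup>+x\<in>V. ennreal \<bar>v i x - u x\<bar> \<partial>M) \<longlonglongrightarrow> 0" using conv unfolding L1_loc_tendsto_def by blast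
      from LIMSEQ_subseq_LIMSEQ[OF this \<psi>]
      show "(\<lambda>i. \<integral>\<^sup>+x\<in>V. ennreal \<bar>v (\<psi> i) x - u x\<bar> \<partial>M) \<longlonglongrightarrow> 0" by (simp add: o_def)
    qed
  qed (use vg in auto)
qed

lemma pp_eq: "sobolev_exponent Q = Q / (Q - 1)"
  unfolding sobolev_exponent_def ..

lemma ball_M: "ball x r \<in> sets M"
  by (rule open_M) simp

lemma average_on_avg:
  assumes u: "(\<lambda>y. u y * indicator \<Omega> y) \<in> borel_measurable M"
  shows "average_on \<mu> (ball x r \<inter> \<Omega>) (\<lambda>y. ennreal (\<bar>u y - c\<bar> powr (Q / (Q - 1)))) = avg (\<lambda>y. u y * indicator \<Omega> y - c) x r"
proof -
  note [measurable] = u ball_M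
  have "(\<integral>\<^sup>+y\<in>ball x r. ennreal (\<bar>u y * indicator \<Omega> y - c\<bar> powr pp) \<partial>\<nu>) =
     (\<integral>\<^sup>+y\<in>\<Omega>. ennreal (\<bar>u y * indicator \<Omega> y - c\<bar> powr pp) * indicator (ball x r) y \<partial>M)"
    by (rule nn_integral_\<nu>) measurable
  also have "\<dots> = (\<integral>\<^sup>+y\<in>ball x r \<inter> \<Omega>. ennreal (\<bar>u y - c\<bar> powr pp) \<partial>M)"
    by (intro nn_integral_cong) (auto simp: indicator_def)
  finally show ?thesis
    unfolding average_on_def avg_def by (simp add: pp_eq emeasure_\<nu>[OF ball_M])
qed

lemma has_trace_value_avg:
  assumes u: "(\<lambda>y. u y * indicator \<Omega> y) \<in> borel_measurable M"
  shows "has_trace_value \<Omega> \<mu> (Q / (Q - 1)) u x c \<longleftrightarrow> ((\<lambda>r. avg (\<lambda>y. u y * indicator \<Omega> y - c) x r) \<longlongrightarrow> 0) (at_right 0)"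
  unfolding has_trace_value_def average_on_avg[OF u] ..

lemma BV_integrable:
  assumes "u \<in> BV \<Omega> \<mu>" shows "integrable \<nu> (\<lambda>y. u y * indicator \<Omega> y)"
proof -
  have int: "integrable M (\<lambda>y. u y * indicator \<Omega> y)"
    using assms unfolding BV_def set_integrable_def by (simp add: mult.commute)
  note m[measurable] = BV_measurable[OF assms]
  show ?thesis
  proof (rule integrableI_bounded)
    show "(\<lambda>y. u y * indicator \<Omega> y) \<in> borel_measurable \<nu>" by (rule meas_\<nu>[OF m])
    have "(\<integral>\<^sup>+y. ennreal (norm (u y * indicator \<Omega> y)) \<partial>\<nu>) = (\<integral>\<^sup>+y\<in>\<Omega>. ennreal (norm (u y * indicator \<Omega> y)) \<partial>M)"
      by (rule nn_integral_\<nu>) measurable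
    also have "\<dots> \<le> (\<integral>\<^sup>+y. ennreal (norm (u y * indicator \<Omega> y)) \<partial>M)"
      by (intro nn_integral_mono) (auto simp: indicator_def)
    also have "\<dots> < \<infinity>" using int unfolding integrable_iff_bounded by blast
    finally show "(\<integral>\<^sup>+y. ennreal (norm (u y * indicator \<Omega> y)) \<partial>\<nu>) < \<infinity>" .
  qed
qed

lemma BV_trace:
  assumes bv: "u \<in> BV \<Omega> \<mu>"
  shows "null_set {x\<in>frontier \<Omega>. \<not> (\<exists>c. has_trace_value \<Omega> \<mu> (Q / (Q - 1)) u x c)}"
proof (cases "frontier \<Omega> = {}")
  case True
  have "null_set (\<Union>t\<in>{}. {})" by (rule null_set_UN_countable) auto
  then show ?thesis using True by simp
next
  case False
  \<comment> \<open>The Whitney radii rest on the distance to the complement, which must therefore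
    be nonempty; a boundary point is an element of it.\<close>
  have ne: "- \<Omega> \<noteq> {}"
  proof -
    obtain x where "x \<in> frontier \<Omega>" using False by blast
    then have "x \<notin> \<Omega>" using opn by (simp add: frontier_def interior_open)
    then show ?thesis by blast
  qed
  define L where "L = 3 * LP"
  define K where "K = 4 * CP"
  interpret whitney_domain \<nu> \<Omega> Cd Q cm L by unfold_locales (use LP ne in \<open>auto simp: L_def\<close>)
  obtain v g and M1 :: real where v: "\<And>i. v i \<in> Lip_loc \<Omega>" and g: "\<And>i. upper_gradient_on \<Omega> (g i) (\<lambda>x. ereal (v i x))"
    and M1: "\<And>i. (\<integral>\<^sup>+x\<in>\<Omega>. g i x \<partial>M) \<le> ennreal M1" and conv: "L1_loc_tendsto \<Omega> \<mu> v u"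
    by (rule BV_sequences[OF bv]) auto
  have vc: "continuous_on \<Omega> (v i)" for i by (rule Lip_loc_continuous[OF v])
  have gfin: "(\<integral>\<^sup>+x\<in>\<Omega>. g i x \<partial>M) < \<infinity>" for i using M1[of i] by (rule order_le_less_trans) simp
  define v0 where "v0 i = (\<lambda>x. v i x * indicator \<Omega> x)" for i
  have lp: "level_poincare \<nu> \<Omega> Cd Q cm (GG (g i)) (v0 i) K L" for i
    unfolding v0_def K_def L_def by (rule level_poincare_dom[OF vc g gfin])
  define u0 where "u0 = (\<lambda>y. u y * indicator \<Omega> y)"
  have u0: "integrable \<nu> u0" unfolding u0_def by (rule BV_integrable[OF bv])
  have u0M[measurable]: "u0 \<in> borel_measurable M" unfolding u0_def by (rule BV_measurable[OF bv])
  have UM: "UNIV \<in> sets M" by (rule open_M) simp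
  have gm: "h \<in> borel_measurable (restrict_space borel \<Omega>)" if "upper_gradient_on \<Omega> h k" for h k
    using that unfolding upper_gradient_on_def by blast
  have tot: "emeasure (GG (g i)) UNIV \<le> ennreal M1" for i
    using emeasure_GG[OF gm[OF g] UM] M1[of i] by simp
  have conv0: "(\<lambda>i. \<integral>\<^sup>+y\<in>ball z r. ennreal \<bar>v0 i y - u0 y\<bar> \<partial>\<nu>) \<longlonglongrightarrow> 0" if z: "z \<in> \<Omega>" "0 < r" "cball z r \<subseteq> \<Omega>" for z r
  proof -
    have "(\<integral>\<^sup>+y\<in>ball z r. ennreal \<bar>v0 i y - u0 y\<bar> \<partial>\<nu>) = (\<integral>\<^sup>+y\<in>ball z r. ennreal \<bar>v i y - u y\<bar> \<partial>M)" for i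
    proof -
      have [measurable]: "v0 i \<in> borel_measurable M" unfolding v0_def by (rule cont_dom_meas[OF vc])
      note [measurable] = ball_M
      have "(\<integral>\<^sup>+y\<in>ball z r. ennreal \<bar>v0 i y - u0 y\<bar> \<partial>\<nu>) = (\<integral>\<^sup>+y\<in>\<Omega>. ennreal \<bar>v0 i y - u0 y\<bar> * indicator (ball z r) y \<partial>M)"
        by (rule nn_integral_\<nu>) measurable
      also have "\<dots> = (\<integral>\<^sup>+y\<in>ball z r. ennreal \<bar>v i y - u y\<bar> \<partial>M)"
        using z(3) by (intro nn_integral_cong) (auto simp: indicator_def v0_def u0_def subset_iff)
      finally show ?thesis .
    qed
    then show ?thesis using conv ball_compactly_inside[OF z(3)] unfolding L1_loc_tendsto_def by simp
  qed
  obtain D Lc where D: "countable D" "D \<subseteq> \<Omega>" "\<And>x. x \<in> \<Omega> \<Longrightarrow> \<exists>z\<in>D. x \<in> ball z (\<rho> z)" and Lc0: "\<And>z. 0 \<le> Lc z"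
    and lip: "\<And>z x x'. z \<in> D \<Longrightarrow> x \<in> ball z (\<rho> z) \<Longrightarrow> x' \<in> ball z (\<rho> z) \<Longrightarrow> \<bar>smooth u0 x - smooth u0 x'\<bar> \<le> Lc z * dist x x'"
    and Lfin: "(\<integral>\<^sup>+z. ennreal (Lc z * measure \<nu> (ball z (\<rho> z))) \<partial>count_space D) < \<infinity>"
    and near: "\<And>z. z \<in> D \<Longrightarrow> \<exists>c. (\<forall>y\<in>ball z (\<rho> z). \<bar>smooth u0 y - c\<bar> \<le> \<rho> z * Lc z) \<and>
       (\<integral>\<^sup>+y\<in>ball z (\<rho> z). ennreal (\<bar>u0 y - c\<bar> powr pp) \<partial>\<nu>) \<le>
       ennreal (dbl 4 * (1 / (2 * Cs)) powr pp * (\<rho> z * Lc z) powr pp * measure \<nu> (ball z (\<rho> z)))"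
    by (rule whitney_smoothing[OF lp u0 tot]) (rule conv0, assumption+, rule that, assumption+)
  define w where "w = smooth u0"
  \<comment> \<open>Each Whitney ball contributes its Lipschitz constant. Near a point, a single
    ball containing it already satisfies the gradient condition, and the other balls only increase
    the sum.\<close>
  define gW where "gW y = (\<integral>\<^sup>+z. ennreal (Lc z) * indicator (ball z (\<rho> z)) y \<partial>count_space D)" for y
  have gWb: "gW \<in> borel_measurable borel"
  proof -
    interpret cD: sigma_finite_measure "count_space D" by (rule sigma_finite_measure_count_space_countable[OF D(1)])
    have "(\<lambda>(z, y). ennreal (Lc z) * indicator (ball z (\<rho> z)) y) \<in> borel_measurable (count_space D \<Otimes>\<^sub>M borel)"
      by (rule measurable_pair_measure_countable1[OF D(1)])
        (simp add: borel_measurable_times_ennreal borel_measurable_indicator)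
    then have "(\<lambda>(y, z). ennreal (Lc z) * indicator (ball z (\<rho> z)) y) \<in> borel_measurable (borel \<Otimes>\<^sub>M count_space D)"
      by (subst measurable_pair_swap_iff) (simp add: case_prod_unfold)
    then show ?thesis unfolding gW_def by (rule cD.borel_measurable_nn_integral)
  qed
  have wUG: "upper_gradient_on \<Omega> gW (\<lambda>x. ereal (w x))"
  proof (rule upper_gradient_lipschitz)
    show "gW \<in> borel_measurable (restrict_space borel \<Omega>)" by (rule measurable_restrict_space1[OF gWb])
    fix x assume "x \<in> \<Omega>"
    then obtain z where z: "z \<in> D" "x \<in> ball z (\<rho> z)" using D(3) by blast
    show "\<exists>V M. open V \<and> x \<in> V \<and> (\<forall>y\<in>V \<inter> \<Omega>. M \<le> gW y) \<and> (\<forall>y\<in>V \<inter> \<Omega>. \<forall>z\<in>V \<inter> \<Omega>. ennreal \<bar>w y - w z\<bar> \<le> M * ennreal (dist y z))"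
    proof (intro exI conjI ballI)
      show "open (ball z (\<rho> z))" "x \<in> ball z (\<rho> z)" using z by auto
      show "ennreal (Lc z) \<le> gW y" if "y \<in> ball z (\<rho> z) \<inter> \<Omega>" for y
        using nn_integral_ge_point[OF z(1), of "\<lambda>z. ennreal (Lc z) * indicator (ball z (\<rho> z)) y"] that unfolding gW_def by simp
      fix y y' assume "y \<in> ball z (\<rho> z) \<inter> \<Omega>" "y' \<in> ball z (\<rho> z) \<inter> \<Omega>"
      then have "\<bar>w y - w y'\<bar> \<le> Lc z * dist y y'" unfolding w_def by (intro lip z) auto
      then show "ennreal \<bar>w y - w y'\<bar> \<le> ennreal (Lc z) * ennreal (dist y y')"
        using Lc0[of z] by (simp add: ennreal_leI flip: ennreal_mult)
    qed
  qed
  have wc: "continuous_on \<Omega> w"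
  proof -
    have "isCont w x" if x: "x \<in> \<Omega>" for x
    proof -
      obtain z where z: "z \<in> D" "x \<in> ball z (\<rho> z)" using D(3)[OF x] by blast
      have "(Lc z)-lipschitz_on (ball z (\<rho> z)) w"
        by (rule lipschitz_onI) (use lip[OF z(1)] Lc0 in \<open>auto simp: w_def dist_real_def\<close>)
      then have "continuous_on (ball z (\<rho> z)) w" by (rule lipschitz_on_continuous_on)
      then show ?thesis using z(2) by (simp add: continuous_on_eq_continuous_at)
    qed
    then show ?thesis by (intro continuous_at_imp_continuous_on) auto
  qed
  have gWm: "gW \<in> borel_measurable (restrict_space borel \<Omega>)" by (rule gm[OF wUG])
  have GW: "emeasure (GG gW) A = (\<integral>\<^sup>+z. ennreal (Lc z * measure \<nu> (A \<inter> ball z (\<rho> z))) \<partial>count_space D)" if A: "A \<in> sets M" for A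
  proof -
    note [measurable] = A ball_M
    have "emeasure (GG gW) A = (\<integral>\<^sup>+y\<in>A \<inter> \<Omega>. gW y \<partial>M)" by (rule emeasure_GG[OF gWm A])
    also have "\<dots> = (\<integral>\<^sup>+y. \<integral>\<^sup>+z. ennreal (Lc z) * indicator (A \<inter> ball z (\<rho> z) \<inter> \<Omega>) y \<partial>count_space D \<partial>M)"
    proof (rule nn_integral_cong)
      fix y
      show "gW y * indicator (A \<inter> \<Omega>) y = (\<integral>\<^sup>+z. ennreal (Lc z) * indicator (A \<inter> ball z (\<rho> z) \<inter> \<Omega>) y \<partial>count_space D)"
        unfolding gW_def by (cases "y \<in> A \<inter> \<Omega>") (auto simp: indicator_def intro!: nn_integral_cong)
    qed
    also have "\<dots> = (\<integral>\<^sup>+z. \<integral>\<^sup>+y. ennreal (Lc z) * indicator (A \<inter> ball z (\<rho> z) \<inter> \<Omega>) y \<partial>M \<partial>count_space D)"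
      by (rule nn_integral_count_space_nn_integral[OF D(1)]) measurable
    also have "\<dots> = (\<integral>\<^sup>+z. ennreal (Lc z * measure \<nu> (A \<inter> ball z (\<rho> z))) \<partial>count_space D)"
    proof (rule nn_integral_cong)
      fix z
      have "(\<integral>\<^sup>+y. ennreal (Lc z) * indicator (A \<inter> ball z (\<rho> z) \<inter> \<Omega>) y \<partial>M) = ennreal (Lc z) * emeasure M (A \<inter> ball z (\<rho> z) \<inter> \<Omega>)"
        by (rule nn_integral_cmult_indicator) measurable
      also have "emeasure M (A \<inter> ball z (\<rho> z) \<inter> \<Omega>) = emeasure \<nu> (A \<inter> ball z (\<rho> z))"
        by (subst emeasure_\<nu>) (auto simp: emeasure_M)
      also have "\<dots> = ennreal (measure \<nu> (A \<inter> ball z (\<rho> z)))" by (rule emeasure_eq_measure)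
      finally show "(\<integral>\<^sup>+y. ennreal (Lc z) * indicator (A \<inter> ball z (\<rho> z) \<inter> \<Omega>) y \<partial>M) = ennreal (Lc z * measure \<nu> (A \<inter> ball z (\<rho> z)))"
        using Lc0[of z] by (simp add: ennreal_mult)
    qed
    finally show ?thesis .
  qed
  have gWfin: "(\<integral>\<^sup>+x\<in>\<Omega>. gW x \<partial>M) < \<infinity>"
    using GW[OF UM] emeasure_GG[OF gWm UM] Lfin by simp
  have lpW: "level_poincare \<nu> \<Omega> Cd Q cm (GG gW) (\<lambda>x. w x * indicator \<Omega> x) K L"
    unfolding K_def L_def by (rule level_poincare_dom[OF wc wUG gWfin])
  have DO: "ball z (\<rho> z) \<subseteq> \<Omega>" if z: "z \<in> D" for z
  proof -
    have "\<rho> z < \<delta> z" using big_ball(2)[of z] \<rho>_pos[of z] z D(2) by auto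
    from cball_dom[OF this] show ?thesis by auto
  qed
  have "null_set {x\<in>frontier \<Omega>. \<not> (\<exists>c. ((\<lambda>r. avg (\<lambda>y. u0 y - c) x r) \<longlongrightarrow> 0) (at_right 0))}"
  proof (rule bv_trace[OF D Lc0 _ _ lpW])
    fix z assume z: "z \<in> D"
    obtain c where c: "\<forall>y\<in>ball z (\<rho> z). \<bar>smooth u0 y - c\<bar> \<le> \<rho> z * Lc z"
       "(\<integral>\<^sup>+y\<in>ball z (\<rho> z). ennreal (\<bar>u0 y - c\<bar> powr pp) \<partial>\<nu>) \<le>
       ennreal (dbl 4 * (1 / (2 * Cs)) powr pp * (\<rho> z * Lc z) powr pp * measure \<nu> (ball z (\<rho> z)))"
      using near[OF z] by blast
    have "\<forall>y\<in>ball z (\<rho> z). \<bar>w y * indicator \<Omega> y - c\<bar> \<le> \<rho> z * Lc z"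
      using c(1) DO[OF z] unfolding w_def by (auto simp: indicator_def)
    then show "\<exists>c. (\<forall>y\<in>ball z (\<rho> z). \<bar>w y * indicator \<Omega> y - c\<bar> \<le> \<rho> z * Lc z) \<and>
       (\<integral>\<^sup>+y\<in>ball z (\<rho> z). ennreal (\<bar>u0 y - c\<bar> powr pp) \<partial>\<nu>) \<le>
       ennreal (dbl 4 * (1 / (2 * Cs)) powr pp * (\<rho> z * Lc z) powr pp * measure \<nu> (ball z (\<rho> z)))"
      using c(2) by blast
  next
    show "u0 \<in> borel_measurable \<nu>" by (rule meas_\<nu>) measurable
    have "- \<Omega> \<in> sets M" by (rule closed_M) (use opn in auto)
    from emeasure_GG[OF gWm this] show "emeasure (GG gW) (- \<Omega>) = 0" by simp
    fix A assume "A \<in> sets \<nu>"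
    then show "(\<integral>\<^sup>+z. ennreal (Lc z * measure \<nu> (A \<inter> ball z (\<rho> z))) \<partial>count_space D) \<le> emeasure (GG gW) A"
      using GW[of A] unfolding sets_\<nu> by simp
  qed
  then show ?thesis
    unfolding has_trace_value_avg[OF BV_measurable[OF bv]] u0_def .
qed

text \<open>\<open>zero_extension\<close> and \<nu> are compared on measurable sets only; contents
  evaluate them on balls intersected with the closure, which are Borel.\<close>

lemma content_zero_extension:
  "codim1_content (closure \<Omega>) (zero_extension \<Omega> \<mu>) R A = codim1_content (closure \<Omega>) (emeasure \<nu>) R A"
proof -
  have "zero_extension \<Omega> \<mu> (ball x r \<inter> closure \<Omega>) = emeasure \<nu> (ball x r \<inter> closure \<Omega>)" for x r
  proof -
    have "ball x r \<inter> closure \<Omega> \<in> sets M" using ball_M closed_M[OF closed_closure[of \<Omega>]] by (rule sets.Int)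
    then show ?thesis unfolding zero_extension_def by (simp add: emeasure_\<nu>)
  qed
  then show ?thesis unfolding codim1_content_def by simp
qed

lemma null_set_hausdorff:
  "null_set A \<longleftrightarrow> codim1_hausdorff (closure \<Omega>) (zero_extension \<Omega> \<mu>) A = 0"
  unfolding null_set_def codim1_hausdorff_eq_0_iff content_zero_extension ..

end

section \<open>The linear trace operator\<close>

text \<open>Putting the value 0 where no trace exists would violate linearity when two functions
  without a trace have a sum with one. Instead, the values on a basis of the domain of the relation
  determine a linear functional that can be extended to all functions; single-valuedness makes it
  agree with the relation.\<close>

lemma linear_relation_extension:
  fixes R :: "('b \<Rightarrow> real) \<Rightarrow> real \<Rightarrow> bool"
  assumes zero: "R (\<lambda>_. 0) 0" and add: "\<And>f g c d. R f c \<Longrightarrow> R g d \<Longrightarrow> R (\<lambda>y. f y + g y) (c + d)"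
    and scale: "\<And>f c a. R f c \<Longrightarrow> R (\<lambda>y. a * f y) (a * c)"
    and unique: "\<And>f c d. R f c \<Longrightarrow> R f d \<Longrightarrow> c = d"
  obtains F where "\<And>a b f g. F (\<lambda>y. a * f y + b * g y) = a * F f + b * F g" "\<And>f c. R f c \<Longrightarrow> F f = c"
proof -
  define sc :: "real \<Rightarrow> ('b \<Rightarrow> real) \<Rightarrow> 'b \<Rightarrow> real" where "sc a f = (\<lambda>y. a * f y)" for a f
  interpret vs: vector_space sc
    by unfold_locales (auto simp: sc_def fun_eq_iff algebra_simps)
  interpret rv: vector_space "times :: real \<Rightarrow> real \<Rightarrow> real"
    by unfold_locales (auto simp: algebra_simps)
  interpret vp: vector_space_pair sc "times :: real \<Rightarrow> real \<Rightarrow> real" by unfold_locales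
  obtain B where B: "B \<subseteq> {f. \<exists>c. R f c}" "vs.independent B" "{f. \<exists>c. R f c} \<subseteq> vs.span B"
    by (rule vs.maximal_independent_subset)
  define \<phi> where "\<phi> f = (SOME c. R f c)" for f
  have \<phi>: "R f (\<phi> f)" if "\<exists>c. R f c" for f unfolding \<phi>_def using that by (rule someI_ex)
  obtain F where lin: "Vector_Spaces.linear sc times F" and F: "\<And>f. f \<in> B \<Longrightarrow> F f = \<phi> f"
    using vp.linear_independent_extend[OF B(2)] by blast
  interpret F: Vector_Spaces.linear sc times F by (rule lin)
  have comb: "F (\<lambda>y. a * f y + b * g y) = a * F f + b * F g" for a b f g
  proof -
    have "(\<lambda>y. a * f y + b * g y) = sc a f + sc b g" by (simp add: sc_def fun_eq_iff)
    then show ?thesis by (simp add: F.add F.scale)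
  qed
  have RF: "R f (F f)" if "f \<in> vs.span B" for f
    using that
  proof (induction rule: vs.span_induct_alt)
    case base
    then show ?case using zero F.zero by (simp add: zero_fun_def)
  next
    case (step a f g)
    have "R f (F f)" using F[OF step(1)] \<phi>[of f] B(1) step(1) by auto
    then have "R (\<lambda>y. a * f y + g y) (a * F f + F g)" by (intro add scale step)
    moreover have "sc a f + g = (\<lambda>y. a * f y + g y)" by (simp add: sc_def fun_eq_iff)
    moreover have "F (sc a f + g) = a * F f + F g" by (simp only: F.add F.scale)
    ultimately show ?case by (simp only:)
  qed
  show ?thesis
  proof (rule that[OF comb])
    fix f c assume "R f c"
    then have "f \<in> vs.span B" using B(3) by blast
    from unique[OF RF[OF this] \<open>R f c\<close>] show "F f = c" .
  qed
qed

text \<open>The operator is constructed for a positive exponent \<open>p\<close>, before a mass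
  bound for \<Omega> is considered, so that one operator serves both conclusions of the
  theorem.\<close>

locale boundary_traces = metric_outer_measure \<mu>
  for \<mu> :: "'a::metric_space set \<Rightarrow> ennreal" +
  fixes \<Omega> :: "'a set" and p :: real
  assumes open_domain: "open \<Omega>" and p: "0 < p" and domain_dub: "doubling_on \<Omega> \<mu>"
begin

lemma domain_M [measurable, simp]: "\<Omega> \<in> sets M" "ball x r \<inter> \<Omega> \<in> sets M"
  using open_domain by (auto intro: open_M)

lemma ball_measure:
  assumes x: "x \<in> closure \<Omega>" and r: "0 < r"
  shows "0 < \<mu> (ball x r \<inter> \<Omega>)" "\<mu> (ball x r \<inter> \<Omega>) < \<infinity>"
proof -
  obtain C where D: "\<And>x r. x \<in> \<Omega> \<Longrightarrow> 0 < r \<Longrightarrow> 0 < \<mu> (ball x r \<inter> \<Omega>)" "\<And>x r. x \<in> \<Omega> \<Longrightarrow> 0 < r \<Longrightarrow> \<mu> (ball x r \<inter> \<Omega>) < \<infinity>"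
    by (rule doubling_onD[OF domain_dub]) auto
  obtain y where y: "y \<in> \<Omega>" "dist y x < r / 2" using x r unfolding closure_approachable by (meson half_gt_zero)
  have "0 < \<mu> (ball y (r / 2) \<inter> \<Omega>)" using y r by (intro D) auto
  also have "\<dots> \<le> \<mu> (ball x r \<inter> \<Omega>)"
  proof (intro mono domain_M subsetI)
    fix z assume "z \<in> ball y (r / 2) \<inter> \<Omega>"
    then show "z \<in> ball x r \<inter> \<Omega>" using dist_triangle[of x z y] y(2) by (simp add: dist_commute)
  qed
  finally show "0 < \<mu> (ball x r \<inter> \<Omega>)" .
  have "\<mu> (ball x r \<inter> \<Omega>) \<le> \<mu> (ball y (2 * r) \<inter> \<Omega>)"
  proof (intro mono domain_M subsetI)
    fix z assume "z \<in> ball x r \<inter> \<Omega>"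
    then show "z \<in> ball y (2 * r) \<inter> \<Omega>" using dist_triangle[of y z x] y(2) r by auto
  qed
  also have "\<dots> < \<infinity>" using y r by (intro D) auto
  finally show "\<mu> (ball x r \<inter> \<Omega>) < \<infinity>" .
qed

text \<open>Measurability is part of the relation because additivity splits integrals of
  sums.\<close>

definition trace_at :: "'a \<Rightarrow> ('a \<Rightarrow> real) \<Rightarrow> real \<Rightarrow> bool" where
  "trace_at x f c \<longleftrightarrow> (\<lambda>y. f y * indicator \<Omega> y) \<in> borel_measurable M \<and> has_trace_value \<Omega> \<mu> p f x c"

lemma trace_at_add:
  assumes "trace_at x f c" "trace_at x g d"
  shows "trace_at x (\<lambda>y. f y + g y) (c + d)"
proof -
  define A where "A f c r = average_on \<mu> (ball x r \<inter> \<Omega>) (\<lambda>y. ennreal (\<bar>f y - c\<bar> powr p))" for f :: "'a \<Rightarrow> real" and c r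
  have m[measurable]: "(\<lambda>y. f y * indicator \<Omega> y) \<in> borel_measurable M" "(\<lambda>y. g y * indicator \<Omega> y) \<in> borel_measurable M"
    and lim: "((\<lambda>r. A f c r) \<longlongrightarrow> 0) (at_right 0)" "((\<lambda>r. A g d r) \<longlongrightarrow> 0) (at_right 0)"
    using assms unfolding trace_at_def has_trace_value_def A_def by auto
  have bound: "A (\<lambda>y. f y + g y) (c + d) r \<le> ennreal (2 powr p) * (A f c r + A g d r)" for r
  proof -
    let ?B = "ball x r \<inter> \<Omega>"
    have ind: "(\<integral>\<^sup>+y\<in>?B. ennreal (\<bar>h y * indicator \<Omega> y - k\<bar> powr p) \<partial>M) = (\<integral>\<^sup>+y\<in>?B. ennreal (\<bar>h y - k\<bar> powr p) \<partial>M)" for h :: "'a \<Rightarrow> real" and k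
      by (intro nn_integral_cong) (auto simp: indicator_def)
    have "(\<integral>\<^sup>+y\<in>?B. ennreal (\<bar>f y + g y - (c + d)\<bar> powr p) \<partial>M) \<le> ennreal (2 powr p) *
      ((\<integral>\<^sup>+y\<in>?B. ennreal (\<bar>f y * indicator \<Omega> y - c\<bar> powr p) \<partial>M) + (\<integral>\<^sup>+y\<in>?B. ennreal (\<bar>g y * indicator \<Omega> y - d\<bar> powr p) \<partial>M))"
      by (rule nn_integral_powr_triangle[OF p]) (auto intro!: AE_I2)
    then have "(\<integral>\<^sup>+y\<in>?B. ennreal (\<bar>f y + g y - (c + d)\<bar> powr p) \<partial>M) / \<mu> ?B \<le> (ennreal (2 powr p) *
      ((\<integral>\<^sup>+y\<in>?B. ennreal (\<bar>f y - c\<bar> powr p) \<partial>M) + (\<integral>\<^sup>+y\<in>?B. ennreal (\<bar>g y - d\<bar> powr p) \<partial>M))) / \<mu> ?B"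
      unfolding ind by (rule divide_right_mono_ennreal)
    then show ?thesis unfolding A_def average_on_def by (simp add: add_divide_distrib_ennreal flip: ennreal_times_divide)
  qed
  have "((\<lambda>r. ennreal (2 powr p) * (A f c r + A g d r)) \<longlongrightarrow> ennreal (2 powr p) * (0 + 0)) (at_right 0)"
    by (intro ennreal_tendsto_cmult tendsto_add lim) simp
  then have lim2: "((\<lambda>r. ennreal (2 powr p) * (A f c r + A g d r)) \<longlongrightarrow> 0) (at_right 0)" by simp
  have "((\<lambda>r. A (\<lambda>y. f y + g y) (c + d) r) \<longlongrightarrow> 0) (at_right 0)"
    by (rule tendsto_sandwich[OF _ _ tendsto_const lim2]) (simp_all add: bound)
  moreover have "(\<lambda>y. f y * indicator \<Omega> y + g y * indicator \<Omega> y) \<in> borel_measurable M"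
    by (rule borel_measurable_add[OF m])
  ultimately show ?thesis unfolding trace_at_def has_trace_value_def A_def by (simp only: distrib_right simp_thms)
qed

lemma trace_at_scale:
  assumes "trace_at x f c"
  shows "trace_at x (\<lambda>y. a * f y) (a * c)"
proof -
  have m[measurable]: "(\<lambda>y. f y * indicator \<Omega> y) \<in> borel_measurable M"
    and lim: "((\<lambda>r. average_on \<mu> (ball x r \<inter> \<Omega>) (\<lambda>y. ennreal (\<bar>f y - c\<bar> powr p))) \<longlongrightarrow> 0) (at_right 0)"
    using assms unfolding trace_at_def has_trace_value_def by auto
  have "average_on \<mu> (ball x r \<inter> \<Omega>) (\<lambda>y. ennreal (\<bar>a * f y - a * c\<bar> powr p)) =
     ennreal (\<bar>a\<bar> powr p) * average_on \<mu> (ball x r \<inter> \<Omega>) (\<lambda>y. ennreal (\<bar>f y - c\<bar> powr p))" for r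
  proof -
    let ?B = "ball x r \<inter> \<Omega>"
    have eq: "\<bar>a * f y - a * c\<bar> powr p = \<bar>a\<bar> powr p * \<bar>f y - c\<bar> powr p" for y
      by (simp add: powr_mult abs_mult flip: right_diff_distrib)
    have "(\<integral>\<^sup>+y\<in>?B. ennreal (\<bar>a * f y - a * c\<bar> powr p) \<partial>M) =
       (\<integral>\<^sup>+y. ennreal (\<bar>a\<bar> powr p) * (ennreal (\<bar>f y * indicator \<Omega> y - c\<bar> powr p) * indicator ?B y) \<partial>M)"
      unfolding eq by (intro nn_integral_cong) (auto simp: indicator_def ennreal_mult)
    also have "\<dots> = ennreal (\<bar>a\<bar> powr p) * (\<integral>\<^sup>+y\<in>?B. ennreal (\<bar>f y * indicator \<Omega> y - c\<bar> powr p) \<partial>M)"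
      by (rule nn_integral_cmult) measurable
    also have "(\<integral>\<^sup>+y\<in>?B. ennreal (\<bar>f y * indicator \<Omega> y - c\<bar> powr p) \<partial>M) = (\<integral>\<^sup>+y\<in>?B. ennreal (\<bar>f y - c\<bar> powr p) \<partial>M)"
      by (intro nn_integral_cong) (auto simp: indicator_def)
    finally show ?thesis unfolding average_on_def by (simp add: ennreal_times_divide)
  qed
  moreover have "((\<lambda>r. ennreal (\<bar>a\<bar> powr p) * average_on \<mu> (ball x r \<inter> \<Omega>) (\<lambda>y. ennreal (\<bar>f y - c\<bar> powr p))) \<longlongrightarrow> ennreal (\<bar>a\<bar> powr p) * 0) (at_right 0)"
    by (intro ennreal_tendsto_cmult lim) simp
  moreover have "(\<lambda>y. a * (f y * indicator \<Omega> y)) \<in> borel_measurable M" by measurable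
  ultimately show ?thesis unfolding trace_at_def has_trace_value_def by (simp add: mult.assoc)
qed

text \<open>Together with linearity this makes the operator independent of the representative, also
  at boundary points where no trace exists.\<close>

lemma trace_at_AE_zero:
  assumes m: "(\<lambda>y. f y * indicator \<Omega> y) \<in> borel_measurable M" and z: "AE y in M. y \<in> \<Omega> \<longrightarrow> f y = 0"
  shows "trace_at x f 0"
proof -
  have "average_on \<mu> (ball x r \<inter> \<Omega>) (\<lambda>y. ennreal (\<bar>f y - 0\<bar> powr p)) = 0" for r
  proof -
    have "(\<integral>\<^sup>+y\<in>ball x r \<inter> \<Omega>. ennreal (\<bar>f y - 0\<bar> powr p) \<partial>M) = (\<integral>\<^sup>+y. 0 \<partial>M)"
    proof (rule nn_integral_cong_AE)
      show "AE y in M. ennreal (\<bar>f y - 0\<bar> powr p) * indicator (ball x r \<inter> \<Omega>) y = 0"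
        using z by eventually_elim (auto simp: indicator_def)
    qed
    then show ?thesis unfolding average_on_def by simp
  qed
  then show ?thesis unfolding trace_at_def has_trace_value_def using m by simp
qed

text \<open>By linearity \<open>c - d\<close> is a trace of the zero function. Balls about
  \<open>x\<close> meet \<Omega> in positive finite mass, so the mean of a constant is that constant
  and cannot tend to 0 unless it vanishes.\<close>

lemma trace_at_unique:
  assumes x: "x \<in> closure \<Omega>" and "trace_at x f c" "trace_at x f d"
  shows "c = d"
proof -
  have "trace_at x (\<lambda>y. f y + (-1) * f y) (c + (-1) * d)" by (intro trace_at_add trace_at_scale assms)
  then have lim: "((\<lambda>r. average_on \<mu> (ball x r \<inter> \<Omega>) (\<lambda>y. ennreal (\<bar>c - d\<bar> powr p))) \<longlongrightarrow> 0) (at_right 0)"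
    unfolding trace_at_def has_trace_value_def by (simp add: abs_minus_commute)
  have "\<forall>\<^sub>F r in at_right 0. average_on \<mu> (ball x r \<inter> \<Omega>) (\<lambda>y. ennreal (\<bar>c - d\<bar> powr p)) = ennreal (\<bar>c - d\<bar> powr p)"
    using eventually_at_right_less[of 0]
  proof eventually_elim
    case (elim r)
    have "0 < \<mu> (ball x r \<inter> \<Omega>)" "\<mu> (ball x r \<inter> \<Omega>) < \<infinity>" using ball_measure[OF x elim] by auto
    then show ?case
      unfolding average_on_def
      by (simp add: nn_integral_cmult_indicator emeasure_M ennreal_mult_divide_eq less_top)
  qed
  then have "((\<lambda>r. ennreal (\<bar>c - d\<bar> powr p)) \<longlongrightarrow> 0) (at_right (0::real))"
    using lim by (rule tendsto_cong[THEN iffD1])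
  then have "ennreal (\<bar>c - d\<bar> powr p) = 0" by (simp add: tendsto_const_iff)
  then show ?thesis by (simp add: ennreal_eq_0_iff)
qed

lemma linear_trace_operator:
  obtains T where "linear_boundary_operator \<Omega> \<mu> T"
    "\<And>u x c. u \<in> BV \<Omega> \<mu> \<Longrightarrow> x \<in> frontier \<Omega> \<Longrightarrow> has_trace_value \<Omega> \<mu> p u x c \<Longrightarrow> T u x = c"
proof -
  have "\<exists>F. (\<forall>a b f g. F (\<lambda>y. a * f y + b * g y) = a * F f + b * F g) \<and> (\<forall>f c. trace_at x f c \<longrightarrow> F f = c)"
    if x: "x \<in> frontier \<Omega>" for x
  proof -
    have xc: "x \<in> closure \<Omega>" using x unfolding frontier_def by blast
    have z: "trace_at x (\<lambda>_. 0) 0" by (rule trace_at_AE_zero) auto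
    show ?thesis
    proof (rule linear_relation_extension[of "trace_at x", OF z trace_at_add trace_at_scale trace_at_unique[OF xc]])
      fix F :: "('a \<Rightarrow> real) \<Rightarrow> real"
      assume a: "\<And>a b f g. F (\<lambda>y. a * f y + b * g y) = a * F f + b * F g" "\<And>f c. trace_at x f c \<Longrightarrow> F f = c"
      show ?thesis by (intro exI[of _ F] conjI allI impI a)
    qed
  qed
  then obtain F where F: "\<And>x a b f g. x \<in> frontier \<Omega> \<Longrightarrow> F x (\<lambda>y. a * f y + b * g y) = a * F x f + b * F x g"
    and Ft: "\<And>x f c. x \<in> frontier \<Omega> \<Longrightarrow> trace_at x f c \<Longrightarrow> F x f = c"
    by metis
  show ?thesis
  proof (rule that[of "\<lambda>u x. F x u"])
    have "F x u = F x v" if uv: "u \<in> BV \<Omega> \<mu>" "v \<in> BV \<Omega> \<mu>" "AE y in M. y \<in> \<Omega> \<longrightarrow> u y = v y" and x: "x \<in> frontier \<Omega>" for u v x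
    proof -
      note [measurable] = BV_measurable[OF uv(1)] BV_measurable[OF uv(2)]
      have "trace_at x (\<lambda>y. 1 * u y + (-1) * v y) 0"
      proof (rule trace_at_AE_zero)
        have "(\<lambda>y. u y * indicator \<Omega> y - v y * indicator \<Omega> y) \<in> borel_measurable M" by measurable
        then show "(\<lambda>y. (1 * u y + (-1) * v y) * indicator \<Omega> y) \<in> borel_measurable M" by (simp add: left_diff_distrib)
        show "AE y in M. y \<in> \<Omega> \<longrightarrow> 1 * u y + (-1) * v y = 0" using uv(3) by eventually_elim auto
      qed
      from Ft[OF x this] F[OF x, of 1 u "-1" v] show ?thesis by simp
    qed
    then show "linear_boundary_operator \<Omega> \<mu> (\<lambda>u x. F x u)"
      unfolding linear_boundary_operator_def using F by blast
    show "F x u = c" if "u \<in> BV \<Omega> \<mu>" "x \<in> frontier \<Omega>" "has_trace_value \<Omega> \<mu> p u x c" for u x c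
      using Ft[OF that(2)] BV_measurable[OF that(1)] that(3) unfolding trace_at_def by blast
  qed
qed

end

section \<open>The measure density condition\<close>

lemma codim1_content_empty: "codim1_content S \<nu> R {} = 0"
  using codim1_contentI[of "{}" "\<lambda>_. undefined" S "\<lambda>_. 1" R "{}" \<nu> 0] by simp

lemma codim1_hausdorff_null_mono:
  assumes "codim1_hausdorff S \<nu> B = 0" "A \<subseteq> B" shows "codim1_hausdorff S \<nu> A = 0"
  using assms codim1_content_mono[OF assms(2), of S \<nu>] unfolding codim1_hausdorff_eq_0_iff by (metis le_zero_eq)

lemma divide_ennreal_real: "0 < r \<Longrightarrow> a / ennreal r = ennreal (1 / r) * a"
  unfolding divide_ennreal_def by (simp add: inverse_ennreal mult.commute inverse_eq_divide)

section \<open>The ambient Poincare inequality near a negligible part of the boundary\<close>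

locale ambient_space = metric_outer_measure \<mu>
  for \<mu> :: "'a::metric_space set \<Rightarrow> ennreal" +
  fixes K CX LX :: real
  assumes K: "1 \<le> K" and ball_pos: "\<And>x r. 0 < r \<Longrightarrow> 0 < \<mu> (ball x r)" and ball_fin: "\<And>x r. 0 < r \<Longrightarrow> \<mu> (ball x r) < \<infinity>"
    and ball_double: "\<And>x r. 0 < r \<Longrightarrow> \<mu> (ball x (2 * r)) \<le> ennreal K * \<mu> (ball x r)"
    and CX: "0 < CX" and LX: "1 \<le> LX"
    and poincareX: "\<And>x r u g. 0 < r \<Longrightarrow> locally_integrable_on UNIV \<mu> u \<Longrightarrow> upper_gradient_on UNIV g u \<Longrightarrow>
        average_on \<mu> (ball x r) (\<lambda>y. e2ennreal \<bar>u y - ereal (mean_value \<mu> (ball x r) u)\<bar>)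
        \<le> ennreal (CX * r) * average_on \<mu> (ball x (LX * r)) g"
    and proper: "\<And>x r. compact (cball (x::'a) r)"
begin

lemma ball_iter: "0 < r \<Longrightarrow> \<mu> (ball x (2 ^ k * r)) \<le> ennreal (K ^ k) * \<mu> (ball x r)"
proof (induction k)
  case (Suc k)
  have "\<mu> (ball x (2 ^ Suc k * r)) \<le> ennreal K * \<mu> (ball x (2 ^ k * r))"
    using ball_double[of "2 ^ k * r" x] Suc(2) by (simp add: mult.assoc)
  also have "\<dots> \<le> ennreal K * (ennreal (K ^ k) * \<mu> (ball x r))" using Suc by (intro mult_left_mono) auto
  finally show ?case using K by (simp add: ennreal_mult mult.assoc)
qed simp

definition bump :: "'a \<Rightarrow> real \<Rightarrow> 'a \<Rightarrow> real" where
  "bump x r z = max 0 (min 1 (dist z x / r - 1))"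

lemma bump_range: "0 \<le> bump x r z" "bump x r z \<le> 1"
  unfolding bump_def by auto

lemma bump_inner: "0 < r \<Longrightarrow> dist z x < r \<Longrightarrow> bump x r z = 0"
proof -
  assume "0 < r" "dist z x < r"
  then have "dist z x / r \<le> 1" by simp
  then show ?thesis unfolding bump_def by (simp add: max_def)
qed

lemma bump_outer: "0 < r \<Longrightarrow> 2 * r \<le> dist z x \<Longrightarrow> bump x r z = 1"
proof -
  assume "0 < r" "2 * r \<le> dist z x"
  then have "2 \<le> dist z x / r" by (simp add: pos_le_divide_eq)
  then show ?thesis unfolding bump_def by simp
qed

lemma bump_lipschitz:
  assumes "0 < r" shows "\<bar>bump x r z - bump x r z'\<bar> \<le> (1 / r) * dist z z'"
proof -
  have "\<bar>bump x r z - bump x r z'\<bar> \<le> \<bar>dist z x / r - dist z' x / r\<bar>" unfolding bump_def by (auto simp: max_def min_def abs_if)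
  also have "dist z x / r - dist z' x / r = (1 / r) * (dist z x - dist z' x)" by (simp add: diff_divide_distrib)
  also have "\<bar>\<dots>\<bar> = (1 / r) * \<bar>dist z x - dist z' x\<bar>" using assms unfolding abs_mult by simp
  also have "\<dots> \<le> (1 / r) * dist z z'"
  proof (rule mult_left_mono)
    show "\<bar>dist z x - dist z' x\<bar> \<le> dist z z'"
      using dist_triangle[of z x z'] dist_triangle[of z' x z] by (simp add: dist_commute)
  qed (use assms in simp)
  finally show ?thesis .
qed

text \<open>The infinite part of the gradient makes the values of \<open>f\<close> outside \<open>cball y R\<close> irrelevant, so
  that only the boundary points inside this ball have to be covered.\<close>

lemma cut_off_gradient:
  fixes I :: "nat set"
  assumes opn: "open \<Omega>" and J: "finite J" "\<And>i. i \<in> J \<Longrightarrow> 0 < (r i :: real)"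
    and cover: "frontier \<Omega> \<inter> cball y R \<subseteq> (\<Union>i\<in>J. ball (x i) (r i))"
  defines "f \<equiv> \<lambda>z. indicator \<Omega> z * (\<Prod>i\<in>J. bump (x i) (r i) z)"
    and "g \<equiv> \<lambda>z. (\<Sum>i\<in>J. ennreal (1 / r i) * indicator (ball (x i) (3 * r i)) z) + \<infinity> * indicator (- cball y R) z"
  shows "upper_gradient_on UNIV g (\<lambda>z. ereal (f z))"
proof (rule upper_gradient_lipschitz)
  have "g \<in> borel_measurable borel" unfolding g_def
    by (intro borel_measurable_add borel_measurable_sum borel_measurable_times_ennreal borel_measurable_const borel_measurable_indicator) auto
  then show "g \<in> borel_measurable (restrict_space borel UNIV)" by (rule measurable_restrict_space1)
  fix z :: 'a
  have diff: "\<bar>(\<Prod>i\<in>J. bump (x i) (r i) a) - (\<Prod>i\<in>J. bump (x i) (r i) b)\<bar> \<le> (\<Sum>i\<in>J. \<bar>bump (x i) (r i) a - bump (x i) (r i) b\<bar>)" for a b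
    using norm_prod_diff[of J "\<lambda>i. bump (x i) (r i) a" "\<lambda>i. bump (x i) (r i) b"] bump_range by simp
  consider "z \<notin> cball y R" | "z \<in> frontier \<Omega>" "z \<in> cball y R" | "z \<notin> frontier \<Omega>" by blast
  then show "\<exists>V M. open V \<and> z \<in> V \<and> (\<forall>y\<in>V \<inter> UNIV. M \<le> g y) \<and>
      (\<forall>y\<in>V \<inter> UNIV. \<forall>z\<in>V \<inter> UNIV. ennreal \<bar>f y - f z\<bar> \<le> M * ennreal (dist y z))"
  proof cases
    case 1
    show ?thesis
    proof (intro exI[of _ "- cball y R"] exI[of _ "\<infinity>::ennreal"] conjI ballI)
      show "ennreal \<bar>f a - f b\<bar> \<le> \<infinity> * ennreal (dist a b)" for a b
        by (cases "a = b") (auto simp: ennreal_top_mult)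
    qed (use 1 in \<open>auto simp: g_def\<close>)
  next
    case 2
    \<comment> \<open>Around a covered boundary point one factor of the product vanishes, so the
      jump of the indicator is invisible and the constant 0 suffices.\<close>
    then obtain i where i: "i \<in> J" "z \<in> ball (x i) (r i)" using cover by blast
    have "f a = 0" if "a \<in> ball (x i) (r i)" for a
    proof -
      have "bump (x i) (r i) a = 0" using J(2)[OF i(1)] that by (intro bump_inner) (auto simp: dist_commute)
      then have "(\<Prod>i\<in>J. bump (x i) (r i) a) = 0" using J(1) i(1) by (metis prod_zero)
      then show ?thesis unfolding f_def by simp
    qed
    then show ?thesis using i(2) by (intro exI[of _ "ball (x i) (r i)"] exI[of _ "0::ennreal"]) auto
  next
    case 3
    obtain e0 where e0: "0 < e0" "ball z e0 \<subseteq> \<Omega> \<or> ball z e0 \<subseteq> - \<Omega>"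
    proof (cases "z \<in> \<Omega>")
      case True
      then show ?thesis using that opn open_contains_ball by blast
    next
      case False
      then have "z \<in> - closure \<Omega>" using 3 opn unfolding frontier_def by (simp add: interior_open)
      then obtain e where "0 < e" "ball z e \<subseteq> - closure \<Omega>" using open_contains_ball[of "- closure \<Omega>"] by auto
      then show ?thesis using that[of e] closure_subset[of \<Omega>] by blast
    qed
    \<comment> \<open>Only the bumps in \<open>J'\<close> vary near \<open>z\<close>. With
      \<open>e \<le> r i / 4\<close> the threshold \<open>5 / 2\<close> leaves room on both sides:
      points of \<open>ball z e\<close> stay within \<open>3 * r i\<close> of \<open>x i\<close> if
      \<open>i\<close> is in \<open>J'\<close>, and otherwise keep the distance
      \<open>2 * r i\<close>, where the bump is 1.\<close>
    define e where "e = Min (insert e0 ((\<lambda>i. r i / 4) ` J))"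
    have e: "0 < e" "e \<le> e0" unfolding e_def using J e0(1) by auto
    have e4: "e \<le> r i / 4" if "i \<in> J" for i unfolding e_def using J(1) that by (intro Min_le) auto
    define J' where "J' = {i\<in>J. dist z (x i) < 5 / 2 * r i}"
    have J': "finite J'" "J' \<subseteq> J" unfolding J'_def using J(1) by auto
    show ?thesis
    proof (intro exI[of _ "ball z e"] exI[of _ "\<Sum>i\<in>J'. ennreal (1 / r i)"] conjI ballI)
      show "open (ball z e)" "z \<in> ball z e" using e(1) by auto
      fix a assume a: "a \<in> ball z e \<inter> UNIV"
      have "(\<Sum>i\<in>J'. ennreal (1 / r i)) \<le> (\<Sum>i\<in>J'. ennreal (1 / r i) * indicator (ball (x i) (3 * r i)) a)"
      proof (rule sum_mono)
        fix i assume i: "i \<in> J'"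
        have "dist a (x i) < 3 * r i"
          using i a e4[of i] J(2)[of i] dist_triangle[of a "x i" z] unfolding J'_def by (auto simp: dist_commute)
        then show "ennreal (1 / r i) \<le> ennreal (1 / r i) * indicator (ball (x i) (3 * r i)) a" by (simp add: dist_commute)
      qed
      also have "\<dots> \<le> (\<Sum>i\<in>J. ennreal (1 / r i) * indicator (ball (x i) (3 * r i)) a)" by (rule sum_mono2[OF J(1) J'(2)]) simp
      also have "\<dots> \<le> g a" unfolding g_def by (simp add: add_increasing2)
      finally show "(\<Sum>i\<in>J'. ennreal (1 / r i)) \<le> g a" .
      fix b assume b: "b \<in> ball z e \<inter> UNIV"
      have "\<bar>f a - f b\<bar> \<le> \<bar>(\<Prod>i\<in>J. bump (x i) (r i) a) - (\<Prod>i\<in>J. bump (x i) (r i) b)\<bar>"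
      proof -
        have "a \<in> ball z e0" "b \<in> ball z e0" using a b e(2) by auto
        then have "a \<in> \<Omega> \<longleftrightarrow> b \<in> \<Omega>" using e0(2) by blast
        then show ?thesis unfolding f_def by (auto simp: indicator_def)
      qed
      also have "\<dots> \<le> (\<Sum>i\<in>J. \<bar>bump (x i) (r i) a - bump (x i) (r i) b\<bar>)" by (rule diff)
      also have "\<dots> = (\<Sum>i\<in>J'. \<bar>bump (x i) (r i) a - bump (x i) (r i) b\<bar>)"
      proof (rule sum.mono_neutral_right[OF J(1) J'(2)], rule ballI)
        fix i assume i: "i \<in> J - J'"
        have far: "2 * r i \<le> dist c (x i)" if "c \<in> ball z e" for c
          using i that e4[of i] J(2)[of i] dist_triangle[of z "x i" c] unfolding J'_def by auto
        have "bump (x i) (r i) a = 1" "bump (x i) (r i) b = 1" using a b i J(2) by (auto intro!: bump_outer far)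
        then show "\<bar>bump (x i) (r i) a - bump (x i) (r i) b\<bar> = 0" by simp
      qed
      also have "\<dots> \<le> (\<Sum>i\<in>J'. (1 / r i) * dist a b)" using J(2) J'(2) by (intro sum_mono bump_lipschitz) auto
      also have "\<dots> = (\<Sum>i\<in>J'. 1 / r i) * dist a b" by (simp add: sum_distrib_right)
      finally have "ennreal \<bar>f a - f b\<bar> \<le> ennreal ((\<Sum>i\<in>J'. 1 / r i) * dist a b)" by (rule ennreal_leI)
      also have "\<dots> = ennreal (\<Sum>i\<in>J'. 1 / r i) * ennreal (dist a b)"
        by (rule ennreal_mult) (use J' J(2) in \<open>auto intro!: sum_nonneg simp: less_imp_le\<close>)
      also have "ennreal (\<Sum>i\<in>J'. 1 / r i) = (\<Sum>i\<in>J'. ennreal (1 / r i))"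
        by (rule sum_ennreal[symmetric]) (use J' J(2) in \<open>auto simp: less_imp_le\<close>)
      finally show "ennreal \<bar>f a - f b\<bar> \<le> (\<Sum>i\<in>J'. ennreal (1 / r i)) * ennreal (dist a b)" .
    qed
  qed
qed

text \<open>The cut-off function is 0 off \<Omega> and 1 on \<Omega> away from the union
  \<open>W\<close> of the doubled balls. The mass of \<open>W\<close> and the integral of the
  gradient are both at most a constant times \<epsilon>, so \<open>poincare_separation\<close> makes
  one of the two parts as small as desired.\<close>

lemma null_frontier_dichotomy:
  assumes opn: "open \<Omega>" and r: "0 < r" and null: "codim1_hausdorff UNIV \<mu> (frontier \<Omega> \<inter> cball y (LX * r)) = 0"
  shows "min (\<mu> (ball y r - \<Omega>)) (\<mu> (ball y r \<inter> \<Omega>)) = 0"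
proof -
  define H where "H = frontier \<Omega> \<inter> cball y (LX * r)"
  have "compact (cball y (LX * r) \<inter> frontier \<Omega>)" by (rule compact_Int_closed[OF proper]) simp
  then have H: "compact H" unfolding H_def by (simp add: Int_commute)
  have ballM: "ball x s \<in> sets M" for x s by (rule open_M) simp
  have \<Omega>M: "\<Omega> \<in> sets M" by (rule open_M[OF opn])
  define E where "E = 2 * CX * r * K ^ 2 + K"
  have E: "0 < E" unfolding E_def using CX r K by (simp add: add_nonneg_pos)
  have key: "min (\<mu> (ball y r - \<Omega>)) (\<mu> (ball y r \<inter> \<Omega>)) \<le> ennreal E * ennreal \<epsilon>" if \<epsilon>: "0 < \<epsilon>" for \<epsilon>
  proof -
    have "codim1_content UNIV \<mu> 1 H = 0" using null unfolding codim1_hausdorff_eq_0_iff H_def by simp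
    then have "codim1_content UNIV \<mu> 1 H < ennreal \<epsilon>" using \<epsilon> by simp
    then obtain I :: "nat set" and x \<rho> where I: "\<And>i. i \<in> I \<Longrightarrow> x i \<in> UNIV \<and> 0 < \<rho> i \<and> \<rho> i \<le> 1"
      "H \<subseteq> (\<Union>i\<in>I. ball (x i) (\<rho> i) \<inter> UNIV)"
      and small: "\<And>F. finite F \<Longrightarrow> F \<subseteq> I \<Longrightarrow> (\<Sum>i\<in>F. \<mu> (ball (x i) (\<rho> i) \<inter> UNIV) / ennreal (\<rho> i)) < ennreal \<epsilon>"
      by (rule codim1_content_lessE) blast
    \<comment> \<open>Compactness leaves finitely many balls, which gives a finite product and a
      positive lower bound for the radii.\<close>
    obtain J where J: "J \<subseteq> I" "finite J" "H \<subseteq> (\<Union>i\<in>J. ball (x i) (\<rho> i))"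
      by (rule compactE_image[OF H, of I "\<lambda>i. ball (x i) (\<rho> i)"]) (use I in auto)
    have \<rho>: "0 < \<rho> i" "\<rho> i \<le> 1" if "i \<in> J" for i using I(1) J(1) that by auto
    define S where "S = (\<Sum>i\<in>J. ennreal (1 / \<rho> i) * \<mu> (ball (x i) (\<rho> i)))"
    have "S = (\<Sum>i\<in>J. \<mu> (ball (x i) (\<rho> i) \<inter> UNIV) / ennreal (\<rho> i))"
      unfolding S_def by (intro sum.cong refl) (simp add: \<rho> divide_ennreal_real)
    then have S: "S \<le> ennreal \<epsilon>" using small[OF J(2,1)] by simp
    define f where "f = (\<lambda>z. indicator \<Omega> z * (\<Prod>i\<in>J. bump (x i) (\<rho> i) z))"
    define g where "g = (\<lambda>z. (\<Sum>i\<in>J. ennreal (1 / \<rho> i) * indicator (ball (x i) (3 * \<rho> i)) z) + \<infinity> * indicator (- cball y (LX * r)) z :: ennreal)"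
    have ug: "upper_gradient_on UNIV g (\<lambda>z. ereal (f z))"
      unfolding f_def g_def by (rule cut_off_gradient[OF opn J(2) \<rho>(1) J(3)[unfolded H_def]])
    have fm[measurable]: "f \<in> borel_measurable M"
    proof -
      have "(\<lambda>z. \<Prod>i\<in>J. bump (x i) (\<rho> i) z) \<in> borel_measurable borel"
      proof (intro borel_measurable_prod)
        fix i assume "i \<in> J"
        then show "bump (x i) (\<rho> i) \<in> borel_measurable borel"
          using \<rho>(1)[of i] unfolding bump_def by (intro borel_measurable_continuous_onI continuous_intros) auto
      qed
      then show ?thesis unfolding f_def using \<Omega>M by (intro borel_measurable_times borel_measurable_indicator M_borel)
    qed
    have f01: "0 \<le> f z \<and> f z \<le> 1" for z
      unfolding f_def using bump_range by (auto simp: indicator_def intro!: prod_nonneg prod_le_1)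
    have sep: "min (\<mu> (ball y r \<inter> UNIV \<inter> {z. f z \<le> 0})) (\<mu> (ball y r \<inter> UNIV \<inter> {z. 1 \<le> f z})) \<le>
      ennreal (2 * CX * r) * (\<integral>\<^sup>+z\<in>ball y (LX * r) \<inter> UNIV. g z \<partial>M)"
      by (rule poincare_separation) (use poincareX CX LX ball_pos ball_fin f01 ug r fm in \<open>auto simp: fun_eq_iff\<close>)
    have fM: "{z. 1 \<le> f z} \<in> sets M" "{z. f z \<le> 0} \<in> sets M"
    proof -
      have "{z\<in>space M. 1 \<le> f z} \<in> sets M" "{z\<in>space M. f z \<le> 0} \<in> sets M" by measurable
      then show "{z. 1 \<le> f z} \<in> sets M" "{z. f z \<le> 0} \<in> sets M" by (simp_all add: space_M)
    qed
    have int: "(\<integral>\<^sup>+z\<in>ball y (LX * r) \<inter> UNIV. g z \<partial>M) \<le> ennreal (K ^ 2) * ennreal \<epsilon>"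
    proof -
      have "(\<integral>\<^sup>+z\<in>ball y (LX * r) \<inter> UNIV. g z \<partial>M) \<le> (\<integral>\<^sup>+z. (\<Sum>i\<in>J. ennreal (1 / \<rho> i) * indicator (ball (x i) (3 * \<rho> i)) z) \<partial>M)"
        unfolding g_def by (intro nn_integral_mono) (auto simp: indicator_def)
      also have "\<dots> = (\<Sum>i\<in>J. \<integral>\<^sup>+z. ennreal (1 / \<rho> i) * indicator (ball (x i) (3 * \<rho> i)) z \<partial>M)"
        using ballM by (intro nn_integral_sum) auto
      also have "\<dots> = (\<Sum>i\<in>J. ennreal (1 / \<rho> i) * \<mu> (ball (x i) (3 * \<rho> i)))"
        using ballM by (intro sum.cong refl) (simp add: nn_integral_cmult_indicator emeasure_M)
      also have "\<dots> \<le> (\<Sum>i\<in>J. ennreal (1 / \<rho> i) * (ennreal (K ^ 2) * \<mu> (ball (x i) (\<rho> i))))"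
      proof (intro sum_mono mult_left_mono)
        fix i assume i: "i \<in> J"
        have "\<mu> (ball (x i) (3 * \<rho> i)) \<le> \<mu> (ball (x i) (2 ^ 2 * \<rho> i))"
          using \<rho>[OF i] by (intro mono ballM subset_ball) auto
        also have "\<dots> \<le> ennreal (K ^ 2) * \<mu> (ball (x i) (\<rho> i))" by (rule ball_iter[OF \<rho>(1)[OF i]])
        finally show "\<mu> (ball (x i) (3 * \<rho> i)) \<le> ennreal (K ^ 2) * \<mu> (ball (x i) (\<rho> i))" .
      qed simp
      also have "\<dots> = ennreal (K ^ 2) * S" unfolding S_def by (simp add: sum_distrib_left mult.left_commute)
      also have "\<dots> \<le> ennreal (K ^ 2) * ennreal \<epsilon>" using S by (rule mult_left_mono) simp
      finally show ?thesis .
    qed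
    define W where "W = (\<Union>i\<in>J. ball (x i) (2 * \<rho> i))"
    have WM: "W \<in> sets M" unfolding W_def by (intro open_M) auto
    have W: "\<mu> W \<le> ennreal K * ennreal \<epsilon>"
    proof -
      have "\<mu> W = emeasure M W" using WM by (simp add: emeasure_M)
      also have "\<dots> \<le> (\<Sum>i\<in>J. emeasure M (ball (x i) (2 * \<rho> i)))"
        unfolding W_def using ballM J(2) by (intro emeasure_subadditive_finite) auto
      also have "\<dots> \<le> (\<Sum>i\<in>J. ennreal K * (ennreal (1 / \<rho> i) * \<mu> (ball (x i) (\<rho> i))))"
      proof (rule sum_mono)
        fix i assume i: "i \<in> J"
        \<comment> \<open>The content was taken at scale 1 for this step: with radii at most 1,
          masses are bounded by masses divided by radii.\<close>
        have "1 \<le> 1 / \<rho> i" using \<rho>[OF i] by simp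
        then have "1 \<le> ennreal (1 / \<rho> i)" using ennreal_leI by fastforce
        then have "1 * \<mu> (ball (x i) (\<rho> i)) \<le> ennreal (1 / \<rho> i) * \<mu> (ball (x i) (\<rho> i))" by (rule mult_right_mono) simp
        then have "ennreal K * \<mu> (ball (x i) (\<rho> i)) \<le> ennreal K * (ennreal (1 / \<rho> i) * \<mu> (ball (x i) (\<rho> i)))"
          by (intro mult_left_mono) auto
        then show "emeasure M (ball (x i) (2 * \<rho> i)) \<le> ennreal K * (ennreal (1 / \<rho> i) * \<mu> (ball (x i) (\<rho> i)))"
          using ball_double[OF \<rho>(1)[OF i], of "x i"] ballM by (simp add: emeasure_M)
      qed
      also have "\<dots> = ennreal K * S" unfolding S_def by (simp add: sum_distrib_left)
      also have "\<dots> \<le> ennreal K * ennreal \<epsilon>" using S by (rule mult_left_mono) simp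
      finally show ?thesis .
    qed
    have a: "\<mu> (ball y r - \<Omega>) \<le> \<mu> (ball y r \<inter> UNIV \<inter> {z. f z \<le> 0})"
      using ballM \<Omega>M fM by (intro mono) (auto simp: f_def)
    have b: "\<mu> (ball y r \<inter> \<Omega>) \<le> \<mu> (ball y r \<inter> UNIV \<inter> {z. 1 \<le> f z}) + \<mu> W"
    proof -
      have sub: "ball y r \<inter> \<Omega> \<subseteq> (ball y r \<inter> UNIV \<inter> {z. 1 \<le> f z}) \<union> W"
      proof
        fix z assume z: "z \<in> ball y r \<inter> \<Omega>"
        show "z \<in> (ball y r \<inter> UNIV \<inter> {z. 1 \<le> f z}) \<union> W"
        proof (cases "z \<in> W")
          case False
          have "bump (x i) (\<rho> i) z = 1" if i: "i \<in> J" for i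
            using False i \<rho>(1)[OF i] unfolding W_def by (intro bump_outer) (auto simp: dist_commute not_less)
          then have "f z = 1" using z unfolding f_def by simp
          then show ?thesis using z by simp
        qed simp
      qed
      have "\<mu> (ball y r \<inter> \<Omega>) \<le> \<mu> ((ball y r \<inter> UNIV \<inter> {z. 1 \<le> f z}) \<union> W)"
        using ballM \<Omega>M fM WM sub by (intro mono) auto
      also have "\<dots> \<le> \<mu> (ball y r \<inter> UNIV \<inter> {z. 1 \<le> f z}) + \<mu> W"
        using emeasure_subadditive[of "ball y r \<inter> UNIV \<inter> {z. 1 \<le> f z}" M W] ballM fM WM by (simp add: emeasure_M)
      finally show ?thesis .
    qed
    have "min (\<mu> (ball y r - \<Omega>)) (\<mu> (ball y r \<inter> \<Omega>)) \<le>
      min (\<mu> (ball y r \<inter> UNIV \<inter> {z. f z \<le> 0}) + \<mu> W) (\<mu> (ball y r \<inter> UNIV \<inter> {z. 1 \<le> f z}) + \<mu> W)"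
      by (rule min.mono[OF order_trans[OF a] b]) simp
    also have "\<dots> = min (\<mu> (ball y r \<inter> UNIV \<inter> {z. f z \<le> 0})) (\<mu> (ball y r \<inter> UNIV \<inter> {z. 1 \<le> f z})) + \<mu> W"
      by (auto simp: min_def intro: antisym add_right_mono)
    also have "\<dots> \<le> ennreal (2 * CX * r) * (ennreal (K ^ 2) * ennreal \<epsilon>) + ennreal K * ennreal \<epsilon>"
      by (rule add_mono[OF order_trans[OF sep mult_left_mono[OF int]] W]) simp
    also have "\<dots> = ennreal E * ennreal \<epsilon>"
      unfolding E_def using CX r K \<epsilon> by (simp add: ennreal_mult[symmetric] ennreal_plus[symmetric] distrib_right mult.assoc del: ennreal_plus)
    finally show ?thesis .
  qed
  have "min (\<mu> (ball y r - \<Omega>)) (\<mu> (ball y r \<inter> \<Omega>)) \<le> 0"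
  proof (rule ennreal_le_epsilon)
    fix e :: real assume "0 < e"
    then show "min (\<mu> (ball y r - \<Omega>)) (\<mu> (ball y r \<inter> \<Omega>)) \<le> 0 + ennreal e"
      using key[of "e / E"] E by (simp flip: ennreal_mult)
  qed
  then show ?thesis by simp
qed

end

section \<open>From density at the boundary to the whole domain\<close>

context ambient_space begin

text \<open>Either a boundary point satisfying the condition lies within \<open>r / 2\<close> of
  \<open>y\<close> and passes its density on, or \<open>null_frontier_dichotomy\<close> applies at
  radius \<open>r / (4 * LX)\<close>. There the alternative that \<Omega> has no mass is excluded,
  so the small ball lies in \<Omega> up to a null set, and doubling returns to radius
  \<open>r\<close>. The two cases give the two terms of \<open>c'\<close>.\<close>

lemma density_in_domain:
  assumes opn: "open \<Omega>" and c: "0 < c"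
    and pos\<Omega>: "\<And>y r. y \<in> \<Omega> \<Longrightarrow> 0 < r \<Longrightarrow> 0 < \<mu> (ball y r \<inter> \<Omega>)"
    and null: "codim1_hausdorff UNIV \<mu>
        {x\<in>frontier \<Omega>. \<not> (\<forall>r. 0 < r \<and> r < d \<longrightarrow> ennreal c * \<mu> (ball x r) \<le> \<mu> (ball x r \<inter> \<Omega>))} = 0"
  obtains c' where "0 < c'" "\<And>y r. y \<in> \<Omega> \<Longrightarrow> 0 < r \<Longrightarrow> r \<le> d \<Longrightarrow> ennreal c' * \<mu> (ball y r) \<le> \<mu> (ball y r \<inter> \<Omega>)"
proof -
  obtain k :: nat where k: "4 * LX < 2 ^ k" using real_arch_pow[of 2] by auto
  define c' where "c' = min (c / K ^ 2) (1 / K ^ k)"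
  have c': "0 < c'" "c' * K ^ 2 \<le> c" "c' * K ^ k \<le> 1"
  proof -
    show "0 < c'" unfolding c'_def using c K by simp
    have "c' * K ^ 2 \<le> c / K ^ 2 * K ^ 2" unfolding c'_def by (intro mult_right_mono) auto
    then show "c' * K ^ 2 \<le> c" using K by simp
    have "c' * K ^ k \<le> 1 / K ^ k * K ^ k" unfolding c'_def using K by (intro mult_right_mono) auto
    then show "c' * K ^ k \<le> 1" using K by simp
  qed
  have ballM: "ball x s \<in> sets M" "ball x s \<inter> \<Omega> \<in> sets M" for x s using opn by (auto intro: open_M)
  have \<Omega>M: "\<Omega> \<in> sets M" by (rule open_M[OF opn])
  show ?thesis
  proof (rule that[OF c'(1)])
    fix y and r :: real assume y: "y \<in> \<Omega>" and r: "0 < r" "r \<le> d"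
    let ?N = "{x\<in>frontier \<Omega>. \<not> (\<forall>r. 0 < r \<and> r < d \<longrightarrow> ennreal c * \<mu> (ball x r) \<le> \<mu> (ball x r \<inter> \<Omega>))}"
    show "ennreal c' * \<mu> (ball y r) \<le> \<mu> (ball y r \<inter> \<Omega>)"
    proof (cases "\<exists>z. z \<in> frontier \<Omega> \<and> dist y z < r / 2 \<and> z \<notin> ?N")
      case True
      then obtain z where z: "z \<in> frontier \<Omega>" "dist y z < r / 2" "z \<notin> ?N" by blast
      have "\<mu> (ball y r) \<le> \<mu> (ball z (2 ^ 2 * (r / 2)))"
      proof (intro mono ballM subsetI)
        fix w assume "w \<in> ball y r"
        then show "w \<in> ball z (2 ^ 2 * (r / 2))" using dist_triangle[of z w y] z(2) r(1) by (auto simp: dist_commute)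
      qed
      also have "\<dots> \<le> ennreal (K ^ 2) * \<mu> (ball z (r / 2))" using r(1) by (intro ball_iter) simp
      finally have "ennreal c' * \<mu> (ball y r) \<le> ennreal c' * (ennreal (K ^ 2) * \<mu> (ball z (r / 2)))" by (rule mult_left_mono) simp
      also have "\<dots> = ennreal (c' * K ^ 2) * \<mu> (ball z (r / 2))" using c'(1) K by (simp add: ennreal_mult mult.assoc)
      also have "\<dots> \<le> ennreal c * \<mu> (ball z (r / 2))" using c'(2) by (intro mult_right_mono ennreal_leI) auto
      also have "\<dots> \<le> \<mu> (ball z (r / 2) \<inter> \<Omega>)" using z(1,3) r by simp
      also have "\<dots> \<le> \<mu> (ball y r \<inter> \<Omega>)"
      proof (intro mono ballM subsetI)
        fix w assume "w \<in> ball z (r / 2) \<inter> \<Omega>"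
        then show "w \<in> ball y r \<inter> \<Omega>" using dist_triangle[of y w z] z(2) by auto
      qed
      finally show ?thesis .
    next
      case False
      define s where "s = r / (4 * LX)"
      have s: "0 < s" "LX * s = r / 4" unfolding s_def using r LX by auto
      have sr: "s \<le> r" "r \<le> 2 ^ k * s"
      proof -
        have "1 * s \<le> LX * s" using LX s(1) by (intro mult_right_mono) auto
        then show "s \<le> r" using s(2) r(1) by simp
        have "4 * LX * s \<le> 2 ^ k * s" using k s(1) by (intro mult_right_mono) auto
        then show "r \<le> 2 ^ k * s" using s(2) by simp
      qed
      have "frontier \<Omega> \<inter> cball y (LX * s) \<subseteq> ?N" using False r(1) unfolding s(2) by fastforce
      then have "codim1_hausdorff UNIV \<mu> (frontier \<Omega> \<inter> cball y (LX * s)) = 0" by (rule codim1_hausdorff_null_mono[OF null])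
      from null_frontier_dichotomy[OF opn s(1) this] have out: "\<mu> (ball y s - \<Omega>) = 0"
        using pos\<Omega>[OF y s(1)] by (auto simp: min_def split: if_splits)
      have "\<mu> (ball y s) = emeasure M ((ball y s \<inter> \<Omega>) \<union> (ball y s - \<Omega>))" using ballM by (simp add: emeasure_M Int_Diff_Un)
      also have "\<dots> \<le> emeasure M (ball y s \<inter> \<Omega>) + emeasure M (ball y s - \<Omega>)"
        using ballM \<Omega>M by (intro emeasure_subadditive) auto
      also have "\<dots> = \<mu> (ball y s \<inter> \<Omega>)" using ballM \<Omega>M out by (simp add: emeasure_M)
      also have "\<dots> \<le> \<mu> (ball y r \<inter> \<Omega>)" using sr(1) by (intro mono ballM) auto
      finally have in\<Omega>: "\<mu> (ball y s) \<le> \<mu> (ball y r \<inter> \<Omega>)" .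
      have "\<mu> (ball y r) \<le> \<mu> (ball y (2 ^ k * s))" using sr(2) by (intro mono ballM subset_ball)
      also have "\<dots> \<le> ennreal (K ^ k) * \<mu> (ball y s)" by (rule ball_iter[OF s(1)])
      finally have "ennreal c' * \<mu> (ball y r) \<le> ennreal c' * (ennreal (K ^ k) * \<mu> (ball y s))" by (rule mult_left_mono) simp
      also have "\<dots> = ennreal (c' * K ^ k) * \<mu> (ball y s)" using c'(1) K by (simp add: ennreal_mult mult.assoc)
      also have "\<dots> \<le> ennreal 1 * \<mu> (ball y s)" using c'(3) by (intro mult_right_mono ennreal_leI) auto
      also have "\<dots> \<le> \<mu> (ball y r \<inter> \<Omega>)" using in\<Omega> by simp
      finally show ?thesis .
    qed
  qed
qed

text \<open>Up to the diameter, density transfers the ambient bound. For larger \<open>r\<close> the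
  ball about \<open>y\<close> contains \<Omega>, and the quotient is at least 1.\<close>

lemma mass_bound_domain:
  assumes opn: "open \<Omega>" and bdd: "bounded \<Omega>" and c: "0 < c" and Q: "0 < Q"
    and pos\<Omega>: "\<And>y r. y \<in> \<Omega> \<Longrightarrow> 0 < r \<Longrightarrow> 0 < \<mu> (ball y r \<inter> \<Omega>)"
    and dens: "\<And>y r. y \<in> \<Omega> \<Longrightarrow> 0 < r \<Longrightarrow> r \<le> diameter \<Omega> \<Longrightarrow> ennreal c * \<mu> (ball y r) \<le> \<mu> (ball y r \<inter> \<Omega>)"
    and mass: "mass_bound_exponent UNIV \<mu> Q"
  shows "mass_bound_exponent \<Omega> \<mu> Q"
proof -
  obtain C where C: "1 \<le> C" and mb: "\<And>x y r R. 0 < r \<Longrightarrow> r \<le> R \<Longrightarrow> y \<in> ball x R \<Longrightarrow>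
        ennreal (inverse C * (r / R) powr Q) \<le> \<mu> (ball y r) / \<mu> (ball x R)"
    using mass unfolding mass_bound_exponent_def by auto
  define D where "D = max 1 (C / c)"
  have D: "1 \<le> D" "inverse D \<le> c * inverse C"
  proof -
    show "1 \<le> D" unfolding D_def by simp
    have "inverse D \<le> inverse (C / c)" unfolding D_def using C c by (intro le_imp_inverse_le) auto
    then show "inverse D \<le> c * inverse C" by (simp add: field_simps)
  qed
  have ballM: "ball x s \<in> sets M" "ball x s \<inter> \<Omega> \<in> sets M" for x s using opn by (auto intro: open_M)
  show ?thesis
    unfolding mass_bound_exponent_def
  proof (intro exI[of _ D] conjI D(1) ballI allI impI)
    fix x y and r R :: real assume x: "x \<in> \<Omega>" and y: "y \<in> \<Omega>" and *: "0 < r \<and> r \<le> R \<and> y \<in> ball x R"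
    have R: "0 < R" using * by simp
    have finR: "\<mu> (ball x R \<inter> \<Omega>) < \<infinity>"
      using mono[OF ballM(2) ballM(1), of x R x R] ball_fin[OF R, of x] by (simp add: order_le_less_trans)
    show "ennreal (inverse D * (r / R) powr Q) \<le> \<mu> (ball y r \<inter> \<Omega>) / \<mu> (ball x R \<inter> \<Omega>)"
    proof (cases "r \<le> diameter \<Omega>")
      case True
      have "inverse D * (r / R) powr Q \<le> c * inverse C * (r / R) powr Q" using D(2) by (rule mult_right_mono) simp
      then have "ennreal (inverse D * (r / R) powr Q) \<le> ennreal (c * (inverse C * (r / R) powr Q))" by (intro ennreal_leI) (simp add: mult.assoc)
      also have "\<dots> = ennreal c * ennreal (inverse C * (r / R) powr Q)" using c C by (intro ennreal_mult) auto
      also have "\<dots> \<le> ennreal c * (\<mu> (ball y r) / \<mu> (ball x R))" using * by (intro mult_left_mono mb) auto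
      also have "\<dots> = (ennreal c * \<mu> (ball y r)) / \<mu> (ball x R)" by (rule ennreal_times_divide)
      also have "\<dots> \<le> \<mu> (ball y r \<inter> \<Omega>) / \<mu> (ball x R)"
        using dens[OF y _ True] * by (intro divide_right_mono_ennreal) simp
      also have "\<dots> \<le> \<mu> (ball y r \<inter> \<Omega>) / \<mu> (ball x R \<inter> \<Omega>)"
      proof (rule divide_le_posI_ennreal[OF ball_pos[OF R]])
        have "\<mu> (ball y r \<inter> \<Omega>) = \<mu> (ball y r \<inter> \<Omega>) / \<mu> (ball x R \<inter> \<Omega>) * \<mu> (ball x R \<inter> \<Omega>)"
          using pos\<Omega>[OF x R] finR by (simp add: ennreal_divide_times ennreal_divide_self less_top)
        also have "\<dots> \<le> \<mu> (ball y r \<inter> \<Omega>) / \<mu> (ball x R \<inter> \<Omega>) * \<mu> (ball x R)"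
          by (intro mult_left_mono mono ballM) auto
        finally show "\<mu> (ball y r \<inter> \<Omega>) \<le> \<mu> (ball x R) * (\<mu> (ball y r \<inter> \<Omega>) / \<mu> (ball x R \<inter> \<Omega>))" by (simp add: mult.commute)
      qed
      finally show ?thesis .
    next
      case False
      have "\<Omega> \<subseteq> ball y r"
      proof
        fix z assume "z \<in> \<Omega>"
        then show "z \<in> ball y r" using diameter_bounded_bound[OF bdd y, of z] False by simp
      qed
      then have "\<mu> (ball x R \<inter> \<Omega>) \<le> \<mu> (ball y r \<inter> \<Omega>)" by (intro mono ballM) auto
      then have "\<mu> (ball x R \<inter> \<Omega>) / \<mu> (ball x R \<inter> \<Omega>) \<le> \<mu> (ball y r \<inter> \<Omega>) / \<mu> (ball x R \<inter> \<Omega>)" by (rule divide_right_mono_ennreal)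
      moreover have "\<mu> (ball x R \<inter> \<Omega>) / \<mu> (ball x R \<inter> \<Omega>) = 1"
        using pos\<Omega>[OF x R] finR by (simp add: ennreal_divide_self less_top)
      moreover have "inverse D * (r / R) powr Q \<le> 1 * 1"
      proof (rule mult_mono)
        show "inverse D \<le> 1" using D(1) by (simp add: inverse_le_1_iff)
        show "(r / R) powr Q \<le> 1" using * R Q by (intro powr_le1) auto
      qed auto
      then have "ennreal (inverse D * (r / R) powr Q) \<le> 1" by (simp add: ennreal_le_1)
      ultimately show ?thesis by (metis order_trans)
    qed
  qed
qed

text \<open>The same covers serve in both spaces: for a centre in the closure and a radius at most
  \<open>d\<close>, density at a nearby point of \<Omega> bounds the ambient mass of the ball by its
  mass in \<Omega>. Hence the scale \<open>min R d\<close>.\<close>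

lemma hausdorff_null_from_closure:
  assumes opn: "open \<Omega>" and c: "0 < c" and d: "0 < d"
    and dens: "\<And>y r. y \<in> \<Omega> \<Longrightarrow> 0 < r \<Longrightarrow> r \<le> d \<Longrightarrow> ennreal c * \<mu> (ball y r) \<le> \<mu> (ball y r \<inter> \<Omega>)"
    and null: "codim1_hausdorff (closure \<Omega>) (zero_extension \<Omega> \<mu>) A = 0"
  shows "codim1_hausdorff UNIV \<mu> A = 0"
  unfolding codim1_hausdorff_eq_0_iff
proof (intro allI impI)
  fix R :: real assume R: "0 < R"
  define B where "B = K ^ 2 / c"
  have B: "0 < B" unfolding B_def using K c by simp
  have ballM: "ball x s \<in> sets M" "ball x s \<inter> \<Omega> \<in> sets M" for x s using opn by (auto intro: open_M)
  have comp: "\<mu> (ball x s) \<le> ennreal B * \<mu> (ball x s \<inter> \<Omega>)" if x: "x \<in> closure \<Omega>" and s: "0 < s" "s \<le> d" for x s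
  proof -
    obtain y where y: "y \<in> \<Omega>" "dist y x < s / 2" using x s(1) unfolding closure_approachable by (meson half_gt_zero)
    have "\<mu> (ball x s) \<le> \<mu> (ball y (2 ^ 2 * (s / 2)))"
    proof (intro mono ballM subsetI)
      fix w assume "w \<in> ball x s"
      then show "w \<in> ball y (2 ^ 2 * (s / 2))" using dist_triangle[of y w x] y(2) s(1) by auto
    qed
    also have "\<dots> \<le> ennreal (K ^ 2) * \<mu> (ball y (s / 2))" using s(1) by (intro ball_iter) simp
    also have "\<dots> = ennreal B * (ennreal c * \<mu> (ball y (s / 2)))"
    proof -
      have "ennreal (K ^ 2) = ennreal B * ennreal c" using B c unfolding B_def by (subst ennreal_mult[symmetric]) auto
      then show ?thesis by (simp add: mult.assoc)
    qed
    also have "\<dots> \<le> ennreal B * \<mu> (ball y (s / 2) \<inter> \<Omega>)" using y(1) s by (intro mult_left_mono dens) auto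
    also have "\<dots> \<le> ennreal B * \<mu> (ball x s \<inter> \<Omega>)"
    proof (intro mult_left_mono mono ballM subsetI)
      fix w assume "w \<in> ball y (s / 2) \<inter> \<Omega>"
      then show "w \<in> ball x s \<inter> \<Omega>" using dist_triangle[of x w y] y(2) by (auto simp: dist_commute)
    qed simp
    finally show ?thesis .
  qed
  have "codim1_content UNIV \<mu> (min R d) A \<le> 0"
  proof (rule ennreal_le_epsilon)
    fix e :: real assume e: "0 < e"
    have "codim1_content (closure \<Omega>) (zero_extension \<Omega> \<mu>) (min R d) A < ennreal (e / B)"
      using null R d e B unfolding codim1_hausdorff_eq_0_iff by simp
    then obtain I :: "nat set" and x r where I: "\<And>i. i \<in> I \<Longrightarrow> x i \<in> closure \<Omega> \<and> 0 < r i \<and> r i \<le> min R d"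
      "A \<subseteq> (\<Union>i\<in>I. ball (x i) (r i) \<inter> closure \<Omega>)"
      and small: "\<And>F. finite F \<Longrightarrow> F \<subseteq> I \<Longrightarrow> (\<Sum>i\<in>F. zero_extension \<Omega> \<mu> (ball (x i) (r i) \<inter> closure \<Omega>) / ennreal (r i)) < ennreal (e / B)"
      by (rule codim1_content_lessE) blast
    have "codim1_content UNIV \<mu> (min R d) A \<le> ennreal e"
    proof (rule codim1_contentI)
      show "x i \<in> UNIV \<and> 0 < r i \<and> r i \<le> min R d" if "i \<in> I" for i using I(1)[OF that] by simp
      show "A \<subseteq> (\<Union>i\<in>I. ball (x i) (r i) \<inter> UNIV)" using I(2) by blast
      fix F assume F: "finite F" "F \<subseteq> I"
      have "(\<Sum>i\<in>F. \<mu> (ball (x i) (r i) \<inter> UNIV) / ennreal (r i)) \<le>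
         (\<Sum>i\<in>F. ennreal B * (zero_extension \<Omega> \<mu> (ball (x i) (r i) \<inter> closure \<Omega>) / ennreal (r i)))"
      proof (rule sum_mono)
        fix i assume "i \<in> F"
        then have i: "x i \<in> closure \<Omega>" "0 < r i" "r i \<le> d" using I(1)[of i] F(2) by auto
        have "ball (x i) (r i) \<inter> closure \<Omega> \<inter> \<Omega> = ball (x i) (r i) \<inter> \<Omega>" using closure_subset[of \<Omega>] by blast
        then show "\<mu> (ball (x i) (r i) \<inter> UNIV) / ennreal (r i) \<le> ennreal B * (zero_extension \<Omega> \<mu> (ball (x i) (r i) \<inter> closure \<Omega>) / ennreal (r i))"
          using divide_right_mono_ennreal[OF comp[OF i]] unfolding zero_extension_def by (simp add: ennreal_times_divide)
      qed
      also have "\<dots> = ennreal B * (\<Sum>i\<in>F. zero_extension \<Omega> \<mu> (ball (x i) (r i) \<inter> closure \<Omega>) / ennreal (r i))"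
        by (simp add: sum_distrib_left)
      also have "\<dots> \<le> ennreal B * ennreal (e / B)" using small[OF F] by (intro mult_left_mono) auto
      also have "\<dots> = ennreal e" using B e by (simp flip: ennreal_mult)
      finally show "(\<Sum>i\<in>F. \<mu> (ball (x i) (r i) \<inter> UNIV) / ennreal (r i)) \<le> ennreal e" .
    qed
    then show "codim1_content UNIV \<mu> (min R d) A \<le> 0 + ennreal e" by simp
  qed
  moreover have "codim1_content UNIV \<mu> R A \<le> codim1_content UNIV \<mu> (min R d) A" by (rule codim1_content_antimono) simp
  ultimately show "codim1_content UNIV \<mu> R A = 0" by simp
qed

end

text \<open>A set of diameter 0 has at most one point and is closed; being open too, it has no
  boundary. A positive diameter provides the radii up to which density can be used.\<close>

lemma frontier_diameter_pos:
  fixes \<Omega> :: "'a::metric_space set"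
  assumes "open \<Omega>" "bounded \<Omega>" "frontier \<Omega> \<noteq> {}"
  shows "0 < diameter \<Omega>"
proof (rule ccontr)
  assume "\<not> 0 < diameter \<Omega>"
  have eq: "x = y" if "x \<in> \<Omega>" "y \<in> \<Omega>" for x y proof -
    have "dist x y \<le> 0" using diameter_bounded_bound[OF assms(2) that] \<open>\<not> 0 < diameter \<Omega>\<close> by linarith
    then show ?thesis by simp
  qed
  have "finite \<Omega>"
  proof (cases "\<Omega> = {}")
    case False
    then obtain x where "x \<in> \<Omega>" by blast
    then have "\<Omega> \<subseteq> {x}" using eq by blast
    then show ?thesis by (rule finite_subset) simp
  qed simp
  then have "closed \<Omega>" by (rule finite_imp_closed)
  then show False using assms(1,3) unfolding frontier_def by (simp add: interior_open)
qed

text \<open>The first conclusion is tied to an exponent of \<Omega> itself, because the covering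
  estimates compare balls in the measure restricted to \<Omega>. Under measure density the ambient
  exponent is one for \<Omega>, and the second conclusion is the first one carried over to the
  ambient Hausdorff measure.\<close>

theorem theorem3p4:
  fixes \<mu> :: "'a::complete_space set \<Rightarrow> ennreal" and \<Omega> :: "'a set" and Q :: real
  assumes "borel_regular_outer_measure \<mu>"
    and "doubling_on UNIV \<mu>"
    and "poincare_1_1_on UNIV \<mu>"
    and "Q > 1" and "mass_bound_exponent UNIV \<mu> Q"
    and "open \<Omega>" and "bounded \<Omega>"
    and "poincare_1_1_on \<Omega> \<mu>"
    and "doubling_on \<Omega> \<mu>"
  shows "\<exists>T. linear_boundary_operator \<Omega> \<mu> T \<and>
    (mass_bound_exponent \<Omega> \<mu> Q \<longrightarrow>
      (\<forall>u\<in>BV \<Omega> \<mu>. codim1_hausdorff (closure \<Omega>) (zero_extension \<Omega> \<mu>)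
        {x \<in> frontier \<Omega>. \<not> has_trace_value \<Omega> \<mu> (Q / (Q - 1)) u x (T u x)} = 0)) \<and>
    (measure_density \<Omega> \<mu> \<longrightarrow>
      (\<forall>u\<in>BV \<Omega> \<mu>. codim1_hausdorff UNIV \<mu>
        {x \<in> frontier \<Omega>. \<not> has_trace_value \<Omega> \<mu> (Q / (Q - 1)) u x (T u x)} = 0))"
proof -
  define p where "p = Q / (Q - 1)"
  interpret metric_outer_measure \<mu> by unfold_locales (rule assms)
  interpret boundary_traces \<mu> \<Omega> p by unfold_locales (use assms in \<open>auto simp: p_def\<close>)
  have proper: "compact (cball (x::'a) r)" for x r by (rule compact_cball[OF assms(2) complete_UNIV])
  obtain T where lin: "linear_boundary_operator \<Omega> \<mu> T"
    and T: "\<And>u x c. u \<in> BV \<Omega> \<mu> \<Longrightarrow> x \<in> frontier \<Omega> \<Longrightarrow> has_trace_value \<Omega> \<mu> p u x c \<Longrightarrow> T u x = c"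
    by (rule linear_trace_operator) blast
  define N where "N u = {x \<in> frontier \<Omega>. \<not> has_trace_value \<Omega> \<mu> p u x (T u x)}" for u
  have inner: "codim1_hausdorff (closure \<Omega>) (zero_extension \<Omega> \<mu>) (N u) = 0"
    if mass: "mass_bound_exponent \<Omega> \<mu> Q" and u: "u \<in> BV \<Omega> \<mu>" for u
  proof -
    obtain CP LP where CP: "0 < CP" "1 \<le> LP" and P: "\<And>x r u g. x \<in> \<Omega> \<Longrightarrow> 0 < r \<Longrightarrow> locally_integrable_on \<Omega> \<mu> u \<Longrightarrow> upper_gradient_on \<Omega> g u \<Longrightarrow>
        average_on \<mu> (ball x r \<inter> \<Omega>) (\<lambda>y. e2ennreal \<bar>u y - ereal (mean_value \<mu> (ball x r \<inter> \<Omega>) u)\<bar>)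
        \<le> ennreal (CP * r) * average_on \<mu> (ball x (LP * r) \<inter> \<Omega>) g"
      using assms(8) unfolding poincare_1_1_on_def by blast
    interpret S: trace_setting \<mu> \<Omega> Q CP LP
      by unfold_locales (fact assms(6) assms(7) assms(4) assms(9) mass CP P proper)+
    have "N u \<subseteq> {x\<in>frontier \<Omega>. \<not> (\<exists>c. has_trace_value \<Omega> \<mu> (Q / (Q - 1)) u x c)}"
      using T[OF u] unfolding N_def p_def by blast
    from S.null_set_mono[OF this S.BV_trace[OF u]] show ?thesis unfolding S.null_set_hausdorff .
  qed
  have outer: "codim1_hausdorff UNIV \<mu> (N u) = 0" if md: "measure_density \<Omega> \<mu>" and u: "u \<in> BV \<Omega> \<mu>" for u
  proof (cases "frontier \<Omega> = {}")
    case True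
    then show ?thesis unfolding N_def codim1_hausdorff_eq_0_iff by (simp add: codim1_content_empty)
  next
    case False
    have diam: "0 < diameter \<Omega>" by (rule frontier_diameter_pos[OF assms(6,7) False])
    obtain c where c: "0 < c" and null: "codim1_hausdorff UNIV \<mu>
        {x\<in>frontier \<Omega>. \<not> (\<forall>r. 0 < r \<and> r < diameter \<Omega> \<longrightarrow> ennreal c * \<mu> (ball x r) \<le> \<mu> (ball x r \<inter> \<Omega>))} = 0"
      using md unfolding measure_density_def by blast
    obtain K where K: "1 \<le> K" "\<And>x r. x \<in> UNIV \<Longrightarrow> 0 < r \<Longrightarrow> 0 < \<mu> (ball x r \<inter> UNIV)"
      "\<And>x r. x \<in> UNIV \<Longrightarrow> 0 < r \<Longrightarrow> \<mu> (ball x r \<inter> UNIV) < \<infinity>"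
      "\<And>x r. x \<in> UNIV \<Longrightarrow> 0 < r \<Longrightarrow> \<mu> (ball x (2 * r) \<inter> UNIV) \<le> ennreal K * \<mu> (ball x r \<inter> UNIV)"
      by (rule doubling_onD[OF assms(2)]) (rule that, assumption+)
    obtain CX LX where CX: "0 < CX" "1 \<le> LX" and P: "\<And>x r u g. x \<in> UNIV \<Longrightarrow> 0 < r \<Longrightarrow> locally_integrable_on UNIV \<mu> u \<Longrightarrow> upper_gradient_on UNIV g u \<Longrightarrow>
        average_on \<mu> (ball x r \<inter> UNIV) (\<lambda>y. e2ennreal \<bar>u y - ereal (mean_value \<mu> (ball x r \<inter> UNIV) u)\<bar>)
        \<le> ennreal (CX * r) * average_on \<mu> (ball x (LX * r) \<inter> UNIV) g"
      using assms(3) unfolding poincare_1_1_on_def by blast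
    interpret A: ambient_space \<mu> K CX LX
      by unfold_locales (fact K(1) K(2-4)[OF UNIV_I, unfolded Int_UNIV_right] CX P[OF UNIV_I, unfolded Int_UNIV_right] proper)+
    have pos: "0 < \<mu> (ball y r \<inter> \<Omega>)" if "y \<in> \<Omega>" "0 < r" for y r
      using ball_measure(1)[of y r] that closure_subset[of \<Omega>] by blast
    obtain c' where c': "0 < c'" and dens: "\<And>y r. y \<in> \<Omega> \<Longrightarrow> 0 < r \<Longrightarrow> r \<le> diameter \<Omega> \<Longrightarrow> ennreal c' * \<mu> (ball y r) \<le> \<mu> (ball y r \<inter> \<Omega>)"
      by (rule A.density_in_domain[OF assms(6) c _ null]) (rule pos, assumption+, rule that, assumption+)
    have "mass_bound_exponent \<Omega> \<mu> Q"
      by (rule A.mass_bound_domain[OF assms(6,7) c' _ pos dens assms(5)]) (use assms(4) in simp)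
    from A.hausdorff_null_from_closure[OF assms(6) c' diam dens inner[OF this u]] show ?thesis .
  qed
  show ?thesis
    using lin inner outer unfolding N_def p_def by blast
qed

end
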